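(* Let $H$, $A$, $V$, $\Omega=(0,\ell)$, $\mu$, $\nu$, ${\mathcal V}$, $P$, ${\mathfrak A}$ and ${\mathbb A}$ be as described in the context. Then ${\mathbb A}$ is the infinitesimal generator of a strongly continuous contraction semigroup $S(t)={\rm e}^{t{\mathbb A}}$ on ${\mathfrak A}$ (so that for every $z\in{\mathfrak A}$ the Cauchy problem $\frac{{\rm d}}{{\rm d}t}Z(t)={\mathbb A}Z(t)$, $Z(0)=z$, has the unique mild solution $Z(t)=S(t)z\in C([0,\infty),{\mathfrak A})$). Moreover, for every $z\in{\mathcal D}({\mathbb A})$, writing $S(t)z=(u(t),v(t),\xi^t)$, the energy equality $$\frac{{\rm d}}{{\rm d}t}\|S(t)z\|^2_{\mathfrak A}=-\nu(0)\|\xi^t(0)\|^2_V-\int_0^\ell\nu'(\tau)\|\xi^t(\tau)\|^2_V\,{\rm d}\tau$$ holds, where $\nu(0)\|\xi^t(0)\|_V^2$ denotes $\lim_{\tau\to0}\nu(\tau)\|\xi^t(\tau)\|_V^2$ (which exists finite).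
   Context: $H$ is a separable real Hilbert space and $A$ is a selfadjoint strictly positive linear operator on $H$ with compact inverse and dense domain ${\mathcal D}(A)$. $V={\mathcal D}(A^{1/2})$ with inner product $\langle u_1,u_2\rangle_V=\langle A^{1/2}u_1,A^{1/2}u_2\rangle_H$. Let $\ell\in(0,\infty]$, $\Omega=(0,\ell)$. The kernel $\mu:\Omega\to(0,\infty)$ is nonincreasing, summable, absolutely continuous on every closed interval contained in $\Omega$, and, if $\ell<\infty$, continuous at $s=\ell$ with $\mu(\ell)=0$. Set $M(s)=\int_s^\ell\mu(\sigma){\rm d}\sigma$. Functions on $\Omega$ are understood to be $0$ outside $\Omega$. Let $\nu=1/\mu$ on $\Omega$ (continuous, nondecreasing, $\nu'\ge0$ a.e.) and $\nu(0)=\lim_{\tau\to0}\nu(\tau)$. ${\mathcal V}=L^2_\nu(\Omega;V)$ is the space of $\xi:\Omega\to V$ with $\|\xi\|_{\mathcal V}^2=\int_0^\ell\nu(\tau)\|\xi(\tau)\|_V^2{\rm d}\tau<\infty$. $D$ denotes the distributional derivative. $P$ is the operator on ${\mathcal V}$ with ${\mathcal D}(P)=\{\xi\in{\mathcal V}: D\xi\in{\mathcal V},\ \lim_{\tau\to\ell}\xi(\tau)=0\text{ in }V\}$ and $P\xi=D\xi$. ${\mathfrak A}=V\times H\times{\mathcal V}$ with $\|(u,v,\xi)\|_{\mathfrak A}^2=\|u\|_V^2+\|v\|_H^2+\|\xi\|_{\mathcal V}^2$. ${\mathbb A}$ is the operator on ${\mathfrak A}$ with domain ${\mathcal D}({\mathbb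 A})=\{(u,v,\xi)\in{\mathfrak A}: v\in V,\ u+\int_0^\ell\xi(\tau){\rm d}\tau\in{\mathcal D}(A),\ \xi\in{\mathcal D}(P)\}$ and ${\mathbb A}(u,v,\xi)=\big(v,\,-A[u+\int_0^\ell\xi(\tau){\rm d}\tau],\,P\xi+\mu v\big)$. *)

theory Defs
  imports "HOL-Analysis.Analysis"
begin

text \<open>A (possibly unbounded) operator is given by its domain D and a function T;
  only the values of T on D matter.\<close>

definition linear_op_on :: "'h::real_inner set \<Rightarrow> ('h \<Rightarrow> 'h) \<Rightarrow> bool" where
  "linear_op_on D T \<longleftrightarrow> 0 \<in> D \<and> (\<forall>x\<in>D. \<forall>y\<in>D. x + y \<in> D \<and> T (x + y) = T x + T y)
     \<and> (\<forall>c. \<forall>x\<in>D. c *\<^sub>R x \<in> D \<and> T (c *\<^sub>R x) = c *\<^sub>R T x)"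

definition adj_dom :: "'h::real_inner set \<Rightarrow> ('h \<Rightarrow> 'h) \<Rightarrow> 'h set" where
  "adj_dom D T = {v. \<exists>w. \<forall>u\<in>D. inner (T u) v = inner u w}"

definition selfadjoint_op :: "'h::real_inner set \<Rightarrow> ('h \<Rightarrow> 'h) \<Rightarrow> bool" where
  "selfadjoint_op D T \<longleftrightarrow> linear_op_on D T \<and> closure D = UNIV \<and> adj_dom D T = D
     \<and> (\<forall>u\<in>D. \<forall>v\<in>D. inner (T u) v = inner u (T v))"

definition strictly_positive_op :: "'h::real_inner set \<Rightarrow> ('h \<Rightarrow> 'h) \<Rightarrow> bool" where
  "strictly_positive_op D T \<longleftrightarrow> (\<forall>u\<in>D. u \<noteq> 0 \<longrightarrow> inner (T u) u > 0)"

definition has_compact_inverse :: "'h::real_inner set \<Rightarrow> ('h \<Rightarrow> 'h) \<Rightarrow> bool" where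
  "has_compact_inverse D T \<longleftrightarrow> bij_betw T D UNIV
     \<and> (\<forall>S. bounded S \<longrightarrow> compact (closure (inv_into D T ` S)))"

text \<open>B (with domain DB) is the positive selfadjoint square root of A (domain DA);
  B is normalised to be 0 outside its domain, which makes it unique.\<close>
definition is_op_sqrt :: "'h::real_inner set \<Rightarrow> ('h \<Rightarrow> 'h) \<Rightarrow> 'h set \<Rightarrow> ('h \<Rightarrow> 'h) \<Rightarrow> bool" where
  "is_op_sqrt DA A DB B \<longleftrightarrow> selfadjoint_op DB B \<and> (\<forall>u\<in>DB. 0 \<le> inner (B u) u)
     \<and> {u \<in> DB. B u \<in> DB} = DA \<and> (\<forall>u\<in>DA. B (B u) = A u) \<and> (\<forall>u. u \<notin> DB \<longrightarrow> B u = 0)"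

definition sqrt_dom :: "'h::real_inner set \<Rightarrow> ('h \<Rightarrow> 'h) \<Rightarrow> 'h set" where
  "sqrt_dom DA A = fst (THE p. is_op_sqrt DA A (fst p) (snd p))"

definition sqrt_op :: "'h::real_inner set \<Rightarrow> ('h \<Rightarrow> 'h) \<Rightarrow> 'h \<Rightarrow> 'h" where
  "sqrt_op DA A = snd (THE p. is_op_sqrt DA A (fst p) (snd p))"

abbreviation Vspace :: "'h::real_inner set \<Rightarrow> ('h \<Rightarrow> 'h) \<Rightarrow> 'h set" where
  "Vspace DA A \<equiv> sqrt_dom DA A"

definition Vnorm :: "'h::real_inner set \<Rightarrow> ('h \<Rightarrow> 'h) \<Rightarrow> 'h \<Rightarrow> real" where
  "Vnorm DA A u = norm (sqrt_op DA A u)"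

definition absolutely_continuous_fun_on :: "real set \<Rightarrow> (real \<Rightarrow> real) \<Rightarrow> bool" where
  "absolutely_continuous_fun_on S f \<longleftrightarrow>
     (\<forall>e>0. \<exists>d>0. \<forall>n::nat. \<forall>a b. (\<forall>i<n. a i \<in> S \<and> b i \<in> S \<and> a i \<le> b i)
        \<and> (\<forall>i<n. \<forall>j<n. i \<noteq> j \<longrightarrow> b i \<le> a j \<or> b j \<le> a i)
        \<and> (\<Sum>i<n. b i - a i) < d \<longrightarrow> (\<Sum>i<n. \<bar>f (b i) - f (a i)\<bar>) < e)"

definition Omega :: "ereal \<Rightarrow> real set" where
  "Omega l = {\<tau>. 0 < \<tau> \<and> ereal \<tau> < l}"

definition at_end :: "ereal \<Rightarrow> real filter" where
  "at_end l = (if l = \<infinity> then at_top else at_left (real_of_ereal l))"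

definition smooth_fun :: "(real \<Rightarrow> real) \<Rightarrow> bool" where
  "smooth_fun \<phi> \<longleftrightarrow> (\<forall>n x. ((deriv ^^ n) \<phi>) differentiable (at x))"

definition test_fun :: "real set \<Rightarrow> (real \<Rightarrow> real) \<Rightarrow> bool" where
  "test_fun U \<phi> \<longleftrightarrow> smooth_fun \<phi> \<and> compact (closure {x. \<phi> x \<noteq> 0})
     \<and> closure {x. \<phi> x \<noteq> 0} \<subseteq> U"

definition distr_deriv :: "real set \<Rightarrow> (real \<Rightarrow> 'h::{real_normed_vector,second_countable_topology}) \<Rightarrow> (real \<Rightarrow> 'h) \<Rightarrow> bool" where
  "distr_deriv U \<xi> \<eta> \<longleftrightarrow> (\<forall>\<phi>. test_fun U \<phi> \<longrightarrow>
     (LINT \<tau>:U|lborel. deriv \<phi> \<tau> *\<^sub>R \<xi> \<tau>) = - (LINT \<tau>:U|lborel. \<phi> \<tau> *\<^sub>R \<eta> \<tau>))"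

definition inVV :: "'h::{real_inner,second_countable_topology} set \<Rightarrow> ('h \<Rightarrow> 'h) \<Rightarrow> ereal \<Rightarrow> (real \<Rightarrow> real) \<Rightarrow> (real \<Rightarrow> 'h) \<Rightarrow> bool" where
  "inVV DA A l \<mu> \<xi> \<longleftrightarrow> (\<forall>\<tau>\<in>Omega l. \<xi> \<tau> \<in> Vspace DA A)
     \<and> set_borel_measurable lborel (Omega l) (\<lambda>\<tau>. sqrt_op DA A (\<xi> \<tau>))
     \<and> set_integrable lborel (Omega l) (\<lambda>\<tau>. (1 / \<mu> \<tau>) * (Vnorm DA A (\<xi> \<tau>))\<^sup>2)"

definition normsqVV :: "'h::{real_inner,second_countable_topology} set \<Rightarrow> ('h \<Rightarrow> 'h) \<Rightarrow> ereal \<Rightarrow> (real \<Rightarrow> real) \<Rightarrow> (real \<Rightarrow> 'h) \<Rightarrow> real" where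
  "normsqVV DA A l \<mu> \<xi> = (LINT \<tau>:Omega l|lborel. (1 / \<mu> \<tau>) * (Vnorm DA A (\<xi> \<tau>))\<^sup>2)"

type_synonym 'h state = "'h \<times> 'h \<times> (real \<Rightarrow> 'h)"

definition inAA :: "'h::{real_inner,second_countable_topology} set \<Rightarrow> ('h \<Rightarrow> 'h) \<Rightarrow> ereal \<Rightarrow> (real \<Rightarrow> real) \<Rightarrow> 'h state \<Rightarrow> bool" where
  "inAA DA A l \<mu> z \<longleftrightarrow> (case z of (u, v, \<xi>) \<Rightarrow> u \<in> Vspace DA A \<and> inVV DA A l \<mu> \<xi>)"

definition normsqAA :: "'h::{real_inner,second_countable_topology} set \<Rightarrow> ('h \<Rightarrow> 'h) \<Rightarrow> ereal \<Rightarrow> (real \<Rightarrow> real) \<Rightarrow> 'h state \<Rightarrow> real" where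
  "normsqAA DA A l \<mu> z = (case z of (u, v, \<xi>) \<Rightarrow>
     (Vnorm DA A u)\<^sup>2 + (norm v)\<^sup>2 + normsqVV DA A l \<mu> \<xi>)"

definition normAA :: "'h::{real_inner,second_countable_topology} set \<Rightarrow> ('h \<Rightarrow> 'h) \<Rightarrow> ereal \<Rightarrow> (real \<Rightarrow> real) \<Rightarrow> 'h state \<Rightarrow> real" where
  "normAA DA A l \<mu> z = sqrt (normsqAA DA A l \<mu> z)"

definition st_add :: "'h::real_vector state \<Rightarrow> 'h state \<Rightarrow> 'h state" where
  "st_add z w = (case z of (u, v, \<xi>) \<Rightarrow> case w of (u', v', \<xi>') \<Rightarrow> (u + u', v + v', \<lambda>\<tau>. \<xi> \<tau> + \<xi>' \<tau>))"

definition st_scale :: "real \<Rightarrow> 'h::real_vector state \<Rightarrow> 'h state" where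
  "st_scale c z = (case z of (u, v, \<xi>) \<Rightarrow> (c *\<^sub>R u, c *\<^sub>R v, \<lambda>\<tau>. c *\<^sub>R \<xi> \<tau>))"

definition st_diff :: "'h::real_vector state \<Rightarrow> 'h state \<Rightarrow> 'h state" where
  "st_diff z w = st_add z (st_scale (-1) w)"

definition domP :: "'h::{real_inner,second_countable_topology} set \<Rightarrow> ('h \<Rightarrow> 'h) \<Rightarrow> ereal \<Rightarrow> (real \<Rightarrow> real) \<Rightarrow> (real \<Rightarrow> 'h) \<Rightarrow> bool" where
  "domP DA A l \<mu> \<xi> \<longleftrightarrow> inVV DA A l \<mu> \<xi>
     \<and> (\<exists>\<eta>. inVV DA A l \<mu> \<eta> \<and> distr_deriv (Omega l) \<xi> \<eta>)
     \<and> (\<exists>\<xi>0. (AE \<tau> in lborel. \<tau> \<in> Omega l \<longrightarrow> \<xi>0 \<tau> = \<xi> \<tau>)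
            \<and> (\<forall>\<tau>\<in>Omega l. \<xi>0 \<tau> \<in> Vspace DA A)
            \<and> ((\<lambda>\<tau>. sqrt_op DA A (\<xi>0 \<tau>)) \<longlongrightarrow> 0) (at_end l))"

definition opP :: "'h::{real_inner,second_countable_topology} set \<Rightarrow> ('h \<Rightarrow> 'h) \<Rightarrow> ereal \<Rightarrow> (real \<Rightarrow> real) \<Rightarrow> (real \<Rightarrow> 'h) \<Rightarrow> (real \<Rightarrow> 'h)" where
  "opP DA A l \<mu> \<xi> = (SOME \<eta>. inVV DA A l \<mu> \<eta> \<and> distr_deriv (Omega l) \<xi> \<eta>)"

definition domAA :: "'h::{real_inner,second_countable_topology} set \<Rightarrow> ('h \<Rightarrow> 'h) \<Rightarrow> ereal \<Rightarrow> (real \<Rightarrow> real) \<Rightarrow> 'h state \<Rightarrow> bool" where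
  "domAA DA A l \<mu> z \<longleftrightarrow> inAA DA A l \<mu> z \<and> (case z of (u, v, \<xi>) \<Rightarrow>
     v \<in> Vspace DA A \<and> u + (LINT \<tau>:Omega l|lborel. \<xi> \<tau>) \<in> DA \<and> domP DA A l \<mu> \<xi>)"

definition opAA :: "'h::{real_inner,second_countable_topology} set \<Rightarrow> ('h \<Rightarrow> 'h) \<Rightarrow> ereal \<Rightarrow> (real \<Rightarrow> real) \<Rightarrow> 'h state \<Rightarrow> 'h state" where
  "opAA DA A l \<mu> z = (case z of (u, v, \<xi>) \<Rightarrow>
     (v, - A (u + (LINT \<tau>:Omega l|lborel. \<xi> \<tau>)), \<lambda>\<tau>. opP DA A l \<mu> \<xi> \<tau> + \<mu> \<tau> *\<^sub>R v))"

text \<open>Elements of \<AA> are represented by triples whose third component is a function;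
  two representatives denote the same element iff the \<AA>-norm of their difference is 0.
  S is a C0 contraction semigroup on \<AA> whose infinitesimal generator is (domAA, opAA).\<close>
definition generates_C0_contraction_semigroup ::
  "'h::{real_inner,second_countable_topology} set \<Rightarrow> ('h \<Rightarrow> 'h) \<Rightarrow> ereal \<Rightarrow> (real \<Rightarrow> real) \<Rightarrow> (real \<Rightarrow> 'h state \<Rightarrow> 'h state) \<Rightarrow> bool" where
  "generates_C0_contraction_semigroup DA A l \<mu> S \<longleftrightarrow>
    (let inA = inAA DA A l \<mu>; nA = normAA DA A l \<mu> in
     (\<forall>t\<ge>0. \<forall>z. inA z \<longrightarrow> inA (S t z))
   \<and> (\<forall>t\<ge>0. \<forall>z w. inA z \<longrightarrow> inA w \<longrightarrow> nA (st_diff z w) = 0 \<longrightarrow> nA (st_diff (S t z) (S t w)) = 0)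
   \<and> (\<forall>t\<ge>0. \<forall>z w a b. inA z \<longrightarrow> inA w \<longrightarrow>
        nA (st_diff (S t (st_add (st_scale a z) (st_scale b w))) (st_add (st_scale a (S t z)) (st_scale b (S t w)))) = 0)
   \<and> (\<forall>z. inA z \<longrightarrow> nA (st_diff (S 0 z) z) = 0)
   \<and> (\<forall>t\<ge>0. \<forall>s\<ge>0. \<forall>z. inA z \<longrightarrow> nA (st_diff (S (t + s) z) (S t (S s z))) = 0)
   \<and> (\<forall>z. inA z \<longrightarrow> (\<forall>t0\<ge>0. ((\<lambda>t. nA (st_diff (S t z) (S t0 z))) \<longlongrightarrow> 0) (at t0 within {0..})))
   \<and> (\<forall>t\<ge>0. \<forall>z. inA z \<longrightarrow> nA (S t z) \<le> nA z)
   \<and> (\<forall>z. inA z \<longrightarrow> (domAA DA A l \<mu> z \<longleftrightarrow>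
        (\<exists>w. inA w \<and> ((\<lambda>h. nA (st_diff (st_scale (1 / h) (st_diff (S h z) z)) w)) \<longlongrightarrow> 0) (at_right 0))))
   \<and> (\<forall>z. domAA DA A l \<mu> z \<longrightarrow> inA (opAA DA A l \<mu> z) \<and>
        ((\<lambda>h. nA (st_diff (st_scale (1 / h) (st_diff (S h z) z)) (opAA DA A l \<mu> z))) \<longlongrightarrow> 0) (at_right 0)))"

end

theory Submission
  imports Defs
begin

text \<open>Let \<open>B\<close> be the square root of \<open>A\<close> and \<open>R\<close> its bounded inverse. The map \<open>(u, v, \<xi>) \<mapsto> (B u, v, \<surd>\<nu> B \<xi>)\<close> turns the extended
  memory space into a closed subspace of \<open>H \<times> H \<times> L\<^sup>2(\<real>; H)\<close>. There the operator becomes m-dissipative: for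
  \<open>D x = y\<close>, integrating \<open>(\<nu> \<bar>x\<bar>\<^sup>2)' = \<nu>' \<bar>x\<bar>\<^sup>2 + 2 \<nu> \<langle>y, x\<rangle>\<close> gives the energy identity, hence dissipativity, and the
  resolvent equation is solved explicitly in the memory variable by \<open>x(t) = \<integral>\<^sub>t exp (\<lambda> (t - s)) \<kappa>(s) ds\<close>, which leaves a
  coercive equation in \<open>H\<close>. The semigroup is \<open>lim\<^sub>n J(t/n)\<^sup>n\<close> with \<open>J(h) = (1 - h G)\<inverse>\<close>, so no Bochner integration in time is needed,
  and differentiating the squared norm along it gives the energy equality.\<close>


subsection \<open>The exponential formula for m-dissipative relations\<close>

text \<open>The elements of the state space are functions up to null sets, and its operator involves
  a choice of distributional derivative. In the Hilbert space to which it is transported, the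
  generator is a relation, so no choice has to be made. The unbounded \<open>A\<close> disappears as
  well: with \<open>u = R p\<close>, \<open>v = R q\<close> and \<open>\<xi> = R x\<close>,
  injectivity of \<open>R\<close> turns the condition on \<open>u + \<integral>\<xi>\<close> into
  \<open>p + \<integral>x = - R w\<close>. Density of the domain is not part of the notion of
  m-dissipativity below; it is extracted from the range condition and single-valuedness. The
  delicate endpoint is \<open>l\<close>: where \<open>\<nu>\<close> is unbounded,
  \<open>x \<longlongrightarrow> 0\<close> says nothing about \<open>\<nu> |x|^2\<close>. For finite
  \<open>l\<close> the boundary term is removed by writing \<open>x\<close> as minus the integral of
  its derivative up to \<open>l\<close> and using monotonicity of \<open>\<nu>\<close>; for infinite
  \<open>l\<close> it is removed by integrability of \<open>\<nu> |x|^2\<close>. At \<open>0\<close>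
  the boundary term survives and is the trace in the energy equality.\<close>

locale m_dissipative =
  fixes G :: "('a::{real_inner, complete_space} \<times> 'a) set"
  assumes sub: "subspace G"
    and single: "(0, y) \<in> G \<Longrightarrow> y = 0"
    and diss: "(x, y) \<in> G \<Longrightarrow> inner y x \<le> 0"
    and range: "0 < h \<Longrightarrow> \<exists>x y. (x, y) \<in> G \<and> x - h *\<^sub>R y = z"
begin

section \<open>Resolvents of an m-dissipative relation\<close>

lemma G_add: "(x, y) \<in> G \<Longrightarrow> (x', y') \<in> G \<Longrightarrow> (x + x', y + y') \<in> G"
  using subspace_add[OF sub] by fastforce

lemma G_scale: "(x, y) \<in> G \<Longrightarrow> (c *\<^sub>R x, c *\<^sub>R y) \<in> G"
  using subspace_scale[OF sub] by fastforce

lemma G_diff: "(x, y) \<in> G \<Longrightarrow> (x', y') \<in> G \<Longrightarrow> (x - x', y - y') \<in> G"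
  using subspace_diff[OF sub] by fastforce

text \<open>Dissipativity makes the cross term of \<open>|x - h y|^2\<close> nonnegative. Applied to
  differences of pairs this gives uniqueness for the resolvent equation, applied to a single pair
  its contractivity.\<close>

lemma G_bound:
  assumes "(x, y) \<in> G" "0 \<le> h"
  shows "norm x \<le> norm (x - h *\<^sub>R y)"
proof -
  have "(norm (x - h *\<^sub>R y))\<^sup>2 = (norm x)\<^sup>2 - 2 * (h * inner y x) + h\<^sup>2 * (norm y)\<^sup>2"
    unfolding power2_norm_eq_inner by (simp add: inner_diff inner_commute power2_eq_square algebra_simps)
  moreover have "h * inner y x \<le> 0" using diss[OF assms(1)] assms(2) by (simp add: mult_nonneg_nonpos)
  ultimately have "(norm x)\<^sup>2 \<le> (norm (x - h *\<^sub>R y))\<^sup>2" by (smt (verit) zero_le_mult_iff zero_le_power2)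
  then show ?thesis by (simp add: power2_le_iff_abs_le)
qed

text \<open>The value at \<open>h = 0\<close> is the identity, the limit of the resolvents, so that
  time \<open>0\<close> needs no separate treatment in the exponential formula. \<open>THE\<close>
  is justified by \<open>range\<close> for existence and by \<open>G_bound\<close> for
  uniqueness.\<close>

definition J :: "real \<Rightarrow> 'a \<Rightarrow> 'a" where
  "J h z = (if h = 0 then z else THE x. \<exists>y. (x, y) \<in> G \<and> x - h *\<^sub>R y = z)"

lemma J_0 [simp]: "J 0 z = z" by (simp add: J_def)

lemma J_eq:
  assumes "(x, y) \<in> G" "0 \<le> h"
  shows "J h (x - h *\<^sub>R y) = x"
proof (cases "h = 0")
  case False
  have "x' = x" if "(x', y') \<in> G" "x' - h *\<^sub>R y' = x - h *\<^sub>R y" for x' y'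
    using G_bound[OF G_diff[OF that(1) assms(1)] assms(2)] that(2) by (simp add: algebra_simps)
  then have "(THE x'. \<exists>y'. (x', y') \<in> G \<and> x' - h *\<^sub>R y' = x - h *\<^sub>R y) = x"
    using assms by (intro the_equality) blast+
  then show ?thesis using False by (simp add: J_def)
qed simp

lemma J_G:
  assumes "0 < h"
  shows "(J h z, (1 / h) *\<^sub>R (J h z - z)) \<in> G"
proof -
  obtain x y where xy: "(x, y) \<in> G" "x - h *\<^sub>R y = z" using range[OF assms] by blast
  have "J h z = x" using J_eq[OF xy(1)] assms xy(2) by auto
  moreover have "(1 / h) *\<^sub>R (x - z) = y" using assms xy(2) by (auto simp: algebra_simps)
  ultimately show ?thesis using xy by simp
qed

lemma J_norm: "0 \<le> h \<Longrightarrow> norm (J h z) \<le> norm z"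
  using G_bound[OF J_G[of h z], of h] by (cases "h = 0") auto

lemma J_add: assumes "0 \<le> h" shows "J h (z + w) = J h z + J h w"
proof (cases "h = 0")
  case False
  then have h: "0 < h" using assms by simp
  have "J h ((J h z + J h w) - h *\<^sub>R ((1 / h) *\<^sub>R (J h z - z) + (1 / h) *\<^sub>R (J h w - w))) = J h z + J h w"
    by (intro J_eq G_add J_G h assms)
  then show ?thesis using h by (simp add: algebra_simps)
qed simp

lemma J_scale: assumes "0 \<le> h" shows "J h (c *\<^sub>R z) = c *\<^sub>R J h z"
proof (cases "h = 0")
  case False
  then have h: "0 < h" using assms by simp
  have "J h (c *\<^sub>R J h z - h *\<^sub>R (c *\<^sub>R (1 / h) *\<^sub>R (J h z - z))) = c *\<^sub>R J h z"
    by (intro J_eq G_scale J_G h assms)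
  then show ?thesis using h by (simp add: algebra_simps)
qed simp

lemma J_linear: "0 \<le> h \<Longrightarrow> linear (J h)"
  by (intro linearI J_add J_scale)

lemma J_diff: "0 \<le> h \<Longrightarrow> J h (z - w) = J h z - J h w"
  by (rule linear_diff[OF J_linear])

text \<open>The increment \<open>J h x - x\<close> is \<open>h\<close> times a vector bounded by
  \<open>norm y\<close>, with no division by \<open>h\<close>. The rates for the iterates rest on
  this.\<close>

lemma J_step: assumes "(x, y) \<in> G" "0 \<le> h" shows "J h x = x + h *\<^sub>R J h y"
  using J_eq[OF assms] assms(2) by (simp add: J_diff J_scale algebra_simps)

lemma J_pair: assumes "(x, y) \<in> G" "0 \<le> h" shows "(J h x, J h y) \<in> G"
proof (cases "h = 0")
  case False
  then show ?thesis using J_G[of h x] J_step[OF assms] assms by simp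
qed (use assms in simp)

text \<open>\<open>J h\<close> maps \<open>G\<close> into itself, so \<open>J h (J k w)\<close>
  solves the resolvent equation with step \<open>k\<close> and datum \<open>J h w\<close>.\<close>

lemma J_commute: assumes "0 \<le> h" "0 \<le> k" shows "J h (J k w) = J k (J h w)"
proof (cases "k = 0")
  case False
  then have k: "0 < k" using assms by simp
  have "J k (J h (J k w) - k *\<^sub>R J h ((1 / k) *\<^sub>R (J k w - w))) = J h (J k w)"
    by (intro J_eq J_pair J_G k assms)
  then show ?thesis using k assms by (simp add: J_scale J_diff)
qed simp

lemma Jn_linear: "0 \<le> h \<Longrightarrow> linear (J h ^^ n)"
  by (induction n) (auto intro!: linear_compose J_linear simp: linear_id id_def[symmetric] simp del: id_apply)

lemma Jn_norm: "0 \<le> h \<Longrightarrow> norm ((J h ^^ n) z) \<le> norm z"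
  by (induction n) (auto intro: order_trans[OF J_norm])

lemma Jn_commute1: "0 \<le> h \<Longrightarrow> 0 \<le> k \<Longrightarrow> J h ((J k ^^ n) z) = (J k ^^ n) (J h z)"
  by (induction n) (auto simp: J_commute[of h k])

text \<open>Each of the \<open>n\<close> steps moves the point by at most \<open>h * norm y\<close>,
  since powers of \<open>J h\<close> are contractions.\<close>

lemma Jn_move:
  assumes "(x, y) \<in> G" "0 \<le> h"
  shows "norm ((J h ^^ n) x - x) \<le> n * h * norm y"
proof (induction n)
  case (Suc n)
  have "(J h ^^ Suc n) x - x = (J h ^^ n) (J h x - x) + ((J h ^^ n) x - x)"
    by (simp add: linear_diff[OF Jn_linear[OF assms(2)]] funpow_swap1)
  moreover have "norm ((J h ^^ n) (J h x - x)) \<le> h * norm y"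
    using Jn_norm[OF assms(2), of n "J h x - x"] J_norm[OF assms(2), of y] assms(2)
    by (simp add: J_step[OF assms]) (meson mult_left_mono order_trans)
  ultimately show ?case using Suc norm_triangle_ineq[of "(J h ^^ n) (J h x - x)" "(J h ^^ n) x - x"]
    by (simp add: algebra_simps)
qed simp

text \<open>A first-order Taylor formula: the increment is \<open>h\<close> times the sum of
  \<open>(J h ^^ k) y\<close> over \<open>1 \<le> k \<le> n\<close>, and each term is compared with
  \<open>y\<close>. The bound \<open>B\<close> is kept abstract because it is linear in the elapsed
  time when \<open>y\<close> lies in the domain, and merely small when \<open>y\<close> is only
  approximated by domain elements.\<close>

lemma Jn_expand:
  assumes "(x, y) \<in> G" "0 \<le> h" "\<And>k. k \<le> n \<Longrightarrow> norm ((J h ^^ k) y - y) \<le> B"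
  shows "norm ((J h ^^ n) x - x - (n * h) *\<^sub>R y) \<le> n * h * B"
  using assms(3)
proof (induction n)
  case (Suc n)
  have "(J h ^^ Suc n) x = (J h ^^ n) x + h *\<^sub>R (J h ^^ Suc n) y"
    by (simp only: funpow_Suc_right o_apply J_step[OF assms(1,2)] linear_add[OF Jn_linear[OF assms(2)]] linear_scale[OF Jn_linear[OF assms(2)]])
  then have "(J h ^^ Suc n) x - x - (Suc n * h) *\<^sub>R y =
      ((J h ^^ n) x - x - (n * h) *\<^sub>R y) + h *\<^sub>R ((J h ^^ Suc n) y - y)"
    by (simp add: algebra_simps)
  moreover have "norm ((J h ^^ n) x - x - (n * h) *\<^sub>R y) \<le> n * h * B" using Suc by simp
  moreover have "norm (h *\<^sub>R ((J h ^^ Suc n) y - y)) \<le> h * B"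
    using Suc.prems[of "Suc n"] assms(2) by (simp add: mult_left_mono)
  ultimately show ?case
    using norm_triangle_ineq[of "(J h ^^ n) x - x - (n * h) *\<^sub>R y" "h *\<^sub>R ((J h ^^ Suc n) y - y)"]
    by (simp add: algebra_simps)
qed simp

lemma Jn_expand2:
  assumes "(x, y) \<in> G" "(y, w) \<in> G" "0 \<le> h"
  shows "norm ((J h ^^ n) x - x - (n * h) *\<^sub>R y) \<le> (n * h)\<^sup>2 * norm w"
proof -
  have "norm ((J h ^^ k) y - y) \<le> n * h * norm w" if "k \<le> n" for k
    using Jn_move[OF assms(2,3), of k] that assms(3)
    by (smt (verit, best) mult_right_mono norm_ge_zero of_nat_mono)
  from Jn_expand[OF assms(1,3) this] show ?thesis by (simp add: power2_eq_square algebra_simps)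
qed

text \<open>Telescoping: since the maps commute, the difference of the powers is a sum of
  \<open>n\<close> terms in which contractions act on \<open>S x - T x\<close>. A local error of
  order \<open>1 / n^2\<close> thus becomes a global one of order \<open>1 / n\<close>.\<close>

lemma commuting_contractions_bound:
  assumes S: "linear S" "\<And>z. norm (S z) \<le> norm z" and T: "linear T" "\<And>z. norm (T z) \<le> norm z"
    and ST: "\<And>z. S (T z) = T (S (z::'a))"
  shows "norm ((S ^^ n) x - (T ^^ n) x) \<le> n * norm (S x - T x)"
proof (induction n)
  case (Suc n)
  have lin: "linear (S ^^ n)" using S(1)
    by (induction n) (auto intro!: linear_compose simp: linear_id id_def[symmetric] simp del: id_apply)
  have con: "norm ((S ^^ n) z) \<le> norm z" for z by (induction n) (auto intro: order_trans[OF S(2)])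
  have com: "(S ^^ n) (T z) = T ((S ^^ n) z)" for z by (induction n) (auto simp: ST)
  have "(S ^^ Suc n) x - (T ^^ Suc n) x = (S ^^ n) (S x - T x) + T ((S ^^ n) x - (T ^^ n) x)"
    by (simp add: linear_diff[OF lin] linear_diff[OF T(1)] com funpow_swap1)
  then show ?case
    using norm_triangle_ineq[of "(S ^^ n) (S x - T x)" "T ((S ^^ n) x - (T ^^ n) x)"]
      con[of "S x - T x"] T(2)[of "(S ^^ n) x - (T ^^ n) x"] Suc by (simp add: algebra_simps)
qed simp

text \<open>This gives density of the domain. The increments \<open>a h = J h z - z\<close> converge
  along \<open>h = 1 / Suc n\<close>, and their limit \<open>c\<close> is orthogonal to the domain.
  The resolvent equation \<open>w - y = c\<close> then gives
  \<open>inner w w = inner y w \<le> 0\<close>, so \<open>w = 0\<close>, and single-valuedness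
  yields \<open>c = 0\<close>.\<close>

lemma J_tendsto: "(\<lambda>n. J (1 / Suc n) z) \<longlonglongrightarrow> z"
proof -
  define a where "a h = J h z - z" for h
  have aG: "(z + a h, (1 / h) *\<^sub>R a h) \<in> G" if "0 < h" for h using J_G[OF that, of z] by (simp add: a_def)
  \<comment> \<open>Multiplying the dissipativity inequality for the steps \<open>h\<close> and
    \<open>k\<close> by \<open>h * k\<close> gives
    \<open>(h + k) |a h - a k|^2 \<le> (h - k) (|a h|^2 - |a k|^2)\<close>. So the norms decrease
    with the step, and their convergence forces that of the vectors.\<close>
  have key: "(norm (a h - a k))\<^sup>2 \<le> (norm (a h))\<^sup>2 - (norm (a k))\<^sup>2" if "0 < k" "k \<le> h" for h k
  proof -
    have h: "0 < h" using that by simp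
    have "inner ((1 / h) *\<^sub>R a h - (1 / k) *\<^sub>R a k) (a h - a k) \<le> 0"
      using diss[OF G_diff[OF aG[OF h] aG[OF that(1)]]] by simp
    then have "(h * k) * inner ((1 / h) *\<^sub>R a h - (1 / k) *\<^sub>R a k) (a h - a k) \<le> 0"
      using h that by (simp add: mult_nonneg_nonpos)
    moreover have "(h * k) * inner ((1 / h) *\<^sub>R a h - (1 / k) *\<^sub>R a k) (a h - a k)
       = k * (norm (a h))\<^sup>2 + h * (norm (a k))\<^sup>2 - (h + k) * inner (a h) (a k)"
      using h that unfolding power2_norm_eq_inner
      by (simp add: inner_diff inner_commute[of "a k" "a h"] algebra_simps)
    moreover have "(norm (a h - a k))\<^sup>2 = (norm (a h))\<^sup>2 + (norm (a k))\<^sup>2 - 2 * inner (a h) (a k)"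
      unfolding power2_norm_eq_inner by (simp add: inner_diff inner_commute)
    moreover have "(h + k) * (norm (a h - a k))\<^sup>2 = (h + k) * ((norm (a h))\<^sup>2 + (norm (a k))\<^sup>2 - 2 * inner (a h) (a k))"
      using calculation(3) by simp
    ultimately have "(h + k) * (norm (a h - a k))\<^sup>2 \<le> (h - k) * ((norm (a h))\<^sup>2 - (norm (a k))\<^sup>2)"
      by (simp add: algebra_simps)
    moreover have "0 \<le> (h + k) * (norm (a h - a k))\<^sup>2" using h that by simp
    moreover have "(norm (a h))\<^sup>2 - (norm (a k))\<^sup>2 \<ge> 0 \<or> h = k"
      using calculation that by (smt (verit) mult_pos_neg)
    ultimately show ?thesis using h that
      by (smt (verit) mult_le_cancel_left_pos mult_right_mono cancel_comm_monoid_add_class.diff_cancel norm_zero zero_eq_power2)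
  qed
  define b where "b n = a (1 / Suc n)" for n
  have key': "(norm (b m - b n))\<^sup>2 \<le> (norm (b m))\<^sup>2 - (norm (b n))\<^sup>2" if "m \<le> n" for m n
    using key[of "1 / Suc n" "1 / Suc m"] that by (simp add: b_def field_simps)
  have dec: "decseq (\<lambda>n. (norm (b n))\<^sup>2)"
    unfolding decseq_def using key' by (smt (verit) zero_le_power2)
  have "convergent (\<lambda>n. (norm (b n))\<^sup>2)"
    using decseq_convergent[OF dec, of 0] by (meson convergentI zero_le_power2)
  then have C: "Cauchy (\<lambda>n. (norm (b n))\<^sup>2)" by (simp add: convergent_Cauchy)
  have "Cauchy b"
  proof (rule metric_CauchyI)
    fix e :: real assume "0 < e"
    then obtain M where M: "\<And>m n. m \<ge> M \<Longrightarrow> n \<ge> M \<Longrightarrow> dist ((norm (b m))\<^sup>2) ((norm (b n))\<^sup>2) < e\<^sup>2"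
      using metric_CauchyD[OF C, of "e\<^sup>2"] by auto
    have le: "dist (b m) (b n) < e" if "M \<le> m" "m \<le> n" for m n
    proof -
      have "(norm (b m - b n))\<^sup>2 < e\<^sup>2" using key'[OF that(2)] M[of m n] that by (simp add: dist_real_def)
      then show ?thesis using \<open>0 < e\<close> by (simp add: dist_norm power2_less_imp_less)
    qed
    have "dist (b m) (b n) < e" if "M \<le> m" "M \<le> n" for m n
      using le[of m n] le[of n m] that by (cases "m \<le> n") (auto simp: dist_commute)
    then show "\<exists>M. \<forall>m\<ge>M. \<forall>n\<ge>M. dist (b m) (b n) < e" by blast
  qed
  then obtain c where c: "b \<longlonglongrightarrow> c" by (metis Cauchy_convergent convergent_def)
  \<comment> \<open>Passing to the limit in dissipativity against a fixed pair leaves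
    \<open>inner (- c) (w' - (z + c)) \<le> 0\<close>. As \<open>w'\<close> may run through a line,
    the part linear in \<open>w'\<close> has to vanish.\<close>
  have orth: "inner c w = 0" if w: "(w, y) \<in> G" for w y
  proof -
    have "inner (- c) (w' - (z + c)) \<le> 0" if w': "(w', y') \<in> G" for w' y'
    proof -
      have "inner ((1 / Suc n) *\<^sub>R y' - b n) (w' - (z + b n)) \<le> 0" for n
      proof -
        have "inner (y' - Suc n *\<^sub>R b n) (w' - (z + b n)) \<le> 0"
          using diss[OF G_diff[OF w' aG[of "1 / Suc n"]]] by (simp add: b_def)
        then have "(1 / Suc n) * inner (y' - Suc n *\<^sub>R b n) (w' - (z + b n)) \<le> 0"
          by (simp add: mult_nonneg_nonpos divide_nonpos_pos)
        then show ?thesis by (simp add: inner_scaleR_left[symmetric] scaleR_diff_right del: inner_scaleR_left)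
      qed
      moreover have "(\<lambda>n. inner ((1 / Suc n) *\<^sub>R y' - b n) (w' - (z + b n))) \<longlonglongrightarrow> inner (0 *\<^sub>R y' - c) (w' - (z + c))"
        using LIMSEQ_inverse_real_of_nat by (intro tendsto_intros c) (simp add: inverse_eq_divide)
      ultimately show ?thesis by (intro LIMSEQ_le_const2[of "\<lambda>n. inner ((1 / Suc n) *\<^sub>R y' - b n) (w' - (z + b n))"]) auto
    qed
    note le = this
    have t: "- t * inner c w \<le> - inner c (z + c)" for t
      using le[OF G_scale[OF w, of t]] by (simp add: inner_diff_right)
    show ?thesis
    proof (rule ccontr)
      assume n: "inner c w \<noteq> 0"
      show False using t[of "- (1 - inner c (z + c)) / inner c w"] n by simp
    qed
  qed
  obtain w y where wy: "(w, y) \<in> G" "w - 1 *\<^sub>R y = c" using range[of 1 c] by auto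
  have "inner (w - y) w = 0" using orth[OF wy(1)] wy(2) by simp
  then have "inner w w \<le> 0" using diss[OF wy(1)] by (simp add: inner_diff_left)
  then have "w = 0" by (metis inner_gt_zero_iff linorder_not_less)
  then have "c = 0" using single wy by auto
  then have "(\<lambda>n. z + b n) \<longlonglongrightarrow> z + 0" using c by (intro tendsto_intros) auto
  then show ?thesis by (simp add: b_def a_def)
qed

lemma dense1: assumes "0 < e" obtains x y where "(x, y) \<in> G" "norm (x - z) < e"
proof -
  obtain n where "dist (J (1 / Suc n) z) z < e"
    using J_tendsto[of z] assms by (metis LIMSEQ_iff_nz dist_norm order_refl)
  then show ?thesis using that J_G[of "1 / Suc n" z] by (simp add: dist_norm)
qed

text \<open>Regularising twice: for \<open>(x, y) \<in> G\<close> the point \<open>J h x\<close>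
  lies in the domain, and so does its image \<open>J h y\<close>. The quadratic error bounds are
  available at such points.\<close>

lemma dense2: assumes "0 < e" obtains x y w where "(x, y) \<in> G" "(y, w) \<in> G" "norm (x - z) < e"
proof -
  obtain x y where xy: "(x, y) \<in> G" "norm (x - z) < e / 2" using dense1[of "e / 2" z] assms by auto
  obtain n where n: "dist (J (1 / Suc n) x) x < e / 2"
    using J_tendsto[of x] assms by (metis LIMSEQ_iff_nz dist_norm order_refl half_gt_zero)
  have "norm (J (1 / Suc n) x - z) < e"
    using n xy(2) by (smt (verit) dist_norm field_sum_of_halves norm_triangle_sub norm_diff_triangle_less)
  then show ?thesis using that J_pair[OF xy(1), of "1 / Suc n"] J_G[of "1 / Suc n" y] by auto
qed

section \<open>The exponential formula and its limit\<close>

definition E :: "nat \<Rightarrow> real \<Rightarrow> 'a \<Rightarrow> 'a" where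
  "E n t = J (t / Suc n) ^^ Suc n"

lemma E_linear: "0 \<le> t \<Longrightarrow> linear (E n t)" unfolding E_def by (rule Jn_linear) simp
lemma E_norm: "0 \<le> t \<Longrightarrow> norm (E n t x) \<le> norm x" unfolding E_def by (rule Jn_norm) simp

text \<open>Both approximations are compared with the one that uses \<open>Suc n * Suc m\<close>
  steps. One coarse step of length \<open>t / N\<close> and the corresponding \<open>M\<close> fine
  steps agree up to \<open>2 (t / N)^2 norm w\<close>, and \<open>N\<close> coarse steps accumulate
  \<open>N\<close> times that.\<close>

lemma E_Cauchy2:
  assumes "(x, y) \<in> G" "(y, w) \<in> G" "0 \<le> t"
  shows "norm (E n t x - E m t x) \<le> 2 * t\<^sup>2 * norm w * (1 / Suc n + 1 / Suc m)"
proof -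
  have *: "norm ((J (t / N) ^^ N) x - (J (t / (N * M)) ^^ (N * M)) x) \<le> 2 * t\<^sup>2 * norm w / N"
    if N: "0 < N" and M: "0 < M" for N M :: nat
  proof -
    let ?h = "t / (N * M)"
    have h: "0 \<le> ?h" "0 \<le> t / N" using assms(3) by auto
    have "norm ((J (t / N) ^^ N) x - ((J ?h ^^ M) ^^ N) x) \<le> N * norm (J (t / N) x - (J ?h ^^ M) x)"
      by (intro commuting_contractions_bound J_linear Jn_linear J_norm Jn_norm Jn_commute1 h)
    moreover have "norm (J (t / N) x - (J ?h ^^ M) x) \<le> 2 * (t / N)\<^sup>2 * norm w"
    proof -
      have "norm (J (t / N) x - x - (t / N) *\<^sub>R y) \<le> (t / N)\<^sup>2 * norm w"
        using Jn_expand2[OF assms(1,2) h(2), of 1] by simp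
      moreover have "norm ((J ?h ^^ M) x - x - (t / N) *\<^sub>R y) \<le> (t / N)\<^sup>2 * norm w"
        using Jn_expand2[OF assms(1,2) h(1), of M] N M by simp
      ultimately show ?thesis
        using norm_triangle_ineq4[of "J (t / N) x - x - (t / N) *\<^sub>R y" "(J ?h ^^ M) x - x - (t / N) *\<^sub>R y"]
        by simp
    qed
    then have "N * norm (J (t / N) x - (J ?h ^^ M) x) \<le> N * (2 * (t / N)\<^sup>2 * norm w)"
      by (rule mult_left_mono) simp
    moreover have "N * (2 * (t / N)\<^sup>2 * norm w) = 2 * t\<^sup>2 * norm w / N"
      using N by (simp add: power2_eq_square)
    moreover have "(J ?h ^^ M) ^^ N = J ?h ^^ (N * M)"
      by (simp add: funpow_mult mult.commute[of M])
    ultimately show ?thesis by simp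
  qed
  have "norm (E n t x - (J (t / (Suc n * Suc m)) ^^ (Suc n * Suc m)) x) \<le> 2 * t\<^sup>2 * norm w / Suc n"
    unfolding E_def by (rule *) auto
  moreover have "norm (E m t x - (J (t / (Suc n * Suc m)) ^^ (Suc n * Suc m)) x) \<le> 2 * t\<^sup>2 * norm w / Suc m"
    using *[of "Suc m" "Suc n"] unfolding E_def by (simp only: mult.commute[of "Suc n"])
  ultimately have "norm (E n t x - E m t x) \<le> 2 * t\<^sup>2 * norm w / Suc n + 2 * t\<^sup>2 * norm w / Suc m"
    using norm_diff_triangle_le norm_minus_commute by metis
  then show ?thesis by (simp add: field_simps)
qed

lemma E_convergent: assumes "0 \<le> t" shows "convergent (\<lambda>n. E n t x)"
proof (rule Cauchy_convergent, rule metric_CauchyI)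
  fix e :: real assume e: "0 < e"
  obtain x' y w where x': "(x', y) \<in> G" "(y, w) \<in> G" "norm (x' - x) < e / 4"
    using dense2[of "e / 4" x] e by auto
  let ?C = "2 * t\<^sup>2 * norm w"
  have "(\<lambda>n. ?C * (1 / Suc n)) \<longlonglongrightarrow> ?C * 0"
    using LIMSEQ_inverse_real_of_nat by (intro tendsto_intros) (simp add: inverse_eq_divide)
  then obtain M where M: "\<And>n. n \<ge> M \<Longrightarrow> ?C * (1 / Suc n) < e / 4"
    using e LIMSEQ_D[of "\<lambda>n. ?C * (1 / Suc n)" 0 "e / 4"] by fastforce
  have "dist (E n t x) (E m t x) < e" if "n \<ge> M" "m \<ge> M" for n m
  proof -
    have "norm (E n t x' - E m t x') < e / 2"
      using E_Cauchy2[OF x'(1,2) assms, of n m] M[OF that(1)] M[OF that(2)] unfolding distrib_left by linarith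
    moreover have "norm (E k t x - E k t x') < e / 4" for k
      using E_norm[OF assms, of k "x' - x"] x'(3) by (simp add: linear_diff[OF E_linear[OF assms]] norm_minus_commute)
    ultimately show ?thesis
      using norm_triangle_ineq[of "E n t x - E n t x'" "E n t x' - E m t x'"]
        norm_triangle_ineq[of "E n t x - E m t x'" "E m t x' - E m t x"]
      by (simp add: dist_norm) (smt (verit) norm_minus_commute field_sum_of_halves)
  qed
  then show "\<exists>M. \<forall>m\<ge>M. \<forall>n\<ge>M. dist (E m t x) (E n t x) < e" by blast
qed

definition sg :: "real \<Rightarrow> 'a \<Rightarrow> 'a" where
  "sg t x = lim (\<lambda>n. E n t x)"

lemma E_tendsto: "0 \<le> t \<Longrightarrow> (\<lambda>n. E n t x) \<longlonglongrightarrow> sg t x"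
  unfolding sg_def using E_convergent convergent_LIMSEQ_iff by blast

lemma sg_linear: assumes "0 \<le> t" shows "linear (sg t)"
proof (rule linearI)
  fix x y c
  have "(\<lambda>n. E n t x + E n t y) \<longlonglongrightarrow> sg t x + sg t y" "(\<lambda>n. c *\<^sub>R E n t x) \<longlonglongrightarrow> c *\<^sub>R sg t x"
    by (intro tendsto_intros E_tendsto assms)+
  then have "(\<lambda>n. E n t (x + y)) \<longlonglongrightarrow> sg t x + sg t y" "(\<lambda>n. E n t (c *\<^sub>R x)) \<longlonglongrightarrow> c *\<^sub>R sg t x"
    by (simp_all add: linear_add[OF E_linear[OF assms]] linear_scale[OF E_linear[OF assms]])
  then show "sg t (x + y) = sg t x + sg t y" "sg t (c *\<^sub>R x) = c *\<^sub>R sg t x"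
    using E_tendsto[OF assms] LIMSEQ_unique by blast+
qed

lemma sg_norm: assumes "0 \<le> t" shows "norm (sg t x) \<le> norm x"
  using tendsto_norm[OF E_tendsto[OF assms, of x]] E_norm[OF assms]
  by (intro LIMSEQ_le_const2[of "\<lambda>n. norm (E n t x)"]) auto

lemma sg_0: "sg 0 x = x"
proof -
  have "(J 0 ^^ n) x = x" for n by (induction n) auto
  then show ?thesis unfolding sg_def E_def by (simp add: funpow_swap1)
qed

lemma sg_limitD:
  assumes "0 \<le> t" "\<And>n. norm (E n t x - z) \<le> B" shows "norm (sg t x - z) \<le> B"
  by (rule LIMSEQ_le_const2[OF tendsto_norm[OF tendsto_diff[OF E_tendsto[OF assms(1)] tendsto_const]]])
    (use assms(2) in auto)

text \<open>Both sides equal \<open>x + (a + b) y\<close> up to second order; the mixed term,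
  \<open>b\<close> times \<open>J a y - y\<close>, is of second order because \<open>y\<close> lies
  in the domain.\<close>

lemma JJ_expand:
  assumes "(x, y) \<in> G" "(y, w) \<in> G" "0 \<le> a" "0 \<le> b"
  shows "norm (J a (J b x) - J (a + b) x) \<le> 2 * (a + b)\<^sup>2 * norm w"
proof -
  have e: "norm (J h x - x - h *\<^sub>R y) \<le> h\<^sup>2 * norm w" if "0 \<le> h" for h
    using Jn_expand2[OF assms(1,2) that, of 1] by simp
  have "J a (J b x) - x - (a + b) *\<^sub>R y = J a (J b x - x - b *\<^sub>R y) + (J a x - x - a *\<^sub>R y) + b *\<^sub>R (J a y - y)"
    using assms by (simp add: J_diff J_add J_scale algebra_simps)
  then have "norm (J a (J b x) - x - (a + b) *\<^sub>R y) \<le> norm (J a (J b x - x - b *\<^sub>R y)) + norm (J a x - x - a *\<^sub>R y) + norm (b *\<^sub>R (J a y - y))"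
    by (metis (no_types, lifting) add_mono_thms_linordered_semiring(3) norm_triangle_ineq norm_triangle_mono order.refl)
  also have "\<dots> \<le> b\<^sup>2 * norm w + a\<^sup>2 * norm w + b * (a * norm w)"
  proof (intro add_mono)
    show "norm (J a (J b x - x - b *\<^sub>R y)) \<le> b\<^sup>2 * norm w"
      using J_norm[OF assms(3)] e[OF assms(4)] order_trans by blast
    show "norm (b *\<^sub>R (J a y - y)) \<le> b * (a * norm w)"
      using Jn_move[OF assms(2,3), of 1] assms(4) by (simp add: mult_left_mono)
  qed (use e assms in auto)
  also have "\<dots> \<le> (a + b)\<^sup>2 * norm w" using assms by (simp add: power2_eq_square algebra_simps)
  finally show ?thesis
    using e[of "a + b"] assms norm_triangle_ineq4[of "J a (J b x) - x - (a + b) *\<^sub>R y" "J (a + b) x - x - (a + b) *\<^sub>R y"]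
    by simp
qed

lemma norm_le_imp_eq_dense:
  assumes f: "linear f" "\<And>x. norm (f x) \<le> C * norm x" and z: "\<And>x y w. (x, y) \<in> G \<Longrightarrow> (y, w) \<in> G \<Longrightarrow> f x = (0::'a)"
  shows "f x = 0"
proof (rule ccontr)
  assume "f x \<noteq> 0"
  define e where "e = norm (f x) / (\<bar>C\<bar> + 1)"
  have e: "0 < e" using \<open>f x \<noteq> 0\<close> by (simp add: e_def add_nonneg_pos)
  obtain x' y w where x': "(x', y) \<in> G" "(y, w) \<in> G" "norm (x' - x) < e" using dense2[OF e] by blast
  have "norm (f x) = norm (f (x' - x))" using z[OF x'(1,2)] by (simp add: linear_diff[OF f(1)])
  also have "\<dots> \<le> (\<bar>C\<bar> + 1) * norm (x' - x)" using f(2)[of "x' - x"] by (smt (verit) mult_right_mono norm_ge_zero)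
  also have "\<dots> < (\<bar>C\<bar> + 1) * e" using x'(3) by (intro mult_strict_left_mono) auto
  also have "\<dots> = norm (f x)" by (simp add: e_def)
  finally show False by simp
qed

text \<open>By commutation \<open>E n t (E n s x)\<close> is the power \<open>Suc n\<close> of
  \<open>J a \<circ> J b\<close> with \<open>a = t / Suc n\<close> and \<open>b = s / Suc n\<close>.
  On the domain of the square of \<open>G\<close> the semigroup law therefore holds up to an
  accumulated local error of order \<open>1 / n\<close>.\<close>

lemma sg_add: assumes "0 \<le> t" "0 \<le> s" shows "sg (t + s) x = sg t (sg s x)"
proof -
  have "sg (t + s) x - sg t (sg s x) = 0"
  proof (rule norm_le_imp_eq_dense[where f = "\<lambda>x. sg (t + s) x - sg t (sg s x)" and C = 2])
    show "linear (\<lambda>x. sg (t + s) x - sg t (sg s x))"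
      using linear_compose[OF sg_linear[OF assms(2)] sg_linear[OF assms(1)]] sg_linear[of "t + s"] assms
      by (intro linear_compose_sub) (auto simp: o_def)
  next
    fix x
    show "norm (sg (t + s) x - sg t (sg s x)) \<le> 2 * norm x"
      using norm_triangle_ineq4[of "sg (t + s) x" "sg t (sg s x)"] sg_norm[of "t + s" x] sg_norm[OF assms(1), of "sg s x"]
        sg_norm[OF assms(2), of x] assms by simp
  next
    fix x y w assume xy: "(x, y) \<in> G" "(y, w) \<in> G"
    have bnd: "norm (E n t (E n s x) - E n (t + s) x) \<le> 2 * (t + s)\<^sup>2 * norm w * inverse (Suc n)" for n
    proof -
      let ?a = "t / Suc n" and ?b = "s / Suc n"
      have ab: "0 \<le> ?a" "0 \<le> ?b" "0 \<le> (t + s) / Suc n" using assms by auto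
      have pow: "(\<lambda>z. J ?a (J ?b z)) ^^ k = (J ?a ^^ k) \<circ> (J ?b ^^ k)" for k
        by (induction k) (simp_all add: fun_eq_iff Jn_commute1[OF ab(2,1)] del: of_nat_Suc)
      have sum: "(t + s) / Suc n = ?a + ?b" by (simp add: add_divide_distrib)
      have lin: "linear (\<lambda>z. J ?a (J ?b z))"
        using linear_compose[OF J_linear[OF ab(2)] J_linear[OF ab(1)]] by (simp add: o_def)
      have "norm (((\<lambda>z. J ?a (J ?b z)) ^^ Suc n) x - (J ((t + s) / Suc n) ^^ Suc n) x)
          \<le> Suc n * norm (J ?a (J ?b x) - J ((t + s) / Suc n) x)"
        using ab by (intro commuting_contractions_bound lin J_linear J_norm) 
          (auto intro: order_trans[OF J_norm] J_norm simp: J_commute)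
      also have "\<dots> \<le> Suc n * (2 * ((t + s) / Suc n)\<^sup>2 * norm w)"
        using JJ_expand[OF xy ab(1,2)] by (intro mult_left_mono) (simp_all only: sum of_nat_0_le_iff)
      also have "\<dots> = 2 * (t + s)\<^sup>2 * norm w * inverse (Suc n)"
        by (simp add: power2_eq_square divide_inverse)
      finally show ?thesis unfolding pow E_def o_apply .
    qed
    have "(\<lambda>n. 2 * (t + s)\<^sup>2 * norm w * inverse (Suc n)) \<longlonglongrightarrow> 2 * (t + s)\<^sup>2 * norm w * 0"
      by (intro tendsto_intros LIMSEQ_inverse_real_of_nat)
    then have 1: "(\<lambda>n. E n t (E n s x) - E n (t + s) x) \<longlonglongrightarrow> 0"
      by (intro Lim_null_comparison[OF eventuallyI[OF bnd]]) (simp only: mult_zero_right)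
    \<comment> \<open>The index occurs in both factors; contractivity of \<open>E n t\<close> allows
      the inner approximation to be replaced by its limit.\<close>
    have 2: "(\<lambda>n. E n t (E n s x - sg s x)) \<longlonglongrightarrow> 0"
    proof (rule Lim_null_comparison)
      show "(\<lambda>n. norm (E n s x - sg s x)) \<longlonglongrightarrow> 0"
        using tendsto_norm[OF tendsto_diff[OF E_tendsto[OF assms(2), of x] tendsto_const[of "sg s x"]]] by simp
    qed (use E_norm assms in auto)
    have "(\<lambda>n. E n t (E n s x - sg s x) - (E n t (E n s x) - E n (t + s) x) + E n t (sg s x)) \<longlonglongrightarrow> 0 - 0 + sg t (sg s x)"
      by (intro tendsto_intros 1 2 E_tendsto assms)
    then have "(\<lambda>n. E n (t + s) x) \<longlonglongrightarrow> sg t (sg s x)"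
      by (simp add: linear_diff[OF E_linear[OF assms(1)]])
    moreover have "(\<lambda>n. E n (t + s) x) \<longlonglongrightarrow> sg (t + s) x" using assms by (intro E_tendsto) auto
    ultimately show "sg (t + s) x - sg t (sg s x) = 0" using LIMSEQ_unique by auto
  qed
  then show ?thesis by simp
qed

lemma sg_expand:
  assumes xy: "(x, y) \<in> G" and e: "0 < e"
  obtains d where "0 < d" "\<And>h. 0 \<le> h \<Longrightarrow> h < d \<Longrightarrow> norm (sg h x - x - h *\<^sub>R y) \<le> e * h"
proof -
  obtain y' w where y': "(y', w) \<in> G" "norm (y' - y) < e / 4" using dense1[of "e / 4" y] e by auto
  \<comment> \<open>Chosen so that \<open>h * norm w \<le> e / 2\<close> for \<open>h < d\<close>;
    the \<open>+ 1\<close> covers \<open>w = 0\<close>.\<close>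
  define d where "d = e / (2 * (norm w + 1))"
  have d: "0 < d" using e by (simp add: d_def add_nonneg_pos)
  have "norm (sg h x - x - h *\<^sub>R y) \<le> e * h" if h: "0 \<le> h" "h < d" for h
  proof -
    have hw: "h * norm w \<le> e / 2"
    proof -
      have "h * norm w \<le> d * (norm w + 1)" using h d by (intro mult_mono) auto
also have "\<dots> = e / 2"
      using add_nonneg_pos[OF norm_ge_zero zero_less_one, of w] unfolding d_def by (simp add: divide_simps)
      finally show ?thesis .
    qed
    have "norm (E n h x - (x + h *\<^sub>R y)) \<le> e * h" for n
    proof -
      let ?h = "h / Suc n"
      have h0: "0 \<le> ?h" using h by simp
      have B: "norm ((J ?h ^^ k) y - y) \<le> e" if "k \<le> Suc n" for k
      proof -
        have eq: "(J ?h ^^ k) y - y = (J ?h ^^ k) (y - y') + ((J ?h ^^ k) y' - y') + (y' - y)"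
          using linear_diff[OF Jn_linear[OF h0], of k y y'] by (simp del: of_nat_Suc)
        have "norm ((J ?h ^^ k) (y - y')) < e / 4"
          using Jn_norm[OF h0, of k "y - y'"] y'(2) by (simp only: norm_minus_commute[of y])
        moreover have "norm ((J ?h ^^ k) y' - y') \<le> e / 2"
        proof -
          have "k * ?h \<le> h" using mult_right_mono[OF of_nat_mono[OF that] h0] by (simp del: of_nat_Suc)
          then have "k * ?h * norm w \<le> h * norm w" by (intro mult_right_mono) auto
          then show ?thesis using Jn_move[OF y'(1) h0, of k] hw by linarith
        qed
        ultimately show ?thesis
          unfolding eq using y'(2) norm_triangle_ineq[of "(J ?h ^^ k) (y - y') + ((J ?h ^^ k) y' - y')" "y' - y"]
            norm_triangle_ineq[of "(J ?h ^^ k) (y - y')" "(J ?h ^^ k) y' - y'"] by linarith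
      qed
      have Nh: "real (Suc n) * ?h = h" by simp
      from Jn_expand[OF xy h0 B, of "Suc n"] show ?thesis
        unfolding E_def Nh by (simp only: diff_diff_eq mult.commute)
    qed
    from sg_limitD[OF h(1) this] show ?thesis by (simp add: algebra_simps)
  qed
  with d show ?thesis by (rule that)
qed

section \<open>The generator of the limit semigroup\<close>

lemma sg_generator1:
  assumes "(x, y) \<in> G"
  shows "((\<lambda>h. (1 / h) *\<^sub>R (sg h x - x)) \<longlongrightarrow> y) (at_right 0)"
proof (rule tendstoI)
  fix e :: real assume "0 < e"
  then obtain d where d: "0 < d" "\<And>h. 0 \<le> h \<Longrightarrow> h < d \<Longrightarrow> norm (sg h x - x - h *\<^sub>R y) \<le> e / 2 * h"
    using sg_expand[OF assms, of "e / 2"] by auto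
  have "dist ((1 / h) *\<^sub>R (sg h x - x)) y < e" if "0 < h" "h < d" for h
  proof -
    have "(1 / h) *\<^sub>R (sg h x - x) - y = (1 / h) *\<^sub>R (sg h x - x - h *\<^sub>R y)"
      using that by (simp add: algebra_simps)
    then have "norm ((1 / h) *\<^sub>R (sg h x - x) - y) \<le> e / 2"
      using d(2)[of h] that by (simp only: norm_scaleR) (simp add: field_simps)
    then show ?thesis using \<open>0 < e\<close> by (simp add: dist_norm)
  qed
  then show "\<forall>\<^sub>F h in at_right 0. dist ((1 / h) *\<^sub>R (sg h x - x)) y < e"
    using d(1) eventually_at_right_less unfolding eventually_at_right_field by blast
qed

text \<open>An m-dissipative relation has no proper dissipative extension. If \<open>y\<close> is
  the derivative at \<open>0\<close>, the resolvent equation with datum \<open>x - y\<close> is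
  solved by a pair \<open>(a, b)\<close>. Contractivity makes the difference quotients at
  \<open>x - a\<close> dissipative, and \<open>y - b = x - a\<close> then forces
  \<open>x = a\<close>.\<close>

lemma sg_generator:
  "(x, y) \<in> G \<longleftrightarrow> ((\<lambda>h. (1 / h) *\<^sub>R (sg h x - x)) \<longlongrightarrow> y) (at_right 0)"
proof
  assume *: "((\<lambda>h. (1 / h) *\<^sub>R (sg h x - x)) \<longlongrightarrow> y) (at_right 0)"
  obtain a b where ab: "(a, b) \<in> G" "a - 1 *\<^sub>R b = x - y" using range[of 1 "x - y"] by auto
  have "((\<lambda>h. (1 / h) *\<^sub>R (sg h x - x) - (1 / h) *\<^sub>R (sg h a - a)) \<longlongrightarrow> y - b) (at_right 0)"
    by (rule tendsto_diff[OF * sg_generator1[OF ab(1)]])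
  then have "((\<lambda>h. inner ((1 / h) *\<^sub>R (sg h x - x) - (1 / h) *\<^sub>R (sg h a - a)) (x - a)) \<longlongrightarrow> inner (y - b) (x - a)) (at_right 0)"
    by (rule tendsto_inner[OF _ tendsto_const])
  moreover have "inner ((1 / h) *\<^sub>R (sg h x - x) - (1 / h) *\<^sub>R (sg h a - a)) (x - a) \<le> 0" if "0 < h" for h
  proof -
    have "(1 / h) *\<^sub>R (sg h x - x) - (1 / h) *\<^sub>R (sg h a - a) = (1 / h) *\<^sub>R (sg h (x - a) - (x - a))"
      using that by (simp add: linear_diff[OF sg_linear] algebra_simps)
    moreover have "inner (sg h (x - a)) (x - a) \<le> inner (x - a) (x - a)"
    proof -
      have "norm (sg h (x - a)) * norm (x - a) \<le> norm (x - a) * norm (x - a)"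
        using that by (intro mult_right_mono sg_norm) auto
      then show ?thesis using norm_cauchy_schwarz[of "sg h (x - a)" "x - a"]
        by (simp add: power2_norm_eq_inner[symmetric] power2_eq_square)
    qed
    ultimately show ?thesis using that by (simp add: inner_diff_left divide_nonpos_pos)
  qed
  then have "\<forall>\<^sub>F h in at_right 0. inner ((1 / h) *\<^sub>R (sg h x - x) - (1 / h) *\<^sub>R (sg h a - a)) (x - a) \<le> 0"
    by (simp add: eventually_at_right_field) (meson zero_less_one)
  ultimately have "inner (y - b) (x - a) \<le> 0" by (intro tendsto_upperbound) auto
  moreover have "y - b = x - a" using ab(2) by (simp add: algebra_simps)
  ultimately have "x = a" by (metis inner_gt_zero_iff linorder_not_less right_minus_eq)
  then show "(x, y) \<in> G" using ab by simp
qed (rule sg_generator1)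

lemma sg_pair: assumes "(x, y) \<in> G" "0 \<le> t" shows "(sg t x, sg t y) \<in> G"
  unfolding sg_generator
proof (rule Lim_transform_eventually)
  have "bounded_linear (sg t)"
    using sg_linear[OF assms(2)] sg_norm[OF assms(2)] by (intro bounded_linear_intro[of _ 1]) (auto simp: linear_add linear_scale)
  then show "((\<lambda>h. sg t ((1 / h) *\<^sub>R (sg h x - x))) \<longlongrightarrow> sg t y) (at_right 0)"
    using sg_generator1[OF assms(1)] bounded_linear.tendsto by blast
  have "sg t ((1 / h) *\<^sub>R (sg h x - x)) = (1 / h) *\<^sub>R (sg h (sg t x) - sg t x)" if "0 < h" for h
    using sg_add[of t h x] sg_add[of h t x] that assms(2)
    by (simp add: linear_diff[OF sg_linear] linear_scale[OF sg_linear] add.commute)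
  then show "\<forall>\<^sub>F h in at_right 0. sg t ((1 / h) *\<^sub>R (sg h x - x)) = (1 / h) *\<^sub>R (sg h (sg t x) - sg t x)"
    by (simp add: eventually_at_right_field) (meson zero_less_one)
qed

lemma sg_lipschitz:
  assumes "(x, y) \<in> G" "0 \<le> s" "0 \<le> t"
  shows "norm (sg t x - sg s x) \<le> \<bar>t - s\<bar> * norm y"
proof -
  have *: "norm (sg h x - x) \<le> h * norm y" if "0 \<le> h" for h
  proof (rule sg_limitD[OF that])
    show "norm (E n h x - x) \<le> h * norm y" for n
      using Jn_move[OF assms(1), of "h / Suc n" "Suc n"] that by (simp add: E_def del: funpow.simps of_nat_Suc)
  qed
  have "norm (sg (s + h) x - sg s x) \<le> h * norm y" if "0 \<le> s" "0 \<le> h" for s h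
    using *[of h] sg_norm[of s "sg h x - x"] that
    by (simp add: sg_add linear_diff[OF sg_linear])
  from this[of s "t - s"] this[of t "s - t"] assms show ?thesis
    by (cases "s \<le> t") (auto simp: norm_minus_commute)
qed

lemma sg_continuous: assumes "0 \<le> t" shows "((\<lambda>s. sg s x) \<longlongrightarrow> sg t x) (at t within {0..})"
proof (rule tendstoI)
  fix e :: real assume e: "0 < e"
  obtain x' y where x': "(x', y) \<in> G" "norm (x' - x) < e / 4" using dense1[of "e / 4" x] e by auto
  define d where "d = e / (2 * (norm y + 1))"
  have d: "0 < d" using e by (simp add: d_def add_nonneg_pos)
  have "dist (sg s x) (sg t x) < e" if s: "0 \<le> s" "dist s t < d" for s
  proof -
    have "\<bar>s - t\<bar> * norm y \<le> d * (norm y + 1)" using s d by (intro mult_mono) (auto simp: dist_real_def)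
also have "\<dots> = e / 2"
      using add_nonneg_pos[OF norm_ge_zero zero_less_one, of y] unfolding d_def by (simp add: divide_simps)
    finally have 1: "norm (sg s x' - sg t x') \<le> e / 2" using sg_lipschitz[OF x'(1) assms s(1)] by simp
    have 2: "norm (sg k (x - x')) < e / 4" if "0 \<le> k" for k
      using sg_norm[OF that, of "x - x'"] x'(2) by (simp add: norm_minus_commute)
    have "sg s x - sg t x = sg s (x - x') + (sg s x' - sg t x') - sg t (x - x')"
      using s(1) assms by (simp add: linear_diff[OF sg_linear])
    then show ?thesis using 1 2[OF s(1)] 2[OF assms]
        norm_triangle_ineq4[of "sg s (x - x') + (sg s x' - sg t x')" "sg t (x - x')"]
        norm_triangle_ineq[of "sg s (x - x')" "sg s x' - sg t x'"] by (simp add: dist_norm)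
  qed
  then show "\<forall>\<^sub>F s in at t within {0..}. dist (sg s x) (sg t x) < e"
    using d unfolding eventually_at by (auto simp: dist_commute)
qed

lemma sg_derivative:
  assumes xy: "(x, y) \<in> G" and t: "0 \<le> t"
  shows "((\<lambda>s. sg s x) has_vector_derivative sg t y) (at t within {0..})"
  unfolding has_vector_derivative_def has_derivative_within_alt
proof (intro conjI allI impI bounded_linear_scaleR_left)
  fix e :: real assume e: "0 < e"
  obtain d1 where d1: "0 < d1" "\<And>h. 0 \<le> h \<Longrightarrow> h < d1 \<Longrightarrow> norm (sg h x - x - h *\<^sub>R y) \<le> e / 2 * h"
    using sg_expand[OF xy, of "e / 2"] e by auto
  have "\<forall>\<^sub>F s in at t within {0..}. dist (sg s y) (sg t y) < e / 2"
    using tendstoD[OF sg_continuous[OF t], of "e / 2" y] e by simp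
  then obtain d2 where d2: "0 < d2" "\<And>s. 0 \<le> s \<Longrightarrow> s \<noteq> t \<Longrightarrow> dist s t < d2 \<Longrightarrow> dist (sg s y) (sg t y) < e / 2"
    unfolding eventually_at by auto
  show "\<exists>d>0. \<forall>s\<in>{0..}. norm (s - t) < d \<longrightarrow>
      norm (sg s x - sg t x - (s - t) *\<^sub>R sg t y) \<le> e * norm (s - t)"
  proof (intro exI[of _ "min d1 d2"] conjI ballI impI)
    fix s :: real assume s: "s \<in> {0..}" "norm (s - t) < min d1 d2"
    show "norm (sg s x - sg t x - (s - t) *\<^sub>R sg t y) \<le> e * norm (s - t)"
    proof (cases "t \<le> s")
      case True
      have "sg s x = sg t (sg (s - t) x)" using sg_add[OF t, of "s - t" x] True by simp
      then have "sg s x - sg t x - (s - t) *\<^sub>R sg t y = sg t (sg (s - t) x - x - (s - t) *\<^sub>R y)"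
        using t by (simp add: linear_diff[OF sg_linear] linear_scale[OF sg_linear])
      then have "norm (sg s x - sg t x - (s - t) *\<^sub>R sg t y) \<le> e / 2 * (s - t)"
        using sg_norm[OF t, of "sg (s - t) x - x - (s - t) *\<^sub>R y"] d1(2)[of "s - t"] True s by auto
      moreover have "0 \<le> e * (s - t)" using True e by simp
      ultimately show ?thesis using True by simp
    next
      case False
      have s0: "0 \<le> s" using s by simp
      \<comment> \<open>For \<open>s < t\<close> the increment is expanded from \<open>s\<close>,
        which produces \<open>sg s y\<close> in place of \<open>sg t y\<close>; strong continuity
        supplies the missing \<open>e / 2\<close>.\<close>
      have "sg t x = sg s (sg (t - s) x)" using sg_add[OF s0, of "t - s" x] False by simp
      then have eq: "sg s x - sg t x - (s - t) *\<^sub>R sg t y =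
          (t - s) *\<^sub>R (sg t y - sg s y) - sg s (sg (t - s) x - x - (t - s) *\<^sub>R y)"
        unfolding linear_diff[OF sg_linear[OF s0]] linear_scale[OF sg_linear[OF s0]]
        by (simp add: scaleR_diff_left scaleR_diff_right)
      have "norm (sg s (sg (t - s) x - x - (t - s) *\<^sub>R y)) \<le> e / 2 * (t - s)"
        using sg_norm[OF s0, of "sg (t - s) x - x - (t - s) *\<^sub>R y"] d1(2)[of "t - s"] False s by auto
      moreover have "norm ((t - s) *\<^sub>R (sg t y - sg s y)) \<le> (t - s) * (e / 2)"
        using d2(2)[of s] s False by (simp add: dist_norm norm_minus_commute)
      moreover have "e * norm (s - t) = (t - s) * (e / 2) + e / 2 * (t - s)" using False by (simp add: field_simps)
      ultimately show ?thesis unfolding eq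
        using norm_triangle_ineq4[of "(t - s) *\<^sub>R (sg t y - sg s y)" "sg s (sg (t - s) x - x - (t - s) *\<^sub>R y)"] False
        by linarith
    qed
  qed (use d1 d2 in auto)
qed

lemma sg_norm_derivative:
  assumes "(x, y) \<in> G" "0 \<le> t"
  shows "((\<lambda>s. (norm (sg s x))\<^sup>2) has_real_derivative 2 * inner (sg t y) (sg t x)) (at t within {0..})"
proof -
  have "((\<lambda>s. inner (sg s x) (sg s x)) has_vector_derivative inner (sg t x) (sg t y) + inner (sg t y) (sg t x)) (at t within {0..})"
    by (intro bounded_bilinear.has_vector_derivative[OF bounded_bilinear_inner] sg_derivative assms)
  then show ?thesis
    by (simp add: has_real_derivative_iff_has_vector_derivative power2_norm_eq_inner inner_commute)
qed

text \<open>An operator that preserves \<open>G\<close> commutes with every resolvent, hence with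
  the exponential formula. It is applied to the restriction of the memory component to the
  interval.\<close>

lemma sg_commute:
  assumes P: "bounded_linear P" and G: "\<And>x y. (x, y) \<in> G \<Longrightarrow> (P x, P y) \<in> G" and t: "0 \<le> t"
  shows "sg t (P z) = P (sg t z)"
proof -
  interpret P: bounded_linear P by (rule P)
  have J: "J h (P z) = P (J h z)" if "0 \<le> h" for h z
  proof (cases "h = 0")
    case False
    then have "0 < h" using that by simp
    then obtain x y where xy: "(x, y) \<in> G" "x - h *\<^sub>R y = z" using range[of h z] by blast
    have "J h (P x - h *\<^sub>R P y) = P x" by (rule J_eq[OF G[OF xy(1)] that])
    moreover have "P z = P x - h *\<^sub>R P y" unfolding xy(2)[symmetric] P.diff P.scaleR ..
    moreover have "J h z = x" using J_eq[OF xy(1) that] unfolding xy(2) .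
    ultimately show ?thesis by simp
  qed simp
  have Jn: "(J h ^^ n) (P z) = P ((J h ^^ n) z)" if "0 \<le> h" for h n
    by (induction n) (simp_all add: J[OF that])
  have "(\<lambda>n. E n t (P z)) \<longlonglongrightarrow> P (sg t z)"
    using P.tendsto[OF E_tendsto[OF t, of z]] t unfolding E_def by (subst Jn) auto
  then show ?thesis using E_tendsto[OF t, of "P z"] LIMSEQ_unique by blast
qed

end

subsection \<open>The inverse of the square root\<close>

text \<open>The iteration solves \<open>X = (T + X\<^sup>2) / 2\<close> for a contraction \<open>T\<close>, so that \<open>(1 - X)\<^sup>2 = 1 - T\<close>;
  it is majorised by the same scalar iteration with \<open>T = 1\<close>.\<close>

primrec sqrt_iter :: "('a::real_vector \<Rightarrow> 'a) \<Rightarrow> nat \<Rightarrow> 'a \<Rightarrow> 'a" where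
  "sqrt_iter T 0 = (\<lambda>v. 0)"
| "sqrt_iter T (Suc n) = (\<lambda>v. (1/2) *\<^sub>R (T v + sqrt_iter T n (sqrt_iter T n v)))"

primrec sqrt_maj :: "nat \<Rightarrow> real" where
  "sqrt_maj 0 = 0"
| "sqrt_maj (Suc n) = (1 + (sqrt_maj n)\<^sup>2) / 2"

lemma sqrt_maj_bounds: "0 \<le> sqrt_maj n \<and> sqrt_maj n \<le> 1"
  by (induction n) (auto simp: power_le_one)

lemma sqrt_maj_mono: "mono sqrt_maj"
proof (rule monoI[OF lift_Suc_mono_le])
  fix n
  have "0 \<le> (1 - sqrt_maj n)\<^sup>2" by simp
  then show "sqrt_maj n \<le> sqrt_maj (Suc n)" by (simp add: power2_eq_square algebra_simps)
qed auto

lemma sqrt_maj_Cauchy: "Cauchy sqrt_maj"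
  using incseq_convergent[OF sqrt_maj_mono, of 1] sqrt_maj_bounds
  by (meson LIMSEQ_imp_Cauchy)

section \<open>Convergence of the square root iteration\<close>

locale contraction_op =
  fixes T :: "'a::{real_inner, complete_space} \<Rightarrow> 'a"
  assumes lin: "linear T" and con: "norm (T v) \<le> norm v"
begin

lemma iter_linear: "linear (sqrt_iter T n)"
proof (induction n)
  case (Suc n)
  show ?case
    by (auto intro!: linearI simp: linear_add[OF Suc] linear_scale[OF Suc] linear_add[OF lin] linear_scale[OF lin] algebra_simps)
qed (auto intro: linearI)

lemma iter_norm: "norm (sqrt_iter T n v) \<le> sqrt_maj n * norm v"
proof (induction n arbitrary: v)
  case (Suc n)
  have "norm (sqrt_iter T n (sqrt_iter T n v)) \<le> sqrt_maj n * (sqrt_maj n * norm v)"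
    using Suc[of v] Suc[of "sqrt_iter T n v"] sqrt_maj_bounds[of n] by (meson mult_left_mono order_trans)
  then have "norm (T v + sqrt_iter T n (sqrt_iter T n v)) \<le> norm v + sqrt_maj n * (sqrt_maj n * norm v)"
    using con[of v] norm_triangle_ineq[of "T v" "sqrt_iter T n (sqrt_iter T n v)"] by linarith
  then show ?case by (simp add: power2_eq_square distrib_right)
qed simp

text \<open>\<open>X^2 - Y^2 = X (X - Y) + (X - Y) Y\<close> is applied to consecutive iterates. The
  scalar iteration satisfies the same identity with nonnegative increasing terms, so it bounds each
  factor.\<close>

lemma iter_step: "norm (sqrt_iter T (Suc n) v - sqrt_iter T n v) \<le> (sqrt_maj (Suc n) - sqrt_maj n) * norm v"
proof (induction n arbitrary: v)
  case 0 then show ?case using con[of v] by simp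
next
  case (Suc n)
  let ?X = "sqrt_iter T" and ?x = sqrt_maj
  have "?X (Suc (Suc n)) v - ?X (Suc n) v = (1/2) *\<^sub>R (?X (Suc n) (?X (Suc n) v) - ?X n (?X n v))"
    by (simp only: sqrt_iter.simps) (simp add: algebra_simps)
  also have "?X (Suc n) (?X (Suc n) v) - ?X n (?X n v) =
      ?X (Suc n) (?X (Suc n) v - ?X n v) + (?X (Suc n) (?X n v) - ?X n (?X n v))"
    by (simp only: linear_diff[OF iter_linear]) simp
  finally have eq: "?X (Suc (Suc n)) v - ?X (Suc n) v = (1/2) *\<^sub>R (?X (Suc n) (?X (Suc n) v - ?X n v) + (?X (Suc n) (?X n v) - ?X n (?X n v)))" .
  have d: "0 \<le> ?x (Suc n) - ?x n" using monoD[OF sqrt_maj_mono, of n "Suc n"] by simp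
  have 1: "norm (?X (Suc n) (?X (Suc n) v - ?X n v)) \<le> ?x (Suc n) * ((?x (Suc n) - ?x n) * norm v)"
    using iter_norm[of "Suc n" "?X (Suc n) v - ?X n v"] Suc[of v] sqrt_maj_bounds[of "Suc n"] by (meson mult_left_mono order_trans)
  have 2: "norm (?X (Suc n) (?X n v) - ?X n (?X n v)) \<le> (?x (Suc n) - ?x n) * (?x n * norm v)"
    using Suc[of "?X n v"] iter_norm[of n v] d by (meson mult_left_mono order_trans)
  have 3: "norm (?X (Suc (Suc n)) v - ?X (Suc n) v) \<le> 1/2 * (?x (Suc n) * ((?x (Suc n) - ?x n) * norm v) + (?x (Suc n) - ?x n) * (?x n * norm v))"
    unfolding eq norm_scaleR using norm_triangle_ineq[of "?X (Suc n) (?X (Suc n) v - ?X n v)" "?X (Suc n) (?X n v) - ?X n (?X n v)"] 1 2 by simp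
  have x: "?x (Suc (Suc n)) = (1 + (?x (Suc n))\<^sup>2) / 2" "(?x n)\<^sup>2 = 2 * ?x (Suc n) - 1" by (simp_all add: field_simps)
  have "1/2 * (?x (Suc n) * ((?x (Suc n) - ?x n) * norm v) + (?x (Suc n) - ?x n) * (?x n * norm v)) = ((?x (Suc n))\<^sup>2 - (?x n)\<^sup>2) / 2 * norm v"
    by (simp del: sqrt_maj.simps add: power2_eq_square algebra_simps diff_divide_distrib)
  also have "\<dots> = (?x (Suc (Suc n)) - ?x (Suc n)) * norm v"
    by (simp only: x) (simp del: sqrt_maj.simps add: field_simps)
  finally show ?case using 3 by simp
qed

lemma iter_Cauchy: "Cauchy (\<lambda>n. sqrt_iter T n v)"
proof (rule metric_CauchyI)
  fix e :: real assume "0 < e"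
  have le: "norm (sqrt_iter T (n + k) v - sqrt_iter T n v) \<le> (sqrt_maj (n + k) - sqrt_maj n) * norm v" for n k
  proof (induction k)
    case (Suc k)
    then show ?case
      using iter_step[of "n + k" v] norm_triangle_ineq[of "sqrt_iter T (n + Suc k) v - sqrt_iter T (n + k) v" "sqrt_iter T (n + k) v - sqrt_iter T n v"]
      by (simp only: add_Suc_right left_diff_distrib diff_add_cancel add_diff_eq)
  qed simp
  have "0 < e / (norm v + 1)" using \<open>0 < e\<close> by (simp add: add_nonneg_pos)
  then obtain M where M: "\<And>m n. m \<ge> M \<Longrightarrow> n \<ge> M \<Longrightarrow> dist (sqrt_maj m) (sqrt_maj n) < e / (norm v + 1)"
    using metric_CauchyD[OF sqrt_maj_Cauchy] by blast
  have lt: "dist (sqrt_iter T m v) (sqrt_iter T n v) < e" if "M \<le> n" "n \<le> m" for m n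
  proof -
    have "norm (sqrt_iter T m v - sqrt_iter T n v) \<le> (sqrt_maj m - sqrt_maj n) * norm v"
      using le[of n "m - n"] that by simp
    also have "\<dots> \<le> (sqrt_maj m - sqrt_maj n) * (norm v + 1)"
      using monoD[OF sqrt_maj_mono that(2)] by (intro mult_left_mono) auto
    also have "\<dots> < e"
      using M[of m n] that \<open>0 < e\<close> monoD[OF sqrt_maj_mono that(2)] by (simp add: dist_real_def pos_less_divide_eq add_nonneg_pos)
    finally show ?thesis by (simp add: dist_norm)
  qed
  show "\<exists>M. \<forall>m\<ge>M. \<forall>n\<ge>M. dist (sqrt_iter T m v) (sqrt_iter T n v) < e"
    using lt by (metis dist_commute nle_le)
qed

definition X :: "'a \<Rightarrow> 'a" where "X v = lim (\<lambda>n. sqrt_iter T n v)"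

lemma X_tendsto: "(\<lambda>n. sqrt_iter T n v) \<longlonglongrightarrow> X v"
  unfolding X_def using Cauchy_convergent[OF iter_Cauchy] convergent_LIMSEQ_iff by blast

lemma X_linear: "linear X"
proof (rule linearI)
  fix x y c
  have "(\<lambda>n. sqrt_iter T n x + sqrt_iter T n y) \<longlonglongrightarrow> X x + X y" "(\<lambda>n. c *\<^sub>R sqrt_iter T n x) \<longlonglongrightarrow> c *\<^sub>R X x"
    by (intro tendsto_intros X_tendsto)+
  then have "(\<lambda>n. sqrt_iter T n (x + y)) \<longlonglongrightarrow> X x + X y" "(\<lambda>n. sqrt_iter T n (c *\<^sub>R x)) \<longlonglongrightarrow> c *\<^sub>R X x"
    by (simp_all add: linear_add[OF iter_linear] linear_scale[OF iter_linear])
  then show "X (x + y) = X x + X y" "X (c *\<^sub>R x) = c *\<^sub>R X x"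
    using X_tendsto LIMSEQ_unique by blast+
qed

lemma iter_norm1: "norm (sqrt_iter T n v) \<le> norm v"
  using iter_norm[of n v] sqrt_maj_bounds[of n] by (meson mult_left_le_one_le norm_ge_zero order_trans)

lemma X_norm: "norm (X v) \<le> norm v"
  using iter_norm1 by (intro LIMSEQ_le_const2[OF tendsto_norm[OF X_tendsto]]) auto

lemma X_fix: "X v = (1/2) *\<^sub>R (T v + X (X v))"
proof -
  have 1: "(\<lambda>n. sqrt_iter T n (sqrt_iter T n v - X v)) \<longlonglongrightarrow> 0"
    using tendsto_norm[OF tendsto_diff[OF X_tendsto[of v] tendsto_const[of "X v"]]]
    by (intro Lim_null_comparison[OF eventuallyI[OF iter_norm1]]) simp
  have "(\<lambda>n. (1/2) *\<^sub>R (T v + (sqrt_iter T n (sqrt_iter T n v - X v) + sqrt_iter T n (X v)))) \<longlonglongrightarrow> (1/2) *\<^sub>R (T v + (0 + X (X v)))"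
    by (intro tendsto_intros 1 X_tendsto)
  then have "(\<lambda>n. sqrt_iter T (Suc n) v) \<longlonglongrightarrow> (1/2) *\<^sub>R (T v + X (X v))"
    by (simp add: linear_diff[OF iter_linear])
  then show ?thesis using LIMSEQ_Suc[OF X_tendsto[of v]] LIMSEQ_unique by blast
qed

lemma X_symmetric:
  assumes "\<And>u v. inner (T u) v = inner u (T v)"
  shows "inner (X u) v = inner u (X v)"
proof -
  have "inner (sqrt_iter T n u) v = inner u (sqrt_iter T n v)" for n u v
    by (induction n arbitrary: u v) (simp_all add: inner_add assms)
  then have "(\<lambda>n. inner (sqrt_iter T n u) v) \<longlonglongrightarrow> inner u (X v)"
    using tendsto_inner[OF tendsto_const X_tendsto] by simp
  moreover have "(\<lambda>n. inner (sqrt_iter T n u) v) \<longlonglongrightarrow> inner (X u) v"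
    by (intro tendsto_intros X_tendsto)
  ultimately show ?thesis using LIMSEQ_unique by blast
qed

lemma X_commute:
  assumes C: "bounded_linear C" and "\<And>v. C (T v) = T (C v)"
  shows "C (X v) = X (C v)"
proof -
  interpret C: bounded_linear C by fact
  have "C (sqrt_iter T n v) = sqrt_iter T n (C v)" for n v
    by (induction n arbitrary: v) (simp_all add: C.add C.scaleR assms)
  then have "(\<lambda>n. C (sqrt_iter T n v)) \<longlonglongrightarrow> X (C v)" using X_tendsto[of "C v"] by simp
  moreover have "(\<lambda>n. C (sqrt_iter T n v)) \<longlonglongrightarrow> C (X v)" by (intro C.tendsto X_tendsto)
  ultimately show ?thesis using LIMSEQ_unique by blast
qed

end

text \<open>With \<open>K' = K / c\<close> of norm at most \<open>1\<close>, the operator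
  \<open>1 - K'\<close> is a contraction, and \<open>X_fix\<close> for it reads
  \<open>(1 - X)^2 = K'\<close>; hence \<open>R = sqrt c (1 - X)\<close>. The commutation clause is
  what the uniqueness of square roots relies on.\<close>

lemma bounded_positive_sqrt:
  fixes K :: "'a::{real_inner, complete_space} \<Rightarrow> 'a"
  assumes K: "bounded_linear K" and sym: "\<And>u v. inner (K u) v = inner u (K v)" and pos: "\<And>v. 0 \<le> inner (K v) v"
  obtains R where "bounded_linear R" "\<And>u v. inner (R u) v = inner u (R v)" "\<And>v. 0 \<le> inner (R v) v"
    "\<And>v. R (R v) = K v" "\<forall>C. bounded_linear C \<longrightarrow> (\<forall>v. C (K v) = K (C v)) \<longrightarrow> (\<forall>v. C (R v) = R (C v))"
proof -
  interpret K: bounded_linear K by fact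
  obtain c where c: "0 < c" "\<And>v. norm (K v) \<le> norm v * c" using K.pos_bounded by blast
  define K' where "K' v = (1 / c) *\<^sub>R K v" for v
  have K'1: "norm (K' v) \<le> norm v" for v using c by (simp add: K'_def field_simps)
  have linK': "linear K'" unfolding K'_def
    by (intro linearI) (auto simp: K.add K.scaleR algebra_simps)
  have sym': "inner (K' u) v = inner u (K' v)" for u v by (simp add: K'_def sym)
  have pos': "0 \<le> inner (K' v) v" for v using pos[of v] c by (simp add: K'_def)
  \<comment> \<open>Positivity at \<open>v - K' v\<close> yields the operator inequality
    \<open>K'^2 \<le> K'\<close>, which makes \<open>1 - K'\<close> a contraction.\<close>
  have K'2: "(norm (K' v))\<^sup>2 \<le> inner (K' v) v" for v
  proof -
    have "0 \<le> inner (K' (v - K' v)) (v - K' v)" by (rule pos')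
    also have "\<dots> = inner (K' v) v - 2 * (norm (K' v))\<^sup>2 + inner (K' (K' v)) (K' v)"
      unfolding power2_norm_eq_inner by (simp add: linear_diff[OF linK'] inner_diff sym' inner_commute)
    also have "inner (K' (K' v)) (K' v) \<le> norm (K' v) * norm (K' v)"
      using norm_cauchy_schwarz[of "K' (K' v)" "K' v"] K'1[of "K' v"] by (meson mult_right_mono norm_ge_zero order_trans)
    finally show ?thesis by (simp add: power2_eq_square)
  qed
  interpret contraction_op "\<lambda>v. v - K' v"
  proof (rule contraction_op.intro)
    show "linear (\<lambda>v. v - K' v)" using linK' by (auto intro!: linearI simp: linear_add linear_scale algebra_simps)
    fix v
    have "(norm (v - K' v))\<^sup>2 = (norm v)\<^sup>2 - 2 * inner (K' v) v + (norm (K' v))\<^sup>2"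
      unfolding power2_norm_eq_inner by (simp add: inner_diff inner_commute)
    also have "\<dots> \<le> (norm v)\<^sup>2" using K'2[of v] pos'[of v] by simp
    finally show "norm (v - K' v) \<le> norm v" by (simp add: power2_le_iff_abs_le)
  qed
  define R where "R v = sqrt c *\<^sub>R (v - X v)" for v
  show ?thesis
  proof (rule that)
    show "bounded_linear R"
    proof (rule bounded_linear_intro)
      fix x show "norm (R x) \<le> norm x * (sqrt c * 2)"
        using X_norm[of x] norm_triangle_ineq4[of x "X x"] c(1) by (simp add: R_def mult.commute mult.left_commute)
    qed (auto simp: R_def linear_add[OF X_linear] linear_scale[OF X_linear] algebra_simps)
    show "inner (R u) v = inner u (R v)" for u v
      using X_symmetric[of u v] by (simp add: R_def inner_diff sym')
    show "0 \<le> inner (R v) v" for v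
    proof -
      have "inner (X v) v \<le> inner v v"
        using norm_cauchy_schwarz[of "X v" v] X_norm[of v]
        unfolding power2_norm_eq_inner[symmetric] power2_eq_square by (meson mult_right_mono norm_ge_zero order_trans)
      then show ?thesis using c by (simp add: R_def inner_diff)
    qed
    show "R (R v) = K v" for v
    proof -
      have *: "X v = (1/2) *\<^sub>R (v - K' v + X (X v))" by (rule X_fix)
      have "X v + X v = v - K' v + X (X v)"
        using arg_cong[OF *, of "scaleR 2"] by (simp add: scaleR_2)
      then have "v - X v - X v + X (X v) = K' v" by (simp add: algebra_simps)
      moreover have "R (R v) = (sqrt c * sqrt c) *\<^sub>R (v - X v - X v + X (X v))"
        by (simp add: R_def linear_diff[OF X_linear] linear_scale[OF X_linear] algebra_simps)
      ultimately show ?thesis using c(1) by (simp add: K'_def)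
    qed
    show "\<forall>C. bounded_linear C \<longrightarrow> (\<forall>v. C (K v) = K (C v)) \<longrightarrow> (\<forall>v. C (R v) = R (C v))"
    proof (intro allI impI)
      fix C v assume C: "bounded_linear C" "\<forall>v. C (K v) = K (C v)"
      interpret C: bounded_linear C by fact
      have "C (X v) = X (C v)" by (rule X_commute[OF C(1)]) (simp add: C.diff C.scaleR C(2) K'_def)
      then show "C (R v) = R (C v)" by (simp add: R_def C.diff C.scaleR)
    qed
  qed
qed

text \<open>With \<open>a = |R y|^2\<close> the quadratic \<open>2 t a + t^2 b\<close> is
  nonnegative for every \<open>t\<close>, which forces its linear coefficient to vanish. The value
  \<open>t = - a / (b + 1)\<close> is close to the minimiser and also covers
  \<open>b = 0\<close>.\<close>

lemma positive_form_null:
  fixes R :: "'a::real_inner \<Rightarrow> 'a"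
  assumes R: "linear R" and sym: "\<And>u v. inner (R u) v = inner u (R v)" and pos: "\<And>v. 0 \<le> inner (R v) v"
    and z: "inner (R y) y = 0"
  shows "R y = 0"
proof -
  have t: "0 \<le> 2 * t * (norm (R y))\<^sup>2 + t\<^sup>2 * inner (R (R y)) (R y)" for t
  proof -
    have "0 \<le> inner (R (y + t *\<^sub>R R y)) (y + t *\<^sub>R R y)" by (rule pos)
    also have "\<dots> = 2 * t * (norm (R y))\<^sup>2 + t\<^sup>2 * inner (R (R y)) (R y)"
      unfolding power2_norm_eq_inner
      by (simp add: linear_add[OF R] linear_scale[OF R] inner_add z sym[of "R y" y] power2_eq_square algebra_simps)
    finally show ?thesis .
  qed
  define a where "a = (norm (R y))\<^sup>2"
  define b where "b = inner (R (R y)) (R y)"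
  have b: "0 \<le> b" unfolding b_def by (rule pos)
  have "0 \<le> 2 * (- a / (b + 1)) * a + (- a / (b + 1))\<^sup>2 * b" using t[of "- a / (b + 1)"] by (simp add: a_def b_def)
  also have "\<dots> = - (a\<^sup>2 * (b + 2) / (b + 1)\<^sup>2)" using b by (simp add: power2_eq_square divide_simps) (simp add: algebra_simps)
  finally have "a\<^sup>2 * (b + 2) / (b + 1)\<^sup>2 \<le> 0" by simp
  then have "a = 0" using b by (smt (verit) divide_pos_pos mult_pos_pos zero_less_power2)
  then show ?thesis by (simp add: a_def)
qed

text \<open>For \<open>y = C x - R x\<close> commutation gives
  \<open>(C + R) y = (C^2 - R^2) x = 0\<close>, so both nonnegative forms vanish at
  \<open>y\<close>, and \<open>positive_form_null\<close> applies.\<close>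

lemma positive_sqrt_unique:
  fixes K R C :: "'a::{real_inner, complete_space} \<Rightarrow> 'a"
  assumes R: "linear R" "\<And>u v. inner (R u) v = inner u (R v)" "\<And>v. 0 \<le> inner (R v) v" "\<And>v. R (R v) = K v"
    and C: "linear C" "\<And>u v. inner (C u) v = inner u (C v)" "\<And>v. 0 \<le> inner (C v) v" "\<And>v. C (C v) = K v"
    and com: "\<And>v. C (R v) = R (C v)" and inj: "\<And>v. K v = 0 \<Longrightarrow> v = 0"
  shows "C = R"
proof
  fix x
  define y where "y = C x - R x"
  have "C y + R y = 0" by (simp add: y_def linear_diff[OF C(1)] linear_diff[OF R(1)] C(4) R(4) com)
  then have "inner (C y) y + inner (R y) y = 0" by (metis inner_add_left inner_zero_left)
  then have "inner (R y) y = 0" using R(3)[of y] C(3)[of y] by linarith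
  then have "R y = 0" by (rule positive_form_null[OF R(1-3)])
  then have "y = 0" using inj[of y] R(4)[of y] linear_0[OF R(1)] by simp
  then show "C x = R x" by (simp add: y_def)
qed

text \<open>\<open>sqrt_dom\<close> and \<open>sqrt_op\<close> are defined by \<open>THE\<close>, so
  existence and uniqueness of the square root both have to be shown. For existence the inverse of
  \<open>R\<close> is taken, where \<open>R\<close> is the root of the inverse \<open>K\<close> of
  \<open>A\<close>. Any other root \<open>B'\<close> yields a bounded positive operator
  \<open>B' K\<close> whose square is \<open>K\<close>; it therefore commutes with \<open>K\<close>,
  hence with \<open>R\<close>, and equals \<open>R\<close>.\<close>

lemma op_sqrt_bounded_inverse:
  fixes A :: "'h::{real_inner, complete_space, second_countable_topology} \<Rightarrow> 'h"
  assumes sa: "selfadjoint_op DA A" and pos: "strictly_positive_op DA A" and cinv: "has_compact_inverse DA A"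
  obtains R where "bounded_linear R" "\<And>u v. inner (R u) v = inner u (R v)" "\<And>v. R v = 0 \<Longrightarrow> v = 0"
    "sqrt_dom DA A = range R" "\<And>a. sqrt_op DA A (R a) = a" "DA = range (\<lambda>a. R (R a))" "\<And>a. A (R (R a)) = a"
proof -
  define K where "K = inv_into DA A"
  have bij: "bij_betw A DA UNIV" using cinv by (simp add: has_compact_inverse_def)
  have KD: "K w \<in> DA" and AK: "A (K w) = w" for w
    using bij unfolding K_def bij_betw_def by (metis UNIV_I inv_into_into, metis UNIV_I f_inv_into_f)
  have KA: "K (A u) = u" if "u \<in> DA" for u
    using bij that unfolding K_def bij_betw_def by simp
  have lop: "linear_op_on DA A" using sa by (simp add: selfadjoint_op_def)
  have Kadd: "K (x + y) = K x + K y" for x y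
    using lop KA[of "K x + K y"] KD AK unfolding linear_op_on_def by metis
  have Ksc: "K (c *\<^sub>R x) = c *\<^sub>R K x" for c x
    using lop KA[of "c *\<^sub>R K x"] KD AK unfolding linear_op_on_def by metis
  \<comment> \<open>Compactness of the inverse makes the image of the unit ball bounded, and by
    scaling \<open>K\<close> is a bounded operator.\<close>
  have "compact (closure (K ` cball 0 1))"
    using cinv unfolding has_compact_inverse_def K_def by auto
  then have "bounded (K ` cball 0 1)" by (rule bounded_subset[OF compact_imp_bounded closure_subset])
  then obtain kb where kb: "\<And>v. norm v \<le> 1 \<Longrightarrow> norm (K v) \<le> kb" unfolding bounded_iff by (metis image_eqI mem_cball_0)
  have Kb: "norm (K v) \<le> norm v * kb" for v
  proof (cases "v = 0")
    case False
    have "norm (K ((1 / norm v) *\<^sub>R v)) \<le> kb" using False by (intro kb) simp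
    then show ?thesis using False by (simp add: Ksc field_simps)
  qed (use Ksc[of 0 v] in auto)
  have Kbl: "bounded_linear K" by (rule bounded_linear_intro[OF Kadd Ksc Kb])
  have Ksym: "inner (K u) v = inner u (K v)" for u v
    using sa KD[of u] KD[of v] AK unfolding selfadjoint_op_def by metis
  have K0: "v = 0" if "K v = 0" for v
    using that AK[of v] AK[of 0] Ksc[of 0 0] by simp
  have Kpos: "0 \<le> inner (K v) v" for v
    using pos KD[of v] AK[of v] unfolding strictly_positive_op_def
    by (metis inner_commute inner_zero_left less_eq_real_def)
  obtain R where R: "bounded_linear R" "\<And>u v. inner (R u) v = inner u (R v)" "\<And>v. 0 \<le> inner (R v) v"
    "\<And>v. R (R v) = K v" and Rcom: "\<forall>C. bounded_linear C \<longrightarrow> (\<forall>v. C (K v) = K (C v)) \<longrightarrow> (\<forall>v. C (R v) = R (C v))"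
    by (rule bounded_positive_sqrt[OF Kbl Ksym Kpos]) (rule that)
  interpret R: bounded_linear R by fact
  have R0: "v = 0" if "R v = 0" for v using that R(4)[of v] K0[of v] by (simp add: R.zero)
  have injR: "inj R" by (metis R0 R.diff injI right_minus_eq)
  have DA: "DA = range (\<lambda>a. R (R a))" using R(4) KD KA by (auto simp: image_iff) metis
  define B where "B u = (if u \<in> range R then inv R u else 0)" for u
  have BR: "B (R a) = a" for a using injR by (simp add: B_def)
  have sqrtB: "is_op_sqrt DA A (range R) B"
    unfolding is_op_sqrt_def
  proof (intro conjI)
    show "selfadjoint_op (range R) B"
      unfolding selfadjoint_op_def
    proof (intro conjI)
      show "linear_op_on (range R) B"
        unfolding linear_op_on_def
      proof (intro conjI ballI allI)
        show "0 \<in> range R" using R.zero by (metis rangeI)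
        fix x y c assume "x \<in> range R"
        then obtain a where x: "x = R a" by blast
        show "c *\<^sub>R x \<in> range R" "B (c *\<^sub>R x) = c *\<^sub>R B x"
          unfolding x R.scaleR[symmetric] BR by auto
        assume "y \<in> range R"
        then obtain b where y: "y = R b" by blast
        show "x + y \<in> range R" "B (x + y) = B x + B y" unfolding x y R.add[symmetric] BR by auto
      qed
      show "closure (range R) = UNIV"
        using sa DA closure_mono[of DA "range R"] unfolding selfadjoint_op_def by auto
      show "adj_dom (range R) B = range R"
      proof
        show "adj_dom (range R) B \<subseteq> range R"
        proof
          fix v assume "v \<in> adj_dom (range R) B"
          then obtain w where "\<forall>u\<in>range R. inner (B u) v = inner u w" by (auto simp: adj_dom_def)
          then have "inner a (v - R w) = 0" for a
            using BR[of a] R(2)[of a w] by (metis inner_diff_right rangeI diff_self)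
          then have "v = R w" by (metis inner_eq_zero_iff right_minus_eq)
          then show "v \<in> range R" by blast
        qed
        show "range R \<subseteq> adj_dom (range R) B"
          unfolding adj_dom_def using BR R(2) by auto
      qed
      show "\<forall>u\<in>range R. \<forall>v\<in>range R. inner (B u) v = inner u (B v)" using BR R(2) by auto
    qed
    show "\<forall>u\<in>range R. 0 \<le> inner (B u) u" using BR R(3) by (auto simp: inner_commute)
    show "{u \<in> range R. B u \<in> range R} = DA" using DA BR by auto
    have "B (B (K a)) = a" for a by (metis BR R(4))
    then show "\<forall>u\<in>DA. B (B u) = A u" using KA KD AK by metis
    show "\<forall>u. u \<notin> range R \<longrightarrow> B u = 0" by (simp add: B_def)
  qed
  have uniq: "DB = range R \<and> B' = B" if S: "is_op_sqrt DA A DB B'" for DB B'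
  proof -
    have lopB: "linear_op_on DB B'" and Bsym: "\<And>u v. u \<in> DB \<Longrightarrow> v \<in> DB \<Longrightarrow> inner (B' u) v = inner u (B' v)"
      and DAB: "\<And>u. u \<in> DA \<longleftrightarrow> u \<in> DB \<and> B' u \<in> DB" and BBA: "\<And>u. u \<in> DA \<Longrightarrow> B' (B' u) = A u"
      and Bpos: "\<And>u. u \<in> DB \<Longrightarrow> 0 \<le> inner (B' u) u" and Bout: "\<And>u. u \<notin> DB \<Longrightarrow> B' u = 0"
      using S unfolding is_op_sqrt_def selfadjoint_op_def by auto
    \<comment> \<open>Formally \<open>B' K = B' B'^{-2}\<close>, so \<open>C\<close> is going to be
      the inverse of \<open>B'\<close>.\<close>
    define C where "C w = B' (K w)" for w
    have CD: "C w \<in> DB" and BC: "B' (C w) = w" for w using KD[of w] DAB BBA AK by (auto simp: C_def)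
    have Badd: "B' (x + y) = B' x + B' y" "x + y \<in> DB" if "x \<in> DB" "y \<in> DB" for x y using lopB that by (auto simp: linear_op_on_def)
    have Bsc: "B' (c *\<^sub>R x) = c *\<^sub>R B' x" "c *\<^sub>R x \<in> DB" if "x \<in> DB" for c x using lopB that by (auto simp: linear_op_on_def)
    have Cadd: "C (x + y) = C x + C y" for x y using KD DAB by (simp add: C_def Kadd Badd)
    have Csc: "C (c *\<^sub>R x) = c *\<^sub>R C x" for c x using KD DAB by (simp add: C_def Ksc Bsc)
    have inj: "u = 0" if "u \<in> DB" "B' u = 0" for u
    proof -
      have "0 \<in> DB" "B' 0 = 0" using lopB Bsc(1)[of 0 0] unfolding linear_op_on_def by auto
      then have "u \<in> DA" "A u = 0" using that DAB BBA[of u] by auto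
      then show ?thesis using KA[of u] Ksc[of 0 0] by simp
    qed
    have CB: "C (B' u) = u" if "u \<in> DB" for u
    proof -
      have "B' (C (B' u) + (-1) *\<^sub>R u) = 0" using that CD[of "B' u"] by (simp only: Badd Bsc BC) simp
      moreover have "C (B' u) + (-1) *\<^sub>R u \<in> DB" using that CD Bsc Badd by blast
      ultimately show ?thesis using inj by fastforce
    qed
    have CC: "C (C w) = K w" for w using CB[of "K w"] KD[of w] DAB by (simp add: C_def)
    have Csym: "inner (C u) v = inner u (C v)" for u v
      using Bsym[OF CD[of u] CD[of v]] BC by simp
    have Cpos: "0 \<le> inner (C v) v" for v using Bpos[OF CD[of v]] BC by (simp add: inner_commute)
    \<comment> \<open>\<open>|C v|^2 = inner (K v) v\<close> bounds \<open>C\<close> by a square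
      root of the bound of \<open>K\<close>; the square of \<open>\<bar>kb\<bar> + 1\<close>
      dominates \<open>kb\<close> whatever its sign.\<close>
    have "norm (C v) \<le> norm v * (\<bar>kb\<bar> + 1)" for v
    proof -
      have "(norm (C v))\<^sup>2 = inner (K v) v" unfolding power2_norm_eq_inner using Csym[of "C v" v] CC by simp
      also have "\<dots> \<le> norm (K v) * norm v" by (rule norm_cauchy_schwarz)
      also have "\<dots> \<le> (norm v * kb) * norm v" by (intro mult_right_mono Kb) auto
      also have "\<dots> = (norm v)\<^sup>2 * kb" by (simp add: power2_eq_square)
      also have "\<dots> \<le> (norm v)\<^sup>2 * (\<bar>kb\<bar> + 1)\<^sup>2"
      proof (rule mult_left_mono)
        have "(\<bar>kb\<bar> + 1) * 1 \<le> (\<bar>kb\<bar> + 1) * (\<bar>kb\<bar> + 1)" by (intro mult_left_mono) auto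
        moreover have "kb \<le> (\<bar>kb\<bar> + 1) * 1" using abs_ge_self[of kb] by simp
        ultimately show "kb \<le> (\<bar>kb\<bar> + 1)\<^sup>2" unfolding power2_eq_square by (rule order_trans[rotated])
      qed simp
      finally have "(norm (C v))\<^sup>2 \<le> (norm v * (\<bar>kb\<bar> + 1))\<^sup>2" by (simp add: power_mult_distrib)
      then show ?thesis by (rule power2_le_imp_le) simp
    qed
    then have Cbl: "bounded_linear C" by (rule bounded_linear_intro[OF Cadd Csc])
    have comm: "C (R v) = R (C v)" for v using Rcom Cbl CC by metis
    have CR: "C = R"
      by (rule positive_sqrt_unique[OF R.linear R(2,3,4) bounded_linear.linear[OF Cbl] Csym Cpos CC comm K0])
    have DB: "DB = range R" using CB CD unfolding CR by (metis image_iff subsetI subset_antisym UNIV_I image_subset_iff)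
    moreover have "B' u = B u" for u
      using BC Bout DB BR unfolding CR by (cases "u \<in> range R") (auto simp: B_def)
    ultimately show ?thesis by auto
  qed
  have the: "(THE p. is_op_sqrt DA A (fst p) (snd p)) = (range R, B)"
  proof (rule the_equality)
    show "is_op_sqrt DA A (fst (range R, B)) (snd (range R, B))" using sqrtB by simp
    show "p = (range R, B)" if "is_op_sqrt DA A (fst p) (snd p)" for p
      using uniq[OF that] by (simp add: prod_eq_iff)
  qed
  show ?thesis
  proof (rule that[of R])
    show "sqrt_dom DA A = range R" "sqrt_op DA A (R a) = a" for a
      by (simp_all add: sqrt_dom_def sqrt_op_def the BR)
    show "A (R (R a)) = a" for a by (simp add: R(4) AK)
  qed (fact R R0 DA)+
qed

subsection \<open>The space of square integrable functions\<close>

definition sq_integrable :: "(real \<Rightarrow> 'a::{real_inner, second_countable_topology}) \<Rightarrow> bool" where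
  "sq_integrable f \<longleftrightarrow> f \<in> borel_measurable lborel \<and> integrable lborel (\<lambda>x. (norm (f x))\<^sup>2)"

lemma sq_integrable_measurable [measurable_dest]: "sq_integrable f \<Longrightarrow> f \<in> borel_measurable lborel"
  by (simp add: sq_integrable_def)

lemma sq_integrable_0: "sq_integrable (\<lambda>x. 0)"
  by (simp add: sq_integrable_def)

lemma sq_integrable_scaleR: "sq_integrable f \<Longrightarrow> sq_integrable (\<lambda>x. c *\<^sub>R f x)"
  by (auto simp: sq_integrable_def power_mult_distrib)

lemma sq_integrable_bound:
  assumes "f \<in> borel_measurable lborel" "integrable lborel g" "AE x in lborel. (norm (f x))\<^sup>2 \<le> g x"
  shows "sq_integrable f"
  unfolding sq_integrable_def using assms(1)
  by (intro conjI Bochner_Integration.integrable_bound[OF assms(2)]) (use assms(3) in auto)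

lemma sq_integrable_add:
  assumes f: "sq_integrable f" and g: "sq_integrable g" shows "sq_integrable (\<lambda>x. f x + g x)"
proof (rule sq_integrable_bound)
  show "integrable lborel (\<lambda>x. 2 * (norm (f x))\<^sup>2 + 2 * (norm (g x))\<^sup>2)"
    using f g by (simp add: sq_integrable_def)
  have "(norm (f x + g x))\<^sup>2 \<le> 2 * (norm (f x))\<^sup>2 + 2 * (norm (g x))\<^sup>2" for x
  proof -
    have "(norm (f x + g x))\<^sup>2 \<le> (norm (f x) + norm (g x))\<^sup>2" by (intro power_mono norm_triangle_ineq) auto
    also have "\<dots> \<le> 2 * (norm (f x))\<^sup>2 + 2 * (norm (g x))\<^sup>2"
      using sum_squares_ge_zero[of "norm (f x) - norm (g x)" 0] by (simp add: power2_eq_square algebra_simps)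
    finally show ?thesis .
  qed
  then show "AE x in lborel. (norm (f x + g x))\<^sup>2 \<le> 2 * (norm (f x))\<^sup>2 + 2 * (norm (g x))\<^sup>2" by simp
qed (use f g in measurable)

lemma sq_integrable_uminus: "sq_integrable f \<Longrightarrow> sq_integrable (\<lambda>x. - f x)"
  using sq_integrable_scaleR[of f "-1"] by simp

lemma sq_integrable_diff:
  "sq_integrable f \<Longrightarrow> sq_integrable g \<Longrightarrow> sq_integrable (\<lambda>x. f x - g x)"
  using sq_integrable_add[OF _ sq_integrable_uminus, of f g] by simp

lemma sq_integrable_inner:
  assumes f: "sq_integrable f" and g: "sq_integrable g"
  shows "integrable lborel (\<lambda>x. inner (f x) (g x))"
proof (rule Bochner_Integration.integrable_bound)
  show "integrable lborel (\<lambda>x. (norm (f x))\<^sup>2 + (norm (g x))\<^sup>2)"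
    using f g by (simp add: sq_integrable_def)
  show "(\<lambda>x. inner (f x) (g x)) \<in> borel_measurable lborel" using f g by measurable
  have "\<bar>inner (f x) (g x)\<bar> \<le> (norm (f x))\<^sup>2 + (norm (g x))\<^sup>2" for x
    using Cauchy_Schwarz_ineq2[of "f x" "g x"] sum_squares_ge_zero[of "norm (f x) - norm (g x)" 0]
      zero_le_power2[of "norm (f x)"] zero_le_power2[of "norm (g x)"]
    by (simp add: power2_eq_square algebra_simps)
  then show "AE x in lborel. norm (inner (f x) (g x)) \<le> norm ((norm (f x))\<^sup>2 + (norm (g x))\<^sup>2)" by simp
qed

lemma sq_integrable_AE_cong:
  assumes "sq_integrable f" "g \<in> borel_measurable lborel" "AE x in lborel. f x = g x"
  shows "sq_integrable g"
  using assms by (intro sq_integrable_bound[of g "\<lambda>x. (norm (f x))\<^sup>2"]) (auto simp: sq_integrable_def)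

lemma sq_integrable_mult_indicator:
  "sq_integrable f \<Longrightarrow> A \<in> sets borel \<Longrightarrow> sq_integrable (\<lambda>x. indicator A x *\<^sub>R f x)"
  by (intro sq_integrable_bound[of _ "\<lambda>x. (norm (f x))\<^sup>2"])
    (auto simp: sq_integrable_def split: split_indicator)

definition sq_equiv :: "(real \<Rightarrow> 'a::{real_inner, second_countable_topology}) \<Rightarrow> (real \<Rightarrow> 'a) \<Rightarrow> bool" where
  "sq_equiv f g \<longleftrightarrow> sq_integrable f \<and> sq_integrable g \<and> (AE x in lborel. f x = g x)"

quotient_type (overloaded) 'a L2 = "real \<Rightarrow> 'a::{real_inner, second_countable_topology}" / partial: sq_equiv
proof (rule part_equivpI)
  show "\<exists>f. sq_equiv f f" using sq_integrable_0 by (auto simp: sq_equiv_def)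
  show "symp sq_equiv" by (auto simp: symp_def sq_equiv_def)
  show "transp sq_equiv" unfolding transp_def sq_equiv_def by (auto elim: AE_mp)
qed

instantiation L2 :: ("{real_inner, second_countable_topology}") real_inner
begin

lift_definition zero_L2 :: "'a L2" is "\<lambda>x. 0"
  by (simp add: sq_equiv_def sq_integrable_0)

lift_definition plus_L2 :: "'a L2 \<Rightarrow> 'a L2 \<Rightarrow> 'a L2" is "\<lambda>f g x. f x + g x"
  unfolding sq_equiv_def by (auto intro: sq_integrable_add)

lift_definition minus_L2 :: "'a L2 \<Rightarrow> 'a L2 \<Rightarrow> 'a L2" is "\<lambda>f g x. f x - g x"
  unfolding sq_equiv_def by (auto intro: sq_integrable_diff)

lift_definition uminus_L2 :: "'a L2 \<Rightarrow> 'a L2" is "\<lambda>f x. - f x"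
  unfolding sq_equiv_def by (auto intro: sq_integrable_uminus)

lift_definition scaleR_L2 :: "real \<Rightarrow> 'a L2 \<Rightarrow> 'a L2" is "\<lambda>c f x. c *\<^sub>R f x"
  unfolding sq_equiv_def by (auto intro: sq_integrable_scaleR)

lift_definition inner_L2 :: "'a L2 \<Rightarrow> 'a L2 \<Rightarrow> real" is "\<lambda>f g. LINT x|lborel. inner (f x) (g x)"
  unfolding sq_equiv_def
  by (intro integral_cong_AE borel_measurable_inner sq_integrable_measurable) auto

definition norm_L2 :: "'a L2 \<Rightarrow> real" where "norm_L2 f = sqrt (inner f f)"
definition sgn_L2 :: "'a L2 \<Rightarrow> 'a L2" where "sgn_L2 f = scaleR (inverse (norm f)) f"
definition dist_L2 :: "'a L2 \<Rightarrow> 'a L2 \<Rightarrow> real" where "dist_L2 f g = norm (f - g)"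
definition uniformity_L2 :: "('a L2 \<times> 'a L2) filter" where
  "uniformity_L2 = (INF e\<in>{0<..}. principal {(x, y). dist x y < e})"
definition open_L2 :: "'a L2 set \<Rightarrow> bool" where
  "open_L2 U = (\<forall>x\<in>U. \<forall>\<^sub>F (x', y) in uniformity. x' = x \<longrightarrow> y \<in> U)"

instance
proof
  fix x y z :: "'a L2" and r s :: real
  show "x + y + z = x + (y + z)" by transfer (auto simp: sq_equiv_def add.assoc intro!: sq_integrable_add)
  show "x + y = y + x" by transfer (auto simp: sq_equiv_def add.commute intro!: sq_integrable_add)
  show "0 + x = x" by transfer (auto simp: sq_equiv_def)
  show "- x + x = 0" by transfer (auto simp: sq_equiv_def sq_integrable_0)
  show "x - y = x + - y" by transfer (auto simp: sq_equiv_def intro!: sq_integrable_diff)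
  show "r *\<^sub>R (x + y) = r *\<^sub>R x + r *\<^sub>R y"
    by transfer (auto simp: sq_equiv_def scaleR_add_right intro!: sq_integrable_add sq_integrable_scaleR)
  show "(r + s) *\<^sub>R x = r *\<^sub>R x + s *\<^sub>R x"
    by transfer (auto simp: sq_equiv_def scaleR_add_left intro!: sq_integrable_add sq_integrable_scaleR)
  show "r *\<^sub>R s *\<^sub>R x = (r * s) *\<^sub>R x"
    by transfer (auto simp: sq_equiv_def intro!: sq_integrable_scaleR)
  show "1 *\<^sub>R x = x" by transfer (auto simp: sq_equiv_def)
  show "dist x y = norm (x - y)" by (rule dist_L2_def)
  show "sgn x = inverse (norm x) *\<^sub>R x" by (rule sgn_L2_def)
  show "uniformity = (INF e\<in>{0<..}. principal {(x, y). dist (x::'a L2) y < e})" by (rule uniformity_L2_def)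
  show "open U = (\<forall>x\<in>U. \<forall>\<^sub>F (x', y) in uniformity. x' = x \<longrightarrow> y \<in> U)" for U :: "'a L2 set" by (rule open_L2_def)
  show "inner x y = inner y x" by transfer (simp add: inner_commute)
  show "inner (x + y) z = inner x z + inner y z"
    by transfer (auto simp: sq_equiv_def inner_add_left intro!: Bochner_Integration.integral_add sq_integrable_inner)
  show "inner (r *\<^sub>R x) y = r * inner x y" by transfer simp
  show "0 \<le> inner x x" by transfer simp
  show "(inner x x = 0) = (x = 0)"
  proof (transfer, goal_cases)
    case (1 f)
    then have "integrable lborel (\<lambda>x. inner (f x) (f x))" "sq_integrable f"
      by (auto simp: sq_equiv_def intro: sq_integrable_inner)
    then show ?case
      using integral_nonneg_eq_0_iff_AE[of lborel "\<lambda>x. inner (f x) (f x)"] by (simp add: sq_equiv_def sq_integrable_0)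
  qed
  show "norm x = sqrt (inner x x)" by (rule norm_L2_def)
qed

end

section \<open>Passing between classes and representatives\<close>

abbreviation cls :: "(real \<Rightarrow> 'a::{real_inner, second_countable_topology}) \<Rightarrow> 'a L2" where
  "cls \<equiv> abs_L2"

lemma cls_eq_iff: "sq_integrable f \<Longrightarrow> sq_integrable g \<Longrightarrow> cls f = cls g \<longleftrightarrow> (AE x in lborel. f x = g x)"
  using Quotient_rel[OF Quotient_L2, of f g] by (auto simp: sq_equiv_def)

lemma sq_integrable_rep: "sq_integrable (rep_L2 f)"
  using Quotient_rep_reflp[OF Quotient_L2, of f] by (simp add: sq_equiv_def)

lemma cls_rep [simp]: "cls (rep_L2 f) = f"
  using Quotient_abs_rep[OF Quotient_L2] .

lemma rep_cls: "sq_integrable f \<Longrightarrow> AE x in lborel. rep_L2 (cls f) x = f x"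
  using cls_eq_iff[of "rep_L2 (cls f)" f] sq_integrable_rep by auto

lemma cls_add: "sq_integrable f \<Longrightarrow> sq_integrable g \<Longrightarrow> cls f + cls g = cls (\<lambda>x. f x + g x)"
  by (rule plus_L2.abs_eq) (auto simp: eq_onp_def sq_equiv_def)

lemma cls_diff: "sq_integrable f \<Longrightarrow> sq_integrable g \<Longrightarrow> cls f - cls g = cls (\<lambda>x. f x - g x)"
  by (rule minus_L2.abs_eq) (auto simp: eq_onp_def sq_equiv_def)

lemma cls_scaleR: "sq_integrable f \<Longrightarrow> c *\<^sub>R cls f = cls (\<lambda>x. c *\<^sub>R f x)"
  by (rule scaleR_L2.abs_eq) (auto simp: eq_onp_def sq_equiv_def)

lemma cls_inner: "sq_integrable f \<Longrightarrow> sq_integrable g \<Longrightarrow> inner (cls f) (cls g) = (LINT x|lborel. inner (f x) (g x))"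
  by (rule inner_L2.abs_eq) (auto simp: eq_onp_def sq_equiv_def)

lemma cls_norm: "sq_integrable f \<Longrightarrow> (norm (cls f))\<^sup>2 = (LINT x|lborel. (norm (f x))\<^sup>2)"
  by (simp add: power2_norm_eq_inner cls_inner)

lemma rep_add: "AE x in lborel. rep_L2 (f + g) x = rep_L2 f x + rep_L2 g x"
  using rep_cls[OF sq_integrable_add[OF sq_integrable_rep sq_integrable_rep, of f g]]
  by (simp add: cls_add[symmetric] sq_integrable_rep)

lemma rep_scaleR: "AE x in lborel. rep_L2 (c *\<^sub>R f) x = c *\<^sub>R rep_L2 f x"
  using rep_cls[OF sq_integrable_scaleR[OF sq_integrable_rep, of c f]]
  by (simp add: cls_scaleR[symmetric] sq_integrable_rep)

lemma nn_integral_sq: "sq_integrable f \<Longrightarrow> (\<integral>\<^sup>+x. ennreal ((norm (f x))\<^sup>2) \<partial>lborel) = ennreal ((norm (cls f))\<^sup>2)"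
  by (simp add: cls_norm nn_integral_eq_integral sq_integrable_def)

text \<open>The argument of Riesz and Fischer for a rapidly converging subsequence. The weights
  \<open>4 ^ n\<close> keep the sum integrable, as \<open>4 ^ n * (1/8) ^ n = (1/2) ^ n\<close>, and
  a finite value of the sum at \<open>x\<close> bounds the increments there by a multiple of
  \<open>(1/2) ^ n\<close>.\<close>

lemma fast_Cauchy_AE:
  fixes f :: "nat \<Rightarrow> real \<Rightarrow> 'a::{real_inner, complete_space, second_countable_topology}"
  assumes f: "\<And>n. sq_integrable (f n)"
    and d: "\<And>n. (norm (cls (f (Suc n)) - cls (f n)))\<^sup>2 \<le> (1/8) ^ n"
  shows "AE x in lborel. convergent (\<lambda>n. f n x)"
proof -
  define h where "h n x = ennreal (4 ^ n * (norm (f (Suc n) x - f n x))\<^sup>2)" for n x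
  have meas [measurable]: "f n \<in> borel_measurable lborel" for n using f by (rule sq_integrable_measurable)
  have hm: "h n \<in> borel_measurable lborel" for n unfolding h_def by measurable
  have "(\<integral>\<^sup>+x. h n x \<partial>lborel) \<le> ennreal ((1/2) ^ n)" for n
  proof -
    have "(\<integral>\<^sup>+x. h n x \<partial>lborel) = ennreal (4 ^ n) * (\<integral>\<^sup>+x. ennreal ((norm (f (Suc n) x - f n x))\<^sup>2) \<partial>lborel)"
      unfolding h_def by (subst nn_integral_cmult[symmetric]) (auto simp: ennreal_mult)
    also have "\<dots> = ennreal (4 ^ n * (norm (cls (f (Suc n)) - cls (f n)))\<^sup>2)"
      by (simp add: nn_integral_sq[OF sq_integrable_diff[OF f f]] cls_diff[OF f f] ennreal_mult)
    also have "\<dots> \<le> ennreal (4 ^ n * (1/8) ^ n)"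
      using d[of n] by (intro ennreal_leI mult_left_mono) auto
    also have "4 ^ n * (1/8) ^ n = ((1/2) ^ n :: real)" by (simp add: power_mult_distrib[symmetric])
    finally show ?thesis .
  qed
  then have "(\<Sum>n. \<integral>\<^sup>+x. h n x \<partial>lborel) \<le> (\<Sum>n. ennreal ((1/2) ^ n))" by (intro suminf_le) auto
  also have "\<dots> < \<infinity>" by (simp add: suminf_ennreal2 summable_geometric)
  finally have "(\<integral>\<^sup>+x. (\<Sum>n. h n x) \<partial>lborel) \<noteq> \<infinity>" by (simp add: nn_integral_suminf[OF hm] less_top)
  then have "AE x in lborel. (\<Sum>n. h n x) \<noteq> \<infinity>"
    by (intro nn_integral_noteq_infinite) (use hm in measurable)
  then show ?thesis
  proof eventually_elim
    fix x assume x: "(\<Sum>n. h n x) \<noteq> \<infinity>"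
    obtain c where c: "0 \<le> c" "(\<Sum>n. h n x) = ennreal c" using x by (cases "\<Sum>n. h n x") auto
    have "h n x \<le> ennreal c" for n
      using sum_le_suminf[of "\<lambda>n. h n x" "{n}"] c by auto
    then have le: "4 ^ n * (norm (f (Suc n) x - f n x))\<^sup>2 \<le> c" for n
      using c by (simp add: h_def ennreal_le_iff)
    have le2: "norm (f (Suc n) x - f n x) \<le> sqrt c * (1/2) ^ n" for n
    proof -
      have "(norm (f (Suc n) x - f n x))\<^sup>2 \<le> c * (1/4) ^ n"
        using le[of n] by (simp add: field_simps power_divide)
      also have "\<dots> = (sqrt c * (1/2) ^ n)\<^sup>2"
        using c by (simp add: power_mult_distrib power_divide power2_eq_square flip: power_mult_distrib[of 2 2])
      finally show ?thesis by (rule power2_le_imp_le) (use c in simp)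
    qed
    have sm: "summable (\<lambda>n. sqrt c * (1/2) ^ n)" by (intro summable_mult summable_geometric) auto
    have s: "summable (\<lambda>n. norm (f (Suc n) x - f n x))"
      by (rule summable_comparison_test'[OF sm, of 0]) (simp only: real_norm_def abs_norm_cancel le2)
    have "Cauchy (\<lambda>n. f n x)"
    proof (rule metric_CauchyI)
      fix e :: real assume "0 < e"
      then obtain N where N: "\<And>m n. m \<ge> N \<Longrightarrow> norm (\<Sum>i=m..<n. norm (f (Suc i) x - f i x)) < e"
        using s unfolding summable_Cauchy by blast
      have lt: "dist (f m x) (f n x) < e" if "N \<le> m" "m \<le> n" for m n
      proof -
        have "f n x - f m x = (\<Sum>i=m..<n. f (Suc i) x - f i x)" using sum_Suc_diff'[OF that(2), of "\<lambda>i. f i x"] by simp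
        then have "norm (f n x - f m x) \<le> (\<Sum>i=m..<n. norm (f (Suc i) x - f i x))" by (metis norm_sum)
        then show ?thesis using N[OF that(1), of n] by (simp add: dist_norm norm_minus_commute)
      qed
      show "\<exists>M. \<forall>m\<ge>M. \<forall>n\<ge>M. dist (f m x) (f n x) < e" using lt by (metis dist_commute nle_le)
    qed
    then show "convergent (\<lambda>n. f n x)" by (rule Cauchy_convergent)
  qed
qed

instance L2 :: ("{real_inner, complete_space, second_countable_topology}") complete_space
proof
  fix X :: "nat \<Rightarrow> 'a L2" assume C: "Cauchy X"
  have "\<exists>N. \<forall>m\<ge>N. \<forall>n\<ge>N. (norm (X m - X n))\<^sup>2 \<le> (1/8) ^ k" for k
  proof -
    have "0 < sqrt ((1/8) ^ k :: real)" by simp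
    then obtain N where N: "\<And>m n. m \<ge> N \<Longrightarrow> n \<ge> N \<Longrightarrow> dist (X m) (X n) < sqrt ((1/8) ^ k)"
      using metric_CauchyD[OF C] by blast
    have "(norm (X m - X n))\<^sup>2 \<le> (1/8) ^ k" if "m \<ge> N" "n \<ge> N" for m n
      using power_strict_mono[OF N[OF that] zero_le_dist, of 2] by (simp add: dist_norm)
    then show ?thesis by blast
  qed
  then obtain N where N: "\<And>k m n. m \<ge> N k \<Longrightarrow> n \<ge> N k \<Longrightarrow> (norm (X m - X n))\<^sup>2 \<le> (1/8) ^ k" by metis
  \<comment> \<open>The sum dominates every single \<open>N i\<close>, and the summand
    \<open>k\<close> makes the choice strictly increasing.\<close>
  define K where "K k = (\<Sum>i\<le>k. N i) + k" for k
  have K: "K k \<ge> N k" "K k < K (Suc k)" for k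
    by (auto simp: K_def intro: trans_le_add1 member_le_sum)
  define f where "f k = rep_L2 (X (K k))" for k
  have sqf: "sq_integrable (f k)" and clsf: "cls (f k) = X (K k)" for k
    by (auto simp: f_def sq_integrable_rep)
  have dk: "(norm (X (K m) - X (K k)))\<^sup>2 \<le> (1/8) ^ k" if "k \<le> m" for k m
  proof -
    have "strict_mono K" using K(2) by (simp add: strict_mono_Suc_iff)
    then have "K k \<le> K m" using that by (simp add: strict_mono_less_eq)
    then show ?thesis using N[of k "K m" "K k"] K(1)[of k] by simp
  qed
  have "AE x in lborel. convergent (\<lambda>n. f n x)"
    by (rule fast_Cauchy_AE[OF sqf]) (use dk in \<open>simp add: clsf\<close>)
  then obtain Z where Z: "Z \<in> null_sets lborel" "{x \<in> space lborel. \<not> convergent (\<lambda>n. f n x)} \<subseteq> Z"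
    unfolding eventually_ae_filter by blast
  \<comment> \<open>Cleared on the exceptional set, so that the limit exists at every point and is
    measurable.\<close>
  define f' where "f' k x = indicator (- Z) x *\<^sub>R f k x" for k x
  have Zm: "- Z \<in> sets borel" using Z(1) by (auto simp: null_sets_def)
  have f'm [measurable]: "f' k \<in> borel_measurable lborel" for k
    unfolding f'_def using sqf[of k] Zm by (auto dest: sq_integrable_measurable)
  define g where "g x = lim (\<lambda>n. f' n x)" for x
  have lim: "(\<lambda>n. f' n x) \<longlonglongrightarrow> g x" for x
  proof -
    have "convergent (\<lambda>n. f' n x)"
      using Z(2) by (cases "x \<in> Z") (auto simp: f'_def convergent_const)
    then show ?thesis by (simp add: g_def convergent_LIMSEQ_iff)
  qed
  have gm [measurable]: "g \<in> borel_measurable lborel"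
    by (rule borel_measurable_LIMSEQ_metric[OF f'm lim])
  have f'AE: "AE x in lborel. f k x = f' k x" for k
    using AE_not_in[OF Z(1)] by eventually_elim (simp add: f'_def)
  have sqf': "sq_integrable (f' k)" and clsf': "cls (f' k) = X (K k)" for k
  proof -
    show s: "sq_integrable (f' k)" by (rule sq_integrable_AE_cong[OF sqf f'm f'AE])
    show "cls (f' k) = X (K k)" using cls_eq_iff[OF sqf s] f'AE clsf by metis
  qed
  \<comment> \<open>Fatou's lemma in the index \<open>m\<close> gives the rate of convergence;
    square integrability of the limit follows from the same bound.\<close>
  have fatou: "(\<integral>\<^sup>+x. ennreal ((norm (g x - f' k x))\<^sup>2) \<partial>lborel) \<le> ennreal ((1/8) ^ k)" for k
  proof -
    have "ennreal ((norm (g x - f' k x))\<^sup>2) = liminf (\<lambda>m. ennreal ((norm (f' m x - f' k x))\<^sup>2))" for x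
      by (rule lim_imp_Liminf[symmetric]) (auto intro!: tendsto_intros lim tendsto_ennrealI)
    then have "(\<integral>\<^sup>+x. ennreal ((norm (g x - f' k x))\<^sup>2) \<partial>lborel)
        = (\<integral>\<^sup>+x. liminf (\<lambda>m. ennreal ((norm (f' m x - f' k x))\<^sup>2)) \<partial>lborel)" by simp
    also have "\<dots> \<le> liminf (\<lambda>m. \<integral>\<^sup>+x. ennreal ((norm (f' m x - f' k x))\<^sup>2) \<partial>lborel)"
      by (intro nn_integral_liminf) measurable
    also have "\<dots> = liminf (\<lambda>m. ennreal ((norm (X (K m) - X (K k)))\<^sup>2))"
      by (simp add: nn_integral_sq[OF sq_integrable_diff[OF sqf' sqf']] cls_diff[OF sqf' sqf', symmetric] clsf')
    also have "\<dots> \<le> ennreal ((1/8) ^ k)"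
      by (rule Liminf_le) (auto intro!: eventually_sequentiallyI[of k] ennreal_leI dk)
    finally show ?thesis .
  qed
  have sqd: "sq_integrable (\<lambda>x. g x - f' k x)" for k
  proof -
    have "integrable lborel (\<lambda>x. (norm (g x - f' k x))\<^sup>2)"
      using fatou[of k] by (intro integrableI_bounded) (auto simp: le_less_trans)
    then show ?thesis by (simp add: sq_integrable_def)
  qed
  have sqg: "sq_integrable g" using sq_integrable_add[OF sqd[of 0] sqf'[of 0]] by simp
  have "(norm (cls g - X (K k)))\<^sup>2 \<le> (1/8) ^ k" for k
    using fatou[of k] by (simp add: nn_integral_sq[OF sqd] cls_diff[OF sqg sqf', symmetric] clsf')
  then have "(\<lambda>k. (norm (cls g - X (K k)))\<^sup>2) \<longlonglongrightarrow> 0"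
    by (intro Lim_null_comparison[OF _ LIMSEQ_realpow_zero[of "1/8"]]) auto
  then have "(\<lambda>k. sqrt ((norm (cls g - X (K k)))\<^sup>2)) \<longlonglongrightarrow> sqrt 0" by (rule tendsto_real_sqrt)
  then have "(\<lambda>k. X (K k)) \<longlonglongrightarrow> cls g"
    by (simp add: tendsto_iff dist_norm norm_minus_commute)
  moreover have "strict_mono K" using K(2) by (simp add: strict_mono_Suc_iff)
  ultimately have "X \<longlonglongrightarrow> cls g"
    using Cauchy_converges_subseq[OF C, of K "cls g"] by (simp add: o_def)
  then show "convergent X" by (rule convergentI)
qed

subsection \<open>Functions with a density\<close>

text \<open>The library has this criterion and its consequences for the sort \<open>banach\<close> only; a type variable of sort
  \<open>{real_normed_vector, complete_space}\<close> does not belong to that class.\<close>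

lemma integrableI_bounded_complete:
  fixes f :: "'a \<Rightarrow> 'b::{real_normed_vector, complete_space, second_countable_topology}"
  assumes f [measurable]: "f \<in> borel_measurable M" and fin: "(\<integral>\<^sup>+x. norm (f x) \<partial>M) < \<infinity>"
  shows "integrable M f"
proof -
  from borel_measurable_implies_sequence_metric[OF f, of 0] obtain s where
    s: "\<And>i. simple_function M (s i)" and
    pointwise: "\<And>x. x \<in> space M \<Longrightarrow> (\<lambda>i. s i x) \<longlonglongrightarrow> f x" and
    bound: "\<And>i x. x \<in> space M \<Longrightarrow> norm (s i x) \<le> 2 * norm (f x)"
    by simp metis
  have sm [measurable]: "s i \<in> borel_measurable M" for i by (rule borel_measurable_simple_function[OF s])
  have fin2: "(\<integral>\<^sup>+x. ennreal (2 * norm (f x)) \<partial>M) < \<infinity>"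
    using fin by (simp add: nn_integral_cmult ennreal_mult ennreal_mult_less_top)
  have sbi: "Bochner_Integration.simple_bochner_integrable M (s i)" for i
  proof (intro simple_bochner_integrableI_bounded s)
    show "(\<integral>\<^sup>+x. ennreal (norm (s i x)) \<partial>M) < \<infinity>"
      by (rule le_less_trans[OF nn_integral_mono fin2]) (simp add: bound ennreal_leI)
  qed
  have lim: "(\<lambda>i. \<integral>\<^sup>+x. ennreal (norm (f x - s i x)) \<partial>M) \<longlonglongrightarrow> 0"
    by (rule nn_integral_dominated_convergence_norm[where w = "\<lambda>x. 2 * norm (f x)"])
      (use bound pointwise fin2 in auto)
  have "Cauchy (\<lambda>i. Bochner_Integration.simple_bochner_integral M (s i))"
  proof (rule metric_CauchyI)
    fix e :: real assume "0 < e"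
    then obtain N where N: "\<And>n. N \<le> n \<Longrightarrow> (\<integral>\<^sup>+x. ennreal (norm (f x - s n x)) \<partial>M) < ennreal (e / 2)"
      using order_tendstoD(2)[OF lim, of "ennreal (e / 2)"] by (auto simp: eventually_sequentially)
    have "dist (Bochner_Integration.simple_bochner_integral M (s m)) (Bochner_Integration.simple_bochner_integral M (s n)) < e" if "N \<le> m" "N \<le> n" for m n
    proof -
      have "ennreal (norm (Bochner_Integration.simple_bochner_integral M (s m) - Bochner_Integration.simple_bochner_integral M (s n)))
          \<le> (\<integral>\<^sup>+x. ennreal (norm (f x - s m x)) \<partial>M) + (\<integral>\<^sup>+x. ennreal (norm (f x - s n x)) \<partial>M)"
        by (intro simple_bochner_integral_bounded sbi f)
      also have "\<dots> < ennreal (e / 2) + ennreal (e / 2)" using N that by (intro add_strict_mono) auto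
      also have "\<dots> = ennreal e" using \<open>0 < e\<close> by (simp flip: ennreal_plus)
      finally show ?thesis using \<open>0 < e\<close> by (simp add: dist_norm ennreal_less_iff)
    qed
    then show "\<exists>M'. \<forall>m\<ge>M'. \<forall>n\<ge>M'. dist (Bochner_Integration.simple_bochner_integral M (s m)) (Bochner_Integration.simple_bochner_integral M (s n)) < e" by blast
  qed
  then obtain x where "(\<lambda>i. Bochner_Integration.simple_bochner_integral M (s i)) \<longlonglongrightarrow> x"
    using Cauchy_convergent convergent_def by blast
  then have "has_bochner_integral M f x"
    by (rule has_bochner_integral.intros[OF f sbi lim])
  then show ?thesis by (rule integrable.intros)
qed

lemma integrable_bound_complete:
  fixes f :: "'a \<Rightarrow> 'b::{real_normed_vector, complete_space, second_countable_topology}"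
  assumes "f \<in> borel_measurable M" "integrable M g" "AE x in M. norm (f x) \<le> (g x :: real)"
  shows "integrable M f"
proof (rule integrableI_bounded_complete[OF assms(1)])
  have "(\<integral>\<^sup>+x. norm (f x) \<partial>M) \<le> (\<integral>\<^sup>+x. ennreal (norm (g x)) \<partial>M)"
    by (rule nn_integral_mono_AE) (use assms(3) in \<open>auto elim!: eventually_mono intro!: ennreal_leI\<close>)
  also have "\<dots> < \<infinity>" using assms(2) by (simp add: integrable_iff_bounded)
  finally show "(\<integral>\<^sup>+x. norm (f x) \<partial>M) < \<infinity>" .
qed

lemma integrable_norm_complete:
  fixes f :: "'a \<Rightarrow> 'b::{real_normed_vector, second_countable_topology}"
  assumes "integrable M f" shows "integrable M (\<lambda>x. norm (f x))"
proof (rule integrableI_bounded)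
  show "(\<lambda>x. norm (f x)) \<in> borel_measurable M" using assms by measurable
  show "(\<integral>\<^sup>+x. ennreal (norm (norm (f x))) \<partial>M) < \<infinity>"
    using has_bochner_integral_implies_finite_norm[OF has_bochner_integral_integrable[OF assms]] by simp
qed

lemma norm_integral_le:
  fixes f :: "'a \<Rightarrow> 'b::{real_normed_vector, second_countable_topology}"
  assumes "integrable M f" shows "norm (integral\<^sup>L M f) \<le> (LINT x|M. norm (f x))"
proof -
  have "ennreal (norm (integral\<^sup>L M f)) \<le> (\<integral>\<^sup>+x. norm (f x) \<partial>M)" by (rule integral_norm_bound_ennreal[OF assms])
  also have "\<dots> = ennreal (LINT x|M. norm (f x))"
    by (rule nn_integral_eq_integral[OF integrable_norm_complete[OF assms]]) simp
  finally show ?thesis by (simp add: integral_nonneg_AE)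
qed

lemma integrable_scaled:
  fixes f :: "'a \<Rightarrow> 'b::{real_normed_vector, complete_space, second_countable_topology}"
  assumes "integrable M f" "c \<in> borel_measurable M" "\<And>x. \<bar>c x\<bar> \<le> C"
  shows "integrable M (\<lambda>x. c x *\<^sub>R f x)"
proof (rule integrable_bound_complete)
  show "(\<lambda>x. c x *\<^sub>R f x) \<in> borel_measurable M" using assms by measurable
  show "integrable M (\<lambda>x. C * norm (f x))" using integrable_norm_complete[OF assms(1)] by simp
  show "AE x in M. norm (c x *\<^sub>R f x) \<le> C * norm (f x)" using assms(3) by (auto intro!: mult_right_mono)
qed

lemma integrable_indicator:
  fixes f :: "'a \<Rightarrow> 'b::{real_normed_vector, complete_space, second_countable_topology}"
  assumes "integrable M f" "A \<in> sets M" shows "integrable M (\<lambda>x. indicator A x *\<^sub>R f x)"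
  by (rule integrable_scaled[OF assms(1), of _ 1]) (use assms(2) in \<open>auto split: split_indicator\<close>)

lemma set_integrable_subset_complete:
  fixes f :: "'a \<Rightarrow> 'b::{real_normed_vector, complete_space, second_countable_topology}"
  assumes "set_integrable M A f" "B \<in> sets M" "B \<subseteq> A" shows "set_integrable M B f"
proof -
  have "(\<lambda>x. indicator B x *\<^sub>R f x) = (\<lambda>x. indicator B x *\<^sub>R (indicator A x *\<^sub>R f x))"
    using assms(3) by (auto simp: indicator_def fun_eq_iff)
  then show ?thesis using integrable_indicator[OF assms(1)[unfolded set_integrable_def] assms(2)] by (simp only: set_integrable_def)
qed

text \<open>Integration by parts as Fubini on the two halves of a square. The diagonal belongs to
  the second half, so the two indicators add up to exactly \<open>1\<close>.\<close>

lemma inner_triangle_Fubini: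
  fixes f g :: "real \<Rightarrow> 'b::{real_inner, complete_space, second_countable_topology}"
  assumes f: "integrable lborel f" and g: "integrable lborel g"
  shows "integrable lborel (\<lambda>s. inner (f s) (LINT t|lborel. indicator {..<s} t *\<^sub>R g t))" (is ?A)
    and "integrable lborel (\<lambda>t. inner (LINT s|lborel. indicator {..t} s *\<^sub>R f s) (g t))" (is ?B)
    and "(LINT s|lborel. inner (f s) (LINT t|lborel. indicator {..<s} t *\<^sub>R g t)) +
      (LINT t|lborel. inner (LINT s|lborel. indicator {..t} s *\<^sub>R f s) (g t)) =
      inner (integral\<^sup>L lborel f) (integral\<^sup>L lborel g)" (is ?C)
proof -
  have [measurable]: "f \<in> borel_measurable lborel" "g \<in> borel_measurable lborel" using f g by auto
  have k: "integrable (lborel \<Otimes>\<^sub>M lborel) (\<lambda>(s, t). norm (f s) * norm (g t))"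
    by (rule lborel_pair.Fubini_integrable) (use f g in \<open>auto simp: integrable_norm_complete\<close>)
  have h: "integrable (lborel \<Otimes>\<^sub>M lborel) (\<lambda>(s, t). c s t * inner (f s) (g t))"
    if "(\<lambda>(s, t). c s t) \<in> borel_measurable (lborel \<Otimes>\<^sub>M lborel)" "\<And>s t. \<bar>c s t\<bar> \<le> 1" for c :: "real \<Rightarrow> real \<Rightarrow> real"
  proof (rule Bochner_Integration.integrable_bound[OF k])
    have "(\<lambda>z. inner (f (fst z)) (g (snd z))) \<in> borel_measurable (lborel \<Otimes>\<^sub>M lborel)" by measurable
    then show "(\<lambda>(s, t). c s t * inner (f s) (g t)) \<in> borel_measurable (lborel \<Otimes>\<^sub>M lborel)"
      using that(1) by (simp add: split_beta')
    have "\<bar>c s t * inner (f s) (g t)\<bar> \<le> 1 * (norm (f s) * norm (g t))" for s t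
      unfolding abs_mult by (intro mult_mono that(2) Cauchy_Schwarz_ineq2) auto
    then show "AE x in lborel \<Otimes>\<^sub>M lborel. norm (case x of (s, t) \<Rightarrow> c s t * inner (f s) (g t)) \<le> norm (case x of (s, t) \<Rightarrow> norm (f s) * norm (g t))"
      by (auto simp: split_beta')
  qed
  have hall: "integrable (lborel \<Otimes>\<^sub>M lborel) (\<lambda>(s, t). inner (f s) (g t))" using h[of "\<lambda>s t. 1"] by simp
  have h1: "integrable (lborel \<Otimes>\<^sub>M lborel) (\<lambda>(s, t). indicator {..<s} t * inner (f s) (g t))"
  proof (rule h)
    have "{z \<in> space (lborel \<Otimes>\<^sub>M (lborel :: real measure)). snd z < fst z} \<in> sets (lborel \<Otimes>\<^sub>M lborel)" by measurable
    then show "(\<lambda>(s, t::real). indicator {..<s} t :: real) \<in> borel_measurable (lborel \<Otimes>\<^sub>M lborel)"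
      unfolding split_beta' by (intro borel_measurable_indicator') simp
  qed (auto split: split_indicator)
  have h2: "integrable (lborel \<Otimes>\<^sub>M lborel) (\<lambda>(s, t). indicator {..t} s * inner (f s) (g t))"
  proof (rule h)
    have "{z \<in> space (lborel \<Otimes>\<^sub>M (lborel :: real measure)). fst z \<le> snd z} \<in> sets (lborel \<Otimes>\<^sub>M lborel)" by measurable
    then show "(\<lambda>(s, t::real). indicator {..t} s :: real) \<in> borel_measurable (lborel \<Otimes>\<^sub>M lborel)"
      unfolding split_beta' by (intro borel_measurable_indicator') simp
  qed (auto split: split_indicator)
  have e1: "(LINT t|lborel. indicator {..<s} t * inner (f s) (g t)) = inner (f s) (LINT t|lborel. indicator {..<s} t *\<^sub>R g t)" for s
    using integral_inner_right[of "f s" lborel "\<lambda>t. indicator {..<s} t *\<^sub>R g t"] integrable_indicator[OF g, of "{..<s}"] by simp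
  have e2: "(LINT s|lborel. indicator {..t} s * inner (f s) (g t)) = inner (LINT s|lborel. indicator {..t} s *\<^sub>R f s) (g t)" for t
    using integral_inner_left[of "g t" lborel "\<lambda>s. indicator {..t} s *\<^sub>R f s"] integrable_indicator[OF f, of "{..t}"] by simp
  have e3: "(LINT t|lborel. inner (f s) (g t)) = inner (f s) (integral\<^sup>L lborel g)" for s
    using g by simp
  show ?A using lborel_pair.integrable_fst'[OF h1] by (simp add: e1)
  show ?B using lborel_pair.integrable_snd[OF h2] by (simp add: e2)
  have "(LINT s|lborel. inner (f s) (LINT t|lborel. indicator {..<s} t *\<^sub>R g t)) +
      (LINT t|lborel. inner (LINT s|lborel. indicator {..t} s *\<^sub>R f s) (g t)) =
     integral\<^sup>L (lborel \<Otimes>\<^sub>M lborel) (\<lambda>(s, t). indicator {..<s} t * inner (f s) (g t)) +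
     integral\<^sup>L (lborel \<Otimes>\<^sub>M lborel) (\<lambda>(s, t). indicator {..t} s * inner (f s) (g t))"
    using lborel_pair.integral_fst'[OF h1] lborel_pair.integral_snd[OF h2] by (simp add: e1 e2)
  also have "\<dots> = integral\<^sup>L (lborel \<Otimes>\<^sub>M lborel) (\<lambda>z. (\<lambda>(s, t). indicator {..<s} t * inner (f s) (g t)) z + (\<lambda>(s, t). indicator {..t} s * inner (f s) (g t)) z)"
    by (rule Bochner_Integration.integral_add[OF h1 h2, symmetric])
  also have "\<dots> = integral\<^sup>L (lborel \<Otimes>\<^sub>M lborel) (\<lambda>(s, t). inner (f s) (g t))"
    by (rule Bochner_Integration.integral_cong) (auto split: split_indicator)
  also have "\<dots> = (LINT s|lborel. inner (f s) (integral\<^sup>L lborel g))"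
    using lborel_pair.integral_fst'[OF hall] by (simp add: e3)
  also have "\<dots> = inner (integral\<^sup>L lborel f) (integral\<^sup>L lborel g)" using f by simp
  finally show ?C .
qed

text \<open>Absolute continuity of \<open>P\<close> with derivative \<open>f\<close>, encoded
  through the integral so that it makes sense for vector values without differentiation. It holds
  trivially when \<open>b < a\<close>.\<close>

definition has_density :: "real \<Rightarrow> real \<Rightarrow> (real \<Rightarrow> 'b::{real_normed_vector, second_countable_topology}) \<Rightarrow> (real \<Rightarrow> 'b) \<Rightarrow> bool" where
  "has_density a b P f \<longleftrightarrow> set_integrable lborel {a..b} f \<and> (\<forall>t\<in>{a..b}. (LINT s:{a..t}|lborel. f s) = P t - P a)"

lemma has_densityD:
  assumes "has_density a b P f"
  shows "set_integrable lborel {a..b} f" "a \<le> t \<Longrightarrow> t \<le> b \<Longrightarrow> (LINT s:{a..t}|lborel. f s) = P t - P a"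
  using assms by (auto simp: has_density_def)

lemma has_density_cong:
  assumes "has_density a b P f" "\<And>t. t \<in> {a..b} \<Longrightarrow> P t = Q t" "\<And>t. t \<in> {a..b} \<Longrightarrow> f t = g t"
  shows "has_density a b Q g"
proof -
  have "set_integrable lborel {a..b} g \<longleftrightarrow> set_integrable lborel {a..b} f"
    unfolding set_integrable_def using assms(3) by (intro Bochner_Integration.integrable_cong) (auto split: split_indicator)
  moreover have "(LINT s:{a..t}|lborel. g s) = (LINT s:{a..t}|lborel. f s)" if "t \<in> {a..b}" for t
    unfolding set_lebesgue_integral_def using assms(3) that
    by (intro Bochner_Integration.integral_cong) (auto split: split_indicator)
  ultimately show ?thesis using assms(1,2) by (auto simp: has_density_def)
qed

lemma has_density_subset:
  fixes P :: "real \<Rightarrow> 'b::{real_normed_vector, complete_space, second_countable_topology}"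
  assumes "has_density a b P f" "t \<le> b" shows "has_density a t P f"
  using set_integrable_subset_complete[OF has_densityD(1)[OF assms(1)], of "{a..t}"] assms by (auto simp: has_density_def)

text \<open>The product rule from \<open>inner_triangle_Fubini\<close> for the densities cut off to
  \<open>{a..c}\<close>: the inner integrals there are \<open>P t - P a\<close> and
  \<open>Q s - Q a\<close>. No pointwise derivative occurs.\<close>

lemma has_density_inner:
  fixes P Q :: "real \<Rightarrow> 'b::{real_inner, complete_space, second_countable_topology}"
  assumes P: "has_density a b P f" and Q: "has_density a b Q g"
  shows "has_density a b (\<lambda>t. inner (P t) (Q t)) (\<lambda>t. inner (f t) (Q t) + inner (P t) (g t))"
proof -
  have *: "set_integrable lborel {a..c} (\<lambda>t. inner (f t) (Q t) + inner (P t) (g t)) \<and>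
      (LINT t:{a..c}|lborel. inner (f t) (Q t) + inner (P t) (g t)) = inner (P c) (Q c) - inner (P a) (Q a)"
    if c: "a \<le> c" "c \<le> b" for c
  proof -
    define f1 where "f1 t = indicator {a..c} t *\<^sub>R f t" for t
    define g1 where "g1 t = indicator {a..c} t *\<^sub>R g t" for t
    have f1: "integrable lborel f1" and g1: "integrable lborel g1"
      using has_densityD(1)[OF has_density_subset[OF P c(2)]] has_densityD(1)[OF has_density_subset[OF Q c(2)]]
      by (auto simp: set_integrable_def f1_def[abs_def] g1_def[abs_def])
    have Pc: "(LINT s|lborel. indicator {..t} s *\<^sub>R f1 s) = P t - P a" if "t \<in> {a..c}" for t
    proof -
      have "(\<lambda>s. indicator {..t} s *\<^sub>R f1 s) = (\<lambda>s. indicator {a..t} s *\<^sub>R f s)"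
        using that by (auto simp: f1_def indicator_def fun_eq_iff)
      then show ?thesis using has_densityD(2)[OF P, of t] that c by (simp add: set_lebesgue_integral_def)
    qed
    have Qc: "(LINT t|lborel. indicator {..<s} t *\<^sub>R g1 t) = Q s - Q a" if "s \<in> {a..c}" for s
    proof -
      have "(LINT t|lborel. indicator {..<s} t *\<^sub>R g1 t) = (LINT t|lborel. indicator {a..s} t *\<^sub>R g t)"
      proof (rule integral_cong_AE)
        show "(\<lambda>t. indicator {..<s} t *\<^sub>R g1 t) \<in> borel_measurable lborel" using g1 by measurable
        have "(\<lambda>t. indicator {a..s} t *\<^sub>R g t) = (\<lambda>t. indicator {a..s} t *\<^sub>R g1 t)"
          using that by (auto simp: g1_def indicator_def fun_eq_iff)
        then show "(\<lambda>t. indicator {a..s} t *\<^sub>R g t) \<in> borel_measurable lborel" using g1 by simp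
        show "AE t in lborel. indicator {..<s} t *\<^sub>R g1 t = indicator {a..s} t *\<^sub>R g t"
          using AE_lborel_singleton[of s] by eventually_elim (use that in \<open>auto simp: g1_def split: split_indicator\<close>)
      qed
      then show ?thesis using has_densityD(2)[OF Q, of s] that c by (simp add: set_lebesgue_integral_def)
    qed
    have sa: "(\<lambda>s. inner (f1 s) (LINT t|lborel. indicator {..<s} t *\<^sub>R g1 t)) = (\<lambda>s. indicator {a..c} s * inner (f s) (Q s) - inner (f1 s) (Q a))"
      by (auto simp: fun_eq_iff f1_def Qc inner_diff_right split: split_indicator)
    have sb: "(\<lambda>t. inner (LINT s|lborel. indicator {..t} s *\<^sub>R f1 s) (g1 t)) = (\<lambda>t. indicator {a..c} t * inner (P t) (g t) - inner (P a) (g1 t))"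
      by (auto simp: fun_eq_iff g1_def Pc inner_diff_left split: split_indicator)
    note tri = inner_triangle_Fubini[OF f1 g1, unfolded sa sb]
    have i1: "integrable lborel (\<lambda>s. indicator {a..c} s * inner (f s) (Q s))"
      using Bochner_Integration.integrable_add[OF tri(1) integrable_inner_left[OF f1, of "Q a"]] by simp
    have i2: "integrable lborel (\<lambda>t. indicator {a..c} t * inner (P t) (g t))"
      using Bochner_Integration.integrable_add[OF tri(2) integrable_inner_right[OF g1, of "P a"]] by simp
    have cc: "integral\<^sup>L lborel f1 = P c - P a" "integral\<^sup>L lborel g1 = Q c - Q a"
      using has_densityD(2)[OF P c] has_densityD(2)[OF Q c] by (simp_all add: set_lebesgue_integral_def f1_def[abs_def] g1_def[abs_def])
    have "set_integrable lborel {a..c} (\<lambda>t. inner (f t) (Q t) + inner (P t) (g t))"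
      using Bochner_Integration.integrable_add[OF i1 i2] by (simp add: set_integrable_def distrib_left)
    moreover have "(LINT t:{a..c}|lborel. inner (f t) (Q t) + inner (P t) (g t)) =
        (LINT s|lborel. indicator {a..c} s * inner (f s) (Q s)) + (LINT t|lborel. indicator {a..c} t * inner (P t) (g t))"
      using Bochner_Integration.integral_add[OF i1 i2] by (simp add: set_lebesgue_integral_def distrib_left)
    moreover have "(LINT s|lborel. indicator {a..c} s * inner (f s) (Q s)) - inner (P c - P a) (Q a) +
        ((LINT t|lborel. indicator {a..c} t * inner (P t) (g t)) - inner (P a) (Q c - Q a)) = inner (P c - P a) (Q c - Q a)"
      using tri(3) i1 i2 f1 g1 by (simp add: cc)
    ultimately show ?thesis by (simp add: inner_diff)
  qed
  show ?thesis
  proof (cases "a \<le> b")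
    case True
    then show ?thesis using * by (auto simp: has_density_def)
  next
    case False
    then show ?thesis by (auto simp: has_density_def set_integrable_def)
  qed
qed

lemma has_density_inner_const:
  fixes P :: "real \<Rightarrow> 'b::{real_inner, complete_space, second_countable_topology}"
  assumes P: "has_density a b P f" shows "has_density a b (\<lambda>t. inner (P t) e) (\<lambda>t. inner (f t) e)"
proof -
  have "has_density a b (\<lambda>t. e) (\<lambda>t. 0)" by (auto simp: has_density_def set_integrable_def set_lebesgue_integral_def)
  from has_density_inner[OF P this] show ?thesis by simp
qed

lemma has_density_mult:
  fixes P Q :: "real \<Rightarrow> real"
  assumes "has_density a b P f" "has_density a b Q g"
  shows "has_density a b (\<lambda>t. P t * Q t) (\<lambda>t. f t * Q t + P t * g t)"
  using has_density_inner[OF assms] by simp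

lemma has_density_C1:
  fixes P :: "real \<Rightarrow> real"
  assumes P: "\<And>t. t \<in> {a..b} \<Longrightarrow> (P has_real_derivative f t) (at t)" and f: "continuous_on {a..b} f"
  shows "has_density a b P f"
proof -
  have "(LINT s:{a..t}|lborel. f s) = P t - P a" if "t \<in> {a..b}" for t
  proof -
    have "(LINT s|lborel. indicator {a..t} s *\<^sub>R f s) = P t - P a"
      using that P f
      by (intro integral_FTC_Icc) (auto simp: has_real_derivative_iff_has_vector_derivative[symmetric]
          intro: has_field_derivative_at_within continuous_on_subset)
    then show ?thesis by (simp add: set_lebesgue_integral_def)
  qed
  moreover have "set_integrable lborel {a..b} f"
    unfolding set_integrable_def using f by (intro borel_integrable_compact) auto
  ultimately show ?thesis by (simp add: has_density_def)
qed

subsection \<open>Absolutely continuous functions\<close>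

text \<open>The definition of absolute continuity speaks of families indexed by an initial segment
  of the naturals, whereas the family to which it is applied is a finite set of tagged
  intervals.\<close>

lemma absolutely_continuous_small_sum:
  fixes I :: "'i set" and u v :: "'i \<Rightarrow> real" and f :: "real \<Rightarrow> real"
  assumes I: "finite I" and S: "\<And>i. i \<in> I \<Longrightarrow> u i \<in> S \<and> v i \<in> S \<and> u i \<le> v i"
    and disj: "\<And>i j. i \<in> I \<Longrightarrow> j \<in> I \<Longrightarrow> i \<noteq> j \<Longrightarrow> v i \<le> u j \<or> v j \<le> u i"
    and sm: "(\<Sum>i\<in>I. v i - u i) < d"
    and d: "\<forall>n::nat. \<forall>a b. (\<forall>i<n. a i \<in> S \<and> b i \<in> S \<and> a i \<le> b i)
        \<and> (\<forall>i<n. \<forall>j<n. i \<noteq> j \<longrightarrow> b i \<le> a j \<or> b j \<le> a i)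
        \<and> (\<Sum>i<n. b i - a i) < d \<longrightarrow> (\<Sum>i<n. \<bar>f (b i) - f (a i)\<bar>) < (e :: real)"
  shows "(\<Sum>i\<in>I. \<bar>f (v i) - f (u i)\<bar>) < e"
proof -
  obtain h where h: "bij_betw h {..<card I} I" using ex_bij_betw_nat_finite[OF I] by (auto simp: atLeast0LessThan)
  have hI: "h i \<in> I" if "i < card I" for i using h that by (auto simp: bij_betw_def)
  have hn: "h i \<noteq> h j" if "i < card I" "j < card I" "i \<noteq> j" for i j
    using h that by (auto simp: bij_betw_def inj_on_def)
  have re: "(\<Sum>i<card I. F (h i)) = (\<Sum>i\<in>I. F i)" for F :: "'i \<Rightarrow> real"
    by (rule sum.reindex_bij_betw[OF h])
  have "(\<Sum>i<card I. \<bar>f (v (h i)) - f (u (h i))\<bar>) < e"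
  proof (rule d[THEN spec, THEN spec, THEN spec, THEN mp], intro conjI allI impI)
    show "(\<Sum>i<card I. v (h i) - u (h i)) < d" using sm re[of "\<lambda>i. v i - u i"] by simp
  qed (use S hI disj hn in simp_all)
  then show ?thesis using re[of "\<lambda>i. \<bar>f (v i) - f (u i)\<bar>"] by simp
qed

lemma absolutely_continuous_fun_on_subset:
  assumes ac: "absolutely_continuous_fun_on S f" and "T \<subseteq> S"
  shows "absolutely_continuous_fun_on T f"
  unfolding absolutely_continuous_fun_on_def
proof (intro allI impI)
  fix e :: real assume "0 < e"
  let ?P = "\<lambda>S d. \<forall>n::nat. \<forall>a b. (\<forall>i<n. a i \<in> S \<and> b i \<in> S \<and> a i \<le> b i)
        \<and> (\<forall>i<n. \<forall>j<n. i \<noteq> j \<longrightarrow> b i \<le> a j \<or> b j \<le> a i)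
        \<and> (\<Sum>i<n. b i - a i) < d \<longrightarrow> (\<Sum>i<n. \<bar>f (b i) - f (a i)\<bar>) < e"
  have "\<exists>d>0. ?P S d"
    by (rule ac[unfolded absolutely_continuous_fun_on_def, THEN spec, THEN mp]) fact
  then obtain d where "0 < d" "?P S d" by (elim exE conjE) (rule that)
  moreover have "?P T d"
  proof (intro allI impI, elim conjE)
    fix n :: nat and a b
    assume "\<forall>i<n. a i \<in> T \<and> b i \<in> T \<and> a i \<le> b i" "\<forall>i<n. \<forall>j<n. i \<noteq> j \<longrightarrow> b i \<le> a j \<or> b j \<le> a i"
      "(\<Sum>i<n. b i - a i) < d"
    then show "(\<Sum>i<n. \<bar>f (b i) - f (a i)\<bar>) < e"
      using assms(2) by (intro \<open>?P S d\<close>[THEN spec, THEN spec, THEN spec, THEN mp] conjI) auto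
  qed
  ultimately show "\<exists>d>0. ?P T d" by blast
qed

text \<open>A gauge argument. Off \<open>N\<close> the gauge is a radius of differentiability, so
  each tagged interval contributes an error of at most \<open>e1\<close> times its length. Intervals
  tagged in \<open>N\<close> are confined to an open set \<open>U\<close> of measure below
  \<open>d\<close>; there the integrand is \<open>0\<close>, and absolute continuity bounds the
  total increment of \<open>f\<close>.\<close>

lemma absolutely_continuous_has_integral:
  fixes f g :: "real \<Rightarrow> real"
  assumes ab: "a \<le> b" and ac: "absolutely_continuous_fun_on {a..b} f"
    and N: "N \<in> null_sets lborel"
    and deriv: "\<And>t. t \<in> {a..b} - N \<Longrightarrow> (f has_real_derivative g t) (at t)"
  shows "((\<lambda>t. indicator (- N) t * g t) has_integral (f b - f a)) {a..b}"
  unfolding has_integral_real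
proof (intro allI impI)
  fix e :: real assume "0 < e"
  \<comment> \<open>The added \<open>1\<close> keeps the constant positive when
    \<open>a = b\<close>.\<close>
  define c where "c = b - a + 1"
  have c: "0 < c" using ab by (simp add: c_def)
  define e1 where "e1 = e / (2 * c)"
  have e1: "0 < e1" using \<open>0 < e\<close> c by (simp add: e1_def)
  have "0 < e / 2" using \<open>0 < e\<close> by simp
  have "\<exists>d>0. \<forall>n::nat. \<forall>u v. (\<forall>i<n. u i \<in> {a..b} \<and> v i \<in> {a..b} \<and> u i \<le> v i)
        \<and> (\<forall>i<n. \<forall>j<n. i \<noteq> j \<longrightarrow> v i \<le> u j \<or> v j \<le> u i)
        \<and> (\<Sum>i<n. v i - u i) < d \<longrightarrow> (\<Sum>i<n. \<bar>f (v i) - f (u i)\<bar>) < e / 2"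
    by (rule ac[unfolded absolutely_continuous_fun_on_def, THEN spec, THEN mp]) fact
  then obtain d where d: "0 < d" and dd: "\<forall>n::nat. \<forall>u v. (\<forall>i<n. u i \<in> {a..b} \<and> v i \<in> {a..b} \<and> u i \<le> v i)
        \<and> (\<forall>i<n. \<forall>j<n. i \<noteq> j \<longrightarrow> v i \<le> u j \<or> v j \<le> u i)
        \<and> (\<Sum>i<n. v i - u i) < d \<longrightarrow> (\<Sum>i<n. \<bar>f (v i) - f (u i)\<bar>) < e / 2"
    by (elim exE conjE) (rule that)
  have NB: "N \<in> sets borel" using N by (simp add: null_sets_def)
  obtain U where U: "open U" "N \<subseteq> U" "emeasure lborel (U - N) < ennreal d"
    using outer_regular_lborel[OF NB d] by blast
  have NU: "emeasure lborel U < ennreal d"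
  proof -
    have "emeasure lborel U = emeasure lborel (U - N)"
      by (rule emeasure_Diff_null_set[OF N, symmetric]) (use U(1) in simp)
    then show ?thesis using U(3) by simp
  qed
  have "\<exists>r>0. \<forall>y. \<bar>y - t\<bar> < r \<longrightarrow> \<bar>f y - f t - g t * (y - t)\<bar> \<le> e1 * \<bar>y - t\<bar>" if "t \<in> {a..b} - N" for t
    using deriv[OF that] e1 unfolding has_field_derivative_def has_derivative_at_alt by (auto simp: mult.commute)
  then obtain r where r: "\<And>t. t \<in> {a..b} - N \<Longrightarrow> 0 < r t"
    and rr: "\<And>t y. t \<in> {a..b} - N \<Longrightarrow> \<bar>y - t\<bar> < r t \<Longrightarrow> \<bar>f y - f t - g t * (y - t)\<bar> \<le> e1 * \<bar>y - t\<bar>" by metis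
  define \<gamma> where "\<gamma> t = (if t \<in> N then U else if t \<in> {a..b} then ball t (r t) else ball t 1)" for t
  have gauge: "gauge \<gamma>" unfolding gauge_def \<gamma>_def using U r by auto
  let ?G = "\<lambda>t. indicator (- N) t * g t"
  have "norm ((\<Sum>(x, k)\<in>p. measure lborel k *\<^sub>R ?G x) - (f b - f a)) < e"
    if p: "p tagged_division_of {a..b}" and fine: "\<gamma> fine p" for p
  proof -
    have fin: "finite p" using p by (rule tagged_division_of_finite)
    have pk: "\<exists>u v. k = {u..v} \<and> u \<le> x \<and> x \<le> v \<and> a \<le> u \<and> v \<le> b \<and> {u..v} \<subseteq> \<gamma> x" if mem: "(x, k) \<in> p" for x k
    proof -
      obtain u v where "k = cbox u v" using tagged_division_ofD(4)[OF p mem] by blast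
      moreover have "x \<in> k" "k \<subseteq> {a..b}" using tagged_division_ofD(2,3)[OF p mem] by auto
      moreover have "k \<subseteq> \<gamma> x" using fine mem by (auto simp: fine_def)
      ultimately show ?thesis by (intro exI[of _ u] exI[of _ v]) auto
    qed
    define D where "D z = f (Sup (snd z)) - f (Inf (snd z))" for z :: "real \<times> real set"
    have tele: "(\<Sum>z\<in>p. D z) = f b - f a"
      using additive_tagged_division_1[OF ab p, of f] by (simp add: D_def split_beta')
    \<comment> \<open>Degenerate intervals are dropped: they contribute nothing, but a single point
      may lie inside another interval of the division, which would violate the ordering demanded by
      absolute continuity.\<close>
    define pN where "pN = {z \<in> p. fst z \<in> N \<and> measure lborel (snd z) > 0}"
    have pNp: "pN \<subseteq> p" "finite pN" using fin by (auto simp: pN_def)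
    have trm: "\<bar>measure lborel (snd z) * ?G (fst z) - D z\<bar> \<le> e1 * measure lborel (snd z) + (if z \<in> pN then \<bar>D z\<bar> else 0)" if z: "z \<in> p" for z
    proof -
      obtain x k where zx: "z = (x, k)" by (cases z)
      obtain u v where k: "k = {u..v}" "u \<le> x" "x \<le> v" "a \<le> u" "v \<le> b" "{u..v} \<subseteq> \<gamma> x" using pk z zx by blast
      have Dz: "D z = f v - f u" and c: "measure lborel (snd z) = v - u" using k by (auto simp: D_def zx)
      show ?thesis
      proof (cases "x \<in> N")
        case True
        have "D z = 0" if "z \<notin> pN"
        proof -
          have "\<not> 0 < v - u" using that True z by (simp add: pN_def zx c[unfolded zx, symmetric])
          then have "u = v" using k by linarith
          then show ?thesis by (simp add: Dz)
        qed
        moreover have "0 \<le> e1 * (v - u)" using e1 k by simp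
        ultimately show ?thesis using True unfolding c by (cases "z \<in> pN") (simp_all add: zx)
      next
        case False
        then have x: "x \<in> {a..b} - N" using k by auto
        have "u \<in> ball x (r x)" "v \<in> ball x (r x)" using k x by (auto simp: \<gamma>_def subset_iff)
        then have 1: "\<bar>f u - f x - g x * (u - x)\<bar> \<le> e1 * (x - u)" "\<bar>f v - f x - g x * (v - x)\<bar> \<le> e1 * (v - x)"
          using rr[OF x, of u] rr[OF x, of v] k by (auto simp: dist_real_def)
        have "(v - u) * g x - (f v - f u) = (f u - f x - g x * (u - x)) - (f v - f x - g x * (v - x))" by (simp add: algebra_simps)
        then have "\<bar>(v - u) * g x - (f v - f u)\<bar> \<le> e1 * (x - u) + e1 * (v - x)" using 1 by linarith
        then have "\<bar>(v - u) * g x - (f v - f u)\<bar> \<le> e1 * (v - u)" by (simp add: algebra_simps)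
        moreover have "z \<notin> pN" using False by (simp add: pN_def zx)
        ultimately show ?thesis using False unfolding Dz c by (simp add: zx)
      qed
    qed
    have sumN: "(\<Sum>z\<in>pN. \<bar>D z\<bar>) < e / 2"
      unfolding D_def
    proof (rule absolutely_continuous_small_sum[OF pNp(2) _ _ _ dd])
      have nd: "\<exists>x u v. z = (x, {u..v}) \<and> u < v \<and> a \<le> u \<and> v \<le> b \<and> {u..v} \<subseteq> U" if z: "z \<in> pN" for z
      proof -
        obtain x k where zx: "z = (x, k)" by (cases z)
        obtain u v where k: "k = {u..v}" "u \<le> x" "x \<le> v" "a \<le> u" "v \<le> b" "{u..v} \<subseteq> \<gamma> x" using pk z zx pNp by blast
        then show ?thesis using z zx by (intro exI[of _ x] exI[of _ u] exI[of _ v]) (auto simp: pN_def \<gamma>_def)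
      qed
      have disj: "interior (snd y) \<inter> interior (snd z) = {}" if "y \<in> pN" "z \<in> pN" "y \<noteq> z" for y z
        using tagged_division_ofD(5)[OF p, of "fst y" "snd y" "fst z" "snd z"] that pNp by (auto simp: prod_eq_iff)
      show "Inf (snd z) \<in> {a..b} \<and> Sup (snd z) \<in> {a..b} \<and> Inf (snd z) \<le> Sup (snd z)" if "z \<in> pN" for z
        using nd[OF that] by auto
      show "Sup (snd y) \<le> Inf (snd z) \<or> Sup (snd z) \<le> Inf (snd y)" if yz: "y \<in> pN" "z \<in> pN" "y \<noteq> z" for y z
      proof (rule ccontr)
        obtain x u v where y: "y = (x, {u..v})" "u < v" using nd[OF yz(1)] by blast
        obtain x' u' v' where z: "z = (x', {u'..v'})" "u' < v'" using nd[OF yz(2)] by blast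
        assume "\<not> ?thesis"
        then have "u' < v" "u < v'" using y z by auto
        then have "(max u u' + min v v') / 2 \<in> interior (snd y) \<inter> interior (snd z)"
          using y z by (auto simp: interior_atLeastAtMost_real min_def max_def)
        then show False using disj[OF yz] by blast
      qed
      have "(\<Sum>z\<in>pN. emeasure lborel (interior (snd z))) = emeasure lborel (\<Union>z\<in>pN. interior (snd z))"
        by (rule sum_emeasure) (use disj pNp in \<open>auto simp: disjoint_family_on_def\<close>)
      also have "\<dots> \<le> emeasure lborel U"
        using nd interior_subset U(1) by (intro emeasure_mono) (fastforce, auto)
      also have "\<dots> < ennreal d" by (rule NU)
      also have "(\<Sum>z\<in>pN. emeasure lborel (interior (snd z))) = (\<Sum>z\<in>pN. ennreal (Sup (snd z) - Inf (snd z)))"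
      proof (rule sum.cong[OF refl])
        fix z assume "z \<in> pN"
        then obtain x u v where "z = (x, {u..v})" "u < v" using nd by blast
        then show "emeasure lborel (interior (snd z)) = ennreal (Sup (snd z) - Inf (snd z))"
          by (simp add: interior_atLeastAtMost_real)
      qed
      also have "\<dots> = ennreal (\<Sum>z\<in>pN. Sup (snd z) - Inf (snd z))"
        using nd by (intro sum_ennreal) fastforce
      finally show "(\<Sum>z\<in>pN. Sup (snd z) - Inf (snd z)) < d"
        by (meson ennreal_leI linorder_not_less)
    qed
    have "norm ((\<Sum>(x, k)\<in>p. measure lborel k *\<^sub>R ?G x) - (f b - f a)) = \<bar>\<Sum>z\<in>p. measure lborel (snd z) * ?G (fst z) - D z\<bar>"
      by (simp add: tele[symmetric] sum_subtractf split_beta')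
    also have "\<dots> \<le> (\<Sum>z\<in>p. \<bar>measure lborel (snd z) * ?G (fst z) - D z\<bar>)" by (rule sum_abs)
    also have "\<dots> \<le> (\<Sum>z\<in>p. e1 * measure lborel (snd z) + (if z \<in> pN then \<bar>D z\<bar> else 0))" by (intro sum_mono trm)
    also have "\<dots> = e1 * (\<Sum>z\<in>p. measure lborel (snd z)) + (\<Sum>z\<in>pN. \<bar>D z\<bar>)"
      using fin pNp by (simp add: sum.distrib sum_distrib_left sum.inter_restrict[symmetric] Int_absorb1)
    also have "(\<Sum>z\<in>p. measure lborel (snd z)) = b - a"
      using additive_content_tagged_division[of p a b] p ab by (simp add: split_beta' )
    also have "e1 * (b - a) + (\<Sum>z\<in>pN. \<bar>D z\<bar>) < e / 2 + e / 2"
    proof (rule add_le_less_mono[OF _ sumN])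
      have "e1 * (b - a) \<le> e1 * c" using e1 by (simp add: c_def)
      also have "\<dots> = e / 2" using c by (simp add: e1_def)
      finally show "e1 * (b - a) \<le> e / 2" .
    qed
    finally show ?thesis by simp
  qed
  then show "\<exists>\<gamma>. gauge \<gamma> \<and> (\<forall>p. p tagged_division_of {a..b} \<and> \<gamma> fine p \<longrightarrow>
      norm ((\<Sum>(x, k)\<in>p. measure lborel k *\<^sub>R ?G x) - (f b - f a)) < e)" using gauge by blast
qed

text \<open>The gauge integral is upgraded to a Lebesgue integral: a nondecreasing function has a
  nonnegative derivative, and a nonnegative gauge integrable function is absolutely integrable.
  Borel measurability is obtained separately.\<close>

lemma absolutely_continuous_has_density:
  fixes f g :: "real \<Rightarrow> real"
  assumes ab: "a \<le> b" and ac: "absolutely_continuous_fun_on {a..b} f" and mono: "mono_on {a..b} f"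
    and cont: "continuous_on {a..b} f" and N: "N \<in> null_sets lborel"
    and deriv: "\<And>t. t \<in> {a..b} - N \<Longrightarrow> (f has_real_derivative g t) (at t)"
  shows "has_density a b f (\<lambda>t. indicator (- N) t * g t)"
    and "\<And>t. t \<in> {a<..<b} - N \<Longrightarrow> 0 \<le> g t"
proof -
  let ?G = "\<lambda>t. indicator (- N) t * g t"
  show nonneg: "0 \<le> g t" if t: "t \<in> {a<..<b} - N" for t
  proof (rule ccontr)
    assume "\<not> 0 \<le> g t"
    then obtain d where d: "0 < d" "\<And>h. 0 < h \<Longrightarrow> h < d \<Longrightarrow> f (t + h) < f t"
      using has_real_derivative_neg_dec_right[of f "g t" t UNIV] deriv[of t] t by auto
    define h where "h = min (d / 2) (b - t)"
    have "0 < h" "h < d" "t + h \<le> b" using d t by (auto simp: h_def min_def)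
    then show False using d(2)[of h] mono_onD[OF mono, of t "t + h"] t by auto
  qed
  \<comment> \<open>\<open>f\<close> is extended constantly beyond \<open>[a, b]\<close>. The
    difference quotients of the extension are Borel on the whole line, and their limit makes
    \<open>g\<close> measurable off \<open>N\<close> on the open interval.\<close>
  define F where "F t = f (max a (min b t))" for t
  have cF: "continuous_on UNIV F"
    unfolding F_def by (rule continuous_on_compose2[OF cont]) (use ab in \<open>auto intro!: continuous_intros\<close>)
  have mG': "(\<lambda>t. indicator ({a<..<b} - N) t * g t) \<in> borel_measurable borel"
  proof (rule borel_measurable_LIMSEQ_real)
    fix t
    show "(\<lambda>n. indicator ({a<..<b} - N) t * ((F (t + inverse (Suc n)) - F t) / inverse (Suc n))) \<longlonglongrightarrow> indicator ({a<..<b} - N) t * g t"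
    proof (cases "t \<in> {a<..<b} - N")
      case True
      have "(F has_real_derivative g t) (at t)"
        using deriv[of t] True
        by (intro has_field_derivative_transform_within_open[of f "g t" t "{a<..<b}" F]) (auto simp: F_def)
      then have "((\<lambda>h. (F (t + h) - F t) / h) \<longlongrightarrow> g t) (at 0)" by (simp add: DERIV_def)
      moreover have "filterlim (\<lambda>n. inverse (real (Suc n))) (at 0) sequentially"
        using LIMSEQ_inverse_real_of_nat by (auto simp: filterlim_at intro!: always_eventually)
      ultimately have "(\<lambda>n. (F (t + inverse (Suc n)) - F t) / inverse (Suc n)) \<longlonglongrightarrow> g t" by (rule filterlim_compose)
      then show ?thesis using True by simp
    qed simp
    have [measurable]: "F \<in> borel_measurable borel" using cF by (rule borel_measurable_continuous_onI)
    have [measurable]: "N \<in> sets borel" using N by (auto simp: null_sets_def)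
    show "(\<lambda>t. indicator ({a<..<b} - N) t * ((F (t + inverse (Suc n)) - F t) / inverse (Suc n))) \<in> borel_measurable borel" for n
      by measurable
  qed
  \<comment> \<open>The endpoints are left out because sign and measurability of \<open>g\<close>
    were obtained at interior points.\<close>
  define G2 where "G2 t = indicator ({a<..<b} - N) t * g t" for t
  have hi: "(?G has_integral (f t - f a)) {a..t}" if "t \<in> {a..b}" for t
  proof (rule absolutely_continuous_has_integral[OF _ _ N])
    show "a \<le> t" using that by simp
    show "absolutely_continuous_fun_on {a..t} f"
      by (rule absolutely_continuous_fun_on_subset[OF ac]) (use that in auto)
  qed (use deriv that in auto)
  have G2b: "G2 \<in> borel_measurable lborel" using mG' by (simp add: G2_def[abs_def])
  have AEG: "AE t in lborel. t \<noteq> a \<and> t \<noteq> b" using AE_lborel_singleton[of a] AE_lborel_singleton[of b] by eventually_elim simp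
  have Gm: "(\<lambda>t. indicator {a..b} t * ?G t) \<in> borel_measurable lborel"
  proof -
    have "(\<lambda>t. indicator {a..b} t * ?G t) = (\<lambda>t. if t = a then indicator {a..b} a * ?G a else if t = b then indicator {a..b} b * ?G b else G2 t)"
      by (auto simp: fun_eq_iff G2_def indicator_def)
    then show ?thesis using G2b by simp
  qed
  have G2i: "integrable lborel G2"
  proof -
    have "((\<lambda>t. indicator ({a<..<b} - N) t * g t) has_integral (f b - f a)) {a..b}"
      by (rule has_integral_spike_finite[of "{a, b}", OF _ _ hi]) (use ab in \<open>auto simp: indicator_def\<close>)
    then have "G2 integrable_on {a..b}" unfolding G2_def[abs_def] by blast
    then have "G2 absolutely_integrable_on {a..b}"
      by (rule nonnegative_absolutely_integrable_1) (use nonneg in \<open>auto simp: G2_def indicator_def\<close>)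
    moreover have "(\<lambda>t. indicator {a..b} t *\<^sub>R G2 t) = G2" by (auto simp: G2_def indicator_def fun_eq_iff)
    ultimately show ?thesis using integrable_completion[OF G2b] by (simp add: set_integrable_def)
  qed
  have si: "set_integrable lborel {a..b} ?G"
    unfolding set_integrable_def real_scaleR_def
    by (rule integrable_cong_AE_imp[OF G2i Gm]) (use AEG in \<open>eventually_elim, auto simp: G2_def indicator_def\<close>)
  have "(LINT s:{a..t}|lborel. ?G s) = f t - f a" if "t \<in> {a..b}" for t
  proof -
    have "set_integrable lborel {a..t} ?G" by (rule set_integrable_subset_complete[OF si]) (use that in auto)
    then have "(LINT s:{a..t}|lborel. ?G s) = integral {a..t} ?G" by (rule set_borel_integral_eq_integral)
    then show ?thesis using hi[OF that] by (simp add: integral_unique)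
  qed
  then show "has_density a b f ?G" using si by (simp add: has_density_def)
qed

subsection \<open>Test functions\<close>

text \<open>\<open>exp (- (1 / s))\<close> continued by \<open>0\<close>, together with the powers
  of \<open>1 / s\<close> that its derivatives produce; the family is closed under differentiation
  up to linear combinations.\<close>

definition flat_exp :: "nat \<Rightarrow> real \<Rightarrow> real" where
  "flat_exp k s = (if 0 < s then (1 / s) ^ k * exp (- (1 / s)) else 0)"

lemma flat_exp_tendsto_0: "((\<lambda>s. flat_exp k s) \<longlongrightarrow> 0) (at_right 0)"
proof -
  have "((\<lambda>s. (inverse s) ^ k / exp (inverse s)) \<longlongrightarrow> (0::real)) (at_right 0)"
    by (rule filterlim_compose[OF tendsto_power_div_exp_0 filterlim_inverse_at_top_right])
  then show ?thesis
    by (rule Lim_transform_eventually)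
      (auto simp: eventually_at_right_field flat_exp_def exp_minus divide_inverse intro!: exI[of _ 1])
qed

lemma flat_exp_derivative:
  "(flat_exp k has_real_derivative (flat_exp (k + 2) s - k * flat_exp (k + 1) s)) (at s)"
proof (cases "s = 0")
  case True
  have "((\<lambda>h. flat_exp k h / h) \<longlongrightarrow> 0) (at 0)"
  proof (rule filterlim_split_at_real)
    have "((\<lambda>h. flat_exp (k + 1) h) \<longlongrightarrow> 0) (at_right 0)" by (rule flat_exp_tendsto_0)
    then show "((\<lambda>h. flat_exp k h / h) \<longlongrightarrow> 0) (at_right 0)"
      by (rule Lim_transform_eventually) (auto simp: eventually_at_right_field flat_exp_def intro!: exI[of _ 1])
    have "((\<lambda>h::real. 0::real) \<longlongrightarrow> 0) (at_left 0)" by simp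
    then show "((\<lambda>h. flat_exp k h / h) \<longlongrightarrow> 0) (at_left 0)"
      by (rule Lim_transform_eventually) (auto simp: eventually_at_left_field flat_exp_def intro!: exI[of _ "-1"])
  qed
  then show ?thesis using True by (simp add: DERIV_def flat_exp_def)
next
  case False
  show ?thesis
  proof (cases "0 < s")
    case True
    have i: "((\<lambda>s. 1 / s) has_real_derivative - ((1 / s)\<^sup>2)) (at s)"
      using True by (auto intro!: derivative_eq_intros simp: power2_eq_square)
    have p: "((\<lambda>s. (1 / s) ^ k) has_real_derivative - (k * (1 / s) ^ (k + 1))) (at s)"
    proof (cases k)
      case (Suc j)
      then show ?thesis using DERIV_power_Suc[OF i, of j] by (simp add: power2_eq_square mult.assoc)
    qed simp
    have e: "((\<lambda>s. exp (- (1 / s))) has_real_derivative exp (- (1 / s)) * (1 / s)\<^sup>2) (at s)"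
      using DERIV_chain2[OF DERIV_exp DERIV_minus[OF i]] by simp
    have "- (k * (1 / s) ^ (k + 1)) * exp (- (1 / s)) + exp (- (1 / s)) * (1 / s)\<^sup>2 * (1 / s) ^ k =
      (1 / s) ^ (k + 2) * exp (- (1 / s)) - k * ((1 / s) ^ (k + 1) * exp (- (1 / s)))"
      by (simp add: power_add power2_eq_square mult_ac)
    with DERIV_mult[OF p e] have d: "((\<lambda>s. (1 / s) ^ k * exp (- (1 / s))) has_real_derivative
        ((1 / s) ^ (k + 2) * exp (- (1 / s)) - k * ((1 / s) ^ (k + 1) * exp (- (1 / s))))) (at s)" by simp
    show ?thesis
      using has_field_derivative_transform_within_open[OF d, of "{0<..}" "flat_exp k"] True by (simp add: flat_exp_def)
  next
    case F: False
    have d: "((\<lambda>s. 0) has_real_derivative 0) (at s)" by simp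
    show ?thesis
      using has_field_derivative_transform_within_open[OF d, of "{..<0}" "flat_exp k"] False F by (simp add: flat_exp_def)
  qed
qed

text \<open>A class of functions in which every member has its derivative again in the class, so
  that smoothness follows by induction without formulas for iterated derivatives. The rule
  \<open>primitive\<close> admits functions that are known only through their derivative.\<close>

inductive infdiff :: "(real \<Rightarrow> real) \<Rightarrow> bool" where
  flat: "infdiff (flat_exp k)"
| const: "infdiff (\<lambda>s. c)"
| add: "infdiff f \<Longrightarrow> infdiff g \<Longrightarrow> infdiff (\<lambda>s. f s + g s)"
| mult: "infdiff f \<Longrightarrow> infdiff g \<Longrightarrow> infdiff (\<lambda>s. f s * g s)"
| affine: "infdiff f \<Longrightarrow> infdiff (\<lambda>s. f (c * s + d))"
| primitive: "infdiff f \<Longrightarrow> (\<And>s. (F has_real_derivative f s) (at s)) \<Longrightarrow> infdiff F"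

lemma infdiff_derivative: "infdiff f \<Longrightarrow> \<exists>f'. infdiff f' \<and> (\<forall>s. (f has_real_derivative f' s) (at s))"
proof (induction rule: infdiff.induct)
  case (flat k)
  have "infdiff (\<lambda>s. flat_exp (k + 2) s + (- real k) * flat_exp (k + 1) s)"
    by (intro infdiff.add infdiff.mult infdiff.const infdiff.flat)
  then have "infdiff (\<lambda>s. flat_exp (k + 2) s - k * flat_exp (k + 1) s)" by simp
  then show ?case using flat_exp_derivative[of k] by blast
next
  case (const c)
  have "infdiff (\<lambda>s. 0)" by (rule infdiff.const)
  moreover have "((\<lambda>s. c) has_real_derivative 0) (at s)" for s by simp
  ultimately show ?case by blast
next
  case (add f g)
  then obtain f' g' where "infdiff f'" "\<And>s. (f has_real_derivative f' s) (at s)" "infdiff g'" "\<And>s. (g has_real_derivative g' s) (at s)" by blast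
  then show ?case by (intro exI[of _ "\<lambda>s. f' s + g' s"]) (auto intro: infdiff.add DERIV_add)
next
  case (mult f g)
  then obtain f' g' where d: "infdiff f'" "\<And>s. (f has_real_derivative f' s) (at s)" "infdiff g'" "\<And>s. (g has_real_derivative g' s) (at s)" by blast
  have "infdiff (\<lambda>s. f' s * g s + g' s * f s)" by (intro infdiff.add infdiff.mult d mult)
  then show ?case using d by (intro exI[of _ "\<lambda>s. f' s * g s + g' s * f s"]) (auto intro: DERIV_mult)
next
  case (affine f c d)
  then obtain f' where f': "infdiff f'" "\<And>s. (f has_real_derivative f' s) (at s)" by blast
  have "((\<lambda>s. f (c * s + d)) has_real_derivative f' (c * s + d) * c) (at s)" for s
    by (rule DERIV_chain2[OF f'(2)]) (auto intro!: derivative_eq_intros)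
  moreover have "infdiff (\<lambda>s. f' (c * s + d) * c)" by (intro infdiff.mult infdiff.affine[OF f'(1)] infdiff.const)
  ultimately show ?case by (intro exI[of _ "\<lambda>s. f' (c * s + d) * c"]) auto
next
  case (primitive f F)
  then show ?case by blast
qed

lemma infdiff_smooth: assumes "infdiff f" shows "smooth_fun f"
proof -
  have "infdiff ((deriv ^^ n) f)" for n
  proof (induction n)
    case (Suc n)
    obtain f' where f': "infdiff f'" "\<And>s. ((deriv ^^ n) f has_real_derivative f' s) (at s)" using infdiff_derivative[OF Suc] by blast
    have "(deriv ^^ Suc n) f = f'" using DERIV_imp_deriv[OF f'(2)] by (simp add: fun_eq_iff)
    then show ?case using f' by simp
  qed (simp add: assms)
  then show ?thesis unfolding smooth_fun_def using infdiff_derivative by (metis real_differentiable_def)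
qed

lemma infdiff_continuous: assumes "infdiff f" shows "continuous_on S f"
proof -
  obtain f' where "\<And>s. (f has_real_derivative f' s) (at s)" using infdiff_derivative[OF assms] by metis
  then show ?thesis by (meson DERIV_continuous_on has_field_derivative_at_within)
qed

lemma infdiff_has_primitive:
  assumes "infdiff f" obtains F where "infdiff F" "\<And>s. (F has_real_derivative f s) (at s)"
proof -
  have "\<exists>F. \<forall>x::real. -\<infinity> < ereal x \<longrightarrow> ereal x < \<infinity> \<longrightarrow> (F has_vector_derivative f x) (at x)"
    using infdiff_continuous[OF assms, of UNIV] by (intro einterval_antiderivative) (auto simp: continuous_on_eq_continuous_at)
  then obtain F where "\<And>s. (F has_real_derivative f s) (at s)"
    by (auto simp: has_real_derivative_iff_has_vector_derivative)
  then show ?thesis using that infdiff.primitive[OF assms] by blast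
qed

text \<open>The normalised primitive of the bump \<open>flat_exp 0 s * flat_exp 0 (1 - s)\<close>,
  which is positive exactly on the open unit interval.\<close>

lemma smooth_step:
  obtains \<sigma> where "infdiff \<sigma>" "\<And>s. s \<le> 0 \<Longrightarrow> \<sigma> s = 0" "\<And>s. 1 \<le> s \<Longrightarrow> \<sigma> s = (1::real)" "\<And>s. 0 \<le> \<sigma> s" "\<And>s. \<sigma> s \<le> 1"
proof -
  define \<eta> where "\<eta> s = flat_exp 0 s * flat_exp 0 ((- 1) * s + 1)" for s
  have \<eta>: "infdiff \<eta>" unfolding \<eta>_def by (intro infdiff.mult infdiff.flat infdiff.affine[OF infdiff.flat])
  obtain F where F: "infdiff F" "\<And>s. (F has_real_derivative \<eta> s) (at s)" using infdiff_has_primitive[OF \<eta>] by metis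
  have \<eta>0: "0 \<le> \<eta> s" "s \<le> 0 \<or> 1 \<le> s \<Longrightarrow> \<eta> s = 0" "0 < s \<Longrightarrow> s < 1 \<Longrightarrow> 0 < \<eta> s" for s
    by (auto simp: \<eta>_def flat_exp_def)
  have mono: "F s \<le> F t" if "s \<le> t" for s t
    using DERIV_nonneg_imp_nondecreasing[OF that, of F] F(2) \<eta>0(1) by blast
  have anti: "F t \<le> F s" if "s \<le> t" "t \<le> 0 \<or> 1 \<le> s" for s t
  proof (rule DERIV_nonpos_imp_nonincreasing[OF that(1)])
    fix x assume "s \<le> x" "x \<le> t"
    then have "\<eta> x = 0" using \<eta>0(2) that(2) by auto
    then show "\<exists>y. (F has_real_derivative y) (at x) \<and> y \<le> 0" using F(2)[of x] by auto
  qed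
  have pos: "F 0 < F 1"
    using F \<eta>0(3) by (intro DERIV_pos_imp_increasing_open[of 0 1 F]) (auto intro: infdiff_continuous)
  define \<sigma> where "\<sigma> s = (F s + (- F 0)) * (1 / (F 1 - F 0))" for s
  show ?thesis
  proof (rule that[of \<sigma>])
    show "infdiff \<sigma>" unfolding \<sigma>_def by (intro infdiff.mult infdiff.add infdiff.const F)
    show "\<sigma> s = 0" if "s \<le> 0" for s using mono[OF that] anti[OF that] by (simp add: \<sigma>_def)
    show one: "\<sigma> s = 1" if "1 \<le> s" for s using mono[OF that] anti[OF that] pos by (simp add: \<sigma>_def)
    show "0 \<le> \<sigma> s" for s
      using mono[of 0 s] anti[of s 0] pos by (cases "0 \<le> s") (auto simp: \<sigma>_def)
    show "\<sigma> s \<le> 1" for s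
      using mono[of s 1] anti[of 1 s] pos by (cases "s \<le> 1") (auto simp: \<sigma>_def)
  qed
qed

lemma test_fun_C1:
  assumes "test_fun U \<phi>"
  shows "\<And>s. (\<phi> has_real_derivative deriv \<phi> s) (at s)" "continuous_on S (deriv \<phi>)"
proof -
  have sm: "((deriv ^^ n) \<phi>) differentiable (at x)" for n x using assms by (simp add: test_fun_def smooth_fun_def)
  show "(\<phi> has_real_derivative deriv \<phi> s) (at s)" for s using sm[of 0 s] by (simp add: DERIV_deriv_iff_real_differentiable)
  have "deriv \<phi> differentiable (at x)" for x using sm[of 1 x] by simp
  then show "continuous_on S (deriv \<phi>)"
    by (intro continuous_at_imp_continuous_on ballI differentiable_imp_continuous_within)
qed

lemma test_fun_interval:
  assumes \<phi>: "test_fun {\<tau>. 0 < \<tau> \<and> ereal \<tau> < l} \<phi>" and l: "0 < l"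
  obtains a b where "0 < a" "a \<le> b" "ereal b < l" "\<And>s. s \<notin> {a<..<b} \<Longrightarrow> \<phi> s = 0"
    "\<And>s. s \<notin> {a<..<b} \<Longrightarrow> deriv \<phi> s = 0"
proof -
  let ?S = "closure {x. \<phi> x \<noteq> 0}"
  \<comment> \<open>A point of the interval is adjoined to the support so that extrema exist even
    when \<open>\<phi>\<close> vanishes identically.\<close>
  obtain c where c: "0 < c" "ereal c < l"
    using l ereal_dense2[of 0 l] by (metis ereal_less(2) zero_ereal_def)
  have cS: "compact (insert c ?S)" using \<phi> by (auto simp: test_fun_def compact_insert)
  have ne: "insert c ?S \<noteq> {}" by simp
  obtain m where m: "m \<in> insert c ?S" "\<And>s. s \<in> insert c ?S \<Longrightarrow> m \<le> s" using compact_attains_inf[OF cS ne] by blast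
  obtain M where M: "M \<in> insert c ?S" "\<And>s. s \<in> insert c ?S \<Longrightarrow> s \<le> M" using compact_attains_sup[OF cS ne] by blast
  have sub: "insert c ?S \<subseteq> {\<tau>. 0 < \<tau> \<and> ereal \<tau> < l}" using \<phi> c by (auto simp: test_fun_def)
  \<comment> \<open>The right end is moved strictly outward, as the left end will be with
    \<open>m / 2\<close>, so that \<open>\<phi>\<close> and its derivative vanish at the endpoints
    as well.\<close>
  obtain M' where M': "M < M'" "ereal M' < l" using sub M(1) ereal_dense2[of "ereal M" l] by auto
  have m0: "0 < m" using sub m(1) by auto
  have z: "\<phi> s = 0" if "s \<notin> {m..M}" for s
    using that m(2)[of s] M(2)[of s] closure_subset[of "{x. \<phi> x \<noteq> 0}"] by force
  have dz: "deriv \<phi> s = 0" if "s \<notin> {m..M}" for s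
  proof -
    have "open (- {m..M})" by (simp add: open_Compl)
    moreover have "((\<lambda>s. 0) has_real_derivative 0) (at s)" by simp
    ultimately have "(\<phi> has_real_derivative 0) (at s)"
      using that z by (intro has_field_derivative_transform_within_open[of "\<lambda>s. 0" 0 s "- {m..M}" \<phi>]) auto
    then show ?thesis by (rule DERIV_imp_deriv)
  qed
  show ?thesis
  proof (rule that[of "m / 2" M'])
    show "m / 2 \<le> M'" using m(2)[OF M(1)] m0 M'(1) by simp
  qed (use m0 M' z dz in \<open>auto\<close>)
qed

text \<open>Test functions whose derivatives converge boundedly to a prescribed combination of two indicators
  of intervals; such a combination has mean zero, so its primitive is compactly supported.\<close>

lemma real_weak_derivative_zero:
  fixes z :: "real \<Rightarrow> real"
  assumes sub: "{a..b'} \<subseteq> \<Omega>" and ord: "a \<le> b" "b < b'" "a \<le> \<alpha>" "\<alpha> \<le> \<beta>" "\<beta> < b'"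
    and \<Omega>: "\<Omega> \<in> sets borel"
    and int: "set_integrable lborel {a..b'} z"
    and weak: "\<And>\<phi>. test_fun \<Omega> \<phi> \<Longrightarrow> (LINT \<tau>:\<Omega>|lborel. deriv \<phi> \<tau> * z \<tau>) = 0"
  shows "(\<beta> - \<alpha>) * (LINT \<tau>:{a..b}|lborel. z \<tau>) = (b - a) * (LINT \<tau>:{\<alpha>..\<beta>}|lborel. z \<tau>)"
proof -
  obtain \<sigma> where \<sigma>: "infdiff \<sigma>" "\<And>s. s \<le> 0 \<Longrightarrow> \<sigma> s = 0" "\<And>s. 1 \<le> s \<Longrightarrow> \<sigma> s = (1::real)" "\<And>s. 0 \<le> \<sigma> s" "\<And>s. \<sigma> s \<le> 1"
    using smooth_step by metis
  obtain \<theta>0 where \<theta>0: "infdiff \<theta>0" "\<And>s. (\<theta>0 has_real_derivative \<sigma> s) (at s)" using infdiff_has_primitive[OF \<sigma>(1)] by metis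
  \<comment> \<open>A smoothed ramp: \<open>0\<close> for \<open>s \<le> 0\<close> and affine with
    slope \<open>1\<close> for \<open>s \<ge> 1\<close>. Rescaled by a large factor in both
    variables, it approximates the positive part of its argument.\<close>
  define \<theta> where "\<theta> s = \<theta>0 s + (- \<theta>0 0)" for s
  have \<theta>: "infdiff \<theta>" unfolding \<theta>_def by (intro infdiff.add infdiff.const \<theta>0)
  have d\<theta>: "(\<theta> has_real_derivative \<sigma> s) (at s)" for s
    unfolding \<theta>_def by (auto intro!: derivative_eq_intros \<theta>0(2))
  have \<theta>neg: "\<theta> s = 0" if "s \<le> 0" for s
  proof -
    have "\<theta>0 s \<le> \<theta>0 0" by (rule DERIV_nonneg_imp_nondecreasing[OF that]) (use \<theta>0(2) \<sigma>(4) in blast)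
    moreover have "\<theta>0 0 \<le> \<theta>0 s" by (rule DERIV_nonpos_imp_nonincreasing[OF that]) (use \<theta>0(2) \<sigma>(2) in \<open>metis order_refl\<close>)
    ultimately show ?thesis by (simp add: \<theta>_def)
  qed
  have \<theta>pos: "\<theta> s = s + (\<theta> 1 - 1)" if "1 \<le> s" for s
  proof -
    have d: "((\<lambda>s. \<theta> s - s) has_real_derivative \<sigma> s - 1) (at s)" for s by (intro derivative_intros d\<theta>)
    have "\<theta> s - s \<le> \<theta> 1 - 1"
      by (rule DERIV_nonpos_imp_nonincreasing[OF that, of "\<lambda>s. \<theta> s - s"]) (use d \<sigma>(5) in \<open>metis diff_le_0_iff_le\<close>)
    moreover have "\<theta> 1 - 1 \<le> \<theta> s - s"
      by (rule DERIV_nonneg_imp_nondecreasing[OF that, of "\<lambda>s. \<theta> s - s"]) (use d \<sigma>(3) in \<open>metis diff_self order_refl\<close>)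
    ultimately show ?thesis by simp
  qed
  \<comment> \<open>The first summand guarantees that at \<open>b'\<close> all four ramps used below
    have reached their affine part; the summand \<open>real n\<close> sharpens their
    corners.\<close>
  define N where "N n = 1 / (b' - max b \<beta>) + real n" for n
  have bb: "0 < b' - max b \<beta>" using ord by simp
  have Npos: "0 < N n" for n using bb by (simp add: N_def add_pos_nonneg)
  have N1: "1 \<le> N n * (b' - c)" if "c \<le> max b \<beta>" for n c
  proof -
    have "1 = 1 / (b' - max b \<beta>) * (b' - max b \<beta>)"
      by (subst times_divide_eq_left, subst mult_1, subst divide_self) (use bb in linarith, rule refl)
    also have "\<dots> \<le> N n * (b' - c)" using that bb by (intro mult_mono) (auto simp: N_def)
    finally show ?thesis .
  qed
  \<comment> \<open>Two differences of ramps whose final heights are both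
    \<open>(\<beta> - \<alpha>) (b - a)\<close>, taken with opposite signs; hence
    \<open>\<phi> n\<close> returns to \<open>0\<close> beyond \<open>b'\<close>.\<close>
  define \<phi> where "\<phi> n s = (\<beta> - \<alpha>) / N n * (\<theta> (N n * s + (- N n * a)) + (-1) * \<theta> (N n * s + (- N n * b)))
     + (- (b - a) / N n) * (\<theta> (N n * s + (- N n * \<alpha>)) + (-1) * \<theta> (N n * s + (- N n * \<beta>)))" for n s
  define \<psi> where "\<psi> n s = (\<beta> - \<alpha>) * (\<sigma> (N n * (s - a)) - \<sigma> (N n * (s - b)))
     - (b - a) * (\<sigma> (N n * (s - \<alpha>)) - \<sigma> (N n * (s - \<beta>)))" for n s
  have d\<phi>: "(\<phi> n has_real_derivative \<psi> n s) (at s)" for n s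
  proof -
    have aff: "((\<lambda>s. \<theta> (N n * s + (- N n * c))) has_real_derivative \<sigma> (N n * (s - c)) * N n) (at s)" for c
    proof -
      have "((\<lambda>s. \<theta> (N n * s + (- N n * c))) has_real_derivative \<sigma> (N n * s + (- N n * c)) * N n) (at s)"
        by (rule DERIV_chain2[OF d\<theta>]) (auto intro!: derivative_eq_intros)
      then show ?thesis by (simp add: algebra_simps)
    qed
    have "(\<phi> n has_real_derivative (\<beta> - \<alpha>) / N n * (\<sigma> (N n * (s - a)) * N n + (-1) * (\<sigma> (N n * (s - b)) * N n))
      + (- (b - a) / N n) * (\<sigma> (N n * (s - \<alpha>)) * N n + (-1) * (\<sigma> (N n * (s - \<beta>)) * N n))) (at s)"
      unfolding \<phi>_def by (intro DERIV_add DERIV_cmult aff)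
    moreover have "(\<beta> - \<alpha>) / N n * (\<sigma> (N n * (s - a)) * N n + (-1) * (\<sigma> (N n * (s - b)) * N n))
      + (- (b - a) / N n) * (\<sigma> (N n * (s - \<alpha>)) * N n + (-1) * (\<sigma> (N n * (s - \<beta>)) * N n)) = \<psi> n s"
      using Npos[of n] unfolding \<psi>_def by (simp add: field_simps)
    ultimately show ?thesis by simp
  qed
  have supp: "\<phi> n s = 0" if "s \<notin> {a..b'}" for n s
  proof (cases "s < a")
    case True
    have "N n * s + - N n * c \<le> 0" if "a \<le> c" for c
    proof -
      have "N n * (s - c) \<le> 0" using Npos[of n] True that by (intro mult_nonneg_nonpos) auto
      then show ?thesis by (simp add: algebra_simps)
    qed
    then show ?thesis using ord by (simp add: \<phi>_def \<theta>neg)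
  next
    case False
    then have s: "b' < s" using that by simp
    have big: "\<theta> (N n * s + - N n * c) = N n * (s - c) + (\<theta> 1 - 1)" if "c \<le> max b \<beta>" for c
    proof -
      have "N n * (b' - c) \<le> N n * (s - c)" using Npos[of n] s by (intro mult_left_mono) auto
      then have "1 \<le> N n * (s - c)" using N1[OF that, of n] by simp
      then show ?thesis using \<theta>pos[of "N n * (s - c)"] by (simp add: algebra_simps)
    qed
    have c: "a \<le> max b \<beta>" "b \<le> max b \<beta>" "\<alpha> \<le> max b \<beta>" "\<beta> \<le> max b \<beta>" using ord by auto
    show ?thesis using Npos[of n] unfolding \<phi>_def big[OF c(1)] big[OF c(2)] big[OF c(3)] big[OF c(4)]
      by (simp add: field_simps)
  qed
  have test: "test_fun \<Omega> (\<phi> n)" for n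
  proof -
    have "infdiff (\<phi> n)" unfolding \<phi>_def by (intro infdiff.add infdiff.mult infdiff.const infdiff.affine[OF \<theta>])
    moreover have "{x. \<phi> n x \<noteq> 0} \<subseteq> {a..b'}" using supp by blast
    then have cl: "closure {x. \<phi> n x \<noteq> 0} \<subseteq> {a..b'}" by (simp add: closure_minimal)
    then have "compact (closure {x. \<phi> n x \<noteq> 0})" using bounded_subset[OF bounded_closed_interval cl] by (simp add: compact_eq_bounded_closed)
    ultimately show ?thesis using cl sub infdiff_smooth by (auto simp: test_fun_def)
  qed
  have deriv: "deriv (\<phi> n) s = \<psi> n s" for n s using d\<phi> by (rule DERIV_imp_deriv)
  have \<psi>0: "\<psi> n s = 0" if "s \<notin> {a..b'}" for n s
  proof -
    have "(\<phi> n has_real_derivative 0) (at s)"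
      using that supp by (intro has_field_derivative_transform_within_open[of "\<lambda>s. 0" 0 s "- {a..b'}" "\<phi> n"]) (auto simp: open_Compl)
    then show ?thesis using d\<phi> DERIV_unique by blast
  qed
  have zero: "(LINT \<tau>|lborel. \<psi> n \<tau> * (indicator {a..b'} \<tau> * z \<tau>)) = 0" for n
  proof -
    have "(LINT \<tau>|lborel. \<psi> n \<tau> * (indicator {a..b'} \<tau> * z \<tau>)) = (LINT \<tau>:\<Omega>|lborel. deriv (\<phi> n) \<tau> * z \<tau>)"
      unfolding set_lebesgue_integral_def
      by (rule Bochner_Integration.integral_cong) (use \<psi>0 sub in \<open>auto simp: deriv indicator_def\<close>)
    then show ?thesis using weak[OF test] by simp
  qed
  \<comment> \<open>The pointwise limit of \<open>\<psi> n\<close>: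
    \<open>\<beta> - \<alpha>\<close> on \<open>(a, b]\<close> minus \<open>b - a\<close> on
    \<open>(\<alpha>, \<beta>]\<close>.\<close>
  define lm where "lm s = (\<beta> - \<alpha>) * (indicator {a<..} s - indicator {b<..} s) - (b - a) * (indicator {\<alpha><..} s - indicator {\<beta><..} s)" for s :: real
  have lim\<sigma>: "(\<lambda>n. \<sigma> (N n * (s - c))) \<longlonglongrightarrow> indicator {c<..} s" for s c
  proof (cases "c < s")
    case True
    have "\<forall>\<^sub>F n in sequentially. \<sigma> (N n * (s - c)) = 1"
    proof -
      obtain k :: nat where k: "1 / (s - c) < k" using reals_Archimedean2 by blast
      have "1 \<le> N n * (s - c)" if "n \<ge> k" for n
      proof -
        have "1 / (s - c) \<le> N n" using k that bb by (auto simp: N_def add_increasing)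
        then show ?thesis using True by (simp add: field_simps)
      qed
      then show ?thesis using \<sigma>(3) by (auto simp: eventually_sequentially)
    qed
    then show ?thesis using True by (simp add: tendsto_eventually)
  next
    case False
    have "N n * (s - c) \<le> 0" for n using Npos[of n] False by (intro mult_nonneg_nonpos) auto
    then show ?thesis using False \<sigma>(2) by simp
  qed
  have lim: "(\<lambda>n. \<psi> n s) \<longlonglongrightarrow> lm s" for s
    unfolding \<psi>_def lm_def by (intro tendsto_intros lim\<sigma>)
  have bnd: "\<bar>\<psi> n s\<bar> \<le> (\<beta> - \<alpha>) + (b - a)" for n s
  proof -
    have "\<bar>\<sigma> x - \<sigma> y\<bar> \<le> 1" for x y using \<sigma>(4)[of x] \<sigma>(5)[of x] \<sigma>(4)[of y] \<sigma>(5)[of y] by linarith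
    then have "\<bar>(\<beta> - \<alpha>) * (\<sigma> (N n * (s - a)) - \<sigma> (N n * (s - b)))\<bar> \<le> (\<beta> - \<alpha>) * 1"
      "\<bar>(b - a) * (\<sigma> (N n * (s - \<alpha>)) - \<sigma> (N n * (s - \<beta>)))\<bar> \<le> (b - a) * 1"
      unfolding abs_mult using ord by (auto intro!: mult_mono simp del: mult_1_right)
    then show ?thesis unfolding \<psi>_def
      by (intro order_trans[OF abs_triangle_ineq4] add_mono) (simp_all only: mult_1_right)
  qed
  have zi: "integrable lborel (\<lambda>\<tau>. indicator {a..b'} \<tau> * z \<tau>)" using int by (simp add: set_integrable_def)
  have m\<psi>: "\<psi> n \<in> borel_measurable borel" for n
  proof -
    have [measurable]: "\<sigma> \<in> borel_measurable borel" by (rule borel_measurable_continuous_onI[OF infdiff_continuous[OF \<sigma>(1)]])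
    show ?thesis unfolding \<psi>_def by measurable
  qed
  have "(\<lambda>n. LINT \<tau>|lborel. \<psi> n \<tau> * (indicator {a..b'} \<tau> * z \<tau>)) \<longlonglongrightarrow> (LINT \<tau>|lborel. lm \<tau> * (indicator {a..b'} \<tau> * z \<tau>))"
  proof (rule integral_dominated_convergence)
    show "integrable lborel (\<lambda>\<tau>. ((\<beta> - \<alpha>) + (b - a)) * \<bar>indicator {a..b'} \<tau> * z \<tau>\<bar>)" using zi by simp
    show "(\<lambda>\<tau>. lm \<tau> * (indicator {a..b'} \<tau> * z \<tau>)) \<in> borel_measurable lborel"
      unfolding lm_def using zi by measurable
    show "(\<lambda>\<tau>. \<psi> n \<tau> * (indicator {a..b'} \<tau> * z \<tau>)) \<in> borel_measurable lborel" for n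
      using m\<psi>[of n] zi by measurable
    show "AE \<tau> in lborel. (\<lambda>n. \<psi> n \<tau> * (indicator {a..b'} \<tau> * z \<tau>)) \<longlonglongrightarrow> lm \<tau> * (indicator {a..b'} \<tau> * z \<tau>)"
      by (intro AE_I2 tendsto_intros lim)
    show "AE \<tau> in lborel. norm (\<psi> n \<tau> * (indicator {a..b'} \<tau> * z \<tau>)) \<le> ((\<beta> - \<alpha>) + (b - a)) * \<bar>indicator {a..b'} \<tau> * z \<tau>\<bar>" for n
      using bnd[of n] unfolding real_norm_def abs_mult[of "\<psi> n _"] by (intro AE_I2 mult_right_mono) auto
  qed
  then have Z: "(LINT \<tau>|lborel. lm \<tau> * (indicator {a..b'} \<tau> * z \<tau>)) = 0"
    unfolding zero using LIMSEQ_unique tendsto_const by metis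
  have ii: "set_integrable lborel {a..b} z" "set_integrable lborel {\<alpha>..\<beta>} z"
    by (rule set_integrable_subset_complete[OF int]; use ord in auto)+
  have "(LINT \<tau>|lborel. lm \<tau> * (indicator {a..b'} \<tau> * z \<tau>))
     = (LINT \<tau>|lborel. (\<beta> - \<alpha>) * (indicator {a..b} \<tau> *\<^sub>R z \<tau>) - (b - a) * (indicator {\<alpha>..\<beta>} \<tau> *\<^sub>R z \<tau>))"
  proof (rule integral_cong_AE)
    show "(\<lambda>\<tau>. lm \<tau> * (indicator {a..b'} \<tau> * z \<tau>)) \<in> borel_measurable lborel"
      unfolding lm_def using zi by measurable
    show "(\<lambda>\<tau>. (\<beta> - \<alpha>) * (indicator {a..b} \<tau> *\<^sub>R z \<tau>) - (b - a) * (indicator {\<alpha>..\<beta>} \<tau> *\<^sub>R z \<tau>)) \<in> borel_measurable lborel"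
      using ii unfolding set_integrable_def by measurable
    show "AE \<tau> in lborel. lm \<tau> * (indicator {a..b'} \<tau> * z \<tau>) = (\<beta> - \<alpha>) * (indicator {a..b} \<tau> *\<^sub>R z \<tau>) - (b - a) * (indicator {\<alpha>..\<beta>} \<tau> *\<^sub>R z \<tau>)"
      using AE_lborel_singleton[of a] AE_lborel_singleton[of \<alpha>]
      by eventually_elim (use ord in \<open>auto simp: lm_def indicator_def algebra_simps\<close>)
  qed
  also have "\<dots> = (\<beta> - \<alpha>) * (LINT \<tau>:{a..b}|lborel. z \<tau>) - (b - a) * (LINT \<tau>:{\<alpha>..\<beta>}|lborel. z \<tau>)"
    using ii by (simp add: set_lebesgue_integral_def set_integrable_def)
  finally show ?thesis using Z by simp
qed

text \<open>Lebesgue differentiation: almost everywhere \<open>f\<close> is the limit of its means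
  over shrinking intervals, which are eventually contained in \<open>U\<close>.\<close>

lemma AE_zero_if_interval_integrals_zero:
  fixes f :: "real \<Rightarrow> real"
  assumes f: "\<And>a b. set_integrable lborel {a..b} f" and U: "open U"
    and z: "\<And>a b. a < b \<Longrightarrow> {a..b} \<subseteq> U \<Longrightarrow> (LINT t:{a..b}|lborel. f t) = 0"
  shows "AE t in lborel. t \<in> U \<longrightarrow> f t = 0"
proof -
  have "f integrable_on cbox a b" for a b using set_borel_integral_eq_integral(1)[OF f[of a b]] by simp
  from integrable_ccontinuous_explicit[OF this] obtain N where N: "negligible N" and
    *: "\<And>x e. x \<notin> N \<Longrightarrow> 0 < e \<Longrightarrow> \<exists>d>0. \<forall>h. 0 < h \<and> h < d \<longrightarrow> norm (integral (cbox x (x + h *\<^sub>R One)) f /\<^sub>R h ^ DIM(real) - f x) < e"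
    by metis
  have "f x = 0" if x: "x \<in> U" "x \<notin> N" for x
  proof (rule ccontr)
    assume "f x \<noteq> 0"
    then obtain d where d: "0 < d" "\<And>h. 0 < h \<Longrightarrow> h < d \<Longrightarrow> norm (integral {x..x + h} f /\<^sub>R h - f x) < \<bar>f x\<bar>"
      using *[OF x(2), of "\<bar>f x\<bar>"] by auto
    obtain r where r: "0 < r" "ball x r \<subseteq> U" using U x(1) open_contains_ball by blast
    define h where "h = min d r / 2"
    have h: "0 < h" "h < d" "h < r" using d r by (auto simp: h_def)
    have "{x..x + h} \<subseteq> U" using h r(2) by (auto simp: subset_iff dist_real_def)
    then have "integral {x..x + h} f = 0"
      using z[of x "x + h"] h set_borel_integral_eq_integral(2)[OF f[of x "x + h"]] by simp
    then show False using d(2)[OF h(1,2)] by simp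
  qed
  moreover have "AE x in lebesgue. x \<notin> N" using N AE_not_in by (auto simp: negligible_iff_null_sets)
  ultimately have "AE x in lebesgue. x \<in> U \<longrightarrow> f x = 0" by (auto elim: eventually_mono)
  then show ?thesis by (simp add: AE_completion_iff)
qed

subsection \<open>The weighted space and primitives vanishing at the end\<close>

text \<open>The oscillation of \<open>P\<close> is dominated by that of \<open>h\<close>, the real
  primitive of \<open>norm (f s)\<close>, so the vector-valued case reduces to continuity of a
  scalar indefinite integral.\<close>

lemma has_density_continuous:
  fixes P :: "real \<Rightarrow> 'b::{real_normed_vector, complete_space, second_countable_topology}"
  assumes P: "has_density a b P f" shows "continuous_on {a..b} P"
proof -
  have fi: "set_integrable lborel {a..b} f" by (rule has_densityD(1)[OF P])
  have gi: "set_integrable lborel {a..b} (\<lambda>s. norm (f s))"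
    using integrable_norm_complete[OF fi[unfolded set_integrable_def]] by (simp add: set_integrable_def)
  define h where "h t = integral {a..t} (\<lambda>s. norm (f s))" for t
  have h: "continuous_on {a..b} h"
    unfolding h_def by (rule indefinite_integral_continuous_1[OF set_borel_integral_eq_integral(1)[OF gi]])
  have sub: "set_integrable lborel {a..t} f" "set_integrable lborel {a..t} (\<lambda>s. norm (f s))" if "t \<in> {a..b}" for t
    by (rule set_integrable_subset_complete[OF fi]; use that in auto)
      (rule set_integrable_subset_complete[OF gi]; use that in auto)
  have hL: "h t = (LINT s|lborel. indicator {a..t} s * norm (f s))" if "t \<in> {a..b}" for t
    using set_borel_integral_eq_integral(2)[OF sub(2)[OF that]] by (simp add: h_def set_lebesgue_integral_def)
  have le: "norm (P t - P s) \<le> \<bar>h t - h s\<bar>" if st: "s \<in> {a..b}" "t \<in> {a..b}" "s \<le> t" for s t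
  proof -
    have i: "integrable lborel (\<lambda>r. indicator {a..t} r *\<^sub>R f r - indicator {a..s} r *\<^sub>R f r)"
      using sub(1)[OF st(1)] sub(1)[OF st(2)] by (simp add: set_integrable_def)
    have "P t - P s = (LINT r|lborel. indicator {a..t} r *\<^sub>R f r - indicator {a..s} r *\<^sub>R f r)"
      using has_densityD(2)[OF P, of t] has_densityD(2)[OF P, of s] sub(1)[OF st(1)] sub(1)[OF st(2)] st
      by (simp add: set_lebesgue_integral_def set_integrable_def)
    then have "norm (P t - P s) \<le> (LINT r|lborel. norm (indicator {a..t} r *\<^sub>R f r - indicator {a..s} r *\<^sub>R f r))"
      using norm_integral_le[OF i] by simp
    also have "(\<lambda>r. norm (indicator {a..t} r *\<^sub>R f r - indicator {a..s} r *\<^sub>R f r)) =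
        (\<lambda>r. indicator {a..t} r * norm (f r) - indicator {a..s} r * norm (f r))"
      using st(3) by (auto simp: fun_eq_iff indicator_def)
    also have "(LINT r|lborel. indicator {a..t} r * norm (f r) - indicator {a..s} r * norm (f r)) = h t - h s"
      using sub(2)[OF st(1)] sub(2)[OF st(2)] hL[OF st(1)] hL[OF st(2)] by (simp add: set_integrable_def)
    finally show ?thesis by linarith
  qed
  have le2: "dist (P t) (P s) \<le> dist (h t) (h s)" if "s \<in> {a..b}" "t \<in> {a..b}" for s t
    using le[of s t] le[of t s] that by (cases "s \<le> t") (auto simp: dist_norm norm_minus_commute abs_minus_commute)
  show ?thesis
    unfolding continuous_on_iff
  proof (intro ballI allI impI)
    fix x e :: real assume x: "x \<in> {a..b}" "0 < e"
    then obtain d where d: "0 < d" "\<And>x'. x' \<in> {a..b} \<Longrightarrow> dist x' x < d \<Longrightarrow> dist (h x') (h x) < e"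
      using h unfolding continuous_on_iff by blast
    have "dist (P x') (P x) < e" if "x' \<in> {a..b}" "dist x' x < d" for x'
      using le2[OF x(1) that(1)] d(2)[OF that] by linarith
    then show "\<exists>d>0. \<forall>x'\<in>{a..b}. dist x' x < d \<longrightarrow> dist (P x') (P x) < e" using d(1) by blast
  qed
qed

lemma absolutely_continuous_fun_on_imp_continuous:
  assumes ac: "absolutely_continuous_fun_on S f" shows "continuous_on S f"
  unfolding continuous_on_iff
proof (intro ballI allI impI)
  fix x e :: real assume x: "x \<in> S" "0 < e"
  have "\<exists>d>0. \<forall>n::nat. \<forall>a b. (\<forall>i<n. a i \<in> S \<and> b i \<in> S \<and> a i \<le> b i)
        \<and> (\<forall>i<n. \<forall>j<n. i \<noteq> j \<longrightarrow> b i \<le> a j \<or> b j \<le> a i)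
        \<and> (\<Sum>i<n. b i - a i) < d \<longrightarrow> (\<Sum>i<n. \<bar>f (b i) - f (a i)\<bar>) < e"
    by (rule ac[unfolded absolutely_continuous_fun_on_def, THEN spec, THEN mp]) fact
  then obtain d where d: "0 < d" and *: "\<forall>n::nat. \<forall>a b. (\<forall>i<n. a i \<in> S \<and> b i \<in> S \<and> a i \<le> b i)
        \<and> (\<forall>i<n. \<forall>j<n. i \<noteq> j \<longrightarrow> b i \<le> a j \<or> b j \<le> a i)
        \<and> (\<Sum>i<n. b i - a i) < d \<longrightarrow> (\<Sum>i<n. \<bar>f (b i) - f (a i)\<bar>) < e"
    by (elim exE conjE) (rule that)
  have "\<bar>f t - f s\<bar> < e" if "s \<in> S" "t \<in> S" "s \<le> t" "t - s < d" for s t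
    using *[THEN spec, of 1, THEN spec, of "\<lambda>i. s", THEN spec, of "\<lambda>i. t"] that by simp
  note * = this
  have "dist (f x') (f x) < e" if "x' \<in> S" "dist x' x < d" for x'
    using x(1) that *[of x x'] *[of x' x] by (cases "x \<le> x'") (auto simp: dist_real_def abs_minus_commute)
  then show "\<exists>d>0. \<forall>x'\<in>S. dist x' x < d \<longrightarrow> dist (f x') (f x) < e" using d by blast
qed

lemma AE_not_in_open_imp_empty:
  fixes U :: "real set"
  assumes U: "open U" and AE: "AE t in lborel. t \<notin> U" shows "U = {}"
proof -
  have "U \<in> null_sets lborel" using AE_iff_null_sets[of U lborel] AE U by simp
  then have "negligible U" by (simp add: negligible_iff_null_sets null_sets_completionI)
  then show ?thesis using U open_not_negligible by blast
qed

section \<open>The kernel and the interval \<open>\<Omega>\<close>\<close>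

locale kernel =
  fixes l :: ereal and \<mu> d\<nu> :: "real \<Rightarrow> real"
  assumes l_pos: "0 < l"
    and mu_pos: "\<forall>s\<in>Omega l. 0 < \<mu> s"
    and mu_noninc: "\<forall>s\<in>Omega l. \<forall>t\<in>Omega l. s \<le> t \<longrightarrow> \<mu> t \<le> \<mu> s"
    and mu_summable: "set_integrable lborel (Omega l) \<mu>"
    and mu_ac: "\<forall>a b. {a..b} \<subseteq> Omega l \<longrightarrow> absolutely_continuous_fun_on {a..b} \<mu>"
    and dnu: "AE \<tau> in lborel. \<tau> \<in> Omega l \<longrightarrow> ((\<lambda>s. 1 / \<mu> s) has_real_derivative d\<nu> \<tau>) (at \<tau>)"
begin

abbreviation \<Omega> :: "real set" where "\<Omega> \<equiv> Omega l"

definition nu :: "real \<Rightarrow> real" where "nu \<tau> = 1 / \<mu> \<tau>"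

lemma Om_iff: "\<tau> \<in> \<Omega> \<longleftrightarrow> 0 < \<tau> \<and> ereal \<tau> < l" by (simp add: Omega_def)

lemma Om_cases: "(l = \<infinity> \<and> \<Omega> = {0<..}) \<or> (\<exists>r>0. l = ereal r \<and> \<Omega> = {0<..<r})"
  using l_pos by (cases l) (auto simp: Omega_def)

lemma Om_open: "open \<Omega>"
  using Om_cases by (metis open_greaterThan open_greaterThanLessThan)

lemma Om_sets [measurable, simp]: "\<Omega> \<in> sets borel" using Om_open by simp

lemma Om_mono: "b \<in> \<Omega> \<Longrightarrow> 0 < a \<Longrightarrow> a \<le> b \<Longrightarrow> a \<in> \<Omega>"
  using le_less_trans[of "ereal a" "ereal b" l] by (simp add: Om_iff)

lemma Om_interval: "a \<in> \<Omega> \<Longrightarrow> b \<in> \<Omega> \<Longrightarrow> {a..b} \<subseteq> \<Omega>"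
proof
  fix t assume ab: "a \<in> \<Omega>" "b \<in> \<Omega>" and t: "t \<in> {a..b}"
  have "0 < t" using ab(1) t by (simp add: Om_iff)
  then show "t \<in> \<Omega>" using Om_mono[OF ab(2)] t by simp
qed

lemma Om_greater: assumes "\<tau> \<in> \<Omega>" obtains b where "b \<in> \<Omega>" "\<tau> < b"
proof -
  obtain b where "ereal \<tau> < ereal b" "ereal b < l" using ereal_dense2[of "ereal \<tau>" l] assms by (auto simp: Om_iff)
  then show ?thesis using that[of b] assms by (simp add: Om_iff)
qed

text \<open>\<open>{exa n..exb n}\<close> is going to exhaust \<open>\<Omega>\<close> by compact
  intervals. For \<open>l = \<infinity>\<close> the length scale is set to \<open>1\<close>. The
  \<open>+ 2\<close> keeps \<open>exa n\<close> at or below \<open>exr / 2\<close> and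
  \<open>exb n\<close> at or above it, so the intervals are never empty.\<close>

definition exr :: real where "exr = (if l = \<infinity> then 1 else real_of_ereal l)"
definition exa :: "nat \<Rightarrow> real" where "exa n = exr / (real n + 2)"
definition exb :: "nat \<Rightarrow> real" where "exb n = (if l = \<infinity> then exr / 2 + real n else exr - exa n)"

lemma exhaust: "exa n \<in> \<Omega>" "exb n \<in> \<Omega>" "exa n \<le> exb n"
    "\<tau> \<in> \<Omega> \<Longrightarrow> \<forall>\<^sub>F n in sequentially. exa n < \<tau> \<and> \<tau> < exb n" "(\<Union>n. {exa n..exb n}) = \<Omega>" "incseq (\<lambda>n. {exa n..exb n})"
proof -
  have Or: "(l \<noteq> \<infinity> \<longrightarrow> \<Omega> = {0<..<exr}) \<and> (l = \<infinity> \<longrightarrow> \<Omega> = {0<..}) \<and> 0 < exr"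
    using Om_cases
  proof (elim disjE exE conjE)
    assume "l = \<infinity>" "\<Omega> = {0<..}" then show ?thesis unfolding exr_def by simp
  next
    fix r assume "0 < r" "l = ereal r" "\<Omega> = {0<..<r}"
    moreover from this have "exr = r" unfolding exr_def by simp
    ultimately show ?thesis by simp
  qed
  then have r: "0 < exr" by blast
  have Or: "l \<noteq> \<infinity> \<Longrightarrow> \<Omega> = {0<..<exr}" "l = \<infinity> \<Longrightarrow> \<Omega> = {0<..}" using Or by blast+
  have r2: "exr / 2 \<in> \<Omega>"
  proof (cases "l = \<infinity>")
    case True
    show ?thesis unfolding Or(2)[OF True] using r by simp
  next
    case False
    show ?thesis unfolding Or(1)[OF False] using r by simp
  qed
  have a: "0 < exa n" "exa n \<le> exr / 2" for n using r by (auto simp: exa_def field_simps)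
  have b: "exb n \<in> \<Omega>" "exr / 2 \<le> exb n" for n
  proof (atomize (full), cases "l = \<infinity>")
    case True
    have "exb n = exr / 2 + real n" unfolding exb_def using True by simp
    then show "exb n \<in> \<Omega> \<and> exr / 2 \<le> exb n" unfolding Or(2)[OF True] using r by simp
  next
    case False
    have "exb n = exr - exa n" unfolding exb_def using False by simp
    then show "exb n \<in> \<Omega> \<and> exr / 2 \<le> exb n" unfolding Or(1)[OF False] using a[of n] by simp
  qed
  have aO: "exa n \<in> \<Omega>" for n using Om_mono[OF r2 a] .
  have ab: "exa n \<le> exb n" for n using a(2)[of n] b(2)[of n] by simp
  have deca: "decseq exa" unfolding decseq_def exa_def using r by (auto intro!: divide_left_mono mult_pos_pos)
  have incb: "incseq exb" using deca by (auto simp: incseq_def decseq_def exb_def)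
  have a0: "exa \<longlonglongrightarrow> 0"
  proof -
    have "filterlim (\<lambda>n. real n + 2) at_top sequentially"
      by (intro filterlim_tendsto_add_at_top[OF _ filterlim_real_sequentially, of "\<lambda>n. 2" 2, unfolded add.commute[of 2]]) auto
    then show ?thesis unfolding exa_def by (intro tendsto_divide_0[OF tendsto_const]) (auto intro: filterlim_at_top_imp_at_infinity)
  qed
  have ev: "\<forall>\<^sub>F n in sequentially. exa n < \<tau> \<and> \<tau> < exb n" if \<tau>: "\<tau> \<in> \<Omega>" for \<tau>
  proof (rule eventually_conj)
    show "\<forall>\<^sub>F n in sequentially. exa n < \<tau>" by (rule order_tendstoD(2)[OF a0]) (use \<tau> in \<open>simp add: Om_iff\<close>)
    show "\<forall>\<^sub>F n in sequentially. \<tau> < exb n"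
    proof (cases "l = \<infinity>")
      case True
      have "\<forall>\<^sub>F n in sequentially. \<tau> < real n" using filterlim_real_sequentially by (simp add: filterlim_at_top_dense)
      then show ?thesis unfolding exb_def if_P[OF True] by (rule eventually_mono) (use r in simp)
    next
      case False
      then have "0 < exr - \<tau>" using \<tau> Or(1) by simp
      then have "\<forall>\<^sub>F n in sequentially. exa n < exr - \<tau>" by (rule order_tendstoD(2)[OF a0])
      then show ?thesis unfolding exb_def if_not_P[OF False] by (rule eventually_mono) simp
    qed
  qed
  have un: "(\<Union>n. {exa n..exb n}) = \<Omega>"
  proof
    show "(\<Union>n. {exa n..exb n}) \<subseteq> \<Omega>" using Om_interval[OF aO b(1)] by blast
    show "\<Omega> \<subseteq> (\<Union>n. {exa n..exb n})"
    proof
      fix \<tau> assume "\<tau> \<in> \<Omega>"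
      then obtain n where "exa n < \<tau> \<and> \<tau> < exb n" using eventually_happens'[OF sequentially_bot ev] by blast
      then show "\<tau> \<in> (\<Union>n. {exa n..exb n})" by (auto intro!: exI[of _ n])
    qed
  qed
  have inc: "incseq (\<lambda>n. {exa n..exb n})"
    using deca incb by (fastforce simp: incseq_def decseq_def)
  show "exa n \<in> \<Omega>" "exb n \<in> \<Omega>" "exa n \<le> exb n" by (rule aO b(1) ab)+
  show "\<tau> \<in> \<Omega> \<Longrightarrow> \<forall>\<^sub>F n in sequentially. exa n < \<tau> \<and> \<tau> < exb n" by (rule ev)
  show "(\<Union>n. {exa n..exb n}) = \<Omega>" "incseq (\<lambda>n. {exa n..exb n})" by (rule un inc)+
qed

lemma eventually_at_end: assumes "b \<in> \<Omega>" shows "\<forall>\<^sub>F t in at_end l. t \<in> \<Omega> \<and> b < t"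
proof (cases "l = \<infinity>")
  case True
  show ?thesis
    unfolding at_end_def if_P[OF True]
  proof (rule eventually_mono[OF eventually_gt_at_top[of b]])
    show "t \<in> \<Omega> \<and> b < t" if "b < t" for t using that assms True by (auto simp: Omega_def)
  qed
next
  case False
  then obtain r where r: "l = ereal r" "0 < r" using Om_cases by auto
  have "\<forall>\<^sub>F t in at_left r. b < t \<and> t < r"
    using assms r by (auto simp: eventually_at_left_field Omega_def intro!: exI[of _ b])
  then show ?thesis using r assms by (auto simp: at_end_def Omega_def elim!: eventually_mono)
qed

lemma nu_pos: "\<tau> \<in> \<Omega> \<Longrightarrow> 0 < nu \<tau>" using mu_pos by (simp add: nu_def)

lemma nu_mono: "s \<in> \<Omega> \<Longrightarrow> t \<in> \<Omega> \<Longrightarrow> s \<le> t \<Longrightarrow> nu s \<le> nu t"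
  using mu_noninc mu_pos unfolding nu_def by (intro divide_left_mono) auto

lemma mu_nu: "\<tau> \<in> \<Omega> \<Longrightarrow> \<mu> \<tau> * nu \<tau> = 1"
  using mu_pos unfolding nu_def by fastforce

lemma mu_continuous: "continuous_on \<Omega> \<mu>"
proof (rule continuous_at_imp_continuous_on, rule ballI)
  fix \<tau> assume \<tau>: "\<tau> \<in> \<Omega>"
  obtain b where b: "b \<in> \<Omega>" "\<tau> < b" using Om_greater[OF \<tau>] .
  have a: "\<tau> / 2 \<in> \<Omega>" using Om_mono[OF \<tau>, of "\<tau> / 2"] \<tau> by (simp add: Om_iff)
  have "continuous_on {\<tau> / 2..b} \<mu>"
    using mu_ac Om_interval[OF a b(1)] by (intro absolutely_continuous_fun_on_imp_continuous) simp
  then have "continuous_on {\<tau> / 2<..<b} \<mu>" by (rule continuous_on_subset) auto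
  moreover have "\<tau> \<in> {\<tau> / 2<..<b}" using \<tau> b by (simp add: Om_iff)
  ultimately show "isCont \<mu> \<tau>" using continuous_on_eq_continuous_at[of "{\<tau> / 2<..<b}" \<mu>] by simp
qed

lemma nu_continuous: "continuous_on \<Omega> nu"
  unfolding nu_def using mu_pos by (intro continuous_intros mu_continuous) fastforce

lemma Om_measurable:
  fixes g :: "real \<Rightarrow> 'b::real_normed_vector"
  assumes "continuous_on \<Omega> g" shows "(\<lambda>\<tau>. indicator \<Omega> \<tau> *\<^sub>R g \<tau>) \<in> borel_measurable lborel"
  using borel_measurable_continuous_on_indicator[OF Om_sets assms] by simp

lemma bad_set: "\<exists>N. N \<in> null_sets lborel \<and> (\<forall>\<tau>. \<tau> \<in> \<Omega> - N \<longrightarrow> (nu has_real_derivative d\<nu> \<tau>) (at \<tau>))"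
proof -
  obtain N where "N \<in> null_sets lborel" "{\<tau> \<in> space lborel. \<not> (\<tau> \<in> \<Omega> \<longrightarrow> ((\<lambda>s. 1 / \<mu> s) has_real_derivative d\<nu> \<tau>) (at \<tau>))} \<subseteq> N"
    using dnu unfolding eventually_ae_filter by blast
  then show ?thesis unfolding nu_def by (intro exI[of _ N]) auto
qed

definition N0 :: "real set" where
  "N0 = (SOME N. N \<in> null_sets lborel \<and> (\<forall>\<tau>. \<tau> \<in> \<Omega> - N \<longrightarrow> (nu has_real_derivative d\<nu> \<tau>) (at \<tau>)))"

lemma N0: "N0 \<in> null_sets lborel" "\<tau> \<in> \<Omega> - N0 \<Longrightarrow> (nu has_real_derivative d\<nu> \<tau>) (at \<tau>)"
  using someI_ex[OF bad_set] unfolding N0_def by blast+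

lemma N0_sets [measurable]: "N0 \<in> sets borel" using N0(1) by (simp add: null_sets_def)

lemma AE_N0: "AE \<tau> in lborel. \<tau> \<notin> N0" by (rule AE_not_in[OF N0(1)])

text \<open>Nothing is known about \<open>d\<nu>\<close> on the exceptional set \<open>N0\<close>, not even Borel measurability.\<close>

definition dn :: "real \<Rightarrow> real" where "dn \<tau> = indicator (- N0) \<tau> * d\<nu> \<tau>"

text \<open>On \<open>{a..b}\<close> the kernel is bounded below by \<open>\<mu> b\<close>, and on
  values above that bound the reciprocal is Lipschitz with constant
  \<open>1 / (\<mu> b)^2\<close>.\<close>

lemma nu_ac: assumes "a \<in> \<Omega>" "b \<in> \<Omega>" shows "absolutely_continuous_fun_on {a..b} nu"
  unfolding absolutely_continuous_fun_on_def
proof (intro allI impI)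
  have sub: "{a..b} \<subseteq> \<Omega>" by (rule Om_interval[OF assms])
  have mb: "0 < \<mu> b" using mu_pos assms by simp
  have lip: "\<bar>nu t - nu s\<bar> \<le> \<bar>\<mu> t - \<mu> s\<bar> * (1 / (\<mu> b)\<^sup>2)" if "s \<in> {a..b}" "t \<in> {a..b}" for s t
  proof -
    have st: "s \<in> \<Omega>" "t \<in> \<Omega>" using that sub by auto
    then have m: "\<mu> b \<le> \<mu> s" "\<mu> b \<le> \<mu> t" using mu_noninc assms that by auto
    have "nu t - nu s = (\<mu> s - \<mu> t) / (\<mu> s * \<mu> t)" using m mb by (simp add: nu_def field_simps)
    then have "\<bar>nu t - nu s\<bar> = \<bar>\<mu> t - \<mu> s\<bar> / (\<mu> s * \<mu> t)" using m mb by (simp add: abs_minus_commute)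
    also have "\<dots> \<le> \<bar>\<mu> t - \<mu> s\<bar> / (\<mu> b)\<^sup>2"
      unfolding power2_eq_square using m mb by (intro divide_left_mono mult_mono) auto
    finally show ?thesis by simp
  qed
  fix e :: real assume e: "0 < e"
  define e' where "e' = e * (\<mu> b)\<^sup>2"
  have e': "0 < e'" using e mb by (simp add: e'_def)
  have "\<exists>d>0. \<forall>n::nat. \<forall>u v. (\<forall>i<n. u i \<in> {a..b} \<and> v i \<in> {a..b} \<and> u i \<le> v i)
        \<and> (\<forall>i<n. \<forall>j<n. i \<noteq> j \<longrightarrow> v i \<le> u j \<or> v j \<le> u i)
        \<and> (\<Sum>i<n. v i - u i) < d \<longrightarrow> (\<Sum>i<n. \<bar>\<mu> (v i) - \<mu> (u i)\<bar>) < e'"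
    by (rule mu_ac[THEN spec, THEN spec, THEN mp, OF sub, unfolded absolutely_continuous_fun_on_def, THEN spec, THEN mp]) fact
  then obtain d where d: "0 < d" and *: "\<forall>n::nat. \<forall>u v. (\<forall>i<n. u i \<in> {a..b} \<and> v i \<in> {a..b} \<and> u i \<le> v i)
        \<and> (\<forall>i<n. \<forall>j<n. i \<noteq> j \<longrightarrow> v i \<le> u j \<or> v j \<le> u i)
        \<and> (\<Sum>i<n. v i - u i) < d \<longrightarrow> (\<Sum>i<n. \<bar>\<mu> (v i) - \<mu> (u i)\<bar>) < e'"
    by (elim exE conjE) (rule that)
  show "\<exists>d>0. \<forall>n::nat. \<forall>u v. (\<forall>i<n. u i \<in> {a..b} \<and> v i \<in> {a..b} \<and> u i \<le> v i)
        \<and> (\<forall>i<n. \<forall>j<n. i \<noteq> j \<longrightarrow> v i \<le> u j \<or> v j \<le> u i)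
        \<and> (\<Sum>i<n. v i - u i) < d \<longrightarrow> (\<Sum>i<n. \<bar>nu (v i) - nu (u i)\<bar>) < e"
  proof (intro exI[of _ d] conjI d allI impI)
    fix n :: nat and u v
    assume uv: "(\<forall>i<n. u i \<in> {a..b} \<and> v i \<in> {a..b} \<and> u i \<le> v i)
        \<and> (\<forall>i<n. \<forall>j<n. i \<noteq> j \<longrightarrow> v i \<le> u j \<or> v j \<le> u i) \<and> (\<Sum>i<n. v i - u i) < d"
    have "(\<Sum>i<n. \<bar>nu (v i) - nu (u i)\<bar>) \<le> (\<Sum>i<n. \<bar>\<mu> (v i) - \<mu> (u i)\<bar> * (1 / (\<mu> b)\<^sup>2))"
      using uv by (intro sum_mono lip) auto
    also have "\<dots> = (\<Sum>i<n. \<bar>\<mu> (v i) - \<mu> (u i)\<bar>) * (1 / (\<mu> b)\<^sup>2)" by (simp only: sum_distrib_right)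
    also have "\<dots> < e' * (1 / (\<mu> b)\<^sup>2)"
      using *[THEN spec, THEN spec, THEN spec, THEN mp, OF uv] mb by (intro mult_strict_right_mono) auto
    also have "\<dots> = e" using mb by (simp add: e'_def)
    finally show "(\<Sum>i<n. \<bar>nu (v i) - nu (u i)\<bar>) < e" .
  qed
qed

lemma nu_density: assumes "a \<in> \<Omega>" "b \<in> \<Omega>" shows "has_density a b nu dn"
proof (cases "a \<le> b")
  case True
  have sub: "{a..b} \<subseteq> \<Omega>" by (rule Om_interval[OF assms])
  have "has_density a b nu (\<lambda>t. indicator (- N0) t * d\<nu> t)"
  proof (rule absolutely_continuous_has_density[OF True nu_ac[OF assms] _ _ N0(1)])
    show "mono_on {a..b} nu" using sub by (intro mono_onI nu_mono) auto
    show "continuous_on {a..b} nu" by (rule continuous_on_subset[OF nu_continuous sub])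
    show "(nu has_real_derivative d\<nu> t) (at t)" if "t \<in> {a..b} - N0" for t using N0(2) that sub by blast
  qed
  then show ?thesis unfolding dn_def[abs_def] .
qed (simp add: has_density_def set_integrable_def)

lemma dn_nonneg: assumes "\<tau> \<in> \<Omega>" shows "0 \<le> dn \<tau>"
proof (cases "\<tau> \<in> N0")
  case False
  obtain b where b: "b \<in> \<Omega>" "\<tau> < b" using Om_greater[OF assms] .
  have a: "\<tau> / 2 \<in> \<Omega>" using Om_mono[OF assms, of "\<tau> / 2"] assms by (simp add: Om_iff)
  have sub: "{\<tau> / 2..b} \<subseteq> \<Omega>" by (rule Om_interval[OF a b(1)])
  have "0 \<le> d\<nu> \<tau>"
  proof (rule absolutely_continuous_has_density(2)[OF _ nu_ac[OF a b(1)] _ _ N0(1), where g = d\<nu> and t = \<tau>])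
    show "\<tau> / 2 \<le> b" "\<tau> \<in> {\<tau> / 2<..<b} - N0" using b assms False by (auto simp: Om_iff)
    show "mono_on {\<tau> / 2..b} nu" using sub by (intro mono_onI nu_mono) auto
    show "continuous_on {\<tau> / 2..b} nu" by (rule continuous_on_subset[OF nu_continuous sub])
    show "(nu has_real_derivative d\<nu> t) (at t)" if "t \<in> {\<tau> / 2..b} - N0" for t using N0(2) that sub by blast
  qed
  then show ?thesis by (simp add: dn_def)
qed (simp add: dn_def)

lemma dn_measurable: "(\<lambda>\<tau>. indicator \<Omega> \<tau> * dn \<tau>) \<in> borel_measurable borel"
proof -
  show ?thesis
  proof (rule borel_measurable_LIMSEQ_real)
    show "(\<lambda>n. indicator {exa n..exb n} \<tau> * dn \<tau>) \<longlonglongrightarrow> indicator \<Omega> \<tau> * dn \<tau>" for \<tau>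
    proof (cases "\<tau> \<in> \<Omega>")
      case True
      show ?thesis by (rule tendsto_eventually, rule eventually_mono[OF exhaust(4)[OF True]]) (use True in simp)
    next
      case False
      then have "\<tau> \<notin> {exa n..exb n}" for n using Om_interval[OF exhaust(1,2)] by blast
      then show ?thesis using False by simp
    qed
    show "(\<lambda>\<tau>. indicator {exa n..exb n} \<tau> * dn \<tau>) \<in> borel_measurable borel" for n
      using has_densityD(1)[OF nu_density[OF exhaust(1,2)], of n n] unfolding set_integrable_def by (auto dest: borel_measurable_integrable)
  qed
qed

section \<open>The weighted space inside the square integrable functions\<close>

definition emb :: "(real \<Rightarrow> 'b::real_vector) \<Rightarrow> real \<Rightarrow> 'b" where
  "emb x \<tau> = (if \<tau> \<in> \<Omega> then sqrt (nu \<tau>) *\<^sub>R x \<tau> else 0)"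

definition unemb :: "(real \<Rightarrow> 'b::real_vector) \<Rightarrow> real \<Rightarrow> 'b" where
  "unemb f \<tau> = (if \<tau> \<in> \<Omega> then sqrt (\<mu> \<tau>) *\<^sub>R f \<tau> else 0)"

definition in_W :: "(real \<Rightarrow> 'b::{real_inner, second_countable_topology}) \<Rightarrow> bool" where
  "in_W x \<longleftrightarrow> sq_integrable (emb x)"

lemma sqrt_mu_nu: "\<tau> \<in> \<Omega> \<Longrightarrow> sqrt (nu \<tau>) * sqrt (\<mu> \<tau>) = 1" "\<tau> \<in> \<Omega> \<Longrightarrow> sqrt (\<mu> \<tau>) * sqrt (nu \<tau>) = 1"
  using mu_nu by (simp_all add: real_sqrt_mult[symmetric] mult.commute)

lemma emb_unemb: "\<tau> \<in> \<Omega> \<Longrightarrow> emb (unemb f) \<tau> = f \<tau>" and unemb_emb: "\<tau> \<in> \<Omega> \<Longrightarrow> unemb (emb f) \<tau> = f \<tau>"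
  by (simp_all add: emb_def unemb_def sqrt_mu_nu)

lemma emb_unemb': "emb (unemb f) = (\<lambda>\<tau>. indicator \<Omega> \<tau> *\<^sub>R f \<tau>)"
  by (auto simp: fun_eq_iff emb_def unemb_def sqrt_mu_nu)

lemma norm_emb: "(norm (emb x \<tau>))\<^sup>2 = indicator \<Omega> \<tau> * (nu \<tau> * (norm (x \<tau>))\<^sup>2)" for x :: "real \<Rightarrow> 'b::real_inner"
  using nu_pos[of \<tau>] by (cases "\<tau> \<in> \<Omega>") (simp_all add: emb_def power_mult_distrib less_imp_le)

lemma in_W_iff: "in_W x \<longleftrightarrow> (\<lambda>\<tau>. indicator \<Omega> \<tau> *\<^sub>R x \<tau>) \<in> borel_measurable lborel \<and> set_integrable lborel \<Omega> (\<lambda>\<tau>. nu \<tau> * (norm (x \<tau>))\<^sup>2)"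
proof -
  have m: "(\<lambda>\<tau>. indicator \<Omega> \<tau> *\<^sub>R sqrt (nu \<tau>)) \<in> borel_measurable lborel" "(\<lambda>\<tau>. indicator \<Omega> \<tau> *\<^sub>R sqrt (\<mu> \<tau>)) \<in> borel_measurable lborel"
    by (intro Om_measurable continuous_intros nu_continuous mu_continuous)+
  have e: "emb x = (\<lambda>\<tau>. (indicator \<Omega> \<tau> *\<^sub>R sqrt (nu \<tau>)) *\<^sub>R (indicator \<Omega> \<tau> *\<^sub>R x \<tau>))"
    "(\<lambda>\<tau>. indicator \<Omega> \<tau> *\<^sub>R x \<tau>) = (\<lambda>\<tau>. (indicator \<Omega> \<tau> *\<^sub>R sqrt (\<mu> \<tau>)) *\<^sub>R emb x \<tau>)"
    by (auto simp: fun_eq_iff emb_def sqrt_mu_nu)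
  have "emb x \<in> borel_measurable lborel \<longleftrightarrow> (\<lambda>\<tau>. indicator \<Omega> \<tau> *\<^sub>R x \<tau>) \<in> borel_measurable lborel"
  proof
    assume "emb x \<in> borel_measurable lborel"
    then show "(\<lambda>\<tau>. indicator \<Omega> \<tau> *\<^sub>R x \<tau>) \<in> borel_measurable lborel"
      unfolding e(2) by (rule borel_measurable_scaleR[OF m(2)])
  next
    assume "(\<lambda>\<tau>. indicator \<Omega> \<tau> *\<^sub>R x \<tau>) \<in> borel_measurable lborel"
    then show "emb x \<in> borel_measurable lborel"
      unfolding e(1) by (rule borel_measurable_scaleR[OF m(1)])
  qed
  then show ?thesis by (simp add: in_W_def sq_integrable_def norm_emb set_integrable_def)
qed

lemma in_WD:
  assumes "in_W x"
  shows "(\<lambda>\<tau>. indicator \<Omega> \<tau> *\<^sub>R x \<tau>) \<in> borel_measurable lborel" "set_integrable lborel \<Omega> (\<lambda>\<tau>. nu \<tau> * (norm (x \<tau>))\<^sup>2)"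
  by (rule in_W_iff[THEN iffD1, OF assms, THEN conjunct1], rule in_W_iff[THEN iffD1, OF assms, THEN conjunct2])

lemma in_W_add: "in_W x \<Longrightarrow> in_W y \<Longrightarrow> in_W (\<lambda>\<tau>. x \<tau> + y \<tau>)"
  and in_W_diff: "in_W x \<Longrightarrow> in_W y \<Longrightarrow> in_W (\<lambda>\<tau>. x \<tau> - y \<tau>)"
  and in_W_scaleR: "in_W x \<Longrightarrow> in_W (\<lambda>\<tau>. c *\<^sub>R x \<tau>)"
proof -
  have "emb (\<lambda>\<tau>. x \<tau> + y \<tau>) = (\<lambda>\<tau>. emb x \<tau> + emb y \<tau>)" "emb (\<lambda>\<tau>. x \<tau> - y \<tau>) = (\<lambda>\<tau>. emb x \<tau> - emb y \<tau>)"
    "emb (\<lambda>\<tau>. c *\<^sub>R x \<tau>) = (\<lambda>\<tau>. c *\<^sub>R emb x \<tau>)"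
    by (auto simp: emb_def fun_eq_iff scaleR_add_right scaleR_diff_right)
  then show "in_W x \<Longrightarrow> in_W y \<Longrightarrow> in_W (\<lambda>\<tau>. x \<tau> + y \<tau>)" "in_W x \<Longrightarrow> in_W y \<Longrightarrow> in_W (\<lambda>\<tau>. x \<tau> - y \<tau>)"
    "in_W x \<Longrightarrow> in_W (\<lambda>\<tau>. c *\<^sub>R x \<tau>)"
    by (simp_all add: in_W_def sq_integrable_add sq_integrable_diff sq_integrable_scaleR)
qed

lemma in_W_unemb: "sq_integrable f \<Longrightarrow> in_W (unemb f)"
  unfolding in_W_def emb_unemb' by (rule sq_integrable_mult_indicator) auto

text \<open>Since \<open>nu \<tau> * \<mu> \<tau> = 1\<close>, the weighted square norm reduces to
  the integral of the kernel times \<open>(norm q)^2\<close>. This covers the forcing term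
  \<open>\<mu> v\<close> of the operator.\<close>

lemma in_W_mu: "in_W (\<lambda>\<tau>. \<mu> \<tau> *\<^sub>R (q::'b::{real_inner, second_countable_topology}))"
  unfolding in_W_iff
proof
  have "(\<lambda>\<tau>. (indicator \<Omega> \<tau> *\<^sub>R \<mu> \<tau>) *\<^sub>R q) \<in> borel_measurable lborel"
    by (rule borel_measurable_scaleR[OF Om_measurable[OF mu_continuous] borel_measurable_const])
  then show "(\<lambda>\<tau>. indicator \<Omega> \<tau> *\<^sub>R \<mu> \<tau> *\<^sub>R q) \<in> borel_measurable lborel" by simp
  have "(\<lambda>\<tau>. indicator \<Omega> \<tau> *\<^sub>R (nu \<tau> * (norm (\<mu> \<tau> *\<^sub>R q))\<^sup>2)) = (\<lambda>\<tau>. (indicator \<Omega> \<tau> *\<^sub>R \<mu> \<tau>) * (norm q)\<^sup>2)"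
    using mu_nu by (auto simp: fun_eq_iff indicator_def power_mult_distrib power2_eq_square mult.assoc[symmetric] mult.commute[of "nu _"])
  then show "set_integrable lborel \<Omega> (\<lambda>\<tau>. nu \<tau> * (norm (\<mu> \<tau> *\<^sub>R q))\<^sup>2)"
    using mu_summable unfolding set_integrable_def by simp
qed

text \<open>As \<open>sqrt (\<mu> \<tau>) * sqrt (nu \<tau>) = 1\<close>, the inequality of
  arithmetic and geometric means dominates \<open>norm (x \<tau>)\<close> by the kernel plus the
  energy density. This is what gives the memory integral a meaning.\<close>

lemma in_W_integrable:
  fixes x :: "real \<Rightarrow> 'b::{real_inner, complete_space, second_countable_topology}"
  assumes "in_W x" shows "set_integrable lborel \<Omega> x"
  unfolding set_integrable_def
proof (rule integrable_bound_complete)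
  show "(\<lambda>\<tau>. indicator \<Omega> \<tau> *\<^sub>R x \<tau>) \<in> borel_measurable lborel" using assms by (rule in_WD)
  show "integrable lborel (\<lambda>\<tau>. indicator \<Omega> \<tau> *\<^sub>R \<mu> \<tau> + indicator \<Omega> \<tau> *\<^sub>R (nu \<tau> * (norm (x \<tau>))\<^sup>2))"
  proof (rule Bochner_Integration.integrable_add)
    show "integrable lborel (\<lambda>\<tau>. indicator \<Omega> \<tau> *\<^sub>R \<mu> \<tau>)" using mu_summable unfolding set_integrable_def .
    show "integrable lborel (\<lambda>\<tau>. indicator \<Omega> \<tau> *\<^sub>R (nu \<tau> * (norm (x \<tau>))\<^sup>2))"
      using in_WD(2)[OF assms] unfolding set_integrable_def .
  qed
  have "norm (x \<tau>) \<le> \<mu> \<tau> + nu \<tau> * (norm (x \<tau>))\<^sup>2" if "\<tau> \<in> \<Omega>" for \<tau>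
  proof -
    have n: "norm (x \<tau>) = sqrt (\<mu> \<tau>) * (sqrt (nu \<tau>) * norm (x \<tau>))" using sqrt_mu_nu(2)[OF that] by (simp add: mult.assoc[symmetric])
    have "0 \<le> (sqrt (\<mu> \<tau>) - sqrt (nu \<tau>) * norm (x \<tau>))\<^sup>2" by simp
    also have "\<dots> = \<mu> \<tau> + nu \<tau> * (norm (x \<tau>))\<^sup>2 - 2 * (sqrt (\<mu> \<tau>) * (sqrt (nu \<tau>) * norm (x \<tau>)))"
      using mu_pos nu_pos that by (simp add: power2_diff power_mult_distrib less_imp_le)
    finally show ?thesis unfolding n[symmetric] using norm_ge_zero[of "x \<tau>"] by linarith
  qed
  note * = this
  show "AE \<tau> in lborel. norm (indicator \<Omega> \<tau> *\<^sub>R x \<tau>) \<le> indicator \<Omega> \<tau> *\<^sub>R \<mu> \<tau> + indicator \<Omega> \<tau> *\<^sub>R (nu \<tau> * (norm (x \<tau>))\<^sup>2)"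
  proof (rule AE_I2)
    show "norm (indicator \<Omega> \<tau> *\<^sub>R x \<tau>) \<le> indicator \<Omega> \<tau> *\<^sub>R \<mu> \<tau> + indicator \<Omega> \<tau> *\<^sub>R (nu \<tau> * (norm (x \<tau>))\<^sup>2)" for \<tau>
      using *[of \<tau>] by (cases "\<tau> \<in> \<Omega>") simp_all
  qed
qed

section \<open>Primitives normalised at the right end of the interval\<close>

definition tail :: "(real \<Rightarrow> 'b::{real_normed_vector, second_countable_topology}) \<Rightarrow> real \<Rightarrow> 'b" where
  "tail y t = (LINT s:{t<..} \<inter> \<Omega>|lborel. y s)"

text \<open>The sign makes \<open>y\<close> the derivative of \<open>prim y\<close>; the condition
  of vanishing at \<open>l\<close> is built in.\<close>

definition prim :: "(real \<Rightarrow> 'b::{real_normed_vector, second_countable_topology}) \<Rightarrow> real \<Rightarrow> 'b" where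
  "prim y t = - tail y t"

lemma tail_integrable:
  fixes y :: "real \<Rightarrow> 'b::{real_normed_vector, complete_space, second_countable_topology}"
  assumes "set_integrable lborel \<Omega> y" shows "set_integrable lborel ({t<..} \<inter> \<Omega>) y"
  by (rule set_integrable_subset_complete[OF assms]) (simp_all add: sets.Int Om_sets)

lemma tail_density:
  fixes y :: "real \<Rightarrow> 'b::{real_normed_vector, complete_space, second_countable_topology}"
  assumes y: "set_integrable lborel \<Omega> y" and ab: "a \<in> \<Omega>" "b \<in> \<Omega>"
  shows "has_density a b (prim y) y"
  unfolding has_density_def
proof (intro conjI ballI)
  have sub: "{a..b} \<subseteq> \<Omega>" by (rule Om_interval[OF ab])
  show "set_integrable lborel {a..b} y" by (rule set_integrable_subset_complete[OF y _ sub]) auto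
  fix t assume t: "t \<in> {a..b}"
  have i: "integrable lborel (\<lambda>s. indicator ({c<..} \<inter> \<Omega>) s *\<^sub>R y s)" for c
    using tail_integrable[OF y, of c] unfolding set_integrable_def .
  have it: "set_integrable lborel {a..t} y"
  proof (rule set_integrable_subset_complete[OF y])
    have "{a..t} \<subseteq> {a..b}" using t by simp
    then show "{a..t} \<subseteq> \<Omega>" using sub by (rule order_trans)
  qed simp
  have "(LINT s:{a..t}|lborel. y s) = (LINT s|lborel. indicator ({a<..} \<inter> \<Omega>) s *\<^sub>R y s - indicator ({t<..} \<inter> \<Omega>) s *\<^sub>R y s)"
    unfolding set_lebesgue_integral_def
  proof (rule integral_cong_AE)
    show "(\<lambda>s. indicator {a..t} s *\<^sub>R y s) \<in> borel_measurable lborel" using it unfolding set_integrable_def by (rule borel_measurable_integrable)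
    show "(\<lambda>s. indicator ({a<..} \<inter> \<Omega>) s *\<^sub>R y s - indicator ({t<..} \<inter> \<Omega>) s *\<^sub>R y s) \<in> borel_measurable lborel"
      by (intro borel_measurable_diff borel_measurable_integrable i)
    show "AE s in lborel. indicator {a..t} s *\<^sub>R y s = indicator ({a<..} \<inter> \<Omega>) s *\<^sub>R y s - indicator ({t<..} \<inter> \<Omega>) s *\<^sub>R y s"
      using AE_lborel_singleton[of a]
    proof eventually_elim
      case (elim s)
      then show ?case using subsetD[OF sub, of s] t by (auto simp: indicator_def)
    qed
  qed
  also have "\<dots> = tail y a - tail y t"
    using i by (simp add: tail_def set_lebesgue_integral_def)
  finally show "(LINT s:{a..t}|lborel. y s) = prim y t - prim y a" by (simp add: prim_def)
qed

lemma density_continuous_Om: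
  fixes P :: "real \<Rightarrow> 'b::{real_normed_vector, complete_space, second_countable_topology}"
  assumes "\<And>a b. a \<in> \<Omega> \<Longrightarrow> b \<in> \<Omega> \<Longrightarrow> has_density a b P f" shows "continuous_on \<Omega> P"
proof (rule continuous_at_imp_continuous_on, rule ballI)
  fix \<tau> assume \<tau>: "\<tau> \<in> \<Omega>"
  obtain b where b: "b \<in> \<Omega>" "\<tau> < b" using Om_greater[OF \<tau>] .
  have a: "\<tau> / 2 \<in> \<Omega>" using Om_mono[OF \<tau>, of "\<tau> / 2"] \<tau> by (simp add: Om_iff)
  have "continuous_on {\<tau> / 2<..<b} P"
    by (rule continuous_on_subset[OF has_density_continuous[OF assms[OF a b(1)]]]) auto
  moreover have "\<tau> \<in> {\<tau> / 2<..<b}" using \<tau> b by (simp add: Om_iff)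
  ultimately show "isCont P \<tau>" using continuous_on_eq_continuous_at[of "{\<tau> / 2<..<b}" P] by simp
qed

lemma prim_continuous:
  fixes y :: "real \<Rightarrow> 'b::{real_normed_vector, complete_space, second_countable_topology}"
  assumes "set_integrable lborel \<Omega> y" shows "continuous_on \<Omega> (prim y)"
  using tail_density[OF assms] by (rule density_continuous_Om)

lemma set_integrable_norm_Om:
  fixes y :: "real \<Rightarrow> 'b::{real_normed_vector, second_countable_topology}"
  assumes "set_integrable lborel A y" shows "set_integrable lborel A (\<lambda>s. norm (y s))"
  using integrable_norm_complete[OF assms[unfolded set_integrable_def]] by (simp add: set_integrable_def)

lemma norm_tail_le:
  fixes y :: "real \<Rightarrow> 'b::{real_normed_vector, complete_space, second_countable_topology}"
  assumes "set_integrable lborel \<Omega> y" shows "norm (tail y t) \<le> tail (\<lambda>s. norm (y s)) t"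
  using norm_integral_le[OF tail_integrable[OF assms, of t, unfolded set_integrable_def]]
  by (simp add: tail_def set_lebesgue_integral_def)

lemma tail_mono:
  fixes g h :: "real \<Rightarrow> real"
  assumes "set_integrable lborel \<Omega> g" "set_integrable lborel \<Omega> h" "\<And>s. s \<in> \<Omega> \<Longrightarrow> t < s \<Longrightarrow> g s \<le> h s"
  shows "tail g t \<le> tail h t"
  unfolding tail_def by (rule set_integral_mono) (use assms tail_integrable in auto)

lemma tail_nonneg_antimono:
  fixes g :: "real \<Rightarrow> real"
  assumes g: "set_integrable lborel \<Omega> g" "\<And>s. s \<in> \<Omega> \<Longrightarrow> 0 \<le> g s" and st: "s \<le> t"
  shows "0 \<le> tail g t" "tail g t \<le> tail g s"
proof -
  show "0 \<le> tail g t" unfolding tail_def set_lebesgue_integral_def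
    by (rule Bochner_Integration.integral_nonneg) (use g(2) in \<open>simp add: indicator_def\<close>)
  show "tail g t \<le> tail g s"
    unfolding tail_def set_lebesgue_integral_def
    by (rule Bochner_Integration.integral_mono[OF tail_integrable[OF g(1), unfolded set_integrable_def] tail_integrable[OF g(1), unfolded set_integrable_def]])
      (use g(2) st in \<open>auto simp: indicator_def\<close>)
qed

text \<open>Along the points \<open>exb n\<close> by dominated convergence; beyond each of them the
  tail of the norm is monotone.\<close>

lemma tail_tendsto_end:
  fixes y :: "real \<Rightarrow> 'b::{real_normed_vector, complete_space, second_countable_topology}"
  assumes y: "set_integrable lborel \<Omega> y" shows "(tail y \<longlongrightarrow> 0) (at_end l)"
proof (rule tendstoI)
  fix e :: real assume e: "0 < e"
  let ?g = "\<lambda>s. norm (y s)"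
  have g: "set_integrable lborel \<Omega> ?g" by (rule set_integrable_norm_Om[OF y])
  have "(\<lambda>n. LINT s|lborel. indicator ({exb n<..} \<inter> \<Omega>) s * ?g s) \<longlonglongrightarrow> integral\<^sup>L lborel (\<lambda>s::real. 0::real)"
  proof (rule integral_dominated_convergence)
    show "integrable lborel (\<lambda>s. indicator \<Omega> s * ?g s)" using g by (simp add: set_integrable_def)
    show "(\<lambda>s. indicator ({exb n<..} \<inter> \<Omega>) s * ?g s) \<in> borel_measurable lborel" for n
      using tail_integrable[OF g, of "exb n"] by (auto simp: set_integrable_def dest: borel_measurable_integrable)
    show "AE s in lborel. (\<lambda>n. indicator ({exb n<..} \<inter> \<Omega>) s * ?g s) \<longlonglongrightarrow> 0"
    proof (rule AE_I2)
      fix s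
      show "(\<lambda>n. indicator ({exb n<..} \<inter> \<Omega>) s * ?g s) \<longlonglongrightarrow> 0"
      proof (cases "s \<in> \<Omega>")
        case True
        show ?thesis by (rule tendsto_eventually, rule eventually_mono[OF exhaust(4)[OF True]]) simp
      qed simp
    qed
    show "AE s in lborel. norm (indicator ({exb n<..} \<inter> \<Omega>) s * ?g s) \<le> indicator \<Omega> s * ?g s" for n
      by (auto simp: indicator_def)
  qed simp
  then have "(\<lambda>n. tail ?g (exb n)) \<longlonglongrightarrow> 0" by (simp add: tail_def set_lebesgue_integral_def)
  then obtain n where n: "tail ?g (exb n) < e"
    using e by (metis (no_types, lifting) eventually_sequentially order_refl order_tendstoD(2))
  show "\<forall>\<^sub>F t in at_end l. dist (tail y t) 0 < e"
    using eventually_at_end[OF exhaust(2)[of n]]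
  proof eventually_elim
    case (elim t)
    have "norm (tail y t) \<le> tail ?g t" by (rule norm_tail_le[OF y])
    also have "\<dots> \<le> tail ?g (exb n)" using elim by (intro tail_nonneg_antimono(2)[OF g]) auto
    finally show ?case using n by simp
  qed
qed

lemma tail_tendsto_0:
  fixes y :: "real \<Rightarrow> 'b::{real_normed_vector, complete_space, second_countable_topology}"
  assumes y: "set_integrable lborel \<Omega> y" shows "(tail y \<longlongrightarrow> (LINT s:\<Omega>|lborel. y s)) (at_right 0)"
proof (rule tendstoI)
  fix e :: real assume e: "0 < e"
  let ?g = "\<lambda>s. norm (y s)"
  have g: "set_integrable lborel \<Omega> ?g" by (rule set_integrable_norm_Om[OF y])
  define hd where "hd t = (LINT s|lborel. indicator ({..t} \<inter> \<Omega>) s * ?g s)" for t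
  have hi: "integrable lborel (\<lambda>s. indicator ({..t} \<inter> \<Omega>) s * ?g s)" for t
    using set_integrable_subset_complete[OF g, of "{..t} \<inter> \<Omega>"] by (simp add: set_integrable_def)
  have hiy: "integrable lborel (\<lambda>s. indicator ({..t} \<inter> \<Omega>) s *\<^sub>R y s)" for t
    using set_integrable_subset_complete[OF y, of "{..t} \<inter> \<Omega>"] by (simp add: set_integrable_def)
  have "(\<lambda>n. hd (exa n)) \<longlonglongrightarrow> integral\<^sup>L lborel (\<lambda>s::real. 0::real)"
    unfolding hd_def
  proof (rule integral_dominated_convergence)
    show "integrable lborel (\<lambda>s. indicator \<Omega> s * ?g s)" using g by (simp add: set_integrable_def)
    show "(\<lambda>s. indicator ({..exa n} \<inter> \<Omega>) s * ?g s) \<in> borel_measurable lborel" for n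
      using hi[of "exa n"] by auto
    show "AE s in lborel. (\<lambda>n. indicator ({..exa n} \<inter> \<Omega>) s * ?g s) \<longlonglongrightarrow> 0"
    proof (rule AE_I2)
      fix s
      show "(\<lambda>n. indicator ({..exa n} \<inter> \<Omega>) s * ?g s) \<longlonglongrightarrow> 0"
      proof (cases "s \<in> \<Omega>")
        case True
        show ?thesis by (rule tendsto_eventually, rule eventually_mono[OF exhaust(4)[OF True]]) simp
      qed simp
    qed
    show "AE s in lborel. norm (indicator ({..exa n} \<inter> \<Omega>) s * ?g s) \<le> indicator \<Omega> s * ?g s" for n
      by (auto simp: indicator_def)
  qed simp
  then have "(\<lambda>n. hd (exa n)) \<longlonglongrightarrow> 0" by simp
  then obtain n where n: "hd (exa n) < e"
    using eventually_happens'[OF sequentially_bot order_tendstoD(2)[OF _ e]] by blast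
  have "\<forall>\<^sub>F t in at_right 0. 0 < t \<and> t < exa n"
    using exhaust(1)[of n] unfolding eventually_at_right_field Om_iff by blast
  then show "\<forall>\<^sub>F t in at_right 0. dist (tail y t) (LINT s:\<Omega>|lborel. y s) < e"
  proof eventually_elim
    case (elim t)
    have "(LINT s:\<Omega>|lborel. y s) - tail y t = (LINT s|lborel. indicator ({..t} \<inter> \<Omega>) s *\<^sub>R y s)"
    proof -
      have "(LINT s:\<Omega>|lborel. y s) - tail y t = (LINT s|lborel. indicator \<Omega> s *\<^sub>R y s - indicator ({t<..} \<inter> \<Omega>) s *\<^sub>R y s)"
        using y tail_integrable[OF y, of t] by (simp add: tail_def set_lebesgue_integral_def set_integrable_def)
      also have "(\<lambda>s. indicator \<Omega> s *\<^sub>R y s - indicator ({t<..} \<inter> \<Omega>) s *\<^sub>R y s) = (\<lambda>s. indicator ({..t} \<inter> \<Omega>) s *\<^sub>R y s)"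
        by (auto simp: fun_eq_iff indicator_def)
      finally show ?thesis .
    qed
    then have "norm ((LINT s:\<Omega>|lborel. y s) - tail y t) \<le> hd t"
      using norm_integral_le[OF hiy[of t]] by (simp add: hd_def)
    also have "\<dots> \<le> hd (exa n)"
      unfolding hd_def by (rule Bochner_Integration.integral_mono[OF hi hi]) (use elim in \<open>auto simp: indicator_def\<close>)
    finally show ?case using n by (simp add: dist_norm norm_minus_commute)
  qed
qed

lemma prim_tendsto_end:
  fixes y :: "real \<Rightarrow> 'b::{real_normed_vector, complete_space, second_countable_topology}"
  assumes "set_integrable lborel \<Omega> y" shows "(prim y \<longlongrightarrow> 0) (at_end l)"
  using tendsto_minus[OF tail_tendsto_end[OF assms]] by (simp add: prim_def[abs_def])

end

context kernel begin

section \<open>The energy identity\<close>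

lemma emb_inner: "inner (emb y \<tau>) (emb x \<tau>) = indicator \<Omega> \<tau> * (nu \<tau> * inner (y \<tau>) (x \<tau>))" for x :: "real \<Rightarrow> 'b::real_inner"
proof (cases "\<tau> \<in> \<Omega>")
  case True
  then have "sqrt (nu \<tau>) * (sqrt (nu \<tau>) * inner (y \<tau>) (x \<tau>)) = nu \<tau> * inner (y \<tau>) (x \<tau>)"
    using nu_pos[OF True] by (simp add: mult.assoc[symmetric])
  then show ?thesis using True by (simp add: emb_def)
qed (simp add: emb_def)

lemma in_W_inner_integrable:
  assumes "in_W x" "in_W y" shows "set_integrable lborel \<Omega> (\<lambda>\<tau>. nu \<tau> * inner (y \<tau>) (x \<tau>))"
  using sq_integrable_inner[of "emb y" "emb x"] assms unfolding in_W_def set_integrable_def by (simp add: emb_inner)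

lemma energy_density:
  fixes x y :: "real \<Rightarrow> 'b::{real_inner, complete_space, second_countable_topology}"
  assumes x: "has_density a b x y" and ab: "a \<in> \<Omega>" "b \<in> \<Omega>"
  shows "has_density a b (\<lambda>\<tau>. nu \<tau> * (norm (x \<tau>))\<^sup>2) (\<lambda>\<tau>. dn \<tau> * (norm (x \<tau>))\<^sup>2 + 2 * (nu \<tau> * inner (y \<tau>) (x \<tau>)))"
  by (rule has_density_cong[OF has_density_mult[OF nu_density[OF ab] has_density_inner[OF x x]]])
    (simp_all add: power2_norm_eq_inner inner_commute algebra_simps)

lemma set_integral_mono_set:
  fixes f :: "real \<Rightarrow> real"
  assumes f: "set_integrable lborel B f" and A: "A \<in> sets borel" "A \<subseteq> B" and pos: "\<And>t. t \<in> B \<Longrightarrow> 0 \<le> f t"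
  shows "(LINT t:A|lborel. f t) \<le> (LINT t:B|lborel. f t)"
  unfolding set_lebesgue_integral_def
proof (rule Bochner_Integration.integral_mono)
  show "integrable lborel (\<lambda>t. indicator A t *\<^sub>R f t)"
    using set_integrable_subset_complete[OF f, of A] A by (simp add: set_integrable_def)
  show "integrable lborel (\<lambda>t. indicator B t *\<^sub>R f t)" using f by (simp add: set_integrable_def)
  show "indicator A t *\<^sub>R f t \<le> indicator B t *\<^sub>R f t" for t
    using pos[of t] A(2) by (auto simp: indicator_def)
qed

lemma integrable_exhaust:
  fixes f :: "real \<Rightarrow> real"
  assumes f: "\<And>n. set_integrable lborel {exa n..exb n} f" and pos: "\<And>t. t \<in> \<Omega> \<Longrightarrow> 0 \<le> f t"
    and B: "\<And>n. (LINT t:{exa n..exb n}|lborel. f t) \<le> B"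
  shows "set_integrable lborel \<Omega> f"
proof -
  have sub: "{exa n..exb n} \<subseteq> \<Omega>" for n by (rule Om_interval[OF exhaust(1,2)])
  have "incseq (\<lambda>n. LINT t:{exa n..exb n}|lborel. f t)"
  proof (rule incseq_SucI, rule set_integral_mono_set[OF f])
    show "{exa n..exb n} \<subseteq> {exa (Suc n)..exb (Suc n)}" for n using incseq_SucD[OF exhaust(6)] .
  qed (simp, use pos sub in blast)
  then obtain L where "(\<lambda>n. LINT t:{exa n..exb n}|lborel. f t) \<longlonglongrightarrow> L"
    using incseq_convergent[of _ B] B by blast
  then have "set_integrable lborel (\<Union>n. {exa n..exb n}) f"
    using pos sub f exhaust(6) by (intro pos_integrable_to_top) (blast | simp)+
  then show ?thesis unfolding exhaust(5) .
qed

text \<open>As \<open>nu\<close> is nondecreasing, \<open>sqrt (nu b)\<close> may be moved under the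
  integral over \<open>s > b\<close>.\<close>

lemma weighted_norm_prim_le:
  fixes y :: "real \<Rightarrow> 'b::{real_inner, complete_space, second_countable_topology}"
  assumes y: "in_W y" and b: "b \<in> \<Omega>"
    and i: "set_integrable lborel \<Omega> (\<lambda>s. norm (emb y s))"
  shows "sqrt (nu b) * norm (prim y b) \<le> tail (\<lambda>s. norm (emb y s)) b"
proof -
  have yi: "set_integrable lborel \<Omega> y" by (rule in_W_integrable[OF y])
  have ny: "set_integrable lborel \<Omega> (\<lambda>s. norm (y s))" by (rule set_integrable_norm_Om[OF yi])
  have ny2: "set_integrable lborel \<Omega> (\<lambda>s. sqrt (nu b) * norm (y s))" using ny by simp
  have "sqrt (nu b) * norm (prim y b) \<le> sqrt (nu b) * tail (\<lambda>s. norm (y s)) b"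
    using norm_tail_le[OF yi, of b] nu_pos[OF b] by (intro mult_left_mono) (auto simp: prim_def)
  also have "\<dots> = tail (\<lambda>s. sqrt (nu b) * norm (y s)) b"
    by (simp add: tail_def set_lebesgue_integral_def mult.left_commute[of "indicator _ _"])
  also have "\<dots> \<le> tail (\<lambda>s. norm (emb y s)) b"
  proof (rule tail_mono[OF ny2 i])
    fix s assume s: "s \<in> \<Omega>" "b < s"
    then have "sqrt (nu b) \<le> sqrt (nu s)" using nu_mono[OF b s(1)] by simp
    then show "sqrt (nu b) * norm (y s) \<le> norm (emb y s)" using nu_pos[OF s(1)] s(1) by (simp add: emb_def mult_right_mono)
  qed
  finally show ?thesis .
qed

text \<open>This excludes a boundary term at \<open>l\<close>. If \<open>l = \<infinity>\<close>, a
  lower bound \<open>e\<close> on a half line would contradict integrability of the energy density.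
  If \<open>l\<close> is finite, \<open>emb y\<close> is integrable over the bounded interval, and
  \<open>weighted_norm_prim_le\<close> bounds the quantity by a vanishing tail. Points arbitrarily
  close to the end are enough for the identity below.\<close>

lemma weighted_norm_small:
  fixes y :: "real \<Rightarrow> 'b::{real_inner, complete_space, second_countable_topology}"
  assumes y: "in_W y" and x: "in_W (prim y)" and e: "0 < e" and c: "c \<in> \<Omega>"
  shows "\<exists>b\<in>\<Omega>. c \<le> b \<and> nu b * (norm (prim y b))\<^sup>2 < e"
proof (cases "l = \<infinity>")
  case True
  show ?thesis
  proof (rule ccontr)
    let ?G = "\<lambda>b. nu b * (norm (prim y b))\<^sup>2"
    assume "\<not> ?thesis"
    then have G: "e \<le> ?G b" if "b \<in> \<Omega>" "c \<le> b" for b using that by (meson linorder_not_less)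
    have Gi: "set_integrable lborel \<Omega> ?G" by (rule in_WD(2)[OF x])
    have Om: "\<Omega> = {0<..}" using True Om_cases by auto
    obtain k :: nat where k: "(LINT t:\<Omega>|lborel. ?G t) / e < k" using reals_Archimedean2 by blast
    have sub: "{c..c + k} \<subseteq> \<Omega>" using c unfolding Om by auto
    have "e * real k = (LINT t|lborel. e * indicator {c..c + k} t)" by simp
    also have "\<dots> \<le> (LINT t|lborel. indicator \<Omega> t *\<^sub>R ?G t)"
    proof (rule Bochner_Integration.integral_mono)
      show "integrable lborel (\<lambda>t. e * indicator {c..c + k} t)" by simp
      show "integrable lborel (\<lambda>t. indicator \<Omega> t *\<^sub>R ?G t)" using Gi unfolding set_integrable_def .
      show "e * indicator {c..c + k} t \<le> indicator \<Omega> t *\<^sub>R ?G t" for t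
        using G[of t] nu_pos[of t] sub by (cases "t \<in> {c..c + k}"; cases "t \<in> \<Omega>") (auto simp: less_imp_le)
    qed
    also have "\<dots> = (LINT t:\<Omega>|lborel. ?G t)" by (simp add: set_lebesgue_integral_def)
    finally show False using k e by (simp add: field_simps)
  qed
next
  case False
  then obtain r where r: "0 < r" "\<Omega> = {0<..<r}" using Om_cases by auto
  have i: "set_integrable lborel \<Omega> (\<lambda>s. norm (emb y s))"
    unfolding set_integrable_def
  proof (rule integrable_bound_complete)
    have sq: "sq_integrable (emb y)" using y by (simp add: in_W_def)
    show "(\<lambda>s. indicator \<Omega> s *\<^sub>R norm (emb y s)) \<in> borel_measurable lborel"
      using sq_integrable_measurable[OF sq] by simp
    show "integrable lborel (\<lambda>s. indicator \<Omega> s + (norm (emb y s))\<^sup>2)"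
      using sq r by (simp add: sq_integrable_def)
    have "t \<le> 1 + t\<^sup>2" for t :: real
      using zero_le_power2[of "t - 1/2"] by (simp add: power2_diff field_simps)
    then show "AE s in lborel. norm (indicator \<Omega> s *\<^sub>R norm (emb y s)) \<le> indicator \<Omega> s + (norm (emb y s))\<^sup>2"
      by (auto simp: indicator_def)
  qed
  have se: "0 < sqrt e" using e by simp
  have ev: "\<forall>\<^sub>F b in at_end l. b \<in> \<Omega> \<and> c < b \<and> dist (tail (\<lambda>s. norm (emb y s)) b) 0 < sqrt e"
    using eventually_at_end[OF c] tendstoD[OF tail_tendsto_end[OF i] se] by eventually_elim auto
  have "at_end l \<noteq> bot" using False by (simp add: at_end_def)
  from eventually_happens'[OF this ev] obtain b where b: "b \<in> \<Omega>" "c < b" "\<bar>tail (\<lambda>s. norm (emb y s)) b\<bar> < sqrt e" by auto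
  have "sqrt (nu b) * norm (prim y b) < sqrt e" using weighted_norm_prim_le[OF y b(1) i] b(3) by simp
  then have "(sqrt (nu b) * norm (prim y b))\<^sup>2 < (sqrt e)\<^sup>2"
    using nu_pos[OF b(1)] by (intro power_strict_mono) auto
  then show ?thesis using b nu_pos[OF b(1)] e by (intro bexI[of _ b]) (auto simp: power_mult_distrib)
qed

text \<open>The relation \<open>G' = D + H\<close> is integrated over \<open>\<Omega>\<close>.
  Integrability of \<open>H\<close> comes from square integrability of both factors, that of
  \<open>D\<close> has to be gained from the relation itself by means of \<open>D \<ge> 0\<close>.
  Once \<open>D + H\<close> is integrable, \<open>G\<close> is minus its tail, and therefore the
  limit \<open>L\<close> at \<open>0\<close> exists.\<close>

lemma energy_identity:
  fixes y :: "real \<Rightarrow> 'b::{real_inner, complete_space, second_countable_topology}"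
  assumes y: "in_W y" and x: "in_W (prim y)"
  obtains L where "0 \<le> L" "((\<lambda>\<tau>. nu \<tau> * (norm (prim y \<tau>))\<^sup>2) \<longlongrightarrow> L) (at_right 0)"
    "set_integrable lborel \<Omega> (\<lambda>\<tau>. dn \<tau> * (norm (prim y \<tau>))\<^sup>2)"
    "2 * (LINT \<tau>:\<Omega>|lborel. nu \<tau> * inner (y \<tau>) (prim y \<tau>)) = - L - (LINT \<tau>:\<Omega>|lborel. dn \<tau> * (norm (prim y \<tau>))\<^sup>2)"
proof -
  define G where "G \<tau> = nu \<tau> * (norm (prim y \<tau>))\<^sup>2" for \<tau>
  define D where "D \<tau> = dn \<tau> * (norm (prim y \<tau>))\<^sup>2" for \<tau>
  define H where "H \<tau> = 2 * (nu \<tau> * inner (y \<tau>) (prim y \<tau>))" for \<tau>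
  have yi: "set_integrable lborel \<Omega> y" by (rule in_W_integrable[OF y])
  have dens: "has_density a b G (\<lambda>\<tau>. D \<tau> + H \<tau>)" if "a \<in> \<Omega>" "b \<in> \<Omega>" for a b
    unfolding G_def D_def H_def by (rule energy_density[OF tail_density[OF yi that] that])
  have Hi: "set_integrable lborel \<Omega> H"
    unfolding H_def using in_W_inner_integrable[OF x y] by simp
  have Hn: "set_integrable lborel \<Omega> (\<lambda>s. norm (H s))" by (rule set_integrable_norm_Om[OF Hi])
  have G0: "0 \<le> G \<tau>" and D0: "0 \<le> D \<tau>" if "\<tau> \<in> \<Omega>" for \<tau>
    using nu_pos[OF that] dn_nonneg[OF that] by (simp_all add: G_def D_def)
  have Dab: "set_integrable lborel {a..b} D" if "a \<in> \<Omega>" "b \<in> \<Omega>" for a b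
  proof -
    have "set_integrable lborel {a..b} H" by (rule set_integrable_subset_complete[OF Hi _ Om_interval[OF that]]) simp
    from set_integral_diff(1)[OF has_densityD(1)[OF dens[OF that]] this] show ?thesis by simp
  qed
  \<comment> \<open>Extending the interval to some \<open>b'\<close> with \<open>G b' < 1\<close>
    makes the boundary terms harmless: \<open>G b' - G a \<le> 1\<close> because
    \<open>G a \<ge> 0\<close>.\<close>
  have bound: "(LINT t:{a..b}|lborel. D t) \<le> (LINT t:\<Omega>|lborel. norm (H t)) + 1"
    if ab: "a \<in> \<Omega>" "b \<in> \<Omega>" "a \<le> b" for a b
  proof -
    obtain b' where b': "b' \<in> \<Omega>" "b \<le> b'" "G b' < 1"
      using weighted_norm_small[OF y x zero_less_one ab(2)] unfolding G_def by blast
    have sub: "{a..b'} \<subseteq> \<Omega>" by (rule Om_interval[OF ab(1) b'(1)])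
    have Hab: "set_integrable lborel {a..b'} H" by (rule set_integrable_subset_complete[OF Hi _ sub]) simp
    have "(LINT t:{a..b}|lborel. D t) \<le> (LINT t:{a..b'}|lborel. D t)"
      by (rule set_integral_mono_set[OF Dab[OF ab(1) b'(1)]]) (use b' sub D0 in auto)
    moreover have "(LINT t:{a..b'}|lborel. D t) + (LINT t:{a..b'}|lborel. H t) = G b' - G a"
      using has_densityD(2)[OF dens[OF ab(1) b'(1)], of b'] ab b' set_integral_add(2)[OF Dab[OF ab(1) b'(1)] Hab] by simp
    moreover have "- (LINT t:{a..b'}|lborel. H t) \<le> (LINT t:\<Omega>|lborel. norm (H t))"
    proof -
      have "- (LINT t:{a..b'}|lborel. H t) \<le> (LINT t:{a..b'}|lborel. norm (H t))"
        using norm_integral_le[OF Hab[unfolded set_integrable_def]] by (simp add: set_lebesgue_integral_def abs_mult)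
      also have "\<dots> \<le> (LINT t:\<Omega>|lborel. norm (H t))" by (rule set_integral_mono_set[OF Hn _ sub]) auto
      finally show ?thesis .
    qed
    ultimately show ?thesis using G0[OF ab(1)] b'(3) by linarith
  qed
  have Di: "set_integrable lborel \<Omega> D"
    by (rule integrable_exhaust[OF Dab[OF exhaust(1,2)] D0 bound[OF exhaust(1,2,3)]])
  define S where "S \<tau> = D \<tau> + H \<tau>" for \<tau>
  have Si: "set_integrable lborel \<Omega> S" unfolding S_def by (rule set_integral_add(1)[OF Di Hi])
  \<comment> \<open>\<open>G + tail S\<close> is constant on \<open>\<Omega>\<close>, and near
    \<open>l\<close> there are points at which both summands are small, so the constant is
    \<open>0\<close>.\<close>
  have Geq: "G a = - tail S a" if a: "a \<in> \<Omega>" for a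
  proof (rule ccontr)
    assume ne: "G a \<noteq> - tail S a"
    define e where "e = \<bar>G a + tail S a\<bar> / 2"
    have e: "0 < e" using ne by (simp add: e_def)
    obtain c where c: "c \<in> \<Omega>" "\<And>t. t \<in> \<Omega> \<Longrightarrow> c \<le> t \<Longrightarrow> \<bar>tail S t\<bar> < e"
    proof -
      have "\<forall>\<^sub>F t in at_end l. t \<in> \<Omega> \<and> dist (tail (\<lambda>s. norm (S s)) t) 0 < e"
        using eventually_at_end[OF a] tendstoD[OF tail_tendsto_end[OF set_integrable_norm_Om[OF Si]] e] by eventually_elim auto
      moreover have "at_end l \<noteq> bot" by (simp add: at_end_def)
      ultimately obtain c where c: "c \<in> \<Omega>" "dist (tail (\<lambda>s. norm (S s)) c) 0 < e"
        using eventually_happens' by blast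
      have "\<bar>tail S t\<bar> < e" if "t \<in> \<Omega>" "c \<le> t" for t
        using norm_tail_le[OF Si, of t] tail_nonneg_antimono(2)[OF set_integrable_norm_Om[OF Si] _ that(2)] c(2) by force
      with c(1) show ?thesis by (rule that)
    qed
    have "max a c \<in> \<Omega>" using a c(1) by (simp add: max_def)
    from weighted_norm_small[OF y x e this] obtain b where b: "b \<in> \<Omega>" "max a c \<le> b" "G b < e" unfolding G_def by blast
    have "G b - G a = prim S b - prim S a"
      using has_densityD(2)[OF dens[OF a b(1)], of b] has_densityD(2)[OF tail_density[OF Si a b(1)], of b] b by (simp add: S_def)
    then have "G a + tail S a = G b + tail S b" by (simp add: prim_def)
    moreover have "\<bar>tail S b\<bar> < e" using c(2)[OF b(1)] b(2) by simp
    ultimately have "\<bar>G a + tail S a\<bar> < 2 * e" using b(3) G0[OF b(1)] by linarith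
    then show False by (simp add: e_def)
  qed
  define L where "L = - (LINT s:\<Omega>|lborel. S s)"
  have evO: "\<forall>\<^sub>F t in at_right 0. t \<in> \<Omega>"
  proof -
    have "\<forall>\<^sub>F t in at_right 0. 0 < t \<and> t < exa 0"
      using exhaust(1)[of 0] unfolding eventually_at_right_field Om_iff by blast
    then show ?thesis by eventually_elim (use Om_mono[OF exhaust(1)[of 0]] in auto)
  qed
  have lim: "(G \<longlongrightarrow> L) (at_right 0)"
    unfolding L_def
  proof (rule Lim_transform_eventually[OF tendsto_minus[OF tail_tendsto_0[OF Si]]])
    show "\<forall>\<^sub>F t in at_right 0. - tail S t = G t" using evO by eventually_elim (simp add: Geq)
  qed
  show ?thesis
  proof (rule that[of L])
    show "0 \<le> L" by (rule tendsto_lowerbound[OF lim]) (use evO G0 in \<open>auto elim: eventually_mono\<close>)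
    show "((\<lambda>\<tau>. nu \<tau> * (norm (prim y \<tau>))\<^sup>2) \<longlongrightarrow> L) (at_right 0)" using lim by (simp add: G_def[abs_def])
    show "set_integrable lborel \<Omega> (\<lambda>\<tau>. dn \<tau> * (norm (prim y \<tau>))\<^sup>2)" using Di by (simp add: D_def[abs_def])
    have "(LINT s:\<Omega>|lborel. S s) = (LINT s:\<Omega>|lborel. D s) + (LINT s:\<Omega>|lborel. H s)"
      unfolding S_def by (rule set_integral_add(2)[OF Di Hi])
    moreover have "(LINT s:\<Omega>|lborel. H s) = 2 * (LINT \<tau>:\<Omega>|lborel. nu \<tau> * inner (y \<tau>) (prim y \<tau>))"
      unfolding H_def by simp
    ultimately show "2 * (LINT \<tau>:\<Omega>|lborel. nu \<tau> * inner (y \<tau>) (prim y \<tau>)) = - L - (LINT \<tau>:\<Omega>|lborel. dn \<tau> * (norm (prim y \<tau>))\<^sup>2)"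
      unfolding L_def D_def by simp
  qed
qed

end

subsection \<open>The resolvent of the derivative\<close>

context kernel begin

lemma density_eq_if_end_eq:
  fixes P Q :: "real \<Rightarrow> 'b::{real_normed_vector, second_countable_topology}"
  assumes P: "\<And>a b. a \<in> \<Omega> \<Longrightarrow> b \<in> \<Omega> \<Longrightarrow> has_density a b P f" and Q: "\<And>a b. a \<in> \<Omega> \<Longrightarrow> b \<in> \<Omega> \<Longrightarrow> has_density a b Q f"
    and lim: "(P \<longlongrightarrow> c) (at_end l)" "(Q \<longlongrightarrow> c) (at_end l)" and a: "a \<in> \<Omega>"
  shows "P a = Q a"
proof -
  have "((\<lambda>b. P b - Q b) \<longlongrightarrow> c - c) (at_end l)" by (intro tendsto_diff lim)
  moreover have "((\<lambda>b. P b - Q b) \<longlongrightarrow> P a - Q a) (at_end l)"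
  proof (rule tendsto_eventually)
    show "\<forall>\<^sub>F b in at_end l. P b - Q b = P a - Q a"
      using eventually_at_end[OF a]
    proof eventually_elim
      case (elim b)
      then show ?case
        using has_densityD(2)[OF P[OF a], of b b] has_densityD(2)[OF Q[OF a], of b b] by (simp add: algebra_simps)
    qed
  qed
  moreover have "at_end l \<noteq> bot" by (simp add: at_end_def)
  ultimately show ?thesis using tendsto_unique by fastforce
qed

lemma continuous_Om_set_integrable:
  fixes g :: "real \<Rightarrow> 'b::{real_normed_vector, complete_space, second_countable_topology}"
  assumes g: "continuous_on \<Omega> g" and ab: "a \<in> \<Omega>" "b \<in> \<Omega>" shows "set_integrable lborel {a..b} g"
proof -
  have cg: "continuous_on {a..b} g" by (rule continuous_on_subset[OF g Om_interval[OF ab]])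
  have "bounded (g ` {a..b})" by (rule compact_imp_bounded[OF compact_continuous_image[OF cg]]) simp
  then obtain C where C: "\<And>t. t \<in> {a..b} \<Longrightarrow> norm (g t) \<le> C" unfolding bounded_iff by (metis image_eqI)
  show ?thesis
    unfolding set_integrable_def
  proof (rule integrable_bound_complete)
    show "(\<lambda>t. indicator {a..b} t *\<^sub>R g t) \<in> borel_measurable lborel"
      using borel_measurable_continuous_on_indicator[OF _ cg] by simp
    show "integrable lborel (\<lambda>t. C * indicator {a..b} t)"
      by (intro integrable_mult_right integrable_real_indicator) (simp_all add: emeasure_lborel_Icc_eq)
    show "AE t in lborel. norm (indicator {a..b} t *\<^sub>R g t) \<le> C * indicator {a..b} t"
      using C by (auto simp: indicator_def)
  qed
qed

lemma exp_shift: "exp (- r * (s - t)) = exp (r * t) * exp (- r * s)" for r s t :: real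
  by (simp add: exp_add[symmetric] right_diff_distrib)

text \<open>The solution of \<open>D x = rr x - k\<close> that vanishes at \<open>l\<close>. The
  exponential is split so that the integrand does not depend on \<open>t\<close> and the results on
  tails apply.\<close>

definition res :: "real \<Rightarrow> (real \<Rightarrow> 'b::{real_normed_vector, second_countable_topology}) \<Rightarrow> real \<Rightarrow> 'b" where
  "res rr k t = exp (rr * t) *\<^sub>R tail (\<lambda>s. exp (- rr * s) *\<^sub>R k s) t"

context
  fixes rr :: real and k :: "real \<Rightarrow> 'b::{real_inner, complete_space, second_countable_topology}"
  assumes lam: "0 < rr" and k: "in_W k"
begin

lemma damped_integrable:
  assumes g: "set_integrable lborel \<Omega> (g :: real \<Rightarrow> 'c::{real_normed_vector, complete_space, second_countable_topology})"
  shows "set_integrable lborel \<Omega> (\<lambda>s. exp (- rr * s) *\<^sub>R g s)"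
proof -
  have "integrable lborel (\<lambda>s. (indicator \<Omega> s * exp (- rr * s)) *\<^sub>R (indicator \<Omega> s *\<^sub>R g s))"
  proof (rule integrable_scaled[OF g[unfolded set_integrable_def], of _ 1])
    show "(\<lambda>s. indicator \<Omega> s * exp (- rr * s)) \<in> borel_measurable lborel" by measurable
    show "\<bar>indicator \<Omega> s * exp (- rr * s)\<bar> \<le> 1" for s using lam by (simp add: indicator_def Om_iff)
  qed
  moreover have "(\<lambda>s. (indicator \<Omega> s * exp (- rr * s)) *\<^sub>R (indicator \<Omega> s *\<^sub>R g s)) = (\<lambda>s. indicator \<Omega> s *\<^sub>R exp (- rr * s) *\<^sub>R g s)"
    by (auto simp: fun_eq_iff indicator_def)
  ultimately show ?thesis by (simp only: set_integrable_def)
qed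

lemma res_continuous: "continuous_on \<Omega> (res rr k)"
proof -
  have "continuous_on \<Omega> (\<lambda>t. - prim (\<lambda>s. exp (- rr * s) *\<^sub>R k s) t)"
    by (intro continuous_intros prim_continuous damped_integrable in_W_integrable k)
  then have "continuous_on \<Omega> (tail (\<lambda>s. exp (- rr * s) *\<^sub>R k s))" by (simp add: prim_def)
  then show ?thesis unfolding res_def[abs_def] by (intro continuous_intros)
qed

lemma res_density:
  assumes ab: "a \<in> \<Omega>" "b \<in> \<Omega>" shows "has_density a b (res rr k) (\<lambda>t. rr *\<^sub>R res rr k t - k t)"
  unfolding has_density_def
proof (intro conjI ballI)
  let ?k = "\<lambda>s. exp (- rr * s) *\<^sub>R k s" and ?y = "\<lambda>t. rr *\<^sub>R res rr k t - k t"
  have ki: "set_integrable lborel \<Omega> ?k" by (intro damped_integrable in_W_integrable k)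
  have sub: "{a..b} \<subseteq> \<Omega>" by (rule Om_interval[OF ab])
  have kab: "set_integrable lborel {a..b} k" by (rule set_integrable_subset_complete[OF in_W_integrable[OF k] _ sub]) simp
  have cy: "set_integrable lborel {a..b} (\<lambda>t. rr *\<^sub>R res rr k t)"
    by (intro continuous_Om_set_integrable continuous_intros res_continuous ab)
  show yab: "set_integrable lborel {a..b} ?y"
    using Bochner_Integration.integrable_diff[OF cy[unfolded set_integrable_def] kab[unfolded set_integrable_def]]
    by (simp add: set_integrable_def scaleR_diff_right)
  fix t assume t: "t \<in> {a..b}"
  have e: "has_density a b (\<lambda>t. exp (rr * t)) (\<lambda>t. rr * exp (rr * t))"
    by (rule has_density_C1) (auto intro!: derivative_eq_intros continuous_intros)
  have yt: "integrable lborel (\<lambda>s. indicator {a..t} s *\<^sub>R ?y s)"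
    using set_integrable_subset_complete[OF yab, of "{a..t}"] t by (simp add: set_integrable_def)
  \<comment> \<open>Componentwise: the scalar product rule applies to \<open>exp (rr * t)\<close>
    times the primitive of the damped datum, and a vector orthogonal to every \<open>v\<close> is
    \<open>0\<close>.\<close>
  have "inner (LINT s:{a..t}|lborel. ?y s) v = inner (res rr k t - res rr k a) v" for v
  proof -
    have "has_density a b (\<lambda>t. exp (rr * t) * inner (prim ?k t) v) (\<lambda>t. rr * exp (rr * t) * inner (prim ?k t) v + exp (rr * t) * inner (?k t) v)"
      by (rule has_density_mult[OF e has_density_inner_const[OF tail_density[OF ki ab]]])
    then have "(LINT s:{a..t}|lborel. rr * exp (rr * s) * inner (prim ?k s) v + exp (rr * s) * inner (?k s) v)
        = exp (rr * t) * inner (prim ?k t) v - exp (rr * a) * inner (prim ?k a) v"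
      using t by (intro has_densityD(2)) auto
    moreover have "rr * exp (rr * s) * inner (prim ?k s) v + exp (rr * s) * inner (?k s) v = - inner (?y s) v" for s
    proof -
      have "exp (rr * s) * (exp (- (rr * s)) * inner (k s) v) = inner (k s) v" by (simp add: mult.assoc[symmetric] exp_minus)
      then show ?thesis by (simp add: res_def prim_def inner_diff_left)
    qed
    moreover have "(LINT s:{a..t}|lborel. - inner (?y s) v) = - inner (LINT s:{a..t}|lborel. ?y s) v"
    proof -
      have "(LINT s|lborel. inner (indicator {a..t} s *\<^sub>R ?y s) v) = inner (LINT s|lborel. indicator {a..t} s *\<^sub>R ?y s) v"
        using yt by (rule integral_inner_left)
      then show ?thesis by (simp add: set_lebesgue_integral_def)
    qed
    ultimately have "inner (LINT s:{a..t}|lborel. ?y s) v = - (exp (rr * t) * inner (prim ?k t) v - exp (rr * a) * inner (prim ?k a) v)"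
      by simp
    then show ?thesis by (simp add: res_def prim_def inner_diff_left)
  qed
  then have "inner ((LINT s:{a..t}|lborel. ?y s) - (res rr k t - res rr k a)) v = 0" for v by (simp add: inner_diff_left)
  from this[of "(LINT s:{a..t}|lborel. ?y s) - (res rr k t - res rr k a)"]
  show "(LINT s:{a..t}|lborel. ?y s) = res rr k t - res rr k a" unfolding inner_eq_zero_iff right_minus_eq .
qed

lemma res_norm_le:
  fixes g :: "real \<Rightarrow> 'c::{real_normed_vector, complete_space, second_countable_topology}"
  assumes g: "set_integrable lborel \<Omega> g" shows "norm (res rr g t) \<le> tail (\<lambda>s. norm (exp (- rr * (s - t)) *\<^sub>R g s)) t"
proof -
  have "norm (res rr g t) = exp (rr * t) * norm (tail (\<lambda>s. exp (- rr * s) *\<^sub>R g s) t)" by (simp add: res_def)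
  also have "\<dots> \<le> exp (rr * t) * tail (\<lambda>s. norm (exp (- rr * s) *\<^sub>R g s)) t"
    by (intro mult_left_mono norm_tail_le damped_integrable g) simp
  also have "\<dots> = tail (\<lambda>s. exp (rr * t) * norm (exp (- rr * s) *\<^sub>R g s)) t"
    by (simp add: tail_def set_lebesgue_integral_def mult.left_commute[of "indicator _ _"])
  also have "(\<lambda>s. exp (rr * t) * norm (exp (- rr * s) *\<^sub>R g s)) = (\<lambda>s. norm (exp (- rr * (s - t)) *\<^sub>R g s))"
    unfolding exp_shift by (simp add: fun_eq_iff mult.assoc)
  finally show ?thesis .
qed

lemma res_tendsto_end: "(res rr k \<longlongrightarrow> 0) (at_end l)"
proof -
  let ?g = "\<lambda>s. norm (k s)"
  have ki: "set_integrable lborel \<Omega> k" by (rule in_W_integrable[OF k])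
  have g: "set_integrable lborel \<Omega> ?g" by (rule set_integrable_norm_Om[OF ki])
  have le: "norm (res rr k t) \<le> tail ?g t" for t
  proof -
    have "norm (res rr k t) \<le> tail (\<lambda>s. norm (exp (- rr * (s - t)) *\<^sub>R k s)) t" by (rule res_norm_le[OF ki])
    also have "\<dots> \<le> tail ?g t"
    proof (rule tail_mono[OF _ g])
      have "(\<lambda>s. norm (exp (- rr * (s - t)) *\<^sub>R k s)) = (\<lambda>s. exp (rr * t) * norm (exp (- rr * s) *\<^sub>R k s))"
        unfolding exp_shift by (simp add: fun_eq_iff mult.assoc)
      then show "set_integrable lborel \<Omega> (\<lambda>s. norm (exp (- rr * (s - t)) *\<^sub>R k s))"
        using set_integrable_norm_Om[OF damped_integrable[OF ki]] by simp
      show "norm (exp (- rr * (s - t)) *\<^sub>R k s) \<le> norm (k s)" if "t < s" for s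
      proof -
        have "exp (- rr * (s - t)) \<le> 1" using lam that by simp
        then have "exp (- rr * (s - t)) * norm (k s) \<le> 1 * norm (k s)" by (rule mult_right_mono) simp
        then show ?thesis by simp
      qed
    qed
    finally show ?thesis .
  qed
  show ?thesis by (rule Lim_null_comparison[OF always_eventually tail_tendsto_end[OF g]]) (use le in simp)
qed

text \<open>A pointwise bound by hand: \<open>sqrt (nu b)\<close> is moved under the integral by
  monotonicity, and a factor \<open>0 \<le> e \<le> 1\<close> satisfies
  \<open>e g \<le> e (1 + g^2) \<le> e + g^2\<close>. The exponential integrates to
  \<open>1 / rr\<close>, the square to the squared norm of \<open>k\<close>.\<close>

lemma weighted_res_bounded: "\<exists>C. \<forall>b\<in>\<Omega>. nu b * (norm (res rr k b))\<^sup>2 \<le> C"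
proof -
  let ?K = "LINT s|lborel. (norm (emb k s))\<^sup>2"
  have sq: "sq_integrable (emb k)" using k by (simp add: in_W_def)
  have ki: "set_integrable lborel \<Omega> k" by (rule in_W_integrable[OF k])
  have bnd: "sqrt (nu b) * norm (res rr k b) \<le> 1 / rr + ?K" if b: "b \<in> \<Omega>" for b
  proof -
    let ?e = "\<lambda>s. exp (- rr * (s - b))"
    have hi: "((\<lambda>s. exp (rr * b) * exp (- rr * s)) has_integral exp (rr * b) * (exp (- rr * b) / rr)) {b..}"
      by (intro has_integral_mult_right has_integral_exp_minus_to_infinity lam)
    have e_eq: "(\<lambda>s. exp (rr * b) * exp (- rr * s)) = ?e" unfolding exp_shift ..
    have val: "exp (rr * b) * (exp (- rr * b) / rr) = 1 / rr" by (simp add: exp_minus)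
    have hi2: "(?e has_integral 1 / rr) {b..}" using hi unfolding e_eq val .
    have "?e absolutely_integrable_on {b..}"
      by (rule nonnegative_absolutely_integrable_1) (use hi2 in blast, simp)
    moreover have em: "(\<lambda>s. indicator {b..} s *\<^sub>R ?e s) \<in> borel_measurable lborel" by measurable
    ultimately have ei: "set_integrable lborel {b..} ?e"
      using integrable_completion[OF em] unfolding set_integrable_def by simp
    have eint: "(LINT s:{b..}|lborel. ?e s) = 1 / rr"
      using set_borel_integral_eq_integral(2)[OF ei] hi2 by (simp add: integral_unique)
    have "sqrt (nu b) * norm (res rr k b) \<le> sqrt (nu b) * tail (\<lambda>s. norm (?e s *\<^sub>R k s)) b"
      using nu_pos[OF b] by (intro mult_left_mono res_norm_le ki) simp
    also have "\<dots> = (LINT s|lborel. indicator ({b<..} \<inter> \<Omega>) s * (sqrt (nu b) * (?e s * norm (k s))))"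
      by (simp add: tail_def set_lebesgue_integral_def mult.left_commute[of "indicator _ _"])
    also have "\<dots> \<le> (LINT s|lborel. indicator {b..} s *\<^sub>R ?e s + (norm (emb k s))\<^sup>2)"
    proof (rule integral_mono')
      show "integrable lborel (\<lambda>s. indicator {b..} s *\<^sub>R ?e s + (norm (emb k s))\<^sup>2)"
        using ei sq by (simp add: set_integrable_def sq_integrable_def)
      fix s
      show "indicator ({b<..} \<inter> \<Omega>) s * (sqrt (nu b) * (?e s * norm (k s))) \<le> indicator {b..} s *\<^sub>R ?e s + (norm (emb k s))\<^sup>2"
      proof (cases "s \<in> {b<..} \<inter> \<Omega>")
        case True
        then have s: "s \<in> \<Omega>" "b < s" by auto
        have e1: "0 \<le> ?e s" "?e s \<le> 1" using lam s by auto
        have "sqrt (nu b) * (?e s * norm (k s)) \<le> ?e s * norm (emb k s)"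
        proof -
          have "sqrt (nu b) \<le> sqrt (nu s)" using nu_mono[OF b s(1)] s(2) by simp
          then have "sqrt (nu b) * norm (k s) \<le> norm (emb k s)" using nu_pos[OF s(1)] s(1) by (simp add: emb_def mult_right_mono)
          then have "?e s * (sqrt (nu b) * norm (k s)) \<le> ?e s * norm (emb k s)" using e1(1) by (rule mult_left_mono)
          then show ?thesis by (simp only: mult.left_commute)
        qed
        also have "\<dots> \<le> ?e s * (1 + (norm (emb k s))\<^sup>2)"
        proof (rule mult_left_mono[OF _ e1(1)])
          show "norm (emb k s) \<le> 1 + (norm (emb k s))\<^sup>2"
            using zero_le_power2[of "norm (emb k s) - 1/2"] by (simp add: power2_diff field_simps)
        qed
        also have "\<dots> \<le> ?e s + (norm (emb k s))\<^sup>2"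
          using mult_right_mono[OF e1(2), of "(norm (emb k s))\<^sup>2"] by (simp add: distrib_left)
        finally show ?thesis using True by simp
      next
        case False
        have "0 \<le> indicator {b..} s *\<^sub>R ?e s + (norm (emb k s))\<^sup>2" by simp
        moreover have "indicator ({b<..} \<inter> \<Omega>) s = (0::real)" using False by (rule indicator_simps(2))
        ultimately show ?thesis by (simp only: mult_zero_left)
      qed
      show "0 \<le> indicator {b..} s *\<^sub>R ?e s + (norm (emb k s))\<^sup>2" by simp
    qed
    also have "\<dots> = 1 / rr + ?K"
      using ei sq eint by (simp add: set_integrable_def sq_integrable_def set_lebesgue_integral_def)
    finally show ?thesis .
  qed
  have "nu b * (norm (res rr k b))\<^sup>2 \<le> (1 / rr + ?K)\<^sup>2" if b: "b \<in> \<Omega>" for b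
    using power_mono[OF bnd[OF b], of 2] nu_pos[OF b] by (simp add: power_mult_distrib)
  then show ?thesis by blast
qed

text \<open>The energy balance used as an estimate: \<open>dn \<ge> 0\<close> and
  \<open>2 inner y x \<ge> rr |x|^2 - |k|^2 / rr\<close> bound the integral of
  \<open>nu |x|^2\<close> over compact intervals by the norm of \<open>k\<close> and a boundary
  term, which \<open>weighted_res_bounded\<close> controls uniformly.\<close>

lemma res_in_W: "in_W (res rr k)"
proof -
  let ?x = "res rr k" and ?y = "\<lambda>t. rr *\<^sub>R res rr k t - k t"
  let ?G = "\<lambda>\<tau>. nu \<tau> * (norm (?x \<tau>))\<^sup>2" and ?Q = "\<lambda>\<tau>. nu \<tau> * (norm (k \<tau>))\<^sup>2"
  obtain C where C: "\<And>b. b \<in> \<Omega> \<Longrightarrow> ?G b \<le> C" using weighted_res_bounded by blast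
  have Q: "set_integrable lborel \<Omega> ?Q" by (rule in_WD(2)[OF k])
  have Gi: "set_integrable lborel {a..b} ?G" if "a \<in> \<Omega>" "b \<in> \<Omega>" for a b
    using that by (intro continuous_Om_set_integrable continuous_intros nu_continuous res_continuous)
  have "set_integrable lborel \<Omega> ?G"
  proof (rule integrable_exhaust[OF Gi[OF exhaust(1,2)]])
    show "0 \<le> ?G t" if "t \<in> \<Omega>" for t using nu_pos[OF that] by simp
    fix n
    let ?I = "{exa n..exb n}"
    have sub: "?I \<subseteq> \<Omega>" by (rule Om_interval[OF exhaust(1,2)])
    have dens: "has_density (exa n) (exb n) ?G (\<lambda>\<tau>. dn \<tau> * (norm (?x \<tau>))\<^sup>2 + 2 * (nu \<tau> * inner (?y \<tau>) (?x \<tau>)))"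
      by (rule energy_density[OF res_density[OF exhaust(1,2)] exhaust(1,2)])
    have QI: "set_integrable lborel ?I ?Q" by (rule set_integrable_subset_complete[OF Q _ sub]) simp
    have "(LINT t:?I|lborel. rr * ?G t - 1 / rr * ?Q t) \<le>
        (LINT t:?I|lborel. dn t * (norm (?x t))\<^sup>2 + 2 * (nu t * inner (?y t) (?x t)))"
    proof (rule set_integral_mono)
      show "set_integrable lborel ?I (\<lambda>t. rr * ?G t - 1 / rr * ?Q t)"
        using Gi[OF exhaust(1,2), of n n] QI by (intro set_integral_diff(1)) simp_all
      show "set_integrable lborel ?I (\<lambda>t. dn t * (norm (?x t))\<^sup>2 + 2 * (nu t * inner (?y t) (?x t)))"
        by (rule has_densityD(1)[OF dens])
      fix t assume "t \<in> ?I"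
      then have t: "t \<in> \<Omega>" using sub by blast
      have "inner (k t) (?x t) \<le> norm (k t) * norm (?x t)" by (rule norm_cauchy_schwarz)
      moreover have "2 * (norm (k t) * norm (?x t)) \<le> rr * (norm (?x t))\<^sup>2 + 1 / rr * (norm (k t))\<^sup>2"
      proof -
        have "0 \<le> (sqrt rr * norm (?x t) - norm (k t) / sqrt rr)\<^sup>2" by simp
        also have "\<dots> = rr * (norm (?x t))\<^sup>2 + 1 / rr * (norm (k t))\<^sup>2 - 2 * (norm (k t) * norm (?x t))"
          using lam by (simp add: power2_diff power_mult_distrib power_divide)
        finally show ?thesis by simp
      qed
      ultimately have "rr * (norm (?x t))\<^sup>2 - 1 / rr * (norm (k t))\<^sup>2 \<le> 2 * inner (?y t) (?x t)"
        by (simp add: inner_diff_left power2_norm_eq_inner)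
      then have "nu t * (rr * (norm (?x t))\<^sup>2 - 1 / rr * (norm (k t))\<^sup>2) \<le> nu t * (2 * inner (?y t) (?x t))"
        using nu_pos[OF t] by (intro mult_left_mono) auto
      moreover have "0 \<le> dn t * (norm (?x t))\<^sup>2" using dn_nonneg[OF t] by simp
      ultimately show "rr * ?G t - 1 / rr * ?Q t \<le> dn t * (norm (?x t))\<^sup>2 + 2 * (nu t * inner (?y t) (?x t))"
        by (simp add: algebra_simps)
    qed
    also have "\<dots> = ?G (exb n) - ?G (exa n)" using has_densityD(2)[OF dens, of "exb n"] exhaust(3) by simp
    also have "\<dots> \<le> C" using C[OF exhaust(2), of n] nu_pos[OF exhaust(1), of n] by (smt (verit) mult_nonneg_nonneg zero_le_power2)
    finally have "rr * (LINT t:?I|lborel. ?G t) - 1 / rr * (LINT t:?I|lborel. ?Q t) \<le> C"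
      using Gi[OF exhaust(1,2), of n n] QI by (simp add: set_integral_diff(2))
    moreover have "(LINT t:?I|lborel. ?Q t) \<le> (LINT t:\<Omega>|lborel. ?Q t)"
      by (rule set_integral_mono_set[OF Q _ sub]) (use nu_pos in \<open>auto simp: less_imp_le\<close>)
    then have "1 / rr * (LINT t:?I|lborel. ?Q t) \<le> 1 / rr * (LINT t:\<Omega>|lborel. ?Q t)"
      using lam by (intro mult_left_mono) auto
    ultimately have "rr * (LINT t:?I|lborel. ?G t) \<le> C + 1 / rr * (LINT t:\<Omega>|lborel. ?Q t)" by linarith
    then show "(LINT t:?I|lborel. ?G t) \<le> (C + 1 / rr * (LINT t:\<Omega>|lborel. ?Q t)) / rr"
      using lam by (simp add: field_simps)
  qed
  then show ?thesis unfolding in_W_iff using Om_measurable[OF res_continuous] by blast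
qed

lemma res_derivative_in_W: "in_W (\<lambda>t. rr *\<^sub>R res rr k t - k t)"
  by (intro in_W_diff in_W_scaleR res_in_W k)

lemma prim_res: "a \<in> \<Omega> \<Longrightarrow> prim (\<lambda>t. rr *\<^sub>R res rr k t - k t) a = res rr k a"
  by (rule density_eq_if_end_eq[OF tail_density res_density prim_tendsto_end res_tendsto_end])
    (rule in_W_integrable[OF res_derivative_in_W] | assumption)+

end

text \<open>Testing against a countable dense set of vectors allows the exceptional null sets to be
  united; a nonzero \<open>f t\<close> has a positive product with some vector of that set.\<close>

lemma AE_zero_vector:
  fixes f :: "real \<Rightarrow> 'b::{real_inner, complete_space, second_countable_topology}"
  assumes f: "\<And>a b. integrable lborel (\<lambda>t. indicator ({a..b} \<inter> \<Omega>) t *\<^sub>R f t)"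
    and z: "\<And>a b. a \<in> \<Omega> \<Longrightarrow> b \<in> \<Omega> \<Longrightarrow> a < b \<Longrightarrow> (LINT t:{a..b}|lborel. f t) = 0"
  shows "AE t in lborel. t \<in> \<Omega> \<longrightarrow> f t = 0"
proof -
  obtain D :: "'b set" where D: "countable D" "\<And>X. open X \<Longrightarrow> X \<noteq> {} \<Longrightarrow> \<exists>d\<in>D. d \<in> X"
    using countable_dense_exists[where 'a = 'b] by blast
  have "AE t in lborel. t \<in> \<Omega> \<longrightarrow> indicator \<Omega> t * inner (f t) e = 0" for e
  proof (rule AE_zero_if_interval_integrals_zero[OF _ Om_open])
    show "set_integrable lborel {a..b} (\<lambda>t. indicator \<Omega> t * inner (f t) e)" for a b
    proof -
      have "integrable lborel (\<lambda>t. inner (indicator ({a..b} \<inter> \<Omega>) t *\<^sub>R f t) e)" by (rule integrable_inner_left[OF f])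
      moreover have "(\<lambda>t. inner (indicator ({a..b} \<inter> \<Omega>) t *\<^sub>R f t) e) = (\<lambda>t. indicator {a..b} t *\<^sub>R (indicator \<Omega> t * inner (f t) e))"
        by (auto simp: fun_eq_iff indicator_def)
      ultimately show ?thesis by (simp only: set_integrable_def)
    qed
    show "(LINT t:{a..b}|lborel. indicator \<Omega> t * inner (f t) e) = 0" if ab: "a < b" "{a..b} \<subseteq> \<Omega>" for a b
    proof -
      have i: "integrable lborel (\<lambda>t. indicator {a..b} t *\<^sub>R f t)" using f[of a b] ab(2) by (simp add: Int_absorb2)
      have "(LINT t:{a..b}|lborel. indicator \<Omega> t * inner (f t) e) = (LINT t|lborel. inner (indicator {a..b} t *\<^sub>R f t) e)"
        unfolding set_lebesgue_integral_def
        by (rule Bochner_Integration.integral_cong) (use ab(2) in \<open>auto simp: indicator_def\<close>)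
      also have "\<dots> = inner (LINT t|lborel. indicator {a..b} t *\<^sub>R f t) e" using i by (rule integral_inner_left)
      also have "\<dots> = 0" using z[of a b] ab by (simp add: set_lebesgue_integral_def subset_iff)
      finally show ?thesis .
    qed
  qed
  then have "AE t in lborel. \<forall>e\<in>D. t \<in> \<Omega> \<longrightarrow> indicator \<Omega> t * inner (f t) e = 0"
    unfolding AE_ball_countable[OF D(1)] by blast
  then show ?thesis
  proof eventually_elim
    case (elim t)
    show ?case
    proof (intro impI, rule ccontr)
      assume t: "t \<in> \<Omega>" and ne: "f t \<noteq> 0"
      have "open {e. 0 < inner (f t) e}" by (intro open_Collect_less continuous_intros)
      moreover have "f t \<in> {e. 0 < inner (f t) e}" using ne by simp
      ultimately obtain e where "e \<in> D" "0 < inner (f t) e" using D(2)[of "{e. 0 < inner (f t) e}"] by blast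
      then show False using elim t by fastforce
    qed
  qed
qed

text \<open>Continuity of \<open>prim y\<close> upgrades the almost everywhere statement to every
  point; then \<open>y\<close> integrates to \<open>0\<close> over every interval.\<close>

lemma prim_AE_zero:
  fixes y :: "real \<Rightarrow> 'b::{real_inner, complete_space, second_countable_topology}"
  assumes y: "set_integrable lborel \<Omega> y" and z: "AE t in lborel. t \<in> \<Omega> \<longrightarrow> prim y t = 0"
  shows "t \<in> \<Omega> \<Longrightarrow> prim y t = 0" and "AE t in lborel. t \<in> \<Omega> \<longrightarrow> y t = 0"
proof -
  have "open (\<Omega> \<inter> prim y -` (- {0}))"
    by (rule continuous_open_preimage[OF prim_continuous[OF y] Om_open]) (simp add: open_Compl)
  moreover have "AE t in lborel. t \<notin> \<Omega> \<inter> prim y -` (- {0})" using z by eventually_elim auto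
  ultimately have "\<Omega> \<inter> prim y -` (- {0}) = {}" by (rule AE_not_in_open_imp_empty)
  then show zero: "prim y t = 0" if "t \<in> \<Omega>" for t using that by blast
  show "AE t in lborel. t \<in> \<Omega> \<longrightarrow> y t = 0"
  proof (rule AE_zero_vector)
    show "integrable lborel (\<lambda>t. indicator ({a..b} \<inter> \<Omega>) t *\<^sub>R y t)" for a b
      using set_integrable_subset_complete[OF y, of "{a..b} \<inter> \<Omega>"] by (simp add: set_integrable_def)
    show "(LINT t:{a..b}|lborel. y t) = 0" if "a \<in> \<Omega>" "b \<in> \<Omega>" "a < b" for a b
      using has_densityD(2)[OF tail_density[OF y that(1,2)], of b] that zero by simp
  qed
qed

end

subsection \<open>Weak derivatives\<close>

context kernel begin

lemma at_end_eventuallyD: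
  assumes "eventually P (at_end l)" shows "\<exists>b\<in>\<Omega>. \<forall>t\<in>\<Omega>. b < t \<longrightarrow> P t"
proof (cases "l = \<infinity>")
  case True
  then obtain b where b: "\<And>t. b \<le> t \<Longrightarrow> P t" using assms by (auto simp: at_end_def eventually_at_top_linorder)
  show ?thesis by (rule bexI[of _ "max b 1"]) (use b True in \<open>auto simp: Omega_def\<close>)
next
  case False
  then obtain r where r: "0 < r" "l = ereal r" "\<Omega> = {0<..<r}" using Om_cases by auto
  then obtain b where b: "b < r" "\<And>t. b < t \<Longrightarrow> t < r \<Longrightarrow> P t"
    using assms by (auto simp: at_end_def eventually_at_left_field)
  show ?thesis unfolding r(3) by (rule bexI[of _ "max b (r / 2)"]) (use b r(1) in auto)
qed

lemma test_fun_support: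
  assumes "test_fun \<Omega> \<phi>"
  obtains a b C where "a \<in> \<Omega>" "b \<in> \<Omega>" "a \<le> b" "\<And>s. s \<notin> {a<..<b} \<Longrightarrow> \<phi> s = 0" "\<And>s. s \<notin> {a<..<b} \<Longrightarrow> deriv \<phi> s = 0"
    "\<And>s. \<bar>\<phi> s\<bar> \<le> C" "\<And>s. \<bar>deriv \<phi> s\<bar> \<le> C"
proof -
  obtain a b where ab: "0 < a" "a \<le> b" "ereal b < l" "\<And>s. s \<notin> {a<..<b} \<Longrightarrow> \<phi> s = 0" "\<And>s. s \<notin> {a<..<b} \<Longrightarrow> deriv \<phi> s = 0"
    using test_fun_interval[OF assms[unfolded Omega_def] l_pos] by blast
  have bO: "b \<in> \<Omega>" using ab by (simp add: Om_iff)
  have aO: "a \<in> \<Omega>" by (rule Om_mono[OF bO ab(1,2)])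
  have bnd: "\<exists>C. \<forall>s\<in>{a..b}. \<bar>g s\<bar> \<le> C" if "continuous_on {a..b} g" for g :: "real \<Rightarrow> real"
    using compact_imp_bounded[OF compact_continuous_image[OF that compact_Icc]] by (auto simp: bounded_iff)
  have c1: "continuous_on {a..b} \<phi>"
    by (rule DERIV_continuous_on[of _ _ "deriv \<phi>"]) (rule has_field_derivative_at_within[OF test_fun_C1(1)[OF assms]])
  obtain C1 where C1: "\<And>s. s \<in> {a..b} \<Longrightarrow> \<bar>\<phi> s\<bar> \<le> C1" using bnd[OF c1] by blast
  obtain C2 where C2: "\<And>s. s \<in> {a..b} \<Longrightarrow> \<bar>deriv \<phi> s\<bar> \<le> C2" using bnd[OF test_fun_C1(2)[OF assms]] by blast
  have "\<bar>\<phi> s\<bar> \<le> max 0 (max C1 C2)" "\<bar>deriv \<phi> s\<bar> \<le> max 0 (max C1 C2)" for s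
    using C1[of s] C2[of s] ab(4,5)[of s] by (cases "s \<in> {a<..<b}"; force)+
  then show ?thesis using that[OF aO bO ab(2,4,5)] by blast
qed

lemma test_fun_integrable:
  fixes y :: "real \<Rightarrow> 'b::{real_inner, complete_space, second_countable_topology}"
  assumes \<phi>: "test_fun \<Omega> \<phi>" and y: "set_integrable lborel \<Omega> y"
  shows "set_integrable lborel \<Omega> (\<lambda>t. \<phi> t *\<^sub>R y t)" "set_integrable lborel \<Omega> (\<lambda>t. deriv \<phi> t *\<^sub>R y t)"
proof -
  obtain a b C where C: "\<And>s. \<bar>\<phi> s\<bar> \<le> C" "\<And>s. \<bar>deriv \<phi> s\<bar> \<le> C" using test_fun_support[OF \<phi>] by metis
  have c1: "continuous_on UNIV \<phi>"
    by (rule DERIV_continuous_on[of _ _ "deriv \<phi>"]) (rule has_field_derivative_at_within[OF test_fun_C1(1)[OF \<phi>]])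
  have m: "\<phi> \<in> borel_measurable lborel" "deriv \<phi> \<in> borel_measurable lborel"
    using borel_measurable_continuous_onI[OF c1] borel_measurable_continuous_onI[OF test_fun_C1(2)[OF \<phi>]] by simp_all
  show "set_integrable lborel \<Omega> (\<lambda>t. \<phi> t *\<^sub>R y t)" "set_integrable lborel \<Omega> (\<lambda>t. deriv \<phi> t *\<^sub>R y t)"
    using integrable_scaled[OF y[unfolded set_integrable_def] m(1) C(1)] integrable_scaled[OF y[unfolded set_integrable_def] m(2) C(2)]
    by (simp_all add: set_integrable_def mult.commute)
qed

text \<open>The product rule on an interval outside which \<open>\<phi>\<close> vanishes; the
  boundary terms drop out, and vectors are handled componentwise.\<close>

lemma prim_weak_derivative:
  fixes y :: "real \<Rightarrow> 'b::{real_inner, complete_space, second_countable_topology}"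
  assumes \<phi>: "test_fun \<Omega> \<phi>" and y: "set_integrable lborel \<Omega> y"
  shows "set_integrable lborel \<Omega> (\<lambda>t. deriv \<phi> t *\<^sub>R prim y t)"
    and "(LINT t:\<Omega>|lborel. deriv \<phi> t *\<^sub>R prim y t) = - (LINT t:\<Omega>|lborel. \<phi> t *\<^sub>R y t)"
proof -
  obtain a b C where ab: "a \<in> \<Omega>" "b \<in> \<Omega>" "a \<le> b" and z: "\<And>s. s \<notin> {a<..<b} \<Longrightarrow> \<phi> s = 0" "\<And>s. s \<notin> {a<..<b} \<Longrightarrow> deriv \<phi> s = 0"
    using test_fun_support[OF \<phi>] by metis
  have sub: "{a..b} \<subseteq> \<Omega>" by (rule Om_interval[OF ab(1,2)])
  have e1: "(\<lambda>t. indicator \<Omega> t *\<^sub>R deriv \<phi> t *\<^sub>R prim y t) = (\<lambda>t. indicator {a..b} t *\<^sub>R deriv \<phi> t *\<^sub>R prim y t)"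
  proof
    show "indicator \<Omega> t *\<^sub>R deriv \<phi> t *\<^sub>R prim y t = indicator {a..b} t *\<^sub>R deriv \<phi> t *\<^sub>R prim y t" for t
      using z(2)[of t] sub by (cases "t \<in> {a<..<b}") (auto simp: indicator_def)
  qed
  have e2: "(\<lambda>t. indicator \<Omega> t *\<^sub>R \<phi> t *\<^sub>R y t) = (\<lambda>t. indicator {a..b} t *\<^sub>R \<phi> t *\<^sub>R y t)"
  proof
    show "indicator \<Omega> t *\<^sub>R \<phi> t *\<^sub>R y t = indicator {a..b} t *\<^sub>R \<phi> t *\<^sub>R y t" for t
      using z(1)[of t] sub by (cases "t \<in> {a<..<b}") (auto simp: indicator_def)
  qed
  have "set_integrable lborel {a..b} (\<lambda>t. deriv \<phi> t *\<^sub>R prim y t)"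
    by (rule continuous_Om_set_integrable[OF _ ab(1,2)]) (intro continuous_intros test_fun_C1(2)[OF \<phi>] prim_continuous[OF y])
  then show i1: "set_integrable lborel \<Omega> (\<lambda>t. deriv \<phi> t *\<^sub>R prim y t)" by (simp only: set_integrable_def e1)
  have i2: "set_integrable lborel \<Omega> (\<lambda>t. \<phi> t *\<^sub>R y t)" by (rule test_fun_integrable(1)[OF \<phi> y])
  have "inner ((LINT t:\<Omega>|lborel. deriv \<phi> t *\<^sub>R prim y t) + (LINT t:\<Omega>|lborel. \<phi> t *\<^sub>R y t)) e = 0" for e
  proof -
    have "has_density a b \<phi> (deriv \<phi>)" by (rule has_density_C1[OF test_fun_C1[OF \<phi>]])
    from has_density_mult[OF this has_density_inner_const[OF tail_density[OF y ab(1,2)], of e]]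
    have "(LINT t:{a..b}|lborel. deriv \<phi> t * inner (prim y t) e + \<phi> t * inner (y t) e) = \<phi> b * inner (prim y b) e - \<phi> a * inner (prim y a) e"
      using ab(3) by (intro has_densityD(2)) auto
    also have "\<dots> = 0" using z(1)[of a] z(1)[of b] by simp
    finally have 0: "(LINT t:{a..b}|lborel. deriv \<phi> t * inner (prim y t) e + \<phi> t * inner (y t) e) = 0" .
    have "inner ((LINT t:\<Omega>|lborel. deriv \<phi> t *\<^sub>R prim y t) + (LINT t:\<Omega>|lborel. \<phi> t *\<^sub>R y t)) e =
      (LINT t|lborel. inner (indicator \<Omega> t *\<^sub>R deriv \<phi> t *\<^sub>R prim y t + indicator \<Omega> t *\<^sub>R \<phi> t *\<^sub>R y t) e)"
      unfolding set_lebesgue_integral_def Bochner_Integration.integral_add[OF i1[unfolded set_integrable_def] i2[unfolded set_integrable_def], symmetric]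
      by (rule integral_inner_left[symmetric]) (rule Bochner_Integration.integrable_add[OF i1[unfolded set_integrable_def] i2[unfolded set_integrable_def]])
    also have "\<dots> = (LINT t:{a..b}|lborel. deriv \<phi> t * inner (prim y t) e + \<phi> t * inner (y t) e)"
      unfolding e1[THEN fun_cong] e2[THEN fun_cong] set_lebesgue_integral_def
      by (simp add: inner_add_left distrib_left mult.assoc)
    finally show ?thesis using 0 by simp
  qed
  from this[of "(LINT t:\<Omega>|lborel. deriv \<phi> t *\<^sub>R prim y t) + (LINT t:\<Omega>|lborel. \<phi> t *\<^sub>R y t)"]
  show "(LINT t:\<Omega>|lborel. deriv \<phi> t *\<^sub>R prim y t) = - (LINT t:\<Omega>|lborel. \<phi> t *\<^sub>R y t)"
    by (simp add: eq_neg_iff_add_eq_0)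
qed

lemma prim_bounded:
  fixes y :: "real \<Rightarrow> 'b::{real_normed_vector, complete_space, second_countable_topology}"
  assumes y: "set_integrable lborel \<Omega> y"
  shows "norm (prim y t) \<le> (LINT s:\<Omega>|lborel. norm (y s))"
proof -
  have "norm (prim y t) \<le> tail (\<lambda>s. norm (y s)) t" using norm_tail_le[OF y] by (simp add: prim_def)
  also have "\<dots> \<le> (LINT s:\<Omega>|lborel. norm (y s))"
    unfolding tail_def by (rule set_integral_mono_set[OF set_integrable_norm_Om[OF y]]) auto
  finally show ?thesis .
qed

text \<open>Du Bois-Reymond: the means of \<open>x - prim y\<close> over all intervals agree, so it is constant,
  and the behaviour at the endpoint \<open>l\<close> forces the constant to vanish.\<close>

lemma weak_derivative_imp_prim:
  fixes x y x0 :: "real \<Rightarrow> 'b::{real_inner, complete_space, second_countable_topology}"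
  assumes x: "set_integrable lborel \<Omega> x" and y: "set_integrable lborel \<Omega> y"
    and weak: "\<And>\<phi>. test_fun \<Omega> \<phi> \<Longrightarrow> (LINT t:\<Omega>|lborel. deriv \<phi> t *\<^sub>R x t) = - (LINT t:\<Omega>|lborel. \<phi> t *\<^sub>R y t)"
    and x0: "AE t in lborel. t \<in> \<Omega> \<longrightarrow> x0 t = x t" "(x0 \<longlongrightarrow> 0) (at_end l)"
  shows "AE t in lborel. t \<in> \<Omega> \<longrightarrow> x t = prim y t"
proof -
  define z where "z t = x t - prim y t" for t
  have zab: "set_integrable lborel {a..b} z" if "a \<in> \<Omega>" "b \<in> \<Omega>" for a b
  proof -
    have "set_integrable lborel {a..b} x" by (rule set_integrable_subset_complete[OF x _ Om_interval[OF that]]) simp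
    moreover have "set_integrable lborel {a..b} (prim y)" by (rule continuous_Om_set_integrable[OF prim_continuous[OF y] that])
    ultimately show ?thesis by (simp add: z_def set_integrable_def scaleR_diff_right)
  qed
  have weak0: "(LINT t:\<Omega>|lborel. deriv \<phi> t * inner (z t) e) = 0" if \<phi>: "test_fun \<Omega> \<phi>" for \<phi> e
  proof -
    note i = test_fun_integrable(2)[OF \<phi> x] prim_weak_derivative(1)[OF \<phi> y]
    have "(LINT t:\<Omega>|lborel. deriv \<phi> t * inner (z t) e) =
        (LINT t|lborel. inner (indicator \<Omega> t *\<^sub>R deriv \<phi> t *\<^sub>R x t - indicator \<Omega> t *\<^sub>R deriv \<phi> t *\<^sub>R prim y t) e)"
      unfolding set_lebesgue_integral_def z_def
      by (rule Bochner_Integration.integral_cong) (auto simp: inner_diff_left right_diff_distrib)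
    also have "\<dots> = inner ((LINT t:\<Omega>|lborel. deriv \<phi> t *\<^sub>R x t) - (LINT t:\<Omega>|lborel. deriv \<phi> t *\<^sub>R prim y t)) e"
      unfolding set_lebesgue_integral_def Bochner_Integration.integral_diff[OF i[unfolded set_integrable_def], symmetric]
      by (rule integral_inner_left) (rule Bochner_Integration.integrable_diff[OF i[unfolded set_integrable_def]])
    also have "\<dots> = 0" using weak[OF \<phi>] prim_weak_derivative(2)[OF \<phi> y] by simp
    finally show ?thesis .
  qed
  have inner_int: "(LINT t:{a..b}|lborel. inner (z t) e) = inner (LINT t:{a..b}|lborel. z t) e"
    and inner_i: "set_integrable lborel {a..b} (\<lambda>t. inner (z t) e)" if "a \<in> \<Omega>" "b \<in> \<Omega>" for a b e
    using integral_inner_left[of e lborel "\<lambda>t. indicator {a..b} t *\<^sub>R z t"] integrable_inner_left[of e lborel "\<lambda>t. indicator {a..b} t *\<^sub>R z t"]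
      zab[OF that] by (simp_all add: set_integrable_def set_lebesgue_integral_def)
  \<comment> \<open>The test functions behind \<open>real_weak_derivative_zero\<close> start at
    \<open>a\<close>, hence the requirement that \<open>a\<close> be the leftmost of the four
    points.\<close>
  have mean1: "(\<beta> - \<alpha>) *\<^sub>R (LINT t:{a..b}|lborel. z t) = (b - a) *\<^sub>R (LINT t:{\<alpha>..\<beta>}|lborel. z t)"
    if O: "a \<in> \<Omega>" "b \<in> \<Omega>" "\<alpha> \<in> \<Omega>" "\<beta> \<in> \<Omega>" and ord: "a \<le> b" "a \<le> \<alpha>" "\<alpha> \<le> \<beta>" for a b \<alpha> \<beta>
  proof -
    have "max b \<beta> \<in> \<Omega>" using O by (simp add: max_def)
    then obtain b' where b': "b' \<in> \<Omega>" "max b \<beta> < b'" by (rule Om_greater)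
    have "(\<beta> - \<alpha>) * (LINT t:{a..b}|lborel. inner (z t) e) = (b - a) * (LINT t:{\<alpha>..\<beta>}|lborel. inner (z t) e)" for e
      by (rule real_weak_derivative_zero[OF Om_interval[OF O(1) b'(1)] ord(1) _ ord(2,3) _ Om_sets inner_i[OF O(1) b'(1)] weak0])
        (use b' in auto)
    then have "inner ((\<beta> - \<alpha>) *\<^sub>R (LINT t:{a..b}|lborel. z t) - (b - a) *\<^sub>R (LINT t:{\<alpha>..\<beta>}|lborel. z t)) e = 0" for e
      using inner_int O by (simp add: inner_diff_left)
    from this[of "(\<beta> - \<alpha>) *\<^sub>R (LINT t:{a..b}|lborel. z t) - (b - a) *\<^sub>R (LINT t:{\<alpha>..\<beta>}|lborel. z t)"]
    show ?thesis unfolding inner_eq_zero_iff right_minus_eq .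
  qed
  obtain \<beta> where ab: "exa 0 \<in> \<Omega>" "\<beta> \<in> \<Omega>" "exa 0 < \<beta>" using Om_greater[OF exhaust(1)[of 0]] exhaust(1)[of 0] by metis
  define c where "c = (1 / (\<beta> - exa 0)) *\<^sub>R (LINT t:{exa 0..\<beta>}|lborel. z t)"
  have mean: "(LINT t:{a..b}|lborel. z t) = (b - a) *\<^sub>R c" if O: "a \<in> \<Omega>" "b \<in> \<Omega>" and "a < b" for a b
  proof -
    \<comment> \<open>The roles of the two intervals in \<open>mean1\<close> depend on which of them
      starts further left.\<close>
    have "(\<beta> - exa 0) *\<^sub>R (LINT t:{a..b}|lborel. z t) = (b - a) *\<^sub>R (LINT t:{exa 0..\<beta>}|lborel. z t)"
    proof (cases "a \<le> exa 0")
      case True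
      show ?thesis by (rule mean1[OF O ab(1,2) less_imp_le[OF \<open>a < b\<close>] True less_imp_le[OF ab(3)]])
    next
      case False
      then have "exa 0 \<le> a" by linarith
      show ?thesis by (rule mean1[OF ab(1,2) O less_imp_le[OF ab(3)] \<open>exa 0 \<le> a\<close> less_imp_le[OF \<open>a < b\<close>], symmetric])
    qed
    then have "(1 / (\<beta> - exa 0)) *\<^sub>R (\<beta> - exa 0) *\<^sub>R (LINT t:{a..b}|lborel. z t) = (1 / (\<beta> - exa 0)) *\<^sub>R (b - a) *\<^sub>R (LINT t:{exa 0..\<beta>}|lborel. z t)"
      by simp
    then show ?thesis using ab(3) by (simp add: c_def mult.commute)
  qed
  have fin: "integrable lborel (indicator {a..b} :: real \<Rightarrow> real)" for a b :: real
    by (intro integrable_real_indicator) (simp_all add: emeasure_lborel_Icc_eq)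
  have "AE t in lborel. t \<in> \<Omega> \<longrightarrow> z t - c = 0"
  proof (rule AE_zero_vector)
    fix a b
    have 1: "integrable lborel (\<lambda>t. indicator ({a..b} \<inter> \<Omega>) t *\<^sub>R x t)"
      using set_integrable_subset_complete[OF x, of "{a..b} \<inter> \<Omega>"] by (simp add: set_integrable_def)
    have 2: "integrable lborel (\<lambda>t. indicator ({a..b} \<inter> \<Omega>) t *\<^sub>R (prim y t + c))"
    proof (rule integrable_bound_complete)
      have "continuous_on \<Omega> (\<lambda>t. prim y t + c)" by (intro continuous_intros prim_continuous[OF y])
      note m = Om_measurable[OF this]
      have "(\<lambda>t. indicator {a..b} t *\<^sub>R (indicator \<Omega> t *\<^sub>R (prim y t + c))) \<in> borel_measurable lborel"
        by (rule borel_measurable_scaleR[OF borel_measurable_indicator m]) simp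
      moreover have "(\<lambda>t. indicator {a..b} t *\<^sub>R (indicator \<Omega> t *\<^sub>R (prim y t + c))) = (\<lambda>t. indicator ({a..b} \<inter> \<Omega>) t *\<^sub>R (prim y t + c))"
        by (auto simp: fun_eq_iff indicator_def)
      ultimately show "(\<lambda>t. indicator ({a..b} \<inter> \<Omega>) t *\<^sub>R (prim y t + c)) \<in> borel_measurable lborel" by simp
      show "integrable lborel (\<lambda>t. ((LINT s:\<Omega>|lborel. norm (y s)) + norm c) * indicator {a..b} t)"
        by (intro integrable_mult_right fin)
      have le: "norm (prim y t + c) \<le> (LINT s:\<Omega>|lborel. norm (y s)) + norm c" for t
        using norm_triangle_ineq[of "prim y t" c] prim_bounded[OF y, of t] by linarith
      have nn: "0 \<le> (LINT s:\<Omega>|lborel. norm (y s)) + norm c" using le[of 0] norm_ge_zero order_trans by blast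
      show "AE t in lborel. norm (indicator ({a..b} \<inter> \<Omega>) t *\<^sub>R (prim y t + c)) \<le> ((LINT s:\<Omega>|lborel. norm (y s)) + norm c) * indicator {a..b} t"
        by (rule AE_I2) (use le nn in \<open>simp add: indicator_def\<close>)
    qed
    have "(\<lambda>t. indicator ({a..b} \<inter> \<Omega>) t *\<^sub>R x t - indicator ({a..b} \<inter> \<Omega>) t *\<^sub>R (prim y t + c)) = (\<lambda>t. indicator ({a..b} \<inter> \<Omega>) t *\<^sub>R (z t - c))"
      by (auto simp: fun_eq_iff z_def indicator_def)
    then show "integrable lborel (\<lambda>t. indicator ({a..b} \<inter> \<Omega>) t *\<^sub>R (z t - c))"
      using Bochner_Integration.integrable_diff[OF 1 2] by simp
  next
    fix a b assume O: "a \<in> \<Omega>" "b \<in> \<Omega>" "a < b"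
    have i: "integrable lborel (\<lambda>t. indicator {a..b} t *\<^sub>R z t)" using zab[OF O(1,2)] by (simp add: set_integrable_def)
    have i2: "integrable lborel (\<lambda>t. indicator {a..b} t *\<^sub>R c)" using fin by simp
    have "(LINT t:{a..b}|lborel. z t - c) = (LINT t:{a..b}|lborel. z t) - (LINT t|lborel. indicator {a..b} t *\<^sub>R c)"
      unfolding set_lebesgue_integral_def scaleR_diff_right by (rule Bochner_Integration.integral_diff[OF i i2])
    also have "(LINT t|lborel. indicator {a..b} t *\<^sub>R c) = (b - a) *\<^sub>R c"
      using integral_scaleR_left[of c lborel "indicator {a..b}"] fin O(3) by simp
    finally show "(LINT t:{a..b}|lborel. z t - c) = 0" using mean[OF O] by simp
  qed
  then have xc: "AE t in lborel. t \<in> \<Omega> \<longrightarrow> x0 t - prim y t = c \<and> x t - prim y t = c"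
    using x0(1) by eventually_elim (auto simp: z_def)
  \<comment> \<open>The difference is known to equal \<open>c\<close> only almost everywhere, so the
    contradiction comes from a nonempty open set, the points of \<open>\<Omega>\<close> beyond
    \<open>b\<close>.\<close>
  have "c = 0"
  proof (rule ccontr)
    assume "c \<noteq> 0"
    have "((\<lambda>t. x0 t - prim y t) \<longlongrightarrow> 0 - 0) (at_end l)" by (intro tendsto_diff x0(2) prim_tendsto_end[OF y])
    then have "\<forall>\<^sub>F t in at_end l. dist (x0 t - prim y t) 0 < norm c" using \<open>c \<noteq> 0\<close> by (intro tendstoD) auto
    then obtain b where b: "b \<in> \<Omega>" "\<And>t. t \<in> \<Omega> \<Longrightarrow> b < t \<Longrightarrow> norm (x0 t - prim y t) < norm c"
      using at_end_eventuallyD by fastforce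
    have "AE t in lborel. t \<notin> \<Omega> \<inter> {b<..}"
      using xc by eventually_elim (use b(2) in fastforce)
    then have "\<Omega> \<inter> {b<..} = {}" by (intro AE_not_in_open_imp_empty open_Int Om_open open_greaterThan)
    then show False using Om_greater[OF b(1)] by blast
  qed
  show ?thesis using xc unfolding \<open>c = 0\<close> by eventually_elim auto
qed

end

subsection \<open>The generator as a relation on \<open>H \<times> H \<times> L2\<close>\<close>

text \<open>The Lax-Milgram argument: a solution is a fixed point of
  \<open>v - th (S v - b)\<close>, which is a contraction for a suitable \<open>th\<close>.\<close>

lemma coercive_surj:
  fixes S :: "'a::{real_inner, complete_space} \<Rightarrow> 'a"
  assumes S: "bounded_linear S" and r: "0 < r" "\<And>v. r * (norm v)\<^sup>2 \<le> inner (S v) v"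
  shows "\<exists>v. S v = b"
proof -
  interpret S: bounded_linear S by (rule S)
  obtain M where M: "0 < M" "\<And>v. norm (S v) \<le> norm v * M" using S.pos_bounded by blast
  \<comment> \<open>The maximum with \<open>r\<close> makes \<open>1 - r^2 / K^2\<close>
    nonnegative. The later choice \<open>th = r / K^2\<close> minimises the squared contraction
    factor \<open>1 - 2 th r + th^2 K^2\<close>.\<close>
  define K where "K = max M r"
  have K: "0 < K" "r \<le> K" "norm (S v) \<le> K * norm v" for v
    using M(1) M(2)[of v] mult_left_mono[of M K "norm v"] by (auto simp: K_def mult.commute)
  define th where "th = r / K\<^sup>2"
  have th: "0 < th" using r K by (simp add: th_def)
  define c where "c = sqrt (1 - r\<^sup>2 / K\<^sup>2)"
  have rK: "r\<^sup>2 / K\<^sup>2 \<le> 1" using r K power_mono[OF K(2), of 2] by simp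
  have c: "0 \<le> c" "c < 1" using rK r K by (simp_all add: c_def)
  have lip: "dist (x - th *\<^sub>R (S x - b)) (y - th *\<^sub>R (S y - b)) \<le> c * dist x y" for x y
  proof -
    define d where "d = x - y"
    have "(norm (d - th *\<^sub>R S d))\<^sup>2 = (norm d)\<^sup>2 - 2 * th * inner (S d) d + th\<^sup>2 * (norm (S d))\<^sup>2"
      unfolding power2_norm_eq_inner by (simp add: inner_diff inner_commute power2_eq_square algebra_simps)
    also have "\<dots> \<le> (norm d)\<^sup>2 - 2 * th * (r * (norm d)\<^sup>2) + th\<^sup>2 * (K * norm d)\<^sup>2"
      using th r(2)[of d] K(3)[of d] by (intro add_mono diff_mono mult_left_mono power_mono order_refl) auto
    also have "\<dots> = (1 - r\<^sup>2 / K\<^sup>2) * (norm d)\<^sup>2"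
      using K(1) by (simp add: th_def power2_eq_square field_simps)
    also have "\<dots> = (c * norm d)\<^sup>2" using rK by (simp add: c_def power_mult_distrib)
    finally have "norm (d - th *\<^sub>R S d) \<le> c * norm d" using c by (simp add: abs_le_square_iff[symmetric])
    moreover have e: "x - th *\<^sub>R (S x - b) - (y - th *\<^sub>R (S y - b)) = d - th *\<^sub>R S d"
      by (simp add: d_def S.diff scaleR_diff_right)
    ultimately show ?thesis unfolding dist_norm e d_def by simp
  qed
  have "\<exists>!x. x - th *\<^sub>R (S x - b) = x" by (rule banach_fix_type[OF c]) (use lip in blast)
  then obtain x where "x - th *\<^sub>R (S x - b) = x" by blast
  then show ?thesis using th by (intro exI[of _ x]) simp
qed

context kernel begin

section \<open>Weighted functions modulo null sets and the restriction to the interval\<close>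

lemma emb_cong: "(\<And>t. t \<in> \<Omega> \<Longrightarrow> x t = y t) \<Longrightarrow> emb x = emb y"
  by (auto simp: emb_def fun_eq_iff)

lemma in_W_cong: "(\<And>t. t \<in> \<Omega> \<Longrightarrow> x t = y t) \<Longrightarrow> in_W x = in_W y"
  using emb_cong[of x y] by (simp add: in_W_def)

lemma emb_add: "emb (\<lambda>t. x t + y t) = (\<lambda>t. emb x t + emb y t)" by (simp add: emb_def scaleR_add_right fun_eq_iff)
lemma emb_scaleR: "emb (\<lambda>t. c *\<^sub>R x t) = (\<lambda>t. c *\<^sub>R emb x t)" by (simp add: emb_def fun_eq_iff)

definition clW :: "(real \<Rightarrow> 'b::{real_inner, second_countable_topology}) \<Rightarrow> 'b L2" where
  "clW x = cls (emb x)"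

text \<open>Multiplication by the indicator of \<open>\<Omega>\<close> on classes, that is, the
  orthogonal projection onto the image of the weighted space.\<close>

definition cut :: "('b::{real_inner, second_countable_topology}) L2 \<Rightarrow> 'b L2" where
  "cut f = clW (unemb (rep_L2 f))"

lemma clW_cong: "(\<And>t. t \<in> \<Omega> \<Longrightarrow> x t = y t) \<Longrightarrow> clW x = clW y"
  using emb_cong[of x y] by (simp add: clW_def)

lemma clW_add: "in_W x \<Longrightarrow> in_W y \<Longrightarrow> clW (\<lambda>t. x t + y t) = clW x + clW y"
  by (simp add: clW_def in_W_def cls_add emb_add)

lemma clW_scaleR: "in_W x \<Longrightarrow> clW (\<lambda>t. c *\<^sub>R x t) = c *\<^sub>R clW x"
  by (simp add: clW_def in_W_def cls_scaleR emb_scaleR)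

lemma clW_diff: assumes "in_W x" "in_W y" shows "clW (\<lambda>t. x t - y t) = clW x - clW y"
proof -
  have "in_W (\<lambda>t. (-1) *\<^sub>R y t)" by (rule in_W_scaleR[OF assms(2)])
  from clW_add[OF assms(1) this] clW_scaleR[OF assms(2), of "-1"] show ?thesis by simp
qed

lemma clW_eq_iff:
  assumes "in_W x" "in_W y" shows "clW x = clW y \<longleftrightarrow> (AE t in lborel. t \<in> \<Omega> \<longrightarrow> x t = y t)"
proof -
  have "emb x t = emb y t \<longleftrightarrow> (t \<in> \<Omega> \<longrightarrow> x t = y t)" for t
    using nu_pos[of t] by (auto simp: emb_def)
  then show ?thesis using assms by (simp add: clW_def in_W_def cls_eq_iff)
qed

lemma clW_inner: "in_W x \<Longrightarrow> in_W y \<Longrightarrow> inner (clW y) (clW x) = (LINT t:\<Omega>|lborel. nu t * inner (y t) (x t))"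
  by (simp add: clW_def in_W_def cls_inner emb_inner set_lebesgue_integral_def)

lemma clW_norm: "in_W x \<Longrightarrow> (norm (clW x))\<^sup>2 = (LINT t:\<Omega>|lborel. nu t * (norm (x t))\<^sup>2)"
  by (simp add: power2_norm_eq_inner clW_inner)

lemma in_W_rep: "in_W (unemb (rep_L2 f))"
  by (rule in_W_unemb[OF sq_integrable_rep])

lemma unemb_rep_clW: assumes "in_W x" shows "AE t in lborel. t \<in> \<Omega> \<longrightarrow> unemb (rep_L2 (clW x)) t = x t"
  using rep_cls[of "emb x"] assms unfolding in_W_def clW_def
  by (auto simp: unemb_def emb_def sqrt_mu_nu elim!: eventually_mono)

lemma cut_clW [simp]: "in_W x \<Longrightarrow> cut (clW x) = clW x"
  unfolding cut_def using unemb_rep_clW by (subst clW_eq_iff) (auto intro: in_W_rep)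

lemma cut_cut [simp]: "cut (cut f) = cut f"
  unfolding cut_def[of f] by (rule cut_clW[OF in_W_rep])

lemma cut_add: "cut (f + g) = cut f + cut g"
proof -
  have "AE t in lborel. t \<in> \<Omega> \<longrightarrow> unemb (rep_L2 (f + g)) t = unemb (rep_L2 f) t + unemb (rep_L2 g) t"
    using rep_add[of f g] by eventually_elim (simp add: unemb_def scaleR_add_right)
  then have "cut (f + g) = clW (\<lambda>t. unemb (rep_L2 f) t + unemb (rep_L2 g) t)"
    unfolding cut_def by (subst clW_eq_iff) (intro in_W_rep in_W_add | assumption)+
  then show ?thesis by (simp add: cut_def clW_add in_W_rep)
qed

lemma cut_scaleR: "cut (c *\<^sub>R f) = c *\<^sub>R cut f"
proof -
  have "AE t in lborel. t \<in> \<Omega> \<longrightarrow> unemb (rep_L2 (c *\<^sub>R f)) t = c *\<^sub>R unemb (rep_L2 f) t"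
    using rep_scaleR[of c f] by eventually_elim (simp add: unemb_def)
  then have "cut (c *\<^sub>R f) = clW (\<lambda>t. c *\<^sub>R unemb (rep_L2 f) t)"
    unfolding cut_def by (subst clW_eq_iff) (intro in_W_rep in_W_scaleR | assumption)+
  then show ?thesis by (simp add: cut_def clW_scaleR in_W_rep)
qed

lemma cut_linear: "linear cut" by (intro linearI cut_add cut_scaleR)

lemma inner_cut: assumes "in_W x" shows "inner (clW x) (cut f) = inner (clW x) f"
proof -
  have "inner (emb x t) (emb (unemb (rep_L2 f)) t) = inner (emb x t) (rep_L2 f t)" for t
    by (cases "t \<in> \<Omega>") (simp_all add: emb_unemb emb_def[of x])
  then have "inner (clW x) (cut f) = inner (clW x) (cls (rep_L2 f))"
    using assms in_W_rep[of f] unfolding clW_def cut_def in_W_def by (simp only: cls_inner sq_integrable_rep)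
  then show ?thesis by simp
qed

lemma norm_cut_le: "norm (cut f) \<le> norm f"
proof -
  have "norm (cut f) * norm (cut f) = inner (cut f) f"
    using inner_cut[OF in_W_rep, of f f] by (simp add: cut_def[symmetric] power2_eq_square[symmetric] power2_norm_eq_inner)
  also have "\<dots> \<le> norm (cut f) * norm f" by (rule norm_cauchy_schwarz)
  finally show ?thesis using norm_ge_zero[of f] by (cases "cut f = 0") (simp_all add: mult_le_cancel_left)
qed

lemma cut_bounded_linear: "bounded_linear cut"
  by (rule bounded_linear_intro[of _ 1]) (simp_all add: cut_add cut_scaleR norm_cut_le)

lemma tail_add:
  fixes x y :: "real \<Rightarrow> 'b::{real_normed_vector, complete_space, second_countable_topology}"
  assumes "set_integrable lborel \<Omega> x" "set_integrable lborel \<Omega> y"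
  shows "tail (\<lambda>s. x s + y s) t = tail x t + tail y t"
  using Bochner_Integration.integral_add[OF assms[THEN tail_integrable, of t, unfolded set_integrable_def]]
  by (simp add: tail_def set_lebesgue_integral_def scaleR_add_right)

lemma tail_scaleR:
  fixes x :: "real \<Rightarrow> 'b::{real_inner, complete_space, second_countable_topology}"
  assumes "set_integrable lborel \<Omega> x"
  shows "tail (\<lambda>s. c *\<^sub>R x s) t = c *\<^sub>R tail x t"
  using integral_scaleR_right[where c = c and M = lborel and f = "\<lambda>s. indicator ({t<..} \<inter> \<Omega>) s *\<^sub>R x s"] tail_integrable[OF assms, of t]
  by (simp add: tail_def set_lebesgue_integral_def set_integrable_def scaleR_left_commute)

lemma prim_add:
  fixes x y :: "real \<Rightarrow> 'b::{real_normed_vector, complete_space, second_countable_topology}"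
  assumes "set_integrable lborel \<Omega> x" "set_integrable lborel \<Omega> y"
  shows "prim (\<lambda>s. x s + y s) = (\<lambda>t. prim x t + prim y t)"
  by (simp add: prim_def tail_add[OF assms] fun_eq_iff)

lemma prim_scaleR:
  fixes x :: "real \<Rightarrow> 'b::{real_inner, complete_space, second_countable_topology}"
  assumes "set_integrable lborel \<Omega> x"
  shows "prim (\<lambda>s. c *\<^sub>R x s) = (\<lambda>t. c *\<^sub>R prim x t)"
  by (simp add: prim_def tail_scaleR[OF assms] fun_eq_iff)

lemma set_integral_bounded_linear:
  assumes "bounded_linear T" "set_integrable M X f"
  shows "(LINT t:X|M. T (f t)) = T (LINT t:X|M. f t)" "set_integrable M X (\<lambda>t. T (f t))"
proof -
  interpret T: bounded_linear T by fact
  show "(LINT t:X|M. T (f t)) = T (LINT t:X|M. f t)" "set_integrable M X (\<lambda>t. T (f t))"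
    using integral_bounded_linear[OF assms(1) assms(2)[unfolded set_integrable_def]]
      integrable_bounded_linear[OF assms(1) assms(2)[unfolded set_integrable_def]]
    by (simp_all add: set_lebesgue_integral_def set_integrable_def T.scaleR)
qed

end

section \<open>The generator relation for an abstract inverse square root\<close>

locale memory = kernel l \<mu> d\<nu> for l \<mu> d\<nu> +
  fixes R :: "'h::{real_inner, complete_space, second_countable_topology} \<Rightarrow> 'h"
  assumes R_bl: "bounded_linear R" and R_sym: "inner (R u) v = inner u (R v)" and R_inj: "R v = 0 \<Longrightarrow> v = 0"
begin

lemma R_add: "R (u + v) = R u + R v" and R_diff: "R (u - v) = R u - R v" and R_scale: "R (c *\<^sub>R u) = c *\<^sub>R R u"
  and R_minus: "R (- u) = - R u" and R_0: "R 0 = 0"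
proof -
  interpret R: bounded_linear R by (rule R_bl)
  show "R (u + v) = R u + R v" "R (u - v) = R u - R v" "R (c *\<^sub>R u) = c *\<^sub>R R u" "R (- u) = - R u" "R 0 = 0"
    by (simp_all add: R.add R.diff R.scaleR R.neg R.zero)
qed

lemma R_eq_iff: "R u = R v \<longleftrightarrow> u = v"
  using R_inj[of "u - v"] by (auto simp: R_diff)

text \<open>\<open>(p, v, f)\<close> stands for the state \<open>(R p, v, R x)\<close> where \<open>f = \<surd>\<nu> x\<close> on \<open>\<Omega>\<close>. The part of \<open>f\<close> outside \<open>\<Omega>\<close> is
  left free and sent to 0, which keeps the relation maximal on the whole of \<open>L2\<close>; \<open>w = - A (u + \<integral>\<xi>)\<close> is written
  without \<open>A\<close>.\<close>

definition gen_by :: "(real \<Rightarrow> 'h) \<Rightarrow> 'h \<Rightarrow> 'h \<Rightarrow> 'h L2 \<Rightarrow> 'h \<Rightarrow> 'h \<Rightarrow> 'h L2 \<Rightarrow> bool" where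
  "gen_by y p v f q w g \<longleftrightarrow> in_W y \<and> in_W (prim y) \<and> v = R q \<and> p + (LINT t:\<Omega>|lborel. prim y t) = - R w
     \<and> cut f = clW (prim y) \<and> g = clW (\<lambda>t. y t + \<mu> t *\<^sub>R q)"

definition gen :: "(('h \<times> 'h \<times> 'h L2) \<times> ('h \<times> 'h \<times> 'h L2)) set" where
  "gen = {((p, v, f), (q, w, g)) | p v f q w g. \<exists>y. gen_by y p v f q w g}"

lemma gen_iff: "((p, v, f), (q, w, g)) \<in> gen \<longleftrightarrow> (\<exists>y. gen_by y p v f q w g)"
  by (simp add: gen_def)

lemma gen_by_add:
  assumes "gen_by y p v f q w g" "gen_by y' p' v' f' q' w' g'"
  shows "gen_by (\<lambda>t. y t + y' t) (p + p') (v + v') (f + f') (q + q') (w + w') (g + g')"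
proof -
  have y: "in_W y" "in_W y'" "in_W (prim y)" "in_W (prim y')" using assms by (simp_all add: gen_by_def)
  have i: "set_integrable lborel \<Omega> (prim y)" "set_integrable lborel \<Omega> (prim y')"
    using y(3,4) by (intro in_W_integrable; simp)+
  have e: "prim (\<lambda>t. y t + y' t) = (\<lambda>t. prim y t + prim y' t)"
    by (rule prim_add[OF in_W_integrable[OF y(1)] in_W_integrable[OF y(2)]])
  have I: "(LINT t:\<Omega>|lborel. prim y t + prim y' t) = (LINT t:\<Omega>|lborel. prim y t) + (LINT t:\<Omega>|lborel. prim y' t)"
    unfolding set_lebesgue_integral_def scaleR_add_right
    by (rule Bochner_Integration.integral_add[OF i[unfolded set_integrable_def]])
  have "clW (\<lambda>t. (y t + y' t) + \<mu> t *\<^sub>R (q + q')) = clW (\<lambda>t. (y t + \<mu> t *\<^sub>R q) + (y' t + \<mu> t *\<^sub>R q'))"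
    by (simp add: algebra_simps)
  also have "\<dots> = clW (\<lambda>t. y t + \<mu> t *\<^sub>R q) + clW (\<lambda>t. y' t + \<mu> t *\<^sub>R q')"
    by (intro clW_add in_W_add in_W_mu y)
  finally have G: "clW (\<lambda>t. (y t + y' t) + \<mu> t *\<^sub>R (q + q')) = clW (\<lambda>t. y t + \<mu> t *\<^sub>R q) + clW (\<lambda>t. y' t + \<mu> t *\<^sub>R q')" .
  have "(p + p') + ((LINT t:\<Omega>|lborel. prim y t) + (LINT t:\<Omega>|lborel. prim y' t)) = - R w + - R w'"
    proof -
    have "p + (LINT t:\<Omega>|lborel. prim y t) = - R w" "p' + (LINT t:\<Omega>|lborel. prim y' t) = - R w'"
      using assms by (simp_all add: gen_by_def)
    from arg_cong2[OF this, of "(+)"] show ?thesis by (simp add: add_ac)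
  qed
  moreover have "in_W (\<lambda>t. y t + y' t)" "in_W (\<lambda>t. prim y t + prim y' t)" by (intro in_W_add y)+
  ultimately show ?thesis using assms unfolding gen_by_def e I G
    by (simp add: R_add cut_add clW_add)
qed

lemma gen_by_scale:
  assumes "gen_by y p v f q w g"
  shows "gen_by (\<lambda>t. c *\<^sub>R y t) (c *\<^sub>R p) (c *\<^sub>R v) (c *\<^sub>R f) (c *\<^sub>R q) (c *\<^sub>R w) (c *\<^sub>R g)"
proof -
  have y: "in_W y" "in_W (prim y)" using assms by (simp_all add: gen_by_def)
  have i: "set_integrable lborel \<Omega> (prim y)" by (rule in_W_integrable[OF y(2)])
  have e: "prim (\<lambda>t. c *\<^sub>R y t) = (\<lambda>t. c *\<^sub>R prim y t)"
    by (rule prim_scaleR[OF in_W_integrable[OF y(1)]])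
  have I: "(LINT t:\<Omega>|lborel. c *\<^sub>R prim y t) = c *\<^sub>R (LINT t:\<Omega>|lborel. prim y t)"
    by (rule set_integral_bounded_linear(1)[OF bounded_linear_scaleR_right i])
  have "clW (\<lambda>t. c *\<^sub>R y t + \<mu> t *\<^sub>R c *\<^sub>R q) = clW (\<lambda>t. c *\<^sub>R (y t + \<mu> t *\<^sub>R q))"
    by (simp add: algebra_simps)
  also have "\<dots> = c *\<^sub>R clW (\<lambda>t. y t + \<mu> t *\<^sub>R q)"
    by (intro clW_scaleR in_W_add in_W_mu y)
  finally have G: "clW (\<lambda>t. c *\<^sub>R y t + \<mu> t *\<^sub>R c *\<^sub>R q) = c *\<^sub>R clW (\<lambda>t. y t + \<mu> t *\<^sub>R q)" .
  have "c *\<^sub>R p + c *\<^sub>R (LINT t:\<Omega>|lborel. prim y t) = - (c *\<^sub>R R w)"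
    using assms by (simp add: gen_by_def scaleR_add_right[symmetric])
  moreover have "in_W (\<lambda>t. c *\<^sub>R y t)" "in_W (\<lambda>t. c *\<^sub>R prim y t)" by (intro in_W_scaleR y)+
  ultimately show ?thesis using assms unfolding gen_by_def e I G
    by (simp add: R_scale cut_scaleR clW_scaleR)
qed

text \<open>The terms coupling the components cancel. As \<open>\<mu> t * nu t = 1\<close>, the
  forcing term contributes \<open>inner q\<close> of the memory integral; its sum with
  \<open>inner q p\<close> and \<open>inner w (R q)\<close> vanishes by
  \<open>p + \<integral>x = - R w\<close>.\<close>

lemma gen_by_inner:
  assumes "gen_by y p v f q w g"
  shows "inner (q, w, g) (p, v, f) = (LINT t:\<Omega>|lborel. nu t * inner (y t) (prim y t))"
proof -
  have y: "in_W y" "in_W (prim y)" using assms by (simp_all add: gen_by_def)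
  have g: "in_W (\<lambda>t. y t + \<mu> t *\<^sub>R q)" by (intro in_W_add in_W_mu y)
  have i: "set_integrable lborel \<Omega> (prim y)" by (rule in_W_integrable[OF y(2)])
  have "inner g f = inner (clW (\<lambda>t. y t + \<mu> t *\<^sub>R q)) (clW (prim y))"
    using assms inner_cut[OF g, of f] by (simp add: gen_by_def)
  also have "\<dots> = (LINT t:\<Omega>|lborel. nu t * inner (y t + \<mu> t *\<^sub>R q) (prim y t))"
    by (rule clW_inner[OF y(2) g])
  also have "\<dots> = (LINT t:\<Omega>|lborel. nu t * inner (y t) (prim y t) + inner q (prim y t))"
    by (rule set_lebesgue_integral_cong) (use mu_nu in \<open>auto simp: inner_add_left algebra_simps\<close>)
  also have "\<dots> = (LINT t:\<Omega>|lborel. nu t * inner (y t) (prim y t)) + inner q (LINT t:\<Omega>|lborel. prim y t)"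
    using set_integral_add(2)[OF in_W_inner_integrable[OF y(2,1)] set_integral_bounded_linear(2)[OF bounded_linear_inner_right i, of q]]
      set_integral_bounded_linear(1)[OF bounded_linear_inner_right i, of q] by simp
  finally have "inner g f = \<dots>" .
  moreover have "inner w (R q) = - inner q (p + (LINT t:\<Omega>|lborel. prim y t))"
    using assms R_sym[of w q] by (simp add: gen_by_def inner_commute)
  ultimately show ?thesis using assms by (simp add: gen_by_def inner_add_right)
qed

lemma gen_dissipative: assumes "(X, Y) \<in> gen" shows "inner Y X \<le> 0"
proof -
  obtain y p v f q w g where XY: "X = (p, v, f)" "Y = (q, w, g)" and y: "gen_by y p v f q w g"
    using assms by (auto simp: gen_def)
  have W: "in_W y" "in_W (prim y)" using y by (simp_all add: gen_by_def)
  obtain L where L: "0 \<le> L" "2 * (LINT \<tau>:\<Omega>|lborel. nu \<tau> * inner (y \<tau>) (prim y \<tau>)) = - L - (LINT \<tau>:\<Omega>|lborel. dn \<tau> * (norm (prim y \<tau>))\<^sup>2)"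
    by (rule energy_identity[OF W])
  have "0 \<le> (LINT \<tau>:\<Omega>|lborel. dn \<tau> * (norm (prim y \<tau>))\<^sup>2)"
    unfolding set_lebesgue_integral_def
  proof (rule Bochner_Integration.integral_nonneg)
    show "0 \<le> indicator \<Omega> t *\<^sub>R (dn t * (norm (prim y t))\<^sup>2)" for t
      using dn_nonneg[of t] by (cases "t \<in> \<Omega>") simp_all
  qed
  then show ?thesis using L gen_by_inner[OF y] XY by simp
qed

text \<open>Injectivity of \<open>R\<close> settles two components; for the third, a primitive that
  vanishes almost everywhere has a derivative that does so too.\<close>

lemma gen_single: assumes "(0, Y) \<in> gen" shows "Y = 0"
proof -
  obtain y q w g where Y: "Y = (q, w, g)" and y: "gen_by y 0 0 0 q w g"
    using assms by (auto simp: gen_def zero_prod_def)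
  have W: "in_W y" "in_W (prim y)" using y by (simp_all add: gen_by_def)
  have yi: "set_integrable lborel \<Omega> y" by (rule in_W_integrable[OF W(1)])
  have q: "q = 0" using y R_inj[of q] by (simp add: gen_by_def)
  have W0: "in_W (\<lambda>t. 0::'h)" using in_W_mu[of "0::'h"] by simp
  have c0: "clW (\<lambda>t. 0::'h) = 0" using clW_scaleR[OF W0, of 0] by simp
  have "cut (0::'h L2) = 0" by (rule linear_0[OF cut_linear])
  then have "clW (prim y) = clW (\<lambda>t. 0)" using y c0 by (simp add: gen_by_def)
  then have z: "AE t in lborel. t \<in> \<Omega> \<longrightarrow> prim y t = 0" using clW_eq_iff[OF W(2) W0] by simp
  have "(LINT t:\<Omega>|lborel. prim y t) = (LINT t:\<Omega>|lborel. (0::'h))"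
    by (rule set_lebesgue_integral_cong) (use prim_AE_zero(1)[OF yi z] in auto)
  then have w: "w = 0" using y R_inj[of w] by (simp add: gen_by_def)
  have "clW y = clW (\<lambda>t. 0)" using prim_AE_zero(2)[OF yi z] by (subst clW_eq_iff[OF W(1) W0])
  then have "g = 0" using y q c0 by (simp add: gen_by_def)
  then show ?thesis using Y q w by (simp add: zero_prod_def)
qed

lemma gen_subspace: "subspace gen"
proof (rule subspaceI)
  have W0: "in_W (\<lambda>t. 0::'h)" using in_W_mu[of "0::'h"] by simp
  have c0: "clW (\<lambda>t. 0::'h) = 0" using clW_scaleR[OF W0, of 0] by simp
  have p0: "prim (\<lambda>t. 0::'h) = (\<lambda>t. 0)" by (simp add: prim_def tail_def set_lebesgue_integral_def fun_eq_iff)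
  have "gen_by (\<lambda>t. 0) 0 0 0 0 0 0"
    by (simp add: gen_by_def p0 W0 c0 R_0 linear_0[OF cut_linear] set_lebesgue_integral_def)
  then show "0 \<in> gen" by (auto simp: gen_def zero_prod_def)
next
  fix X Y assume "X \<in> gen" "Y \<in> gen"
  then obtain y p v f q w g y' p' v' f' q' w' g' where "X = ((p, v, f), (q, w, g))" "Y = ((p', v', f'), (q', w', g'))"
      "gen_by y p v f q w g" "gen_by y' p' v' f' q' w' g'" unfolding gen_def by blast
  then show "X + Y \<in> gen" using gen_by_add by (simp add: gen_iff) blast
next
  fix c X assume "X \<in> gen"
  then obtain y p v f q w g where "X = ((p, v, f), (q, w, g))" "gen_by y p v f q w g" unfolding gen_def by blast
  then show "c *\<^sub>R X \<in> gen" using gen_by_scale by (simp add: gen_iff) blast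
qed

lemma res_mu:
  fixes q :: 'h
  assumes "0 < r" shows "res r (\<lambda>t. \<mu> t *\<^sub>R q) t = res r \<mu> t *\<^sub>R q"
proof -
  have W: "in_W \<mu>" using in_W_mu[of "1::real"] by simp
  have i: "set_integrable lborel \<Omega> (\<lambda>s. exp (- r * s) *\<^sub>R \<mu> s)" by (rule damped_integrable[OF assms W mu_summable])
  show ?thesis
    using integral_bounded_linear[OF bounded_linear_scaleR_left tail_integrable[OF i, of t, unfolded set_integrable_def], of q]
    by (simp add: res_def tail_def set_lebesgue_integral_def)
qed

lemma res_add:
  fixes x y :: "real \<Rightarrow> 'h"
  assumes r: "0 < r" and "in_W x" "in_W y" shows "res r (\<lambda>t. x t + y t) t = res r x t + res r y t"
  using tail_add[OF damped_integrable[OF r assms(2) in_W_integrable[OF assms(2)]] damped_integrable[OF r assms(3) in_W_integrable[OF assms(3)]], of t]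
  by (simp add: res_def scaleR_add_right)

text \<open>The resolvent equation reduces to a coercive equation for \<open>q = B v\<close>.\<close>

lemma gen_range:
  assumes h: "0 < h" shows "\<exists>X Y. (X, Y) \<in> gen \<and> X - h *\<^sub>R Y = Z"
proof -
  obtain g1 g2 g3 where Z: "Z = (g1, g2, g3)" by (cases Z)
  define r where "r = 1 / h"
  have r: "0 < r" "h * r = 1" using h by (simp_all add: r_def)
  have Wm: "in_W \<mu>" using in_W_mu[of "1::real"] by simp
  define c where "c = (LINT t:\<Omega>|lborel. res r \<mu> t)"
  have mi: "set_integrable lborel \<Omega> (res r \<mu>)" by (rule in_W_integrable[OF res_in_W[OF r(1) Wm]])
  have "0 \<le> res r \<mu> t" for t
  proof -
    have "0 \<le> indicator ({t<..} \<inter> \<Omega>) s *\<^sub>R exp (- r * s) *\<^sub>R \<mu> s" for s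
      using mu_pos by (cases "s \<in> \<Omega>") (simp_all add: less_imp_le)
    then show ?thesis unfolding res_def tail_def set_lebesgue_integral_def
      by (intro scaleR_nonneg_nonneg[OF exp_ge_zero] Bochner_Integration.integral_nonneg)
  qed
  then have c: "0 \<le> c" unfolding c_def set_lebesgue_integral_def
    by (intro Bochner_Integration.integral_nonneg) auto
  define k where "k t = r *\<^sub>R unemb (rep_L2 g3) t" for t
  have Wk: "in_W k" unfolding k_def by (intro in_W_scaleR in_W_rep)
  \<comment> \<open>Obtained by inserting \<open>p = g1 + h q\<close>,
    \<open>w = r (R q - g2)\<close> and the memory solution with datum \<open>\<mu> q + k\<close>
    into \<open>p + \<integral>x = - R w\<close>. Nonnegativity of \<open>c\<close> makes it
    coercive with constant \<open>h\<close>.\<close>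
  define S where "S q = (h + c) *\<^sub>R q + r *\<^sub>R R (R q)" for q
  have "bounded_linear S" unfolding S_def
    by (intro bounded_linear_add bounded_linear_scaleR_right bounded_linear_ident
        bounded_linear_compose[OF bounded_linear_scaleR_right, of "\<lambda>q. R (R q)"] bounded_linear_compose[OF R_bl R_bl])
  moreover have "h * (norm q)\<^sup>2 \<le> inner (S q) q" for q
  proof -
    have "inner (R (R q)) q = inner (R q) (R q)" by (rule R_sym)
    then show ?thesis using c r(1) by (simp add: S_def inner_add_left power2_norm_eq_inner distrib_right)
  qed
  ultimately obtain q where q: "S q = r *\<^sub>R R g2 - g1 - (LINT t:\<Omega>|lborel. res r k t)"
    using coercive_surj[OF _ h] by metis
  define \<kappa> where "\<kappa> t = \<mu> t *\<^sub>R q + k t" for t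
  have W\<kappa>: "in_W \<kappa>" unfolding \<kappa>_def by (intro in_W_add in_W_mu Wk)
  define y where "y t = r *\<^sub>R res r \<kappa> t - \<kappa> t" for t
  have Wy: "in_W y" unfolding y_def by (rule res_derivative_in_W[OF r(1) W\<kappa>])
  have py: "prim y t = res r \<kappa> t" if "t \<in> \<Omega>" for t unfolding y_def by (rule prim_res[OF r(1) W\<kappa> that])
  have Wp: "in_W (prim y)" using res_in_W[OF r(1) W\<kappa>] in_W_cong[OF py] by simp
  have "(LINT t:\<Omega>|lborel. prim y t) = (LINT t:\<Omega>|lborel. res r \<mu> t *\<^sub>R q + res r k t)"
    by (rule set_lebesgue_integral_cong) (use py in \<open>auto simp: \<kappa>_def[abs_def] res_add[OF r(1) in_W_mu Wk] res_mu[OF r(1)]\<close>)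
  also have "\<dots> = c *\<^sub>R q + (LINT t:\<Omega>|lborel. res r k t)"
  proof -
    note 1 = set_integral_bounded_linear[OF bounded_linear_scaleR_left mi, of q]
    have 2: "set_integrable lborel \<Omega> (res r k)" by (rule in_W_integrable[OF res_in_W[OF r(1) Wk]])
    show ?thesis unfolding c_def 1(1)[symmetric]
      unfolding set_lebesgue_integral_def scaleR_add_right
      by (rule Bochner_Integration.integral_add[OF 1(2)[unfolded set_integrable_def] 2[unfolded set_integrable_def]])
  qed
  finally have I: "(LINT t:\<Omega>|lborel. prim y t) = c *\<^sub>R q + (LINT t:\<Omega>|lborel. res r k t)" .
  define p where "p = g1 + h *\<^sub>R q"
  define w where "w = r *\<^sub>R (R q - g2)"
  \<comment> \<open>Outside \<open>\<Omega>\<close> the relation returns \<open>0\<close>, so there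
    the resolvent has to copy the datum \<open>g3\<close>.\<close>
  define f where "f = clW (prim y) + (g3 - cut g3)"
  define g where "g = clW (\<lambda>t. y t + \<mu> t *\<^sub>R q)"
  have "cut f = clW (prim y)"
    unfolding f_def cut_add linear_diff[OF cut_linear] by (simp add: Wp)
  moreover have "p + (LINT t:\<Omega>|lborel. prim y t) = - R w"
    using q unfolding I p_def w_def S_def by (simp add: R_scale R_diff algebra_simps)
  ultimately have "gen_by y p (R q) f q w g" by (simp add: gen_by_def Wy Wp g_def)
  then have "((p, R q, f), (q, w, g)) \<in> gen" by (auto simp: gen_iff)
  moreover have "(p, R q, f) - h *\<^sub>R (q, w, g) = Z"
  proof -
    have "clW (prim y) - h *\<^sub>R g = clW (\<lambda>t. prim y t - h *\<^sub>R (y t + \<mu> t *\<^sub>R q))"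
      unfolding g_def using Wp Wy by (simp add: clW_diff clW_scaleR in_W_scaleR in_W_add in_W_mu)
    also have "\<dots> = clW (unemb (rep_L2 g3))"
    proof (rule clW_cong)
      fix t assume "t \<in> \<Omega>"
      then have "prim y t - h *\<^sub>R (y t + \<mu> t *\<^sub>R q) = res r \<kappa> t - (h * r) *\<^sub>R res r \<kappa> t + (h * r) *\<^sub>R unemb (rep_L2 g3) t"
        by (simp add: py) (simp add: y_def \<kappa>_def k_def algebra_simps)
      then show "prim y t - h *\<^sub>R (y t + \<mu> t *\<^sub>R q) = unemb (rep_L2 g3) t" using r(2) by simp
    qed
    also have "\<dots> = cut g3" by (simp add: cut_def)
    finally have "f - h *\<^sub>R g = g3" by (simp add: f_def algebra_simps)
    moreover have "R q - h *\<^sub>R w = g2" using r(2) by (simp add: w_def)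
    ultimately show ?thesis by (simp add: Z p_def)
  qed
  ultimately show ?thesis by blast
qed

sublocale G: m_dissipative gen
  by (rule m_dissipative.intro) (fact gen_subspace, erule gen_single, erule gen_dissipative, erule gen_range)

definition cut3 :: "'h \<times> 'h \<times> 'h L2 \<Rightarrow> 'h \<times> 'h \<times> 'h L2" where
  "cut3 X = (fst X, fst (snd X), cut (snd (snd X)))"

text \<open>Restriction to \<open>\<Omega>\<close> leaves \<open>gen\<close> invariant and hence
  commutes with the semigroup, which therefore preserves the image of the state space.\<close>

lemma sg_cut3: assumes "0 \<le> t" shows "G.sg t (cut3 X) = cut3 (G.sg t X)"
proof (rule G.sg_commute[OF _ _ assms])
  show "bounded_linear cut3" unfolding cut3_def
    by (rule bounded_linear_Pair[OF bounded_linear_fst bounded_linear_Pair[OF bounded_linear_compose[OF bounded_linear_fst bounded_linear_snd]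
        bounded_linear_compose[OF cut_bounded_linear bounded_linear_compose[OF bounded_linear_snd bounded_linear_snd]]]])
  show "(cut3 X, cut3 Y) \<in> gen" if XY: "(X, Y) \<in> gen" for X Y
  proof -
    obtain y p v f q w g where XY: "X = (p, v, f)" "Y = (q, w, g)" and y: "gen_by y p v f q w g"
      using XY unfolding gen_def by blast
    have "in_W y" using y by (simp add: gen_by_def)
    then have "in_W (\<lambda>t. y t + \<mu> t *\<^sub>R q)" by (intro in_W_add in_W_mu)
    then have "gen_by y p v (cut f) q w (cut g)" using y by (simp add: gen_by_def)
    then show ?thesis by (auto simp: cut3_def XY gen_iff)
  qed
qed

end

subsection \<open>Representatives in the state space\<close>

context kernel begin

lemma in_W_AE:
  fixes x x' :: "real \<Rightarrow> 'b::{real_inner, second_countable_topology}"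
  assumes x: "in_W x" and m: "(\<lambda>t. indicator \<Omega> t *\<^sub>R x' t) \<in> borel_measurable lborel"
    and e: "AE t in lborel. t \<in> \<Omega> \<longrightarrow> x t = x' t"
  shows "in_W x'"
proof -
  have "(\<lambda>t. (indicator \<Omega> t *\<^sub>R sqrt (nu t)) *\<^sub>R (indicator \<Omega> t *\<^sub>R x' t)) \<in> borel_measurable lborel"
    by (rule borel_measurable_scaleR[OF Om_measurable m]) (intro continuous_intros nu_continuous)
  moreover have "(\<lambda>t. (indicator \<Omega> t *\<^sub>R sqrt (nu t)) *\<^sub>R (indicator \<Omega> t *\<^sub>R x' t)) = emb x'"
    by (auto simp: fun_eq_iff emb_def indicator_def)
  ultimately have "emb x' \<in> borel_measurable lborel" by simp
  moreover have "AE t in lborel. emb x t = emb x' t" using e by eventually_elim (simp add: emb_def)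
  ultimately show ?thesis using x unfolding in_W_def by (intro sq_integrable_AE_cong[of "emb x" "emb x'"])
qed

text \<open>The energy equality mentions \<open>d\<nu> \<tau> * (Vnorm DA A (\<xi> \<tau>))\<^sup>2\<close> for the chosen representative \<open>\<xi>\<close>, so the
  representative has to vanish where \<open>d\<nu>\<close> is uncontrolled.\<close>

definition zap :: "(real \<Rightarrow> 'b::real_vector) \<Rightarrow> real \<Rightarrow> 'b" where
  "zap x t = (if t \<in> \<Omega> - N0 then x t else 0)"

lemma zap_AE: "AE t in lborel. t \<in> \<Omega> \<longrightarrow> zap x t = x t"
  using AE_N0 by eventually_elim (simp add: zap_def)

lemma in_W_zap: assumes "in_W x" shows "in_W (zap x)"
proof -
  have "sq_integrable (\<lambda>t. indicator (- N0) t *\<^sub>R emb x t)"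
    using assms N0_sets unfolding in_W_def by (intro sq_integrable_mult_indicator) auto
  moreover have "(\<lambda>t. indicator (- N0) t *\<^sub>R emb x t) = emb (zap x)"
    by (auto simp: fun_eq_iff emb_def zap_def indicator_def)
  ultimately show ?thesis by (simp add: in_W_def)
qed

lemma clW_zap: "in_W x \<Longrightarrow> clW (zap x) = clW x"
  using zap_AE by (subst clW_eq_iff) (auto intro: in_W_zap)

end

section \<open>Translation between the state space and its image\<close>

locale memory_op = memory l \<mu> d\<nu> R for l \<mu> d\<nu> and R :: "'h::{real_inner, complete_space, second_countable_topology} \<Rightarrow> 'h" +
  fixes DA :: "'h set" and A :: "'h \<Rightarrow> 'h"
  assumes V_eq: "sqrt_dom DA A = range R" and B_R [simp]: "sqrt_op DA A (R a) = a"
    and DA_eq: "DA = range (\<lambda>a. R (R a))" and A_R: "A (R (R a)) = a"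
begin

abbreviation B :: "'h \<Rightarrow> 'h" where "B \<equiv> sqrt_op DA A"

definition Phi :: "'h state \<Rightarrow> 'h \<times> 'h \<times> 'h L2" where
  "Phi z = (B (fst z), fst (snd z), clW (\<lambda>t. B (snd (snd z) t)))"

text \<open>A right inverse of \<open>Phi\<close> on triples whose memory component is supported in
  \<open>\<Omega>\<close>; it fixes the representatives in which the semigroup is expressed.\<close>

definition Psi :: "'h \<times> 'h \<times> 'h L2 \<Rightarrow> 'h state" where
  "Psi X = (R (fst X), fst (snd X), \<lambda>t. R (zap (unemb (rep_L2 (snd (snd X)))) t))"

lemma R_B [simp]: "u \<in> range R \<Longrightarrow> R (B u) = u" by auto

lemma B_add: "u \<in> range R \<Longrightarrow> v \<in> range R \<Longrightarrow> B (u + v) = B u + B v"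
  by (metis B_R R_add R_B)

lemma B_scale: "u \<in> range R \<Longrightarrow> B (c *\<^sub>R u) = c *\<^sub>R B u"
  by (metis B_R R_scale R_B)

lemma range_add: "u \<in> range R \<Longrightarrow> v \<in> range R \<Longrightarrow> u + v \<in> range R"
  by (metis R_add R_B rangeI)

lemma range_scale: "u \<in> range R \<Longrightarrow> c *\<^sub>R u \<in> range R"
  by (metis R_scale R_B rangeI)

lemma inVV_iff: "inVV DA A l \<mu> \<xi> \<longleftrightarrow> (\<forall>t\<in>\<Omega>. \<xi> t \<in> range R) \<and> in_W (\<lambda>t. B (\<xi> t))"
  unfolding inVV_def in_W_iff V_eq set_borel_measurable_def Vnorm_def nu_def by blast

lemma inAA_iff: "inAA DA A l \<mu> (u, v, \<xi>) \<longleftrightarrow> u \<in> range R \<and> (\<forall>t\<in>\<Omega>. \<xi> t \<in> range R) \<and> in_W (\<lambda>t. B (\<xi> t))"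
  unfolding inAA_def V_eq inVV_iff by simp

lemma normsqAA_eq: assumes "inAA DA A l \<mu> z" shows "normsqAA DA A l \<mu> z = (norm (Phi z))\<^sup>2"
proof -
  obtain u v \<xi> where z: "z = (u, v, \<xi>)" by (cases z)
  have W: "in_W (\<lambda>t. B (\<xi> t))" using assms unfolding z inAA_iff by simp
  have e: "(norm (clW (\<lambda>t. B (\<xi> t))))\<^sup>2 = (LINT t:\<Omega>|lborel. 1 / \<mu> t * (norm (B (\<xi> t)))\<^sup>2)"
    unfolding clW_norm[OF W] nu_def ..
  show ?thesis unfolding z Phi_def normsqAA_def normsqVV_def Vnorm_def prod.case fst_conv snd_conv
    unfolding e[symmetric] by (simp add: norm_Pair)
qed

lemma normAA_eq: "inAA DA A l \<mu> z \<Longrightarrow> normAA DA A l \<mu> z = norm (Phi z)"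
  by (simp add: normAA_def normsqAA_eq)

lemma st_add:
  assumes "inAA DA A l \<mu> z" "inAA DA A l \<mu> w"
  shows "inAA DA A l \<mu> (st_add z w)" "Phi (st_add z w) = Phi z + Phi w"
proof -
  obtain u v \<xi> u' v' \<xi>' where z: "z = (u, v, \<xi>)" "w = (u', v', \<xi>')" by (cases z, cases w)
  note h = assms[unfolded z inAA_iff]
  have e: "B (\<xi> t + \<xi>' t) = B (\<xi> t) + B (\<xi>' t)" if "t \<in> \<Omega>" for t
    using h that by (intro B_add) auto
  have W: "in_W (\<lambda>t. B (\<xi> t) + B (\<xi>' t))" using h by (intro in_W_add) auto
  show "inAA DA A l \<mu> (st_add z w)"
    unfolding z st_add_def prod.case inAA_iff using h in_W_cong[OF e, THEN iffD2, OF _ W] by (auto intro: range_add simp del: image_iff)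
  show "Phi (st_add z w) = Phi z + Phi w"
    using h clW_cong[OF e] unfolding z st_add_def prod.case Phi_def fst_conv snd_conv by (simp add: clW_add B_add)
qed

lemma st_scale:
  assumes "inAA DA A l \<mu> z"
  shows "inAA DA A l \<mu> (st_scale c z)" "Phi (st_scale c z) = c *\<^sub>R Phi z"
proof -
  obtain u v \<xi> where z: "z = (u, v, \<xi>)" by (cases z)
  note h = assms[unfolded z inAA_iff]
  have e: "B (c *\<^sub>R \<xi> t) = c *\<^sub>R B (\<xi> t)" if "t \<in> \<Omega>" for t
    using h that by (intro B_scale) auto
  have W: "in_W (\<lambda>t. c *\<^sub>R B (\<xi> t))" using h by (intro in_W_scaleR) auto
  show "inAA DA A l \<mu> (st_scale c z)"
    unfolding z st_scale_def prod.case inAA_iff using h in_W_cong[OF e, THEN iffD2, OF _ W] by (auto intro: range_scale simp del: image_iff)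
  show "Phi (st_scale c z) = c *\<^sub>R Phi z"
    using h clW_cong[OF e] unfolding z st_scale_def prod.case Phi_def fst_conv snd_conv by (simp add: clW_scaleR B_scale)
qed

lemma st_diff:
  assumes "inAA DA A l \<mu> z" "inAA DA A l \<mu> w"
  shows "inAA DA A l \<mu> (st_diff z w)" "Phi (st_diff z w) = Phi z - Phi w"
  using st_add[OF assms(1) st_scale(1)[OF assms(2), of "-1"]] st_scale(2)[OF assms(2), of "-1"]
  by (simp_all add: st_diff_def)

lemma Psi: "inAA DA A l \<mu> (Psi X)" "Phi (Psi X) = cut3 X"
proof -
  obtain p v f where X: "X = (p, v, f)" by (cases X)
  have W: "in_W (zap (unemb (rep_L2 f)))" by (rule in_W_zap[OF in_W_rep])
  show "inAA DA A l \<mu> (Psi X)" unfolding X Psi_def fst_conv snd_conv inAA_iff using W by simp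
  show "Phi (Psi X) = cut3 X" unfolding X Psi_def fst_conv snd_conv Phi_def B_R cut3_def
    using clW_zap[OF in_W_rep, of f] by (simp add: cut_def)
qed

lemma cut3_Phi: assumes "inAA DA A l \<mu> z" shows "cut3 (Phi z) = Phi z"
proof -
  obtain u v \<xi> where z: "z = (u, v, \<xi>)" by (cases z)
  show ?thesis using assms by (simp add: z Phi_def cut3_def inAA_iff)
qed

definition S :: "real \<Rightarrow> 'h state \<Rightarrow> 'h state" where
  "S t z = Psi (G.sg t (Phi z))"

lemma S: "inAA DA A l \<mu> (S t z)" unfolding S_def by (rule Psi(1))

lemma Phi_S: "inAA DA A l \<mu> z \<Longrightarrow> 0 \<le> t \<Longrightarrow> Phi (S t z) = G.sg t (Phi z)"
  unfolding S_def Psi(2) by (simp add: sg_cut3[symmetric] cut3_Phi)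

text \<open>\<open>R\<close> is bounded and injective, so it passes through both integrals and can
  be cancelled.\<close>

lemma distr_deriv_iff:
  assumes x: "in_W x" and y: "in_W y" and \<xi>: "\<And>t. t \<in> \<Omega> \<Longrightarrow> \<xi> t = R (x t)" and \<eta>: "\<And>t. t \<in> \<Omega> \<Longrightarrow> \<eta> t = R (y t)"
  shows "distr_deriv \<Omega> \<xi> \<eta> \<longleftrightarrow>
    (\<forall>\<phi>. test_fun \<Omega> \<phi> \<longrightarrow> (LINT t:\<Omega>|lborel. deriv \<phi> t *\<^sub>R x t) = - (LINT t:\<Omega>|lborel. \<phi> t *\<^sub>R y t))"
proof -
  have "(LINT t:\<Omega>|lborel. deriv \<phi> t *\<^sub>R \<xi> t) = - (LINT t:\<Omega>|lborel. \<phi> t *\<^sub>R \<eta> t) \<longleftrightarrow>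
      (LINT t:\<Omega>|lborel. deriv \<phi> t *\<^sub>R x t) = - (LINT t:\<Omega>|lborel. \<phi> t *\<^sub>R y t)" if \<phi>: "test_fun \<Omega> \<phi>" for \<phi>
  proof -
    have 1: "(LINT t:\<Omega>|lborel. deriv \<phi> t *\<^sub>R \<xi> t) = R (LINT t:\<Omega>|lborel. deriv \<phi> t *\<^sub>R x t)"
      unfolding set_integral_bounded_linear(1)[OF R_bl test_fun_integrable(2)[OF \<phi> in_W_integrable[OF x]], symmetric]
      by (rule set_lebesgue_integral_cong) (simp_all add: \<xi> R_scale)
    have 2: "(LINT t:\<Omega>|lborel. \<phi> t *\<^sub>R \<eta> t) = R (LINT t:\<Omega>|lborel. \<phi> t *\<^sub>R y t)"
      unfolding set_integral_bounded_linear(1)[OF R_bl test_fun_integrable(1)[OF \<phi> in_W_integrable[OF y]], symmetric]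
      by (rule set_lebesgue_integral_cong) (simp_all add: \<eta> R_scale)
    show ?thesis unfolding 1 2 R_minus[symmetric] R_eq_iff ..
  qed
  then show ?thesis unfolding distr_deriv_def by blast
qed

lemma set_integral_AE_cong:
  fixes x x' :: "real \<Rightarrow> 'h"
  assumes "set_integrable lborel \<Omega> x" "set_integrable lborel \<Omega> x'" "AE t in lborel. t \<in> \<Omega> \<longrightarrow> x t = x' t"
  shows "(LINT t:\<Omega>|lborel. x t) = (LINT t:\<Omega>|lborel. x' t)"
  unfolding set_lebesgue_integral_def
proof (rule integral_cong_AE)
  show "(\<lambda>t. indicator \<Omega> t *\<^sub>R x t) \<in> borel_measurable lborel" "(\<lambda>t. indicator \<Omega> t *\<^sub>R x' t) \<in> borel_measurable lborel"
    using assms(1,2)[unfolded set_integrable_def, THEN borel_measurable_integrable] by simp_all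
  show "AE t in lborel. indicator \<Omega> t *\<^sub>R x t = indicator \<Omega> t *\<^sub>R x' t"
    using assms(3) by eventually_elim (auto simp: indicator_def)
qed

text \<open>Whichever weak derivative \<open>opP\<close> selects, the end condition in
  \<open>domP\<close> makes \<open>x = B \<xi>\<close> equal to \<open>prim y\<close> almost
  everywhere. Cancelling \<open>R\<close> in \<open>u + \<integral>\<xi> = R (R a)\<close> then
  gives the relation without \<open>A\<close>.\<close>

lemma domAA_imp_gen:
  assumes z: "domAA DA A l \<mu> z"
  shows "inAA DA A l \<mu> (opAA DA A l \<mu> z)" "(Phi z, Phi (opAA DA A l \<mu> z)) \<in> gen"
proof -
  obtain u v \<xi> where zz: "z = (u, v, \<xi>)" by (cases z)
  have in_z: "u \<in> range R" "\<And>t. t \<in> \<Omega> \<Longrightarrow> \<xi> t \<in> range R" "in_W (\<lambda>t. B (\<xi> t))"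
    and v: "v \<in> range R" and uD: "u + (LINT t:\<Omega>|lborel. \<xi> t) \<in> DA" and dP: "domP DA A l \<mu> \<xi>"
    using z unfolding zz domAA_def prod.case inAA_iff V_eq by auto
  define \<eta> where "\<eta> = opP DA A l \<mu> \<xi>"
  obtain \<xi>0 where \<xi>0: "AE t in lborel. t \<in> \<Omega> \<longrightarrow> \<xi>0 t = \<xi> t" "((\<lambda>t. B (\<xi>0 t)) \<longlongrightarrow> 0) (at_end l)"
    and ex: "\<exists>\<eta>. inVV DA A l \<mu> \<eta> \<and> distr_deriv \<Omega> \<xi> \<eta>" using dP unfolding domP_def by blast
  have \<eta>: "inVV DA A l \<mu> \<eta>" "distr_deriv \<Omega> \<xi> \<eta>" using someI_ex[OF ex] unfolding \<eta>_def opP_def by blast+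
  define x where "x t = B (\<xi> t)" for t
  define y where "y t = B (\<eta> t)" for t
  have Wx: "in_W x" and Wy: "in_W y" and \<xi>x: "\<And>t. t \<in> \<Omega> \<Longrightarrow> \<xi> t = R (x t)" and \<eta>R: "\<And>t. t \<in> \<Omega> \<Longrightarrow> \<eta> t \<in> range R"
    using in_z \<eta>(1) unfolding inVV_iff x_def[abs_def] y_def[abs_def] by simp_all
  have \<eta>y: "\<And>t. t \<in> \<Omega> \<Longrightarrow> \<eta> t = R (y t)" using \<eta>R by (simp add: y_def)
  note xi = in_W_integrable[OF Wx] and yi = in_W_integrable[OF Wy]
  have xp: "AE t in lborel. t \<in> \<Omega> \<longrightarrow> x t = prim y t"
  proof (rule weak_derivative_imp_prim[OF xi yi])
    show "(LINT t:\<Omega>|lborel. deriv \<phi> t *\<^sub>R x t) = - (LINT t:\<Omega>|lborel. \<phi> t *\<^sub>R y t)" if "test_fun \<Omega> \<phi>" for \<phi>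
      using distr_deriv_iff[OF Wx Wy \<xi>x \<eta>y, THEN iffD1, OF _ _ \<eta>(2)] that by blast
    show "AE t in lborel. t \<in> \<Omega> \<longrightarrow> B (\<xi>0 t) = x t" using \<xi>0(1) by eventually_elim (simp add: x_def)
  qed (rule \<xi>0(2))
  have Wp: "in_W (prim y)" by (rule in_W_AE[OF Wx Om_measurable[OF prim_continuous[OF yi]] xp])
  have I: "(LINT t:\<Omega>|lborel. \<xi> t) = R (LINT t:\<Omega>|lborel. prim y t)"
  proof -
    have "(LINT t:\<Omega>|lborel. \<xi> t) = (LINT t:\<Omega>|lborel. R (x t))"
      by (rule set_lebesgue_integral_cong) (simp_all add: \<xi>x)
    then show ?thesis
      using set_integral_bounded_linear(1)[OF R_bl xi] set_integral_AE_cong[OF xi in_W_integrable[OF Wp] xp] by simp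
  qed
  obtain q where q: "v = R q" using v by blast
  obtain p where p: "u = R p" using in_z(1) by blast
  obtain a where a: "u + (LINT t:\<Omega>|lborel. \<xi> t) = R (R a)" using uD unfolding DA_eq by blast
  have pa: "p + (LINT t:\<Omega>|lborel. prim y t) = R a" using a unfolding I p R_add[symmetric] R_eq_iff .
  have op: "opAA DA A l \<mu> z = (R q, - a, \<lambda>t. \<eta> t + \<mu> t *\<^sub>R R q)"
    unfolding zz opAA_def prod.case a A_R q \<eta>_def ..
  have e: "\<eta> t + \<mu> t *\<^sub>R R q = R (y t + \<mu> t *\<^sub>R q)" if "t \<in> \<Omega>" for t by (simp add: \<eta>y that R_add R_scale)
  have e': "B (\<eta> t + \<mu> t *\<^sub>R R q) = y t + \<mu> t *\<^sub>R q" if "t \<in> \<Omega>" for t unfolding e[OF that] B_R ..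
  have Wg: "in_W (\<lambda>t. y t + \<mu> t *\<^sub>R q)" by (intro in_W_add in_W_mu Wy)
  show "inAA DA A l \<mu> (opAA DA A l \<mu> z)"
    unfolding op inAA_iff using in_W_cong[OF e', THEN iffD2, OF _ Wg] e by simp
  have "clW x = clW (prim y)" unfolding clW_eq_iff[OF Wx Wp] by (rule xp)
  then have "gen_by y p v (clW x) q (- a) (clW (\<lambda>t. y t + \<mu> t *\<^sub>R q))"
    using Wy Wp pa q by (simp add: gen_by_def R_minus)
  moreover have "clW (\<lambda>t. B (\<eta> t + \<mu> t *\<^sub>R R q)) = clW (\<lambda>t. y t + \<mu> t *\<^sub>R q)" by (rule clW_cong) (rule e')
  then have "Phi (opAA DA A l \<mu> z) = (q, - a, clW (\<lambda>t. y t + \<mu> t *\<^sub>R q))"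
    unfolding op Phi_def fst_conv snd_conv by simp
  moreover have "Phi z = (p, v, clW x)" by (simp add: zz p Phi_def x_def[abs_def])
  ultimately show "(Phi z, Phi (opAA DA A l \<mu> z)) \<in> gen" by (auto simp: gen_iff)
qed

text \<open>The continuous representative \<open>R (prim y t)\<close> witnesses the end condition,
  and \<open>R (y t)\<close> is the weak derivative.\<close>

lemma gen_imp_domAA:
  assumes z: "inAA DA A l \<mu> z" and g: "(Phi z, Y) \<in> gen" shows "domAA DA A l \<mu> z"
proof -
  obtain u v \<xi> where zz: "z = (u, v, \<xi>)" by (cases z)
  obtain q w g where Y: "Y = (q, w, g)" by (cases Y)
  have in_z: "u \<in> range R" "\<And>t. t \<in> \<Omega> \<Longrightarrow> \<xi> t \<in> range R" "in_W (\<lambda>t. B (\<xi> t))"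
    using z unfolding zz inAA_iff by auto
  define x where "x t = B (\<xi> t)" for t
  have Wx: "in_W x" and \<xi>x: "\<And>t. t \<in> \<Omega> \<Longrightarrow> \<xi> t = R (x t)" using in_z by (simp_all add: x_def[abs_def])
  have "Phi z = (B u, v, clW x)" by (simp add: zz Phi_def x_def[abs_def])
  then obtain y where "gen_by y (B u) v (clW x) q w g" using g unfolding Y by (auto simp: gen_iff)
  then have y: "in_W y" "in_W (prim y)" "v = R q" "B u + (LINT t:\<Omega>|lborel. prim y t) = - R w" "clW x = clW (prim y)"
    using Wx by (simp_all add: gen_by_def)
  have xp: "AE t in lborel. t \<in> \<Omega> \<longrightarrow> x t = prim y t" using y(5) unfolding clW_eq_iff[OF Wx y(2)] .
  note xi = in_W_integrable[OF Wx] and yi = in_W_integrable[OF y(1)] and pi = in_W_integrable[OF y(2)]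
  have "(LINT t:\<Omega>|lborel. \<xi> t) = (LINT t:\<Omega>|lborel. R (x t))"
    by (rule set_lebesgue_integral_cong) (simp_all add: \<xi>x)
  also have "\<dots> = R (LINT t:\<Omega>|lborel. prim y t)"
    using set_integral_bounded_linear(1)[OF R_bl xi] set_integral_AE_cong[OF xi pi xp] by simp
  finally have "u + (LINT t:\<Omega>|lborel. \<xi> t) = R (B u + (LINT t:\<Omega>|lborel. prim y t))"
    using in_z(1) by (simp add: R_add)
  then have "u + (LINT t:\<Omega>|lborel. \<xi> t) = R (R (- w))" unfolding y(4) R_minus[symmetric] .
  then have uD: "u + (LINT t:\<Omega>|lborel. \<xi> t) \<in> DA" unfolding DA_eq by blast
  have "domP DA A l \<mu> \<xi>"
    unfolding domP_def
  proof (intro conjI exI)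
    show "inVV DA A l \<mu> \<xi>" unfolding inVV_iff using in_z by blast
    show "inVV DA A l \<mu> (\<lambda>t. R (y t))" unfolding inVV_iff using y(1) by simp
    have "distr_deriv \<Omega> \<xi> (\<lambda>t. R (y t)) \<longleftrightarrow>
        (\<forall>\<phi>. test_fun \<Omega> \<phi> \<longrightarrow> (LINT t:\<Omega>|lborel. deriv \<phi> t *\<^sub>R x t) = - (LINT t:\<Omega>|lborel. \<phi> t *\<^sub>R y t))"
      by (rule distr_deriv_iff[OF Wx y(1)]) (simp_all add: \<xi>x)
    then show "distr_deriv \<Omega> \<xi> (\<lambda>t. R (y t))"
    proof (rule iffD2, intro allI impI)
      fix \<phi> assume \<phi>: "test_fun \<Omega> \<phi>"
      have "AE t in lborel. t \<in> \<Omega> \<longrightarrow> deriv \<phi> t *\<^sub>R x t = deriv \<phi> t *\<^sub>R prim y t" using xp by eventually_elim simp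
      from set_integral_AE_cong[OF test_fun_integrable(2)[OF \<phi> xi] test_fun_integrable(2)[OF \<phi> pi] this]
      show "(LINT t:\<Omega>|lborel. deriv \<phi> t *\<^sub>R x t) = - (LINT t:\<Omega>|lborel. \<phi> t *\<^sub>R y t)"
        using prim_weak_derivative(2)[OF \<phi> yi] by simp
    qed
    show "AE t in lborel. t \<in> \<Omega> \<longrightarrow> R (prim y t) = \<xi> t" using xp by eventually_elim (simp add: \<xi>x)
    show "\<forall>t\<in>\<Omega>. R (prim y t) \<in> Vspace DA A" unfolding V_eq by simp
    show "((\<lambda>t. B (R (prim y t))) \<longlongrightarrow> 0) (at_end l)" using prim_tendsto_end[OF yi] by simp
  qed
  then show ?thesis using z uD y(3) unfolding zz domAA_def prod.case V_eq by simp
qed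

end

context memory_op begin

section \<open>The semigroup on the state space and its energy equality\<close>

lemma normAA_diff_S:
  "inAA DA A l \<mu> z \<Longrightarrow> inAA DA A l \<mu> w \<Longrightarrow> normAA DA A l \<mu> (st_diff z w) = norm (Phi z - Phi w)"
  by (simp add: normAA_eq st_diff)

text \<open>The quotient is transported to the Hilbert space, where \<open>sg_generator\<close>
  decides its convergence. Since the candidate \<open>w\<close> is arbitrary, the domain of the
  generator is identified exactly.\<close>

lemma difference_quotient:
  assumes z: "inAA DA A l \<mu> z" and w: "inAA DA A l \<mu> w"
  shows "((\<lambda>h. normAA DA A l \<mu> (st_diff (st_scale (1 / h) (st_diff (S h z) z)) w)) \<longlongrightarrow> 0) (at_right 0)
    \<longleftrightarrow> (Phi z, Phi w) \<in> gen"
proof -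
  have e: "normAA DA A l \<mu> (st_diff (st_scale (1 / h) (st_diff (S h z) z)) w) = norm ((1 / h) *\<^sub>R (G.sg h (Phi z) - Phi z) - Phi w)"
    if "0 < h" for h
    using that z w S[of h z] by (simp add: normAA_eq st_diff st_scale Phi_S)
  have "((\<lambda>h. normAA DA A l \<mu> (st_diff (st_scale (1 / h) (st_diff (S h z) z)) w)) \<longlongrightarrow> 0) (at_right 0)
      \<longleftrightarrow> ((\<lambda>h. norm ((1 / h) *\<^sub>R (G.sg h (Phi z) - Phi z) - Phi w)) \<longlongrightarrow> 0) (at_right 0)"
    by (rule tendsto_cong) (use e in \<open>auto simp: eventually_at_right_less intro: eventually_mono[OF eventually_at_right_less[of 0]]\<close>)
  also have "\<dots> \<longleftrightarrow> (Phi z, Phi w) \<in> gen"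
    unfolding G.sg_generator tendsto_norm_zero_iff Lim_null[of _ "Phi w"] ..
  finally show ?thesis .
qed

lemma generates: "generates_C0_contraction_semigroup DA A l \<mu> S"
  unfolding generates_C0_contraction_semigroup_def Let_def
proof (intro conjI allI impI)
  fix t :: real and z w :: "'h state" and a b :: real assume t: "0 \<le> t"
  interpret sg: linear "G.sg t" by (rule G.sg_linear[OF t])
  {
    assume "inAA DA A l \<mu> z" "inAA DA A l \<mu> w" "normAA DA A l \<mu> (st_diff z w) = 0"
    then show "normAA DA A l \<mu> (st_diff (S t z) (S t w)) = 0" using t by (simp add: normAA_diff_S S Phi_S)
  }
  {
    assume "inAA DA A l \<mu> z" "inAA DA A l \<mu> w"
    then show "normAA DA A l \<mu> (st_diff (S t (st_add (st_scale a z) (st_scale b w))) (st_add (st_scale a (S t z)) (st_scale b (S t w)))) = 0"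
      using t by (simp add: normAA_diff_S S Phi_S st_add st_scale sg.add sg.scale)
  }
  {
    assume "inAA DA A l \<mu> z"
    then show "normAA DA A l \<mu> (S t z) \<le> normAA DA A l \<mu> z"
      using t by (simp add: normAA_eq S Phi_S G.sg_norm)
  }
  {
    fix s :: real assume "0 \<le> s" "inAA DA A l \<mu> z"
    then show "normAA DA A l \<mu> (st_diff (S (t + s) z) (S t (S s z))) = 0"
      using t by (simp add: normAA_diff_S S Phi_S G.sg_add)
  }
  {
    assume z: "inAA DA A l \<mu> z"
    have "((\<lambda>s. norm (G.sg s (Phi z) - G.sg t (Phi z))) \<longlongrightarrow> 0) (at t within {0..})"
      using G.sg_continuous[OF t] by (simp add: tendsto_norm_zero_iff Lim_null[symmetric])
    moreover have "\<forall>\<^sub>F s in at t within {0..}. norm (G.sg s (Phi z) - G.sg t (Phi z)) = normAA DA A l \<mu> (st_diff (S s z) (S t z))"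
      using t z by (auto simp: eventually_at_filter normAA_diff_S S Phi_S)
    ultimately show "((\<lambda>s. normAA DA A l \<mu> (st_diff (S s z) (S t z))) \<longlongrightarrow> 0) (at t within {0..})"
      by (rule Lim_transform_eventually)
  }
next
  fix z :: "'h state"
  show "normAA DA A l \<mu> (st_diff (S 0 z) z) = 0" if "inAA DA A l \<mu> z"
    using that by (simp add: normAA_diff_S S Phi_S G.sg_0)
  show "inAA DA A l \<mu> (opAA DA A l \<mu> z)" if "domAA DA A l \<mu> z" by (rule domAA_imp_gen(1)[OF that])
  have in_z: "inAA DA A l \<mu> z" if "domAA DA A l \<mu> z" using that by (simp add: domAA_def)
  show gen: "((\<lambda>h. normAA DA A l \<mu> (st_diff (st_scale (1 / h) (st_diff (S h z) z)) (opAA DA A l \<mu> z))) \<longlongrightarrow> 0) (at_right 0)"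
    if "domAA DA A l \<mu> z"
    using difference_quotient[OF in_z[OF that] domAA_imp_gen(1)[OF that]] domAA_imp_gen(2)[OF that] by simp
  show "domAA DA A l \<mu> z \<longleftrightarrow>
      (\<exists>w. inAA DA A l \<mu> w \<and> ((\<lambda>h. normAA DA A l \<mu> (st_diff (st_scale (1 / h) (st_diff (S h z) z)) w)) \<longlongrightarrow> 0) (at_right 0))"
    if z: "inAA DA A l \<mu> z"
    using gen domAA_imp_gen(1) difference_quotient[OF z] gen_imp_domAA[OF z] by blast
qed (rule S)

text \<open>By \<open>sg_pair\<close> the orbit stays in the domain, so at each time a derivative
  \<open>y\<close> of the memory component is available, and the derivative of the squared norm is
  the quadratic form evaluated by \<open>energy_identity\<close>. The trace at \<open>0\<close> is
  taken along the continuous representative \<open>R (prim y \<tau>)\<close>, while the integral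
  uses the representative chosen by \<open>S\<close>.\<close>

lemma energy_equality:
  assumes z: "domAA DA A l \<mu> z" and t: "0 \<le> t"
  shows "\<exists>L \<xi>0. (AE \<tau> in lborel. \<tau> \<in> \<Omega> \<longrightarrow> \<xi>0 \<tau> = snd (snd (S t z)) \<tau>)
            \<and> (\<forall>\<tau>\<in>\<Omega>. \<xi>0 \<tau> \<in> Vspace DA A)
            \<and> ((\<lambda>\<tau>. (1 / \<mu> \<tau>) * (Vnorm DA A (\<xi>0 \<tau>))\<^sup>2) \<longlongrightarrow> L) (at_right 0)
            \<and> set_integrable lborel \<Omega> (\<lambda>\<tau>. d\<nu> \<tau> * (Vnorm DA A (snd (snd (S t z)) \<tau>))\<^sup>2)
            \<and> ((\<lambda>s. normsqAA DA A l \<mu> (S s z)) has_real_derivative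
                 (- L - (LINT \<tau>:\<Omega>|lborel. d\<nu> \<tau> * (Vnorm DA A (snd (snd (S t z)) \<tau>))\<^sup>2)))
               (at t within {0..})"
proof -
  have in_z: "inAA DA A l \<mu> z" using z by (simp add: domAA_def)
  obtain p v f where X: "G.sg t (Phi z) = (p, v, f)" by (cases "G.sg t (Phi z)")
  obtain q w g where Y: "G.sg t (Phi (opAA DA A l \<mu> z)) = (q, w, g)" by (cases "G.sg t (Phi (opAA DA A l \<mu> z))")
  have "((p, v, f), (q, w, g)) \<in> gen" using G.sg_pair[OF domAA_imp_gen(2)[OF z] t] by (simp add: X Y)
  then obtain y where y: "gen_by y p v f q w g" by (auto simp: gen_iff)
  have W: "in_W y" "in_W (prim y)" using y by (simp_all add: gen_by_def)
  obtain L where L: "((\<lambda>\<tau>. nu \<tau> * (norm (prim y \<tau>))\<^sup>2) \<longlongrightarrow> L) (at_right 0)"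
    and dnI: "set_integrable lborel \<Omega> (\<lambda>\<tau>. dn \<tau> * (norm (prim y \<tau>))\<^sup>2)"
    and en: "2 * (LINT \<tau>:\<Omega>|lborel. nu \<tau> * inner (y \<tau>) (prim y \<tau>)) = - L - (LINT \<tau>:\<Omega>|lborel. dn \<tau> * (norm (prim y \<tau>))\<^sup>2)"
    by (rule energy_identity[OF W])
  define x where "x = zap (unemb (rep_L2 f))"
  have \<xi>: "snd (snd (S t z)) = (\<lambda>\<tau>. R (x \<tau>))" by (simp add: S_def Psi_def X x_def)
  have Wx: "in_W x" unfolding x_def by (rule in_W_zap[OF in_W_rep])
  have "clW x = clW (prim y)" using y clW_zap[OF in_W_rep, of f] by (simp add: x_def gen_by_def cut_def)
  then have xp: "AE \<tau> in lborel. \<tau> \<in> \<Omega> \<longrightarrow> x \<tau> = prim y \<tau>" unfolding clW_eq_iff[OF Wx W(2)] .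
  \<comment> \<open>\<open>x\<close> vanishes on \<open>N0\<close>, so \<open>d\<nu>\<close> may be
    exchanged for \<open>dn\<close> at every point, which also yields measurability on
    \<open>\<Omega>\<close>.\<close>
  have Vx: "d\<nu> \<tau> * (Vnorm DA A (R (x \<tau>)))\<^sup>2 = dn \<tau> * (norm (x \<tau>))\<^sup>2" for \<tau>
    by (simp add: Vnorm_def dn_def x_def zap_def indicator_def)
  have bx: "(\<lambda>\<tau>. indicator \<Omega> \<tau> *\<^sub>R x \<tau>) \<in> borel_measurable borel" using in_WD(1)[OF Wx] by simp
  have "(\<lambda>\<tau>. (indicator \<Omega> \<tau> * dn \<tau>) * (norm (indicator \<Omega> \<tau> *\<^sub>R x \<tau>))\<^sup>2) \<in> borel_measurable borel"
    by (rule borel_measurable_times[OF dn_measurable borel_measurable_power[OF measurable_compose[OF bx borel_measurable_norm]]])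
  moreover have "(\<lambda>\<tau>. (indicator \<Omega> \<tau> * dn \<tau>) * (norm (indicator \<Omega> \<tau> *\<^sub>R x \<tau>))\<^sup>2) = (\<lambda>\<tau>. indicator \<Omega> \<tau> *\<^sub>R (dn \<tau> * (norm (x \<tau>))\<^sup>2))"
    by (auto simp: fun_eq_iff indicator_def)
  ultimately have m: "(\<lambda>\<tau>. indicator \<Omega> \<tau> *\<^sub>R (dn \<tau> * (norm (x \<tau>))\<^sup>2)) \<in> borel_measurable lborel" by simp
  have ae: "AE \<tau> in lborel. indicator \<Omega> \<tau> *\<^sub>R (dn \<tau> * (norm (prim y \<tau>))\<^sup>2) = indicator \<Omega> \<tau> *\<^sub>R (dn \<tau> * (norm (x \<tau>))\<^sup>2)"
    using xp by eventually_elim (auto simp: indicator_def)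
  have I1: "set_integrable lborel \<Omega> (\<lambda>\<tau>. dn \<tau> * (norm (x \<tau>))\<^sup>2)"
    unfolding set_integrable_def by (rule integrable_cong_AE_imp[OF dnI[unfolded set_integrable_def] m ae])
  have I2: "(LINT \<tau>:\<Omega>|lborel. dn \<tau> * (norm (prim y \<tau>))\<^sup>2) = (LINT \<tau>:\<Omega>|lborel. dn \<tau> * (norm (x \<tau>))\<^sup>2)"
    unfolding set_lebesgue_integral_def
    by (rule integral_cong_AE[OF borel_measurable_integrable[OF dnI[unfolded set_integrable_def]] m ae])
  have "((\<lambda>s. (norm (G.sg s (Phi z)))\<^sup>2) has_real_derivative 2 * inner (q, w, g) (p, v, f)) (at t within {0..})"
    using G.sg_norm_derivative[OF domAA_imp_gen(2)[OF z] t] by (simp only: X Y)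
  then have D: "((\<lambda>s. (norm (G.sg s (Phi z)))\<^sup>2) has_real_derivative - L - (LINT \<tau>:\<Omega>|lborel. dn \<tau> * (norm (x \<tau>))\<^sup>2)) (at t within {0..})"
    unfolding gen_by_inner[OF y] en I2 .
  have D': "((\<lambda>s. normsqAA DA A l \<mu> (S s z)) has_real_derivative - L - (LINT \<tau>:\<Omega>|lborel. dn \<tau> * (norm (x \<tau>))\<^sup>2)) (at t within {0..})"
    by (rule has_field_derivative_transform_within[OF D zero_less_one]) (use t in_z in \<open>auto simp: normsqAA_eq S Phi_S\<close>)
  show ?thesis
  proof (intro exI conjI)
    show "AE \<tau> in lborel. \<tau> \<in> \<Omega> \<longrightarrow> R (prim y \<tau>) = snd (snd (S t z)) \<tau>"
      unfolding \<xi> using xp by eventually_elim simp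
    show "\<forall>\<tau>\<in>\<Omega>. R (prim y \<tau>) \<in> Vspace DA A" unfolding V_eq by simp
    show "((\<lambda>\<tau>. (1 / \<mu> \<tau>) * (Vnorm DA A (R (prim y \<tau>)))\<^sup>2) \<longlongrightarrow> L) (at_right 0)"
      using L unfolding nu_def Vnorm_def B_R .
    show "set_integrable lborel \<Omega> (\<lambda>\<tau>. d\<nu> \<tau> * (Vnorm DA A (snd (snd (S t z)) \<tau>))\<^sup>2)"
      unfolding \<xi> Vx by (rule I1)
    show "((\<lambda>s. normsqAA DA A l \<mu> (S s z)) has_real_derivative
                 (- L - (LINT \<tau>:\<Omega>|lborel. d\<nu> \<tau> * (Vnorm DA A (snd (snd (S t z)) \<tau>))\<^sup>2)))
               (at t within {0..})"
      unfolding \<xi> Vx by (rule D')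
  qed
qed

end

theorem theorem8p1:
  fixes DA :: "'h::{real_inner, complete_space, second_countable_topology} set" and A :: "'h \<Rightarrow> 'h"
    and l :: ereal and \<mu> :: "real \<Rightarrow> real" and d\<nu> :: "real \<Rightarrow> real"
  assumes A_sa: "selfadjoint_op DA A"
    and A_pos: "strictly_positive_op DA A"
    and A_cinv: "has_compact_inverse DA A"
    and l_pos: "0 < l"
    and mu_pos: "\<forall>s\<in>Omega l. 0 < \<mu> s"
    and mu_noninc: "\<forall>s\<in>Omega l. \<forall>t\<in>Omega l. s \<le> t \<longrightarrow> \<mu> t \<le> \<mu> s"
    and mu_summable: "set_integrable lborel (Omega l) \<mu>"
    and mu_ac: "\<forall>a b. {a..b} \<subseteq> Omega l \<longrightarrow> absolutely_continuous_fun_on {a..b} \<mu>"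
    and mu_end: "l \<noteq> \<infinity> \<longrightarrow> (\<mu> \<longlongrightarrow> 0) (at_left (real_of_ereal l))"
    and dnu: "AE \<tau> in lborel. \<tau> \<in> Omega l \<longrightarrow> ((\<lambda>s. 1 / \<mu> s) has_real_derivative d\<nu> \<tau>) (at \<tau>)"
  shows "\<exists>S. generates_C0_contraction_semigroup DA A l \<mu> S
    \<and> (\<forall>z. domAA DA A l \<mu> z \<longrightarrow> (\<forall>t\<ge>0.
         (\<exists>L \<xi>0. (AE \<tau> in lborel. \<tau> \<in> Omega l \<longrightarrow> \<xi>0 \<tau> = snd (snd (S t z)) \<tau>)
            \<and> (\<forall>\<tau>\<in>Omega l. \<xi>0 \<tau> \<in> Vspace DA A)
            \<and> ((\<lambda>\<tau>. (1 / \<mu> \<tau>) * (Vnorm DA A (\<xi>0 \<tau>))\<^sup>2) \<longlongrightarrow> L) (at_right 0)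
            \<and> set_integrable lborel (Omega l) (\<lambda>\<tau>. d\<nu> \<tau> * (Vnorm DA A (snd (snd (S t z)) \<tau>))\<^sup>2)
            \<and> ((\<lambda>s. normsqAA DA A l \<mu> (S s z)) has_real_derivative
                 (- L - (LINT \<tau>:Omega l|lborel. d\<nu> \<tau> * (Vnorm DA A (snd (snd (S t z)) \<tau>))\<^sup>2)))
               (at t within {0..}))))"
proof (rule op_sqrt_bounded_inverse[OF A_sa A_pos A_cinv])
  fix R :: "'h \<Rightarrow> 'h"
  assume R: "bounded_linear R" "\<And>u v. inner (R u) v = inner u (R v)" "\<And>v. R v = 0 \<Longrightarrow> v = 0"
      "sqrt_dom DA A = range R" "\<And>a. sqrt_op DA A (R a) = a" "DA = range (\<lambda>a. R (R a))" "\<And>a. A (R (R a)) = a"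
  interpret memory_op l \<mu> d\<nu> R DA A
    by (intro memory_op.intro memory.intro memory_axioms.intro memory_op_axioms.intro kernel.intro)
      (rule l_pos mu_pos mu_noninc mu_summable mu_ac dnu R; assumption?)+
  show ?thesis using generates energy_equality by blast
qed

end
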